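(* Let $q>0$, $0<c_0<1$ and $c_i>0$, $i=1,2,3$. Consider the system ($x\in(0,1)$, $t\ge0$) $$\begin{aligned} & \varepsilon_{tt}=\varepsilon_{xx},\quad \varepsilon_x(0,t)=c_1\varepsilon(0,t),\quad \varepsilon_x(1,t)=\beta_x(1,t)-Y_x(1,t),\\ & \beta_{tt}=\beta_{xx},\quad \beta_x(0,t)=\tfrac{c_1}{1-c_0}\beta(0,t)+\tfrac{c_0}{1-c_0}\beta_t(0,t),\quad \beta(1,t)=0,\\ & \widetilde w_{tt}(x,t)=\widetilde w_{xx}(x,t)-(c_1+q)(c_2+q)e^{qx}\varepsilon(0,t),\\ & \widetilde w_x(0,t)=c_2\widetilde w(0,t)+(c_1+q)\varepsilon(0,t),\quad \widetilde w_x(1,t)=-c_3\widetilde w_t(1,t),\\ & Y_t=-Y_x,\quad Y(0,t)=-c_0\varepsilon(0,t), \end{aligned}$$ in the space $\mathcal X=\mathbb H\times H^1(0,1)\times H^1_R(0,1)\times L^2(0,1)\times\mathbb H$. For any initial value $(\varepsilon_0,\varepsilon_1,Y_0,\beta_0,\beta_1,\widetilde w_0,\widetilde w_1)\in\mathcal X$ with the compatibility condition $Y_0(0)=-c_0\varepsilon_0(0)$, the system admits a unique solution $(\varepsilon,\varepsilon_t,Y,\beta,\beta_t,\widetilde w,\widetilde w_t)\in C(0,\infty;\mathcal X)$ and there exist two constants $M,\mu>0$ such that, for all $t\ge0$, $$\|(\varepsilon(\cdot,t),\varepsilon_t(\cdot,t),Y(\cdot,t),\beta(\cdot,t),\beta_t(\cdot,t),\widetilde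 w(\cdot,t),\widetilde w_t(\cdot,t))\|_{\mathcal X}\le Me^{-\mu t}.$$
   Context: $\mathbb H=H^1(0,1)\times L^2(0,1)$ with norm $\|(\phi,\psi)\|_{\mathbb H}^2=\int_0^1(|\phi'|^2+|\psi|^2)\,dx+|\phi(0)|^2$; $H^1_R(0,1)=\{\phi\in H^1(0,1):\phi(1)=0\}$; $\mathcal X$ carries the product norm. $C(0,\infty;X)$ denotes the continuous functions $[0,\infty)\to X$. The initial value is the value of $(\varepsilon,\varepsilon_t,Y,\beta,\beta_t,\widetilde w,\widetilde w_t)$ at $t=0$. Solutions are understood in the usual weak (mild) sense: the PDEs hold in the sense of distributions and the boundary conditions hold for almost every $t$, the boundary traces of the first derivatives being in $L^2_{loc}[0,\infty)$. *)

theory Defs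
  imports "HOL-Analysis.Analysis"
begin

primrec C_k :: "nat \<Rightarrow> ('a::euclidean_space \<Rightarrow> real) \<Rightarrow> bool" where
  "C_k 0 f \<longleftrightarrow> continuous_on UNIV f"
| "C_k (Suc k) f \<longleftrightarrow>
     f differentiable_on UNIV \<and> (\<forall>b\<in>Basis. C_k k (\<lambda>z. frechet_derivative f (at z) b))"

definition smooth :: "('a::euclidean_space \<Rightarrow> real) \<Rightarrow> bool" where
  "smooth f \<longleftrightarrow> (\<forall>k. C_k k f)"

definition test_function :: "'a::euclidean_space set \<Rightarrow> ('a \<Rightarrow> real) \<Rightarrow> bool" where
  "test_function U \<phi> \<longleftrightarrow> smooth \<phi> \<and>
     compact (closure {z. \<phi> z \<noteq> 0}) \<and> closure {z. \<phi> z \<noteq> 0} \<subseteq> U"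

text \<open>
  An element of \<open>L\<^sup>2(0,1)\<close> is given by a Borel representative, and functions that agree almost
  everywhere on \<open>(0,1)\<close> represent the same element. An element of \<open>H\<^sup>1(0,1)\<close> is given by its
  representative that is continuous on \<open>[0,1]\<close>, so that its values at 0 and 1 make sense.
  Values outside \<open>[0,1]\<close> are irrelevant throughout.
\<close>

definition L2 :: "(real \<Rightarrow> real) set" where
  "L2 = {f. set_borel_measurable lborel {0<..<1} f \<and>
            set_integrable lborel {0<..<1} (\<lambda>x. (f x)\<^sup>2)}"

definition norm_L2 :: "(real \<Rightarrow> real) \<Rightarrow> real" where
  "norm_L2 f = sqrt (LINT x:{0<..<1}|lborel. (f x)\<^sup>2)"

definition has_weak_deriv :: "(real \<Rightarrow> real) \<Rightarrow> (real \<Rightarrow> real) \<Rightarrow> bool" where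
  "has_weak_deriv f g \<longleftrightarrow> (\<forall>\<phi>. test_function {0<..<1} \<phi> \<longrightarrow>
     (LINT x:{0<..<1}|lborel. f x * deriv \<phi> x) = - (LINT x:{0<..<1}|lborel. g x * \<phi> x))"

definition H1 :: "(real \<Rightarrow> real) set" where
  "H1 = {f. continuous_on {0..1} f \<and> (\<exists>g\<in>L2. has_weak_deriv f g)}"

text \<open>For \<open>f \<in> H1\<close> this is determined almost everywhere on \<open>(0,1)\<close>.\<close>

definition wderiv :: "(real \<Rightarrow> real) \<Rightarrow> (real \<Rightarrow> real)" where
  "wderiv f = (SOME g. g \<in> L2 \<and> has_weak_deriv f g)"

definition norm_H1 :: "(real \<Rightarrow> real) \<Rightarrow> real" where
  "norm_H1 f = sqrt ((norm_L2 f)\<^sup>2 + (norm_L2 (wderiv f))\<^sup>2)"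

definition H1_R :: "(real \<Rightarrow> real) set" where
  "H1_R = {f \<in> H1. f 1 = 0}"

definition norm_HH :: "(real \<Rightarrow> real) \<times> (real \<Rightarrow> real) \<Rightarrow> real" where
  "norm_HH = (\<lambda>(f, g). sqrt ((norm_L2 (wderiv f))\<^sup>2 + (norm_L2 g)\<^sup>2 + (f 0)\<^sup>2))"

text \<open>The components are \<open>(\<epsilon>, \<epsilon>\<^sub>t, Y, \<beta>, \<beta>\<^sub>t, w, w\<^sub>t)\<close>.\<close>

type_synonym state =
  "(real \<Rightarrow> real) \<times> (real \<Rightarrow> real) \<times> (real \<Rightarrow> real) \<times> (real \<Rightarrow> real) \<times> (real \<Rightarrow> real) \<times>
   (real \<Rightarrow> real) \<times> (real \<Rightarrow> real)"

definition X_space :: "state set" where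
  "X_space = H1 \<times> L2 \<times> H1 \<times> H1_R \<times> L2 \<times> H1 \<times> L2"

definition norm_X :: "state \<Rightarrow> real" where
  "norm_X = (\<lambda>(\<epsilon>, \<epsilon>', Y, \<beta>, \<beta>', w, w').
     sqrt ((norm_HH (\<epsilon>, \<epsilon>'))\<^sup>2 + (norm_H1 Y)\<^sup>2 + (norm_H1 \<beta>)\<^sup>2 + (norm_L2 \<beta>')\<^sup>2 + (norm_HH (w, w'))\<^sup>2))"

text \<open>
  Equality of two elements of the space: it amounts to equality on \<open>[0,1]\<close> of the \<open>H\<^sup>1\<close> components
  and equality almost everywhere on \<open>(0,1)\<close> of the \<open>L\<^sup>2\<close> components.
\<close>

definition eq_X :: "state \<Rightarrow> state \<Rightarrow> bool" where
  "eq_X u v \<longleftrightarrow> norm_X (u - v) = 0"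

definition continuous_X :: "(real \<Rightarrow> state) \<Rightarrow> bool" where
  "continuous_X u \<longleftrightarrow> (\<forall>t\<ge>0. u t \<in> X_space) \<and>
     (\<forall>s\<ge>0. ((\<lambda>t. norm_X (u t - u s)) \<longlongrightarrow> 0) (at s within {0..}))"

text \<open>
  Trajectories take the time first, \<open>F t x\<close>, whereas test functions depend on the pair \<open>(x, t)\<close>.
  The iterated integral only needs \<open>F t \<in> L\<^sup>2\<close> for every \<open>t\<close> and \<open>L\<^sup>2\<close>-continuity in \<open>t\<close>, not
  joint measurability of the chosen representatives.
\<close>

definition test_xt :: "(real \<times> real \<Rightarrow> real) \<Rightarrow> bool" where
  "test_xt \<phi> \<longleftrightarrow> test_function ({0<..<1} \<times> {0<..}) \<phi>"

definition dpair :: "(real \<Rightarrow> real \<Rightarrow> real) \<Rightarrow> (real \<times> real \<Rightarrow> real) \<Rightarrow> real" where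
  "dpair F \<phi> = (LINT t:{0<..}|lborel. (LINT x:{0<..<1}|lborel. F t x * \<phi> (x, t)))"

definition D_x :: "(real \<times> real \<Rightarrow> real) \<Rightarrow> (real \<times> real \<Rightarrow> real)" where
  "D_x \<phi> z = frechet_derivative \<phi> (at z) (1, 0)"

definition D_t :: "(real \<times> real \<Rightarrow> real) \<Rightarrow> (real \<times> real \<Rightarrow> real)" where
  "D_t \<phi> z = frechet_derivative \<phi> (at z) (0, 1)"

definition time_deriv :: "(real \<Rightarrow> real \<Rightarrow> real) \<Rightarrow> (real \<Rightarrow> real \<Rightarrow> real) \<Rightarrow> bool" where
  "time_deriv F G \<longleftrightarrow> (\<forall>\<phi>. test_xt \<phi> \<longrightarrow> - dpair F (D_t \<phi>) = dpair G \<phi>)"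

definition wave_eq :: "(real \<Rightarrow> real \<Rightarrow> real) \<Rightarrow> (real \<Rightarrow> real \<Rightarrow> real) \<Rightarrow> bool" where
  "wave_eq F S \<longleftrightarrow> (\<forall>\<phi>. test_xt \<phi> \<longrightarrow>
     dpair F (D_t (D_t \<phi>)) = dpair F (D_x (D_x \<phi>)) + dpair S \<phi>)"

definition transport_eq :: "(real \<Rightarrow> real \<Rightarrow> real) \<Rightarrow> bool" where
  "transport_eq F \<longleftrightarrow> (\<forall>\<phi>. test_xt \<phi> \<longrightarrow> - dpair F (D_t \<phi>) = dpair F (D_x \<phi>))"

definition L2_loc :: "(real \<Rightarrow> real) \<Rightarrow> bool" where
  "L2_loc a \<longleftrightarrow> set_borel_measurable lborel {0..} a \<and>
     (\<forall>T>0. set_integrable lborel {0..T} (\<lambda>t. (a t)\<^sup>2))"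

text \<open>
  The function \<open>a\<close> in \<open>L\<^sup>2\<^sub>l\<^sub>o\<^sub>c[0,\<infinity>)\<close> is the trace at \<open>x = \<xi>\<close> (where \<open>\<xi>\<close> is 0 or 1) of \<open>G\<close>: for every
  \<open>T\<close>, \<open>G(\<cdot>,x)\<close> converges to \<open>a\<close> in \<open>L\<^sup>2(0,T)\<close> as \<open>x \<rightarrow> \<xi>\<close> outside a null set. As \<open>G t\<close>
  is an element of \<open>L\<^sup>2(0,1)\<close> for each \<open>t\<close>, one first passes to a jointly measurable
  representative \<open>p\<close>, which is determined almost everywhere on \<open>(0,\<infinity>) \<times> (0,1)\<close>.
\<close>

definition has_trace :: "(real \<Rightarrow> real \<Rightarrow> real) \<Rightarrow> real \<Rightarrow> (real \<Rightarrow> real) \<Rightarrow> bool" where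
  "has_trace G \<xi> a \<longleftrightarrow> L2_loc a \<and>
     (\<exists>p. (\<lambda>(t, x). p t x) \<in> borel_measurable (lborel \<Otimes>\<^sub>M lborel) \<and>
        (AE t in lborel. 0 < t \<longrightarrow> (AE x in lborel. x \<in> {0<..<1} \<longrightarrow> p t x = G t x)) \<and>
        (\<forall>T>0. \<forall>e>0. \<exists>\<delta>>0. AE x in lborel. x \<in> {0<..<1} \<and> \<bar>x - \<xi>\<bar> < \<delta> \<longrightarrow>
           (\<integral>\<^sup>+t\<in>{0..T}. ennreal ((p t x - a t)\<^sup>2) \<partial>lborel) < ennreal e))"

abbreviation has_trace_x :: "(real \<Rightarrow> real \<Rightarrow> real) \<Rightarrow> real \<Rightarrow> (real \<Rightarrow> real) \<Rightarrow> bool" where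
  "has_trace_x F \<equiv> has_trace (\<lambda>t. wderiv (F t))"

definition is_solution ::
  "real \<Rightarrow> real \<Rightarrow> real \<Rightarrow> real \<Rightarrow> real \<Rightarrow> state \<Rightarrow> (real \<Rightarrow> state) \<Rightarrow> bool" where
  "is_solution q c0 c1 c2 c3 u0 u \<longleftrightarrow>
     continuous_X u \<and> eq_X (u 0) u0 \<and>
     (\<exists>\<epsilon> \<epsilon>' Y \<beta> \<beta>' w w'. u = (\<lambda>t. (\<epsilon> t, \<epsilon>' t, Y t, \<beta> t, \<beta>' t, w t, w' t)) \<and>
        time_deriv \<epsilon> \<epsilon>' \<and> time_deriv \<beta> \<beta>' \<and> time_deriv w w' \<and>
        wave_eq \<epsilon> (\<lambda>t x. 0) \<and>
        wave_eq \<beta> (\<lambda>t x. 0) \<and>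
        wave_eq w (\<lambda>t x. - ((c1 + q) * (c2 + q) * exp (q * x) * \<epsilon> t 0)) \<and>
        transport_eq Y \<and>
        (\<exists>\<epsilon>x0 \<epsilon>x1 \<beta>x0 \<beta>x1 \<beta>t0 Yx1 wx0 wx1 wt1.
           has_trace_x \<epsilon> 0 \<epsilon>x0 \<and> has_trace_x \<epsilon> 1 \<epsilon>x1 \<and>
           has_trace_x \<beta> 0 \<beta>x0 \<and> has_trace_x \<beta> 1 \<beta>x1 \<and> has_trace \<beta>' 0 \<beta>t0 \<and>
           has_trace_x Y 1 Yx1 \<and>
           has_trace_x w 0 wx0 \<and> has_trace_x w 1 wx1 \<and> has_trace w' 1 wt1 \<and>
           (AE t in lborel. 0 < t \<longrightarrow>
              \<epsilon>x0 t = c1 * \<epsilon> t 0 \<and>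
              \<epsilon>x1 t = \<beta>x1 t - Yx1 t \<and>
              \<beta>x0 t = c1 / (1 - c0) * \<beta> t 0 + c0 / (1 - c0) * \<beta>t0 t \<and>
              \<beta> t 1 = 0 \<and>
              wx0 t = c2 * w t 0 + (c1 + q) * \<epsilon> t 0 \<and>
              wx1 t = - c3 * wt1 t \<and>
              Y t 0 = - c0 * \<epsilon> t 0)))"

end

theory Submission
  imports Defs "HOL-Computational_Algebra.Polynomial"
begin

text \<open>
  The three wave equations are solved by travelling waves: a wave on \<open>(0,1)\<close> has the
  form \<open>f (t + x) + g (t - x)\<close>, and the boundary conditions become relations between
  the profiles \<open>f\<close> and \<open>g\<close>. The condition at \<open>x = 0\<close> is a
  first order differential equation linking \<open>f\<close> and \<open>g\<close> at the same time
  \<open>t\<close>, and the condition at \<open>x = 1\<close> expresses \<open>f'\<close> at time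
  \<open>t + 1\<close> by \<open>g'\<close> at time \<open>t - 1\<close>. Such a pair of relations
  is called \<open>delay_system\<close> below. It is solved uniquely in steps of length 2, the
  time a wave needs to travel to the far end and back (\<open>delay_system_exists\<close>,
  \<open>delay_system_zero\<close>).

  The coupling between \<open>\<epsilon>\<close>, \<open>Y\<close> and \<open>\<beta>\<close>
  disappears in suitable unknowns. The transport equation gives \<open>Y t x = y (t - x)\<close>,
  so that \<open>Y\<close> is also a solution of the wave equation. The function \<open>z =
  \<epsilon> + Y - \<beta>\<close> then solves the wave equation with \<open>z\<^sub>x = 0\<close>
  at \<open>x = 1\<close>, and at \<open>x = 0\<close> the relation \<open>Y = - c\<^sub>0
  \<epsilon>\<close> turns the condition \<open>\<epsilon>\<^sub>x = c\<^sub>1 \<epsilon>\<close>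
  into the damping condition which \<open>\<beta>\<close> satisfies. Thus \<open>\<beta>\<close>
  and \<open>z\<close> solve two independent damped wave equations, one clamped and one free at
  \<open>x = 1\<close>, and \<open>Y\<close> and \<open>\<epsilon>\<close> are recovered from
  them, since \<open>\<epsilon> + Y = (1 - c\<^sub>0) \<epsilon>\<close> at \<open>x = 0\<close>
  (\<open>boundary_conditions_iff_cascade\<close>). In the equation for \<open>w\<close>, the
  source \<open>exp (q x)\<close> times a multiple \<open>s\<close> of \<open>\<epsilon> t
  0\<close> is absorbed by a particular solution \<open>exp (q x) * r t\<close>, where
  \<open>r\<close> is the solution of \<open>r'' = q\<^sup>2 r + s\<close> that decays with
  \<open>s\<close> (\<open>decaying_particular_solution\<close>). What is left is a delay system
  with damping at the far end.

  Exponential decay comes from energy identities on the time windows \<open>[2n, 2n + 2]\<close>.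
  For \<open>\<beta>\<close> and \<open>z\<close> the energy lost in two windows is at least a
  fixed fraction of the energy (\<open>boundary_damping_decay\<close>); for \<open>w\<close> the
  reflection at \<open>x = 1\<close> multiplies by a factor of modulus less than 1
  (\<open>far_end_damping_decay\<close>). Decay of the profiles is decay in the norm of the state
  space (\<open>U_decays\<close>).

  The solutions in question are only weak. For uniqueness one therefore shows that every weak
  solution is a travelling wave (\<open>weak_wave_is_travelling\<close>): testing the equation
  with functions which are constant along a characteristic direction, up to a factor depending on
  time, shows that \<open>F\<^sub>t \<plusminus> F\<^sub>x\<close> is transported. The traces at
  the end points are then the values of the profiles (\<open>has_trace_iff\<close>), so the
  profiles of an arbitrary solution satisfy the delay systems and are determined by the initial
  values.
\<close>

section \<open>Smooth functions and bump functions\<close>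

lemma C_k_SucI:
  assumes "\<And>z. (f has_derivative D z) (at z)" and "\<And>b. b \<in> Basis \<Longrightarrow> C_k k (\<lambda>z. D z b)"
  shows "C_k (Suc k) f"
proof -
  have "frechet_derivative f (at z) = D z" for z
    using frechet_derivative_at[OF assms(1)] by metis
  then show ?thesis using assms
    by (auto simp: differentiable_on_def differentiable_def intro: has_derivative_at_withinI)
qed

lemma C_k_Suc_D: "C_k (Suc k) f \<Longrightarrow> C_k k f"
proof (induction k arbitrary: f)
  case 0
  then show ?case by (simp add: differentiable_imp_continuous_on)
next
  case (Suc k)
  then show ?case by (metis C_k.simps(2))
qed

lemma C_k_const: "C_k k (\<lambda>z. c)"
proof (induction k arbitrary: c)
  case (Suc k)
  show ?case by (rule C_k_SucI[where D="\<lambda>_ _. 0"]) (auto intro: Suc)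
qed auto

lemma C_k_Suc_has_derivative:
  "C_k (Suc k) f \<Longrightarrow> (f has_derivative frechet_derivative f (at z)) (at z)"
  by (simp add: differentiable_on_def frechet_derivative_works[symmetric])

lemma C_k_add: "C_k k f \<Longrightarrow> C_k k g \<Longrightarrow> C_k k (\<lambda>z. f z + g z)"
proof (induction k arbitrary: f g)
  case (Suc k)
  show ?case
  proof (rule C_k_SucI)
    show "((\<lambda>z. f z + g z) has_derivative
        (\<lambda>h. frechet_derivative f (at z) h + frechet_derivative g (at z) h)) (at z)" for z
      by (intro has_derivative_add C_k_Suc_has_derivative[of k] Suc.prems)
  qed (use Suc in auto)
qed (auto intro: continuous_on_add)

lemma C_k_mult: "C_k k f \<Longrightarrow> C_k k g \<Longrightarrow> C_k k (\<lambda>z. f z * g z)"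
proof (induction k arbitrary: f g)
  case (Suc k)
  show ?case
  proof (rule C_k_SucI)
    show "((\<lambda>z. f z * g z) has_derivative
        (\<lambda>h. f z * frechet_derivative g (at z) h + frechet_derivative f (at z) h * g z)) (at z)" for z
      by (intro has_derivative_mult C_k_Suc_has_derivative[of k] Suc.prems)
    show "C_k k (\<lambda>z. f z * frechet_derivative g (at z) b + frechet_derivative f (at z) b * g z)"
      if "b \<in> Basis" for b
      using Suc.prems that C_k_Suc_D[OF Suc.prems(1)] C_k_Suc_D[OF Suc.prems(2)]
      by (intro C_k_add Suc.IH) auto
  qed
qed (auto intro: continuous_on_mult)

lemma smooth_const: "smooth (\<lambda>z. c)"
  and smooth_add: "smooth f \<Longrightarrow> smooth g \<Longrightarrow> smooth (\<lambda>z. f z + g z)"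
  and smooth_mult: "smooth f \<Longrightarrow> smooth g \<Longrightarrow> smooth (\<lambda>z. f z * g z)"
  by (auto simp: smooth_def C_k_const C_k_add C_k_mult)

lemma smooth_diff: "smooth f \<Longrightarrow> smooth g \<Longrightarrow> smooth (\<lambda>z. f z - g z)"
  using smooth_add[of f "\<lambda>z. (-1) * g z"] smooth_mult[OF smooth_const[of "-1"], of g] by simp

lemma smooth_continuous: "smooth f \<Longrightarrow> continuous_on A f"
proof -
  assume "smooth f"
  then have "C_k 0 f" unfolding smooth_def by blast
  then show ?thesis by (auto intro: continuous_on_subset)
qed

lemma smooth_has_derivative:
  "smooth f \<Longrightarrow> (f has_derivative frechet_derivative f (at z)) (at z)"
proof -
  assume "smooth f"
  then have "C_k (Suc 0) f" unfolding smooth_def by blast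
  then show ?thesis by (rule C_k_Suc_has_derivative)
qed

lemma smooth_frechet:
  "smooth f \<Longrightarrow> b \<in> Basis \<Longrightarrow> smooth (\<lambda>z. frechet_derivative f (at z) b)"
  unfolding smooth_def
proof
  fix k assume "\<forall>k. C_k k f" and b: "b \<in> Basis"
  then have "C_k (Suc k) f" by blast
  then show "C_k k (\<lambda>z. frechet_derivative f (at z) b)" using b by simp
qed

lemma smooth_frechet_real:
  fixes f :: "real \<Rightarrow> real" assumes "smooth f"
  shows "frechet_derivative f (at x) 1 = deriv f x"
proof -
  have h: "(f has_derivative frechet_derivative f (at x)) (at x)" by (rule smooth_has_derivative[OF assms])
  have "frechet_derivative f (at x) 1 * r = frechet_derivative f (at x) r" for r
    using linear_cmul[OF has_derivative_linear[OF h], of r 1] by (simp add: mult.commute)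
  then have "(f has_real_derivative frechet_derivative f (at x) 1) (at x)"
    by (intro has_derivative_imp_has_field_derivative[OF h]) (simp add: mult.commute)
  then show ?thesis by (simp add: DERIV_imp_deriv)
qed

lemma smooth_deriv:
  fixes f :: "real \<Rightarrow> real" assumes "smooth f"
  shows "(f has_real_derivative deriv f x) (at x)" and "smooth (deriv f)"
proof -
  have "f differentiable (at x)" using smooth_has_derivative[OF assms] by (auto simp: differentiable_def)
  then show "(f has_real_derivative deriv f x) (at x)"
    using DERIV_deriv_iff_real_differentiable by blast
  have "deriv f = (\<lambda>z. frechet_derivative f (at z) 1)"
    by (simp add: smooth_frechet_real[OF assms] fun_eq_iff)
  then show "smooth (deriv f)" using smooth_frechet[OF assms, of 1] by simp
qed

lemma C_k_real_SucI:
  fixes f :: "real \<Rightarrow> real"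
  assumes "\<And>x. (f has_real_derivative f' x) (at x)" and "C_k k f'"
  shows "C_k (Suc k) f"
  by (rule C_k_SucI[where D="\<lambda>x h. f' x * h"])
     (use assms in \<open>auto simp: has_field_derivative_def\<close>)

lemma smooth_real_primitive:
  fixes f :: "real \<Rightarrow> real"
  assumes "\<And>x. (f has_real_derivative f' x) (at x)" and "smooth f'"
  shows "smooth f"
  unfolding smooth_def
proof
  fix k show "C_k k f"
    using C_k_Suc_D[OF C_k_real_SucI[OF assms(1), of k]] assms(2) by (simp add: smooth_def)
qed

lemma smooth_compose_affine:
  fixes l :: "'a::euclidean_space"
  assumes "smooth \<theta>" shows "smooth (\<lambda>z. \<theta> (inner l z + c))"
proof -
  have "C_k k (\<lambda>z. \<theta> (inner l z + c))" if "smooth \<theta>" for k \<theta> using that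
  proof (induction k arbitrary: \<theta>)
    case 0
    then show ?case
      by (auto intro!: continuous_intros continuous_on_compose2[OF smooth_continuous[of \<theta> UNIV]])
  next
    case (Suc k)
    show ?case
    proof (rule C_k_SucI)
      show "((\<lambda>z. \<theta> (inner l z + c)) has_derivative
          (\<lambda>h. inner l h * deriv \<theta> (inner l z + c))) (at z)" for z
      proof -
        have "((\<lambda>z. inner l z + c) has_derivative (\<lambda>h. inner l h)) (at z)"
          by (auto intro!: derivative_eq_intros)
        from has_derivative_compose[OF this, of \<theta> "\<lambda>h. deriv \<theta> (inner l z + c) * h"]
        show ?thesis using smooth_deriv(1)[OF Suc.prems, of "inner l z + c"]
          by (simp add: has_field_derivative_def mult.commute[of "inner l _"])
      qed
    qed (intro C_k_mult C_k_const Suc.IH smooth_deriv(2) Suc.prems)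
  qed
  then show ?thesis using assms by (simp add: smooth_def)
qed

text \<open>
  The polynomial parameter makes this family closed under differentiation.
\<close>

definition exp_inv :: "real poly \<Rightarrow> real \<Rightarrow> real" where
  "exp_inv p x = (if x > 0 then poly p (1 / x) * exp (- (1 / x)) else 0)"

lemma poly_times_exp_tendsto_0: "((\<lambda>y::real. y ^ k * poly p y * exp (- y)) \<longlongrightarrow> 0) at_top"
proof (induction p arbitrary: k)
  case (pCons a p)
  have "((\<lambda>y::real. a * (y ^ k / exp y) + y ^ Suc k * poly p y * exp (- y)) \<longlongrightarrow> a * 0 + 0) at_top"
    by (intro tendsto_intros tendsto_power_div_exp_0 pCons.IH)
  then show ?case by (simp add: algebra_simps exp_minus divide_inverse)
qed auto

lemma exp_inv_quotient_tendsto_0: "((\<lambda>x. exp_inv p x / x) \<longlongrightarrow> 0) (at_right 0)"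
proof -
  have "((\<lambda>x::real. (1 / x) ^ 1 * poly p (1 / x) * exp (- (1 / x))) \<longlongrightarrow> 0) (at_right 0)"
    by (rule filterlim_compose[OF poly_times_exp_tendsto_0])
       (use filterlim_inverse_at_top_right in \<open>simp add: inverse_eq_divide\<close>)
  then show ?thesis
    by (rule Lim_transform_eventually)
       (auto simp: eventually_at_filter exp_inv_def intro!: always_eventually)
qed

text \<open>
  With \<open>y = 1 / x\<close> the chain rule gives the factor \<open>- y\<^sup>2\<close>, which
  turns \<open>p\<close> into \<open>y\<^sup>2 (p - p')\<close>; at 0 all difference quotients
  vanish in the limit because the exponential beats every polynomial.
\<close>

lemma exp_inv_has_derivative:
  "(exp_inv p has_real_derivative exp_inv ([:0, 0, 1:] * (p - pderiv p)) x) (at x)"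
proof -
  consider "x < 0" | "x > 0" | "x = 0" by linarith
  then show ?thesis
  proof cases
    case 1
    have "((\<lambda>x. 0) has_real_derivative exp_inv ([:0, 0, 1:] * (p - pderiv p)) x) (at x)"
      using 1 by (simp add: exp_inv_def)
    then show ?thesis
      by (rule has_field_derivative_transform_within_open[where S="{..<0}"])
         (use 1 in \<open>auto simp: exp_inv_def\<close>)
  next
    case 2
    have "((\<lambda>x. poly p (1 / x) * exp (- (1 / x))) has_real_derivative
        exp_inv ([:0, 0, 1:] * (p - pderiv p)) x) (at x)"
      using 2 by (auto intro!: derivative_eq_intros simp: exp_inv_def field_simps power2_eq_square)
    then show ?thesis
      by (rule has_field_derivative_transform_within_open[where S="{0<..}"])
         (use 2 in \<open>auto simp: exp_inv_def\<close>)
  next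
    case 3
    have "((\<lambda>x. exp_inv p x / x) \<longlongrightarrow> 0) (at_left 0)"
      by (rule Lim_transform_eventually[OF tendsto_const])
         (auto simp: eventually_at_filter exp_inv_def intro!: always_eventually)
    then have "((\<lambda>x. exp_inv p x / x) \<longlongrightarrow> 0) (at 0)"
      using exp_inv_quotient_tendsto_0 filterlim_split_at by blast
    then show ?thesis using 3 by (simp add: has_field_derivative_iff exp_inv_def)
  qed
qed

lemma smooth_exp_inv: "smooth (exp_inv p)"
proof -
  have "C_k k (exp_inv p)" for k
  proof (induction k arbitrary: p)
    case 0
    have "continuous_on UNIV (exp_inv p)"
      using exp_inv_has_derivative DERIV_isCont continuous_at_imp_continuous_on by blast
    then show ?case by simp
  next
    case (Suc k)
    show ?case by (rule C_k_real_SucI[OF exp_inv_has_derivative Suc])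
  qed
  then show ?thesis by (simp add: smooth_def)
qed

definition bump :: "real \<Rightarrow> real \<Rightarrow> real \<Rightarrow> real" where
  "bump c \<delta> x = exp_inv 1 (\<delta> - (x - c)) * exp_inv 1 (\<delta> + (x - c))"

lemma bump_pos_iff: "bump c \<delta> x > 0 \<longleftrightarrow> \<bar>x - c\<bar> < \<delta>"
  and bump_nonneg: "bump c \<delta> x \<ge> 0"
  and bump_zero_iff: "bump c \<delta> x = 0 \<longleftrightarrow> \<not> \<bar>x - c\<bar> < \<delta>"
  by (auto simp: bump_def exp_inv_def zero_less_mult_iff)

lemma smooth_bump: "smooth (bump c \<delta>)"
proof -
  have "smooth (\<lambda>x. exp_inv 1 (inner (-1) x + (\<delta> + c)) * exp_inv 1 (inner 1 x + (\<delta> - c)))"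
    by (intro smooth_mult smooth_compose_affine smooth_exp_inv)
  then show ?thesis
    by (rule back_subst[where P=smooth]) (auto simp: bump_def fun_eq_iff algebra_simps)
qed

lemma test_functionI:
  assumes "smooth \<phi>" and "compact K" and "K \<subseteq> U" and "\<And>z. \<phi> z \<noteq> 0 \<Longrightarrow> z \<in> K"
  shows "test_function U \<phi>"
proof -
  have "closure {z. \<phi> z \<noteq> 0} \<subseteq> K"
    using assms by (intro closure_minimal) (auto simp: compact_imp_closed)
  then show ?thesis unfolding test_function_def using assms
    by (metis compact_closure bounded_subset closure_subset compact_imp_bounded subset_trans)
qed

text \<open>
  The support is enlarged so that \<open>c < d\<close> even if it is empty or a single point.
\<close>

lemma test_function_real_support:
  fixes \<phi> :: "real \<Rightarrow> real"
  assumes "test_function {a<..<b} \<phi>" "a < b"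
  obtains c d where "a < c" "c < d" "d < b" "\<And>x. x \<notin> {c..d} \<Longrightarrow> \<phi> x = 0"
proof -
  let ?S = "closure {z. \<phi> z \<noteq> 0}"
  have S: "compact ?S" "?S \<subseteq> {a<..<b}" using assms by (auto simp: test_function_def)
  show ?thesis
  proof (cases "?S = {}")
    case True
    then have "\<phi> x = 0" for x using closure_subset[of "{z. \<phi> z \<noteq> 0}"] by auto
    then show ?thesis using that[of "(2*a+b)/3" "(a+2*b)/3"] assms(2) by auto
  next
    case False
    obtain m where m: "m \<in> ?S" "\<And>y. y \<in> ?S \<Longrightarrow> m \<le> y" using compact_attains_inf[OF S(1) False] by auto
    obtain M where M: "M \<in> ?S" "\<And>y. y \<in> ?S \<Longrightarrow> y \<le> M" using compact_attains_sup[OF S(1) False] by auto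
    have mM: "a < m" "m \<le> M" "M < b" using m M S(2) by auto
    have "\<phi> x = 0" if "x \<notin> {m..(M + b)/2}" for x
    proof (rule ccontr)
      assume "\<phi> x \<noteq> 0"
      then have "x \<in> ?S" using closure_subset[of "{z. \<phi> z \<noteq> 0}"] by auto
      then show False using m(2) M(2) that mM by fastforce
    qed
    then show ?thesis using that[of m "(M + b)/2"] mM by auto
  qed
qed

section \<open>Locally square integrable functions and their primitives\<close>

definition L2loc :: "(real \<Rightarrow> real) \<Rightarrow> bool" where
  "L2loc f \<longleftrightarrow> f \<in> borel_measurable borel \<and> (\<forall>a b. set_integrable lborel {a..b} (\<lambda>x. (f x)\<^sup>2))"

text \<open>
  An absolutely continuous function is carried together with one chosen Borel representative of
  its derivative. This avoids repeated passages to almost everywhere classes: \<open>f'\<close>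
  can be shifted, reflected and glued like an ordinary function.
\<close>

definition prim :: "(real \<Rightarrow> real) \<Rightarrow> (real \<Rightarrow> real) \<Rightarrow> bool" where
  "prim f f' \<longleftrightarrow> L2loc f' \<and> (\<forall>a b. a \<le> b \<longrightarrow> f b - f a = (LINT x:{a..b}|lborel. f' x))"

lemma L2loc_measurable: "L2loc f \<Longrightarrow> f \<in> borel_measurable borel"
  and L2loc_square_integrable: "L2loc f \<Longrightarrow> set_integrable lborel {a..b} (\<lambda>x. (f x)\<^sup>2)"
  by (auto simp: L2loc_def)

lemma set_integrable_continuous:
  fixes f :: "real \<Rightarrow> real"
  shows "continuous_on {a..b} f \<Longrightarrow> set_integrable lborel {a..b} f"
  unfolding set_integrable_def by (rule borel_integrable_compact) auto

lemma set_integrable_bound_mult: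
  fixes f g :: "real \<Rightarrow> real"
  assumes "set_integrable lborel A f" and "A \<in> sets lborel"
    and "g \<in> borel_measurable borel" and "\<And>x. x \<in> A \<Longrightarrow> \<bar>g x\<bar> \<le> C"
  shows "set_integrable lborel A (\<lambda>x. f x * g x)"
proof -
  have m: "(\<lambda>x. indicator A x *\<^sub>R f x) \<in> borel_measurable lborel"
    using assms(1) by (auto simp: set_integrable_def)
  have "integrable lborel (\<lambda>x. C * (indicator A x *\<^sub>R f x))"
    using assms(1) by (auto simp: set_integrable_def)
  then have "integrable lborel (\<lambda>x. (indicator A x *\<^sub>R f x) * g x)"
  proof (rule Bochner_Integration.integrable_bound)
    have "\<bar>f x\<bar> * \<bar>g x\<bar> \<le> \<bar>C\<bar> * \<bar>f x\<bar>" if "x \<in> A" for x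
      using assms(4)[OF that] by (subst mult.commute, intro mult_right_mono) auto
    then show "AE x in lborel. norm ((indicator A x *\<^sub>R f x) * g x) \<le> norm (C * (indicator A x *\<^sub>R f x))"
      by (auto simp: indicator_def abs_mult)
  qed (use m assms(3) in auto)
  then show ?thesis by (simp add: set_integrable_def ac_simps)
qed

lemma L2loc_integrable: assumes "L2loc f" shows "set_integrable lborel {a..b} f"
proof (rule set_integrable_bound)
  show "set_integrable lborel {a..b} (\<lambda>x. 1 + (f x)\<^sup>2)"
    by (intro set_integral_add set_integrable_continuous L2loc_square_integrable assms) auto
  show "set_borel_measurable lborel {a..b} f"
    using assms by (auto simp: set_borel_measurable_def L2loc_def)
  have "\<bar>y\<bar> \<le> 1 + y\<^sup>2" for y :: real
    using sum_squares_bound[of 1 "\<bar>y\<bar>"] by simp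
  then show "AE x in lborel. x \<in> {a..b} \<longrightarrow> norm (f x) \<le> norm (1 + (f x)\<^sup>2)"
    by auto
qed

lemma set_integrable_square_bound:
  fixes f g :: "real \<Rightarrow> real"
  assumes "set_integrable lborel A (\<lambda>x. (f x)\<^sup>2)" "set_integrable lborel A (\<lambda>x. (g x)\<^sup>2)"
    and "set_borel_measurable lborel A f" "set_borel_measurable lborel A g"
  shows "set_integrable lborel A (\<lambda>x. (f x + g x)\<^sup>2)"
proof (rule set_integrable_bound)
  show "set_integrable lborel A (\<lambda>x. 2 * (f x)\<^sup>2 + 2 * (g x)\<^sup>2)"
    using assms by (intro set_integral_add set_integrable_mult_right) auto
  have "(\<lambda>x. (indicator A x *\<^sub>R f x + indicator A x *\<^sub>R g x)\<^sup>2) \<in> borel_measurable lborel"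
    using assms(3,4) unfolding set_borel_measurable_def by measurable
  then show "set_borel_measurable lborel A (\<lambda>x. (f x + g x)\<^sup>2)"
    unfolding set_borel_measurable_def
    by (rule back_subst[where P="\<lambda>f. f \<in> borel_measurable lborel"]) (auto simp: indicator_def fun_eq_iff)
  have "(y + z)\<^sup>2 \<le> 2 * y\<^sup>2 + 2 * z\<^sup>2" for y z :: real
    using sum_squares_bound[of y z] by (simp add: power2_sum)
  then show "AE x in lborel. x \<in> A \<longrightarrow> norm ((f x + g x)\<^sup>2) \<le> norm (2 * (f x)\<^sup>2 + 2 * (g x)\<^sup>2)"
    by auto
qed

lemma L2loc_add: "L2loc f \<Longrightarrow> L2loc g \<Longrightarrow> L2loc (\<lambda>x. f x + g x)"
  unfolding L2loc_def by (auto intro!: set_integrable_square_bound simp: set_borel_measurable_def)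

lemma L2loc_continuous_mult:
  assumes "L2loc f" "continuous_on UNIV g" shows "L2loc (\<lambda>x. f x * g x)"
  unfolding L2loc_def
proof (intro conjI allI)
  have m: "g \<in> borel_measurable borel" using assms by (simp add: borel_measurable_continuous_onI)
  then show "(\<lambda>x. f x * g x) \<in> borel_measurable borel" using assms by (auto simp: L2loc_def)
  fix a b :: real
  have "bounded ((\<lambda>x. (g x)\<^sup>2) ` {a..b})"
    by (intro compact_imp_bounded compact_continuous_image continuous_intros)
       (use assms(2) in \<open>auto intro: continuous_on_subset\<close>)
  then obtain C where "\<And>x. x \<in> {a..b} \<Longrightarrow> \<bar>(g x)\<^sup>2\<bar> \<le> C" unfolding bounded_iff by force
  then have "set_integrable lborel {a..b} (\<lambda>x. (f x)\<^sup>2 * (g x)\<^sup>2)"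
    by (intro set_integrable_bound_mult[where C=C] L2loc_square_integrable assms) (use m in auto)
  then show "set_integrable lborel {a..b} (\<lambda>x. (f x * g x)\<^sup>2)" by (simp add: power_mult_distrib)
qed

lemma L2loc_continuous: "continuous_on UNIV g \<Longrightarrow> L2loc g"
  unfolding L2loc_def
  by (auto intro!: set_integrable_continuous continuous_intros borel_measurable_continuous_onI
      intro: continuous_on_subset)

lemma L2loc_cmult: "L2loc f \<Longrightarrow> L2loc (\<lambda>x. c * f x)"
  using L2loc_continuous_mult[of f "\<lambda>_. c"] by (simp add: mult.commute)

lemma L2loc_uminus: "L2loc f \<Longrightarrow> L2loc (\<lambda>x. - f x)"
  using L2loc_cmult[of f "-1"] by simp

lemma L2loc_diff: "L2loc f \<Longrightarrow> L2loc g \<Longrightarrow> L2loc (\<lambda>x. f x - g x)"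
  using L2loc_add[of f "\<lambda>x. - g x"] L2loc_uminus[of g] by simp

lemma set_integral_translate_reflect:
  fixes f :: "real \<Rightarrow> real"
  shows set_integral_shift: "(LINT x:{a..b}|lborel. f (t + x)) = (LINT x:{t + a..t + b}|lborel. f x)"
    and set_integral_flip: "(LINT x:{a..b}|lborel. f (t - x)) = (LINT x:{t - b..t - a}|lborel. f x)"
    and set_integrable_shift: "set_integrable lborel {a..b} (\<lambda>x. f (t + x)) \<longleftrightarrow> set_integrable lborel {t + a..t + b} f"
    and set_integrable_flip: "set_integrable lborel {a..b} (\<lambda>x. f (t - x)) \<longleftrightarrow> set_integrable lborel {t - b..t - a} f"
proof -
  have 1: "indicator {t + a..t + b} (t + 1 * x) = (indicator {a..b} x :: real)" for x
    by (auto simp: indicator_def)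
  have 2: "indicator {t - b..t - a} (t + (- 1) * x) = (indicator {a..b} x :: real)" for x
    by (auto simp: indicator_def)
  show "(LINT x:{a..b}|lborel. f (t + x)) = (LINT x:{t + a..t + b}|lborel. f x)"
    unfolding set_lebesgue_integral_def
    using lborel_integral_real_affine[of 1 "\<lambda>x. indicator {t + a..t + b} x *\<^sub>R f x" t]
    unfolding 1 by simp
  show "(LINT x:{a..b}|lborel. f (t - x)) = (LINT x:{t - b..t - a}|lborel. f x)"
    unfolding set_lebesgue_integral_def
    using lborel_integral_real_affine[of "-1" "\<lambda>x. indicator {t - b..t - a} x *\<^sub>R f x" t]
    unfolding 2 by simp
  show "set_integrable lborel {a..b} (\<lambda>x. f (t + x)) \<longleftrightarrow> set_integrable lborel {t + a..t + b} f"
    unfolding set_integrable_def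
    using lborel_integrable_real_affine_iff[of 1 "\<lambda>x. indicator {t + a..t + b} x *\<^sub>R f x" t]
    unfolding 1 by simp
  show "set_integrable lborel {a..b} (\<lambda>x. f (t - x)) \<longleftrightarrow> set_integrable lborel {t - b..t - a} f"
    unfolding set_integrable_def
    using lborel_integrable_real_affine_iff[of "-1" "\<lambda>x. indicator {t - b..t - a} x *\<^sub>R f x" t]
    unfolding 2 by simp
qed

lemma L2loc_shift: "L2loc f \<Longrightarrow> L2loc (\<lambda>x. f (t + x))"
  unfolding L2loc_def using set_integrable_shift[of _ _ "\<lambda>x. (f x)\<^sup>2" t] by (auto simp: )

lemma L2loc_flip: "L2loc f \<Longrightarrow> L2loc (\<lambda>x. f (t - x))"
  unfolding L2loc_def using set_integrable_flip[of _ _ "\<lambda>x. (f x)\<^sup>2" t] by (auto simp: )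

lemma prim_L2loc: "prim f f' \<Longrightarrow> L2loc f'"
  by (simp add: prim_def)

lemma prim_eq:
  assumes "prim f f'" "a \<le> b"
  shows "f b = f a + (LINT x:{a..b}|lborel. f' x)"
proof -
  have "f b - f a = (LINT x:{a..b}|lborel. f' x)" using assms unfolding prim_def by blast
  then show ?thesis by linarith
qed

lemma prim_integrable: "prim f f' \<Longrightarrow> set_integrable lborel {a..b} f'"
  by (simp add: L2loc_integrable prim_L2loc)

lemma prim_continuous_on: assumes "prim f f'" shows "continuous_on A f"
proof -
  have "isCont f x" for x
  proof -
    have i: "f' integrable_on {x-1..x+1}" "\<And>y. set_integrable lborel {x-1..y} f'"
      using prim_integrable[OF assms] set_borel_integral_eq_integral(1) by auto
    have "continuous_on {x-1..x+1} (\<lambda>y. f (x-1) + integral {x-1..y} f')"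
      by (intro continuous_intros indefinite_integral_continuous_1 i)
    moreover have "f (x-1) + integral {x-1..y} f' = f y" if "y \<in> {x-1..x+1}" for y
      using prim_eq[OF assms, of "x-1" y] set_borel_integral_eq_integral(2)[OF i(2), of y] that by simp
    ultimately have "continuous_on {x-1..x+1} f"
      by (rule continuous_on_eq)
    then show ?thesis by (rule continuous_on_interior) auto
  qed
  then show ?thesis by (auto intro: continuous_at_imp_continuous_on)
qed

lemma prim_add:
  assumes "prim f f'" "prim g g'" shows "prim (\<lambda>x. f x + g x) (\<lambda>x. f' x + g' x)"
  unfolding prim_def
proof (intro conjI allI impI)
  show "L2loc (\<lambda>x. f' x + g' x)" by (intro L2loc_add prim_L2loc[OF assms(1)] prim_L2loc[OF assms(2)])
  fix a b :: real assume "a \<le> b"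
  then show "f b + g b - (f a + g a) = (LINT x:{a..b}|lborel. f' x + g' x)"
    using prim_eq[OF assms(1), of a b] prim_eq[OF assms(2), of a b]
    by (subst set_integral_add(2)[OF prim_integrable[OF assms(1)] prim_integrable[OF assms(2)]]) auto
qed

lemma prim_cmult: assumes "prim f f'" shows "prim (\<lambda>x. c * f x) (\<lambda>x. c * f' x)"
  unfolding prim_def
proof (intro conjI allI impI)
  show "L2loc (\<lambda>x. c * f' x)" by (intro L2loc_cmult prim_L2loc[OF assms])
  fix a b :: real assume "a \<le> b"
  then show "c * f b - c * f a = (LINT x:{a..b}|lborel. c * f' x)"
    using prim_eq[OF assms, of a b] by (simp add: algebra_simps)
qed

lemma prim_uminus: "prim f f' \<Longrightarrow> prim (\<lambda>x. - f x) (\<lambda>x. - f' x)"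
  using prim_cmult[of f f' "-1"] by simp

lemma prim_diff: "prim f f' \<Longrightarrow> prim g g' \<Longrightarrow> prim (\<lambda>x. f x - g x) (\<lambda>x. f' x - g' x)"
  using prim_add[of f f' "\<lambda>x. - g x" "\<lambda>x. - g' x"] prim_uminus[of g g'] by simp

lemma prim_const: "prim (\<lambda>x. c) (\<lambda>x. 0)"
  by (simp add: prim_def L2loc_continuous)

lemma prim_shift: "prim f f' \<Longrightarrow> prim (\<lambda>x. f (t + x)) (\<lambda>x. f' (t + x))"
  by (auto simp: prim_def L2loc_shift set_integral_shift[of _ _ f'])

lemma prim_flip: assumes "prim f f'" shows "prim (\<lambda>x. f (t - x)) (\<lambda>x. - f' (t - x))"
  unfolding prim_def
proof (intro conjI allI impI)
  show "L2loc (\<lambda>x. - f' (t - x))" by (intro L2loc_uminus L2loc_flip prim_L2loc[OF assms])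
  fix a b :: real assume "a \<le> b"
  then show "f (t - b) - f (t - a) = (LINT x:{a..b}|lborel. - f' (t - x))"
    using prim_eq[OF assms, of "t - b" "t - a"] prim_integrable[OF assms]
    by (subst set_integral_uminus) (auto simp: set_integrable_flip set_integral_flip)
qed

lemma prim_C1:
  assumes "\<And>x. (f has_real_derivative f' x) (at x)" "continuous_on UNIV f'"
  shows "prim f f'"
  unfolding prim_def
proof (intro conjI allI impI)
  show "L2loc f'" by (rule L2loc_continuous[OF assms(2)])
  fix a b :: real assume "a \<le> b"
  have "(\<integral>x. f' x * indicator {a..b} x \<partial>lborel) = f b - f a"
    by (rule integral_FTC_Icc_real[OF \<open>a \<le> b\<close>])
       (use assms in \<open>auto simp: continuous_on_eq_continuous_at\<close>)
  then show "f b - f a = (LINT x:{a..b}|lborel. f' x)"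
    by (simp add: set_lebesgue_integral_def mult.commute)
qed

lemma prim_of_integral:
  assumes "L2loc f'"
  obtains f where "prim f f'" "f c = 0"
proof
  define f where "f = (\<lambda>x. if c \<le> x then LINT y:{c..x}|lborel. f' y else - (LINT y:{x..c}|lborel. f' y))"
  have U: "(LINT y:{a..d}|lborel. f' y) = (LINT y:{a..b}|lborel. f' y) + (LINT y:{b..d}|lborel. f' y)"
    if "a \<le> b" "b \<le> d" for a b d
  proof -
    have "(LINT y:{a..b} \<union> {b..d}|lborel. f' y) = (LINT y:{a..b}|lborel. f' y) + (LINT y:{b..d}|lborel. f' y)"
    proof (rule set_integral_Un_AE)
      show "AE x in lborel. \<not> (x \<in> {a..b} \<and> x \<in> {b..d})"
        using AE_lborel_singleton[of b] by eventually_elim auto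
    qed (auto intro: L2loc_integrable[OF assms])
    moreover have "{a..b} \<union> {b..d} = {a..d}" using that by auto
    ultimately show ?thesis by simp
  qed
  show "prim f f'"
    unfolding prim_def
  proof (intro conjI allI impI assms)
    fix a b :: real assume "a \<le> b"
    then show "f b - f a = (LINT x:{a..b}|lborel. f' x)"
      using U[of c a b] U[of a c b] U[of a b c] by (auto simp: f_def)
  qed
  have "(LINT y:{c..c}|lborel. f' y) = 0"
    using U[of c c c] by simp
  then show "f c = 0" by (simp add: f_def)
qed

text \<open>
  Fubini's theorem on the triangle \<open>a \<le> y \<le> x \<le> b\<close>.
\<close>

lemma prim_product_integral:
  assumes f: "prim f f'" and \<eta>: "prim \<eta> \<eta>'" and "a \<le> b"
  shows "(LINT x:{a..b}|lborel. f x * \<eta>' x + f' x * \<eta> x) = f b * \<eta> b - f a * \<eta> a"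
proof -
  have c\<eta>: "continuous_on UNIV \<eta>" by (rule prim_continuous_on[OF \<eta>])
  have m[measurable]: "\<eta>' \<in> borel_measurable borel" "\<eta> \<in> borel_measurable borel" "f' \<in> borel_measurable borel"
    using c\<eta> f \<eta> by (auto intro: borel_measurable_continuous_onI L2loc_measurable prim_L2loc)
  define K where "K = (\<lambda>(x::real, y::real). (if a \<le> y \<and> y \<le> x \<and> x \<le> b then f' y * \<eta>' x else 0))"
  have mK: "K \<in> borel_measurable (lborel \<Otimes>\<^sub>M lborel)" unfolding K_def by measurable
  have iK: "integrable (lborel \<Otimes>\<^sub>M lborel) K"
  proof (rule Bochner_Integration.integrable_bound)
    show "integrable (lborel \<Otimes>\<^sub>M lborel) (\<lambda>(x, y). (indicator {a..b} x * \<eta>' x) * (indicator {a..b} y * f' y))"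
    proof (rule lborel_pair.Fubini_integrable)
      show "integrable lborel (\<lambda>x. LINT y|lborel. norm (case (x, y) of (x, y) \<Rightarrow> (indicator {a..b} x * \<eta>' x) * (indicator {a..b} y * f' y)))"
        using integrable_abs[OF prim_integrable[OF \<eta>, of a b, unfolded set_integrable_def]] by (simp add: abs_mult)
      show "AE x in lborel. integrable lborel (\<lambda>y. case (x, y) of (x, y) \<Rightarrow> (indicator {a..b} x * \<eta>' x) * (indicator {a..b} y * f' y))"
        using prim_integrable[OF f, of a b] by (auto simp: set_integrable_def)
    qed measurable
    show "AE z in lborel \<Otimes>\<^sub>M lborel. norm (K z) \<le> norm (case z of (x, y) \<Rightarrow> (indicator {a..b} x * \<eta>' x) * (indicator {a..b} y * f' y))"
      by (rule AE_I2) (auto simp: K_def indicator_def mult.commute)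
  qed (rule mK)
  have "(LINT x|lborel. LINT y|lborel. K (x, y)) = (LINT y|lborel. LINT x|lborel. K (x, y))"
    using lborel_pair.Fubini_integral[of "\<lambda>x y. K (x, y)"] iK by (simp add: case_prod_unfold)
  moreover have "(LINT y|lborel. K (x, y)) = indicator {a..b} x *\<^sub>R (\<eta>' x * (f x - f a))" for x
  proof -
    have "(LINT y|lborel. K (x, y)) = (LINT y|lborel. indicator {a..b} x * \<eta>' x * (indicator {a..x} y *\<^sub>R f' y))"
      by (intro Bochner_Integration.integral_cong) (auto simp: K_def indicator_def)
    also have "\<dots> = indicator {a..b} x * \<eta>' x * (LINT y:{a..x}|lborel. f' y)"
      by (simp add: set_lebesgue_integral_def)
    finally show ?thesis using prim_eq[OF f, of a x] by (auto simp: indicator_def)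
  qed
  moreover have "(LINT x|lborel. K (x, y)) = indicator {a..b} y *\<^sub>R (f' y * (\<eta> b - \<eta> y))" for y
  proof -
    have "(LINT x|lborel. K (x, y)) = (LINT x|lborel. indicator {a..b} y * f' y * (indicator {y..b} x *\<^sub>R \<eta>' x))"
      by (intro Bochner_Integration.integral_cong) (auto simp: K_def indicator_def)
    also have "\<dots> = indicator {a..b} y * f' y * (LINT x:{y..b}|lborel. \<eta>' x)"
      by (simp add: set_lebesgue_integral_def)
    finally show ?thesis using prim_eq[OF \<eta>, of y b] by (auto simp: indicator_def)
  qed
  ultimately have *: "(LINT x:{a..b}|lborel. \<eta>' x * (f x - f a)) = (LINT y:{a..b}|lborel. f' y * (\<eta> b - \<eta> y))"
    by (simp add: set_lebesgue_integral_def)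
  have "L2loc (\<lambda>x. \<eta>' x * f x)" by (intro L2loc_continuous_mult prim_L2loc[OF \<eta>] prim_continuous_on[OF f])
  then have i: "set_integrable lborel {a..b} (\<lambda>x. \<eta>' x * f x)" "set_integrable lborel {a..b} (\<lambda>x. f a * \<eta>' x)"
    using prim_integrable[OF \<eta>] by (auto intro: L2loc_integrable)
  have "L2loc (\<lambda>y. f' y * \<eta> y)" by (intro L2loc_continuous_mult prim_L2loc[OF f] c\<eta>)
  then have j: "set_integrable lborel {a..b} (\<lambda>y. f' y * \<eta> y)" "set_integrable lborel {a..b} (\<lambda>y. \<eta> b * f' y)"
    using prim_integrable[OF f] by (auto intro: L2loc_integrable)
  have "(LINT x:{a..b}|lborel. \<eta>' x * f x - f a * \<eta>' x) = (LINT x:{a..b}|lborel. \<eta>' x * f x) - f a * (\<eta> b - \<eta> a)"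
    using i prim_eq[OF \<eta> \<open>a \<le> b\<close>] by (subst set_integral_diff) auto
  moreover have "(LINT y:{a..b}|lborel. \<eta> b * f' y - f' y * \<eta> y) = \<eta> b * (f b - f a) - (LINT y:{a..b}|lborel. f' y * \<eta> y)"
    using j prim_eq[OF f \<open>a \<le> b\<close>] by (subst set_integral_diff) auto
  ultimately have "(LINT x:{a..b}|lborel. \<eta>' x * f x) + (LINT y:{a..b}|lborel. f' y * \<eta> y) = f b * \<eta> b - f a * \<eta> a"
    using * by (simp add: algebra_simps)
  then show ?thesis using i j by (subst set_integral_add) (auto simp: mult.commute)
qed

lemma prim_by_parts:
  assumes "prim f f'" and "\<And>x. (\<eta> has_real_derivative \<eta>' x) (at x)" "continuous_on UNIV \<eta>'" and "a \<le> b"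
  shows "(LINT x:{a..b}|lborel. f x * \<eta>' x + f' x * \<eta> x) = f b * \<eta> b - f a * \<eta> a"
  by (rule prim_product_integral[OF assms(1) prim_C1[OF assms(2,3)] assms(4)])

lemma prim_mult:
  assumes f: "prim f f'" and \<eta>: "prim \<eta> \<eta>'"
  shows "prim (\<lambda>x. f x * \<eta> x) (\<lambda>x. f x * \<eta>' x + f' x * \<eta> x)"
proof -
  have "L2loc (\<lambda>x. \<eta>' x * f x + f' x * \<eta> x)"
    by (intro L2loc_add L2loc_continuous_mult prim_continuous_on[OF f] prim_continuous_on[OF \<eta>]
        prim_L2loc[OF f] prim_L2loc[OF \<eta>])
  then show ?thesis using prim_product_integral[OF assms] by (simp add: prim_def mult.commute)
qed

section \<open>The lemma of du Bois-Reymond and the space H1\<close>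

lemma set_integral_Ioo_Icc:
  fixes f :: "real \<Rightarrow> real"
  shows "(LINT x:{a<..<b}|lborel. f x) = (LINT x:{a..b}|lborel. f x)"
  by (rule set_integral_discrete_difference[where X="{a, b}"]) auto

lemma set_integrable_Ioo_Icc:
  fixes f :: "real \<Rightarrow> real"
  shows "set_integrable lborel {a<..<b} f \<longleftrightarrow> set_integrable lborel {a..b} f"
  by (rule set_integrable_discrete_difference[where X="{a, b}"]) auto

lemma prim_test_by_parts:
  assumes f: "prim f f'" and \<eta>: "test_function {a<..<b} \<eta>" and "a < b"
  shows "(LINT x:{a<..<b}|lborel. f x * deriv \<eta> x) = - (LINT x:{a<..<b}|lborel. f' x * \<eta> x)"
proof -
  have s: "smooth \<eta>" using \<eta> by (simp add: test_function_def)
  note d = smooth_deriv[OF s]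
  obtain c e where ce: "a < c" "c < e" "e < b" "\<And>x. x \<notin> {c..e} \<Longrightarrow> \<eta> x = 0"
    using test_function_real_support[OF \<eta> \<open>a < b\<close>] by metis
  have "(LINT x:{a..b}|lborel. f x * deriv \<eta> x + f' x * \<eta> x) = f b * \<eta> b - f a * \<eta> a"
    using prim_by_parts[OF f d(1) smooth_continuous[OF d(2)], of a b] \<open>a < b\<close> by simp
  moreover have "\<eta> a = 0" "\<eta> b = 0" using ce by auto
  moreover have "set_integrable lborel {a..b} (\<lambda>x. f x * deriv \<eta> x)"
    by (intro set_integrable_continuous continuous_intros prim_continuous_on[OF f] smooth_continuous[OF d(2)])
  moreover have "set_integrable lborel {a..b} (\<lambda>x. f' x * \<eta> x)"
    by (intro L2loc_integrable L2loc_continuous_mult prim_L2loc[OF f] smooth_continuous[OF s])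
  ultimately show ?thesis
    by (simp add: set_integral_Ioo_Icc set_integral_add)
qed

text \<open>
  If \<open>k x > k y\<close>, a bump near \<open>x\<close> minus the same bump near
  \<open>y\<close> has integral 0, hence is the derivative of a test function, and
  \<open>k\<close> has a positive integral against it.
\<close>

lemma du_bois_reymond:
  assumes k: "continuous_on {a..b} k" and "a < b"
    and orth: "\<And>\<eta>. test_function {a<..<b} \<eta> \<Longrightarrow> (LINT x:{a<..<b}|lborel. k x * deriv \<eta> x) = 0"
  shows "\<And>x. x \<in> {a..b} \<Longrightarrow> k x = k a"
proof -
  have F: False if xy: "x \<in> {a<..<b}" "y \<in> {a<..<b}" "k x > k y" for x y
  proof -
    \<comment> \<open>The level \<open>m\<close> separates the values of \<open>k\<close> near
      \<open>x\<close> from those near \<open>y\<close>.\<close>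
    define m where "m = (k x + k y) / 2"
    have k': "continuous_on {a<..<b} k" by (rule continuous_on_subset[OF k]) auto
    have U: "open ({a<..<b} \<inter> k -` {m<..})" "open ({a<..<b} \<inter> k -` {..<m})"
      by (auto intro: continuous_open_preimage[OF k'])
    have "x \<in> {a<..<b} \<inter> k -` {m<..}" "y \<in> {a<..<b} \<inter> k -` {..<m}" using xy by (auto simp: m_def)
    then obtain \<delta>1 \<delta>2 where d12: "\<delta>1 > 0" "cball x \<delta>1 \<subseteq> {a<..<b} \<inter> k -` {m<..}"
        "\<delta>2 > 0" "cball y \<delta>2 \<subseteq> {a<..<b} \<inter> k -` {..<m}"
      using U by (meson open_contains_cball)
    define \<delta> where "\<delta> = min \<delta>1 \<delta>2"
    have \<delta>: "\<delta> > 0" "\<And>z. \<bar>z - x\<bar> \<le> \<delta> \<Longrightarrow> z \<in> {a<..<b} \<and> k z > m"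
      "\<And>z. \<bar>z - y\<bar> \<le> \<delta> \<Longrightarrow> z \<in> {a<..<b} \<and> k z < m"
      using d12 by (auto simp: \<delta>_def subset_iff dist_real_def abs_minus_commute)
    define B where "B = bump 0 \<delta>"
    have B: "smooth B" "\<And>z. B z \<ge> 0" "\<And>z. B z > 0 \<longleftrightarrow> \<bar>z\<bar> < \<delta>" "\<And>z. B z = 0 \<longleftrightarrow> \<not> \<bar>z\<bar> < \<delta>"
      unfolding B_def by (auto simp: smooth_bump bump_nonneg bump_pos_iff bump_zero_iff)
    have "\<exists>G. \<forall>z. - \<infinity> < ereal z \<longrightarrow> ereal z < \<infinity> \<longrightarrow> (G has_vector_derivative B z) (at z)"
      by (rule einterval_antiderivative)
         (use smooth_continuous[OF B(1), of UNIV] in \<open>auto simp: continuous_on_eq_continuous_at\<close>)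
    then obtain G where G: "\<And>z. (G has_real_derivative B z) (at z)"
      by (auto simp: has_real_derivative_iff_has_vector_derivative)
    have sG: "smooth G" by (rule smooth_real_primitive[OF G B(1)])
    have G0: "(G has_field_derivative 0) (at z within S)" if "\<not> \<bar>z\<bar> < \<delta>" for z S
      using has_field_derivative_at_within[OF G[of z], of S] B(4)[of z] that by simp
    have "\<exists>c. \<forall>z\<in>{..-\<delta>}. G z = c"
      by (rule has_field_derivative_zero_constant) (use \<delta>(1) in \<open>auto intro!: G0\<close>)
    then have G1: "\<And>z. z \<le> -\<delta> \<Longrightarrow> G z = G (-\<delta>)" by force
    have "\<exists>c. \<forall>z\<in>{\<delta>..}. G z = c"
      by (rule has_field_derivative_zero_constant) (use \<delta>(1) in \<open>auto intro!: G0\<close>)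
    then have G2: "\<And>z. z \<ge> \<delta> \<Longrightarrow> G z = G \<delta>" by force
    have G3: "G (-\<delta>) < G \<delta>"
    proof (rule DERIV_pos_imp_increasing_open[where f=G])
      fix z assume "-\<delta> < z" "z < \<delta>"
      then show "\<exists>y. (G has_real_derivative y) (at z) \<and> 0 < y" using G[of z] B(3)[of z] by auto
    qed (use \<delta>(1) smooth_continuous[OF sG] in auto)
    define \<Theta> where "\<Theta> = (\<lambda>z. G (z - x) - G (z - y))"
    define \<theta> where "\<theta> = (\<lambda>z. B (z - x) - B (z - y))"
    have D: "(\<Theta> has_real_derivative \<theta> z) (at z)" for z
      unfolding \<Theta>_def \<theta>_def
      by (auto intro!: derivative_eq_intros DERIV_chain2[OF G])
    then have dT: "deriv \<Theta> = \<theta>" by (auto simp: DERIV_imp_deriv fun_eq_iff)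
    have s\<theta>: "smooth \<theta>"
      using smooth_diff[OF smooth_compose_affine[OF B(1), of "1::real" "-x"] smooth_compose_affine[OF B(1), of "1::real" "-y"]]
      by (simp add: \<theta>_def inner_real_def)
    have "test_function {a<..<b} \<Theta>"
    proof (rule test_functionI[where K="{min x y - \<delta>..max x y + \<delta>}"])
      show "smooth \<Theta>" by (rule smooth_real_primitive[OF D s\<theta>])
      show "{min x y - \<delta>..max x y + \<delta>} \<subseteq> {a<..<b}"
        using \<delta>(2)[of "x - \<delta>"] \<delta>(2)[of "x + \<delta>"] \<delta>(3)[of "y - \<delta>"] \<delta>(3)[of "y + \<delta>"] \<delta>(1)
        by (auto simp: min_def max_def split: if_splits)
      fix z assume "\<Theta> z \<noteq> 0"
      then show "z \<in> {min x y - \<delta>..max x y + \<delta>}"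
        using G1[of "z - x"] G1[of "z - y"] G2[of "z - x"] G2[of "z - y"]
        by (fastforce simp: \<Theta>_def min_def max_def)
    qed simp
    from orth[OF this] have 1: "(LINT z:{a..b}|lborel. k z * \<theta> z) = 0"
      by (simp add: dT set_integral_Ioo_Icc)
    have "\<Theta> a = 0" "\<Theta> b = 0"
      using \<delta>(2)[of "x - \<delta>"] \<delta>(2)[of "x + \<delta>"] \<delta>(3)[of "y - \<delta>"] \<delta>(3)[of "y + \<delta>"] \<delta>(1)
        G1[of "a - x"] G1[of "a - y"] G2[of "b - x"] G2[of "b - y"] by (auto simp: \<Theta>_def)
    then have 2: "(LINT z:{a..b}|lborel. \<theta> z) = 0"
      using prim_eq[OF prim_C1[OF D smooth_continuous[OF s\<theta>]], of a b] \<open>a < b\<close> by simp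
    have DG: "((\<lambda>z. G (z - x)) has_real_derivative B (z - x)) (at z)" for z
      using DERIV_shift[of G "B (z - x)" z "- x"] G[of "z - x"] by simp
    have cB: "continuous_on UNIV (\<lambda>z. B (z - x))"
      by (intro continuous_on_compose2[OF smooth_continuous[OF B(1), of UNIV]] continuous_intros) auto
    have 3: "(LINT z:{a..b}|lborel. B (z - x)) > 0"
      using prim_eq[OF prim_C1[OF DG cB], of a b] \<open>a < b\<close> G3
        \<delta>(2)[of "x - \<delta>"] \<delta>(2)[of "x + \<delta>"] \<delta>(1) G1[of "a - x"] G2[of "b - x"] by auto
    have sub: "{x - \<delta>..x + \<delta>} \<subseteq> {a..b}"
    proof
      fix z assume "z \<in> {x - \<delta>..x + \<delta>}"
      then show "z \<in> {a..b}" using \<delta>(2)[of z] by (simp add: abs_le_iff)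
    qed
    have "{x - \<delta>..x + \<delta>} \<noteq> {}" using \<delta>(1) by simp
    then obtain z0 where z0: "z0 \<in> {x - \<delta>..x + \<delta>}" "\<And>z. z \<in> {x - \<delta>..x + \<delta>} \<Longrightarrow> k z0 \<le> k z"
      using continuous_attains_inf[OF compact_Icc _ continuous_on_subset[OF k sub]] by blast
    have z0m: "k z0 > m" using \<delta>(2)[of z0] z0(1) by (auto simp: abs_le_iff)
    have "(k z0 - m) * B (z - x) \<le> k z * \<theta> z - m * \<theta> z" for z
    proof -
      have "(k z0 - m) * B (z - x) \<le> (k z - m) * B (z - x)"
        using z0(2)[of z] B(4)[of "z - x"] B(2)[of "z - x"]
        by (cases "\<bar>z - x\<bar> < \<delta>") (auto intro!: mult_right_mono simp: abs_less_iff)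
      moreover have "0 \<le> (m - k z) * B (z - y)"
        using \<delta>(3)[of z] B(4)[of "z - y"] B(2)[of "z - y"]
        by (cases "\<bar>z - y\<bar> < \<delta>") (auto intro!: mult_nonneg_nonneg)
      ultimately show ?thesis by (simp add: \<theta>_def algebra_simps)
    qed
    then have "(LINT z:{a..b}|lborel. (k z0 - m) * B (z - x)) \<le> (LINT z:{a..b}|lborel. k z * \<theta> z - m * \<theta> z)"
      by (intro set_integral_mono set_integrable_continuous set_integral_diff(1) continuous_intros k
          continuous_on_subset[OF cB] smooth_continuous[OF s\<theta>]) auto
    also have "\<dots> = (LINT z:{a..b}|lborel. k z * \<theta> z) - m * (LINT z:{a..b}|lborel. \<theta> z)"
      by (subst set_integral_diff) (auto intro!: set_integrable_continuous continuous_intros k smooth_continuous[OF s\<theta>])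
    finally show False using 1 2 3 z0m by (simp add: mult_le_0_iff)
  qed
  define p where "p = (a + b) / 2"
  have p: "p \<in> {a<..<b}" using \<open>a < b\<close> by (auto simp: p_def)
  have "k x = k p" if "x \<in> {a<..<b}" for x
    using F[OF that p] F[OF p that] by (meson linorder_less_linear)
  then have *: "k x = k p" if "x \<in> {a..b}" for x
    using continuous_constant_on_closure[of "{a<..<b}" k "k p" x] k \<open>a < b\<close> that by auto
  fix x assume "x \<in> {a..b}"
  then show "k x = k a" using *[of x] *[of a] \<open>a < b\<close> by auto
qed

text \<open>
  A primitive of \<open>g\<close> is orthogonal to all derivatives of test functions, hence
  constant, and by Lebesgue's differentiation theorem \<open>g\<close> is its derivative almost
  everywhere.
\<close>

lemma AE_zero_if_orthogonal:
  assumes g: "L2loc g" and "a < b"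
    and orth: "\<And>\<eta>. test_function {a<..<b} \<eta> \<Longrightarrow> (LINT x:{a<..<b}|lborel. g x * \<eta> x) = 0"
  shows "AE x in lborel. x \<in> {a<..<b} \<longrightarrow> g x = 0"
proof -
  obtain G where G: "prim G g" using prim_of_integral[OF g] by metis
  have c: "G x = G a" if "x \<in> {a..b}" for x
    using du_bois_reymond[OF prim_continuous_on[OF G] \<open>a < b\<close> _ that]
      prim_test_by_parts[OF G _ \<open>a < b\<close>] orth by auto
  have i: "integral {x..y} g = G y - G x" if "x \<le> y" for x y
    using set_borel_integral_eq_integral(2)[OF L2loc_integrable[OF g, of x y]] prim_eq[OF G that] by simp
  have "\<And>x y. g integrable_on cbox x y"
    using set_borel_integral_eq_integral(1)[OF L2loc_integrable[OF g]] by simp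
  then obtain N where N: "negligible N"
    "\<And>x e. \<lbrakk>x \<notin> N; 0 < e\<rbrakk> \<Longrightarrow> \<exists>d>0. \<forall>h. 0 < h \<and> h < d \<longrightarrow>
        norm (integral (cbox x (x + h *\<^sub>R One)) g /\<^sub>R h ^ DIM(real) - g x) < e"
    using integrable_ccontinuous_explicit[of g] by metis
  have "g x = 0" if x: "x \<notin> N" "x \<in> {a<..<b}" for x
  proof (rule ccontr)
    assume "g x \<noteq> 0"
    then obtain d where d: "d > 0"
      "\<And>h. 0 < h \<Longrightarrow> h < d \<Longrightarrow> \<bar>integral {x..x + h} g / h - g x\<bar> < \<bar>g x\<bar>"
      using N(2)[OF x(1), of "\<bar>g x\<bar>"] by (auto simp: divide_inverse mult.commute)
    define h where "h = min (d / 2) (b - x)"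
    have h: "0 < h" "h < d" "x + h \<le> b" using d x by (auto simp: h_def)
    have "integral {x..x + h} g = 0" using i[of x "x + h"] c[of x] c[of "x + h"] h x by auto
    then show False using d(2)[OF h(1,2)] by simp
  qed
  moreover have "AE x in lborel. x \<notin> N"
    using N(1) by (metis AE_completion_iff AE_not_in negligible_iff_null_sets)
  ultimately show ?thesis by auto
qed

lemma L2loc_imp_L2: "L2loc f \<Longrightarrow> f \<in> L2"
  by (auto simp: L2_def L2loc_def set_integrable_Ioo_Icc set_borel_measurable_def)

lemma L2_imp_L2loc:
  assumes "f \<in> L2" shows "L2loc (\<lambda>x. indicator {0<..<1} x * f x)"
  unfolding L2loc_def
proof (intro conjI allI)
  show "(\<lambda>x. indicator {0<..<1} x * f x) \<in> borel_measurable borel"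
    using assms by (simp add: L2_def set_borel_measurable_def)
  fix a b :: real
  have "integrable lborel (\<lambda>x. indicator {a..b} x *\<^sub>R (indicator {0<..<1} x *\<^sub>R (f x)\<^sup>2))"
    by (rule integrable_mult_indicator) (use assms in \<open>auto simp: L2_def set_integrable_def\<close>)
  then show "set_integrable lborel {a..b} (\<lambda>x. (indicator {0<..<1} x * f x)\<^sup>2)"
    unfolding set_integrable_def
    by (rule back_subst[where P="integrable lborel"]) (auto simp: indicator_def fun_eq_iff)
qed

lemma L2_repr:
  assumes "f \<in> L2" obtains g where "L2loc g" "\<And>x. x \<in> {0<..<1} \<Longrightarrow> g x = f x"
  using L2_imp_L2loc[OF assms] by (rule that) auto

lemma prim_has_weak_deriv: "prim F G \<Longrightarrow> has_weak_deriv F G"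
  unfolding has_weak_deriv_def using prim_test_by_parts[of F G 0 1] by auto

lemma has_weak_deriv_cong:
  assumes "\<And>x. x \<in> {0<..<1} \<Longrightarrow> f x = F x" "\<And>x. x \<in> {0<..<1} \<Longrightarrow> g x = G x"
  shows "has_weak_deriv f g \<longleftrightarrow> has_weak_deriv F G"
proof -
  have "(LINT x:{0<..<1}|lborel. f x * h x) = (LINT x:{0<..<1}|lborel. F x * h x)"
    "(LINT x:{0<..<1}|lborel. g x * h x) = (LINT x:{0<..<1}|lborel. G x * h x)" for h
    using assms by (auto intro!: set_lebesgue_integral_cong)
  then show ?thesis by (simp add: has_weak_deriv_def)
qed

text \<open>
  Subtracting a primitive of the weak derivative leaves a continuous function with weak derivative
  0, which is constant. Hence the elements of \<open>H1\<close> are exactly the restrictions of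
  primitives of square integrable functions, and all further work is done with primitives.
\<close>

lemma weak_deriv_prim:
  assumes "continuous_on {0..1} f" "g \<in> L2" "has_weak_deriv f g"
  obtains F G where "prim F G" "\<And>x. x \<in> {0..1} \<Longrightarrow> f x = F x" "\<And>x. x \<in> {0<..<1} \<Longrightarrow> g x = G x"
proof -
  obtain G where G: "L2loc G" "\<And>x. x \<in> {0<..<1} \<Longrightarrow> G x = g x" using L2_repr[OF assms(2)] by metis
  obtain F where F: "prim F G" "F 0 = 0" using prim_of_integral[OF G(1)] by metis
  have w: "has_weak_deriv f G" using assms(3) G(2) has_weak_deriv_cong[of f f g G] by auto
  have c: "continuous_on {0..1} (\<lambda>x. f x - F x)"
    by (intro continuous_intros assms(1) prim_continuous_on[OF F(1)])
  have k: "f x - F x = f 0 - F 0" if "x \<in> {0..1}" for x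
  proof (rule du_bois_reymond[OF c _ _ that])
    fix \<eta> :: "real \<Rightarrow> real" assume \<eta>: "test_function {0<..<1} \<eta>"
    then have c\<eta>: "continuous_on {0..1} (deriv \<eta>)"
      by (intro smooth_continuous smooth_deriv) (simp add: test_function_def)
    have "(LINT x:{0<..<1}|lborel. f x * deriv \<eta> x - F x * deriv \<eta> x) =
        (LINT x:{0<..<1}|lborel. f x * deriv \<eta> x) - (LINT x:{0<..<1}|lborel. F x * deriv \<eta> x)"
      by (intro set_integral_diff(2); unfold set_integrable_Ioo_Icc;
          intro set_integrable_continuous continuous_intros assms(1) prim_continuous_on[OF F(1)] c\<eta>)
    also have "\<dots> = 0"
      using w prim_has_weak_deriv[OF F(1)] \<eta> by (auto simp: has_weak_deriv_def)
    finally show "(LINT x:{0<..<1}|lborel. (f x - F x) * deriv \<eta> x) = 0"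
      by (simp add: left_diff_distrib)
  qed simp
  show ?thesis
  proof (rule that)
    show "prim (\<lambda>x. F x + f 0) G" using prim_add[OF F(1) prim_const[of "f 0"]] by simp
    show "\<And>x. x \<in> {0..1} \<Longrightarrow> f x = F x + f 0" using k F(2) by force
    show "\<And>x. x \<in> {0<..<1} \<Longrightarrow> g x = G x" using G(2) by simp
  qed
qed

lemma prim_AE_unique:
  assumes "prim f f'" "prim g g'" "a < b" "\<And>x. x \<in> {a<..<b} \<Longrightarrow> f x = g x"
  shows "AE x in lborel. x \<in> {a<..<b} \<longrightarrow> f' x = g' x"
proof -
  have p: "prim (\<lambda>x. f x - g x) (\<lambda>x. f' x - g' x)" by (rule prim_diff[OF assms(1,2)])
  have "AE x in lborel. x \<in> {a<..<b} \<longrightarrow> f' x - g' x = 0"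
  proof (rule AE_zero_if_orthogonal[OF prim_L2loc[OF p] \<open>a < b\<close>])
    fix \<eta> :: "real \<Rightarrow> real" assume \<eta>: "test_function {a<..<b} \<eta>"
    have "(LINT x:{a<..<b}|lborel. (f x - g x) * deriv \<eta> x) = (LINT x:{a<..<b}|lborel. 0)"
      using assms(4) by (intro set_lebesgue_integral_cong) auto
    then show "(LINT x:{a<..<b}|lborel. (f' x - g' x) * \<eta> x) = 0"
      using prim_test_by_parts[OF p \<eta> \<open>a < b\<close>] by simp
  qed
  then show ?thesis by simp
qed

lemma wderiv_H1: "f \<in> H1 \<Longrightarrow> wderiv f \<in> L2 \<and> has_weak_deriv f (wderiv f)"
  unfolding wderiv_def H1_def using someI_ex[of "\<lambda>g. g \<in> L2 \<and> has_weak_deriv f g"] by auto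

lemma H1_repr:
  assumes "f \<in> H1"
  obtains F G where "prim F G" "\<And>x. x \<in> {0..1} \<Longrightarrow> f x = F x" "\<And>x. x \<in> {0<..<1} \<Longrightarrow> wderiv f x = G x"
  using weak_deriv_prim[of f "wderiv f"] wderiv_H1[OF assms] assms by (auto simp: H1_def)

lemma H1_of_prim:
  assumes "prim F G" "\<And>x. x \<in> {0..1} \<Longrightarrow> f x = F x"
  shows "f \<in> H1" and "AE x\<in>{0<..<1} in lborel. wderiv f x = G x"
proof -
  have "has_weak_deriv f G"
    using prim_has_weak_deriv[OF assms(1)] has_weak_deriv_cong[of f F G G] assms(2) by simp
  moreover have "continuous_on {0..1} f"
    using prim_continuous_on[OF assms(1)] by (rule continuous_on_eq) (use assms(2) in auto)
  ultimately show H: "f \<in> H1"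
    using L2loc_imp_L2[OF prim_L2loc[OF assms(1)]] by (auto simp: H1_def)
  obtain F' G' where F': "prim F' G'" "\<And>x. x \<in> {0..1} \<Longrightarrow> f x = F' x" "\<And>x. x \<in> {0<..<1} \<Longrightarrow> wderiv f x = G' x"
    using H1_repr[OF H] by blast
  have "AE x\<in>{0<..<1} in lborel. G' x = G x"
    by (rule prim_AE_unique[OF F'(1) assms(1)]) (use F'(2) assms(2) in force)+
  then show "AE x\<in>{0<..<1} in lborel. wderiv f x = G x"
    by eventually_elim (use F'(3) in auto)
qed

lemma L2loc_abs: "L2loc u \<Longrightarrow> L2loc (\<lambda>x. \<bar>u x\<bar>)"
  by (auto simp: L2loc_def)

lemma set_integral_const_Icc: "a \<le> b \<Longrightarrow> (LINT x:{a..b}|lborel. c) = c * (b - a :: real)"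
  by (simp add: set_lebesgue_integral_def)

text \<open>
  The integral of \<open>(u - m)\<^sup>2\<close>, with \<open>m\<close> the mean of
  \<open>u\<close>, is nonnegative.
\<close>

lemma L2loc_cauchy_schwarz:
  assumes u: "L2loc u" and "a \<le> b"
  shows "(LINT x:{a..b}|lborel. u x)\<^sup>2 \<le> (b - a) * (LINT x:{a..b}|lborel. (u x)\<^sup>2)"
proof (cases "a = b")
  case True
  have "(LINT x:{b..b}|lborel. u x) = 0"
    using set_integral_Ioo_Icc[of b b u] by (simp add: set_lebesgue_integral_def)
  then show ?thesis using True by simp
next
  case False
  then have ab: "a < b" using assms by simp
  define I where "I = (LINT x:{a..b}|lborel. u x)"
  define m where "m = I / (b - a)"
  have i: "set_integrable lborel {a..b} u" "set_integrable lborel {a..b} (\<lambda>x. (u x)\<^sup>2)"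
    "set_integrable lborel {a..b} (\<lambda>x. m\<^sup>2)"
    by (auto intro: L2loc_integrable[OF u] L2loc_square_integrable[OF u] set_integrable_continuous)
  have "0 \<le> (LINT x:{a..b}|lborel. (u x - m)\<^sup>2)"
    by (auto simp: set_lebesgue_integral_def intro!: integral_nonneg)
  also have "\<dots> = (LINT x:{a..b}|lborel. (u x)\<^sup>2 - 2 * m * u x + m\<^sup>2)"
    by (simp add: power2_diff algebra_simps)
  also have "\<dots> = (LINT x:{a..b}|lborel. (u x)\<^sup>2) - 2 * m * I + m\<^sup>2 * (b - a)"
    using i assms(2) by (subst set_integral_add, auto simp: I_def set_integral_const_Icc)
  also have "\<dots> = (LINT x:{a..b}|lborel. (u x)\<^sup>2) - I\<^sup>2 / (b - a)"
  proof -
    have "m * (b - a) = I" using ab by (simp add: m_def)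
    then have "m\<^sup>2 * (b - a) = m * I" by (simp add: power2_eq_square mult.assoc)
    moreover have "I\<^sup>2 / (b - a) = m * I" by (simp add: m_def power2_eq_square)
    ultimately show ?thesis by simp
  qed
  finally show ?thesis using ab by (simp add: I_def field_simps)
qed

section \<open>Continuity of translations\<close>

text \<open>
  The integral is twice the measure of the part of \<open>U\<close> that the translation moves out
  of \<open>U\<close>, as \<open>U\<close> and its translate have the same measure. Openness makes
  this part shrink pointwise to nothing.
\<close>

lemma open_indicator_translation:
  fixes U :: "real set"
  assumes U: "open U" "emeasure lborel U < \<infinity>" and h: "h \<longlonglongrightarrow> 0"
  shows "(\<lambda>n. LINT x|lborel. \<bar>indicator U (x + h n) - indicator U x :: real\<bar>) \<longlonglongrightarrow> 0"
proof -
  have [measurable]: "U \<in> sets borel" using U by simp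
  have i: "integrable lborel (indicator U :: real \<Rightarrow> real)" using U by simp
  have ih: "integrable lborel (\<lambda>x. indicator U (x + c) :: real)"
    and Ih: "(LINT x|lborel. indicator U (x + c) :: real) = (LINT x|lborel. indicator U x)" for c
    using lborel_integrable_real_affine[of "indicator U :: real \<Rightarrow> real" 1 c] i
      lborel_integral_real_affine[of 1 "indicator U :: real \<Rightarrow> real" c] by (auto simp: add.commute)
  define D where "D = (\<lambda>n x. indicator U x * (1 - indicator U (x + h n)) :: real)"
  have iD: "integrable lborel (D n)" for n
    by (rule Bochner_Integration.integrable_bound[OF i]) (auto simp: D_def indicator_def)
  have "(\<lambda>n. LINT x|lborel. D n x) \<longlonglongrightarrow> integral\<^sup>L (lborel :: real measure) (\<lambda>_. 0::real)"
  proof (rule integral_dominated_convergence[where w="indicator U"])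
    show "AE x in lborel. (\<lambda>n. D n x) \<longlonglongrightarrow> 0"
    proof (rule AE_I2)
      fix x :: real
      show "(\<lambda>n. D n x) \<longlonglongrightarrow> 0"
      proof (cases "x \<in> U")
        case True
        have "(\<lambda>n. x + h n) \<longlonglongrightarrow> x + 0" by (intro tendsto_intros h)
        then have "eventually (\<lambda>n. x + h n \<in> U) sequentially"
          using topological_tendstoD[OF _ U(1), of _ "x + 0"] True by simp
        then have "eventually (\<lambda>n. D n x = 0) sequentially"
          by eventually_elim (simp add: D_def)
        then show ?thesis by (rule tendsto_eventually)
      qed (simp add: D_def)
    qed
  qed (use i in \<open>auto simp: D_def indicator_def\<close>)
  then have "(\<lambda>n. 2 * (LINT x|lborel. D n x)) \<longlonglongrightarrow> 0" using tendsto_mult_right_zero by fastforce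
  moreover have "(LINT x|lborel. \<bar>indicator U (x + h n) - indicator U x :: real\<bar>) = 2 * (LINT x|lborel. D n x)" for n
  proof -
    have "(LINT x|lborel. \<bar>indicator U (x + h n) - indicator U x :: real\<bar>)
        = (LINT x|lborel. (indicator U (x + h n) - indicator U x) + 2 * D n x)"
      by (intro Bochner_Integration.integral_cong) (auto simp: D_def indicator_def)
    then show ?thesis using iD i ih Ih by simp
  qed
  ultimately show ?thesis by simp
qed

text \<open>
  From open sets to measurable sets by outer regularity, and from there to integrable functions by
  density.
\<close>

lemma L1_translation_continuous:
  assumes f: "integrable lborel (f :: real \<Rightarrow> real)" and h: "h \<longlonglongrightarrow> 0"
  shows "(\<lambda>n. LINT x|lborel. \<bar>f (x + h n) - f x\<bar>) \<longlonglongrightarrow> 0"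
proof -
  have ish: "integrable lborel (\<lambda>x. g (x + c))"
    and Ish: "(LINT x|lborel. \<bar>g (x + c)\<bar>) = (LINT x|lborel. \<bar>g x\<bar>)"
    if "integrable lborel g" for g :: "real \<Rightarrow> real" and c
    using lborel_integrable_real_affine[of g 1 c] that
      lborel_integral_real_affine[of 1 "\<lambda>x. \<bar>g x\<bar>" c] by (auto simp: add.commute)
  have approx: "(\<lambda>n. LINT x|lborel. \<bar>f (x + h n) - f x\<bar>) \<longlonglongrightarrow> 0"
    if f: "integrable lborel f"
      and a: "\<And>e. e > 0 \<Longrightarrow> \<exists>g. integrable lborel g \<and> (LINT x|lborel. \<bar>f x - g x\<bar>) < e \<and>
         (\<lambda>n. LINT x|lborel. \<bar>g (x + h n) - g x\<bar>) \<longlonglongrightarrow> 0" for f :: "real \<Rightarrow> real"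
  proof (rule LIMSEQ_I)
    fix r :: real assume "r > 0"
    then obtain g where g: "integrable lborel g" "(LINT x|lborel. \<bar>f x - g x\<bar>) < r / 3"
      "(\<lambda>n. LINT x|lborel. \<bar>g (x + h n) - g x\<bar>) \<longlonglongrightarrow> 0" using a[of "r / 3"] by auto
    obtain N where N: "\<And>n. n \<ge> N \<Longrightarrow> \<bar>LINT x|lborel. \<bar>g (x + h n) - g x\<bar>\<bar> < r / 3"
      using LIMSEQ_D[OF g(3), of "r / 3"] \<open>r > 0\<close> by auto
    have "\<bar>LINT x|lborel. \<bar>f (x + h n) - f x\<bar>\<bar> < r" if "n \<ge> N" for n
    proof -
      have "(LINT x|lborel. \<bar>f (x + h n) - f x\<bar>) \<le>
          (LINT x|lborel. \<bar>f (x + h n) - g (x + h n)\<bar> + \<bar>g (x + h n) - g x\<bar> + \<bar>f x - g x\<bar>)"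
        using f g(1) by (intro integral_mono Bochner_Integration.integrable_add integrable_abs Bochner_Integration.integrable_diff ish) auto
      also have "\<dots> = 2 * (LINT x|lborel. \<bar>f x - g x\<bar>) + (LINT x|lborel. \<bar>g (x + h n) - g x\<bar>)"
        using Ish[of "\<lambda>x. f x - g x" "h n"] f g(1) by (simp add: ish)
      finally show ?thesis using g(2) N[OF that] by (simp add: abs_less_iff integral_nonneg)
    qed
    then show "\<exists>N. \<forall>n\<ge>N. norm ((LINT x|lborel. \<bar>f (x + h n) - f x\<bar>) - 0) < r" by auto
  qed
  show ?thesis using f
  proof (induction f rule: integrable_induct)
    case (base A c)
    then have A: "A \<in> sets lborel" "emeasure lborel A < \<infinity>" by auto
    show ?case
    proof (rule approx)
      fix e :: real assume "e > 0"
      define e' where "e' = e / (\<bar>c\<bar> + 1)"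
      have e': "e' > 0" "e' * \<bar>c\<bar> < e" using \<open>e > 0\<close> by (auto simp: e'_def field_simps)
      obtain U where U: "open U" "A \<subseteq> U" "emeasure lborel (U - A) < ennreal e'"
        using outer_regular_lborel[OF _ e'(1), of A] A by auto
      have fin: "emeasure lborel (U - A) < \<infinity>" using U(3) by (simp add: order_less_trans)
      have "emeasure lborel U = emeasure lborel A + emeasure lborel (U - A)"
        using A U by (subst plus_emeasure) (auto simp: Un_absorb1)
      then have finU: "emeasure lborel U < \<infinity>" using A fin by simp
      have iU: "integrable lborel (indicator U :: real \<Rightarrow> real)" using U finU by simp
      have "(LINT x|lborel. \<bar>indicator A x *\<^sub>R c - indicator U x *\<^sub>R c\<bar>) = (LINT x|lborel. indicator (U - A) x * \<bar>c\<bar>)"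
        using U(2) by (intro Bochner_Integration.integral_cong) (auto simp: indicator_def)
      also have "\<dots> = measure lborel (U - A) * \<bar>c\<bar>" by simp
      also have "\<dots> \<le> e' * \<bar>c\<bar>"
        using U(3) e' by (intro mult_right_mono) (auto simp: measure_def enn2real_leI)
      finally have 1: "(LINT x|lborel. \<bar>indicator A x *\<^sub>R c - indicator U x *\<^sub>R c\<bar>) < e" using e' by simp
      have "(\<lambda>n. (LINT x|lborel. \<bar>indicator U (x + h n) - indicator U x :: real\<bar>) * \<bar>c\<bar>) \<longlonglongrightarrow> 0"
        using open_indicator_translation[OF U(1) finU h] tendsto_mult_left_zero by blast
      then have 2: "(\<lambda>n. LINT x|lborel. \<bar>indicator U (x + h n) *\<^sub>R c - indicator U x *\<^sub>R c\<bar>) \<longlonglongrightarrow> 0"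
        by (simp add: abs_mult flip: left_diff_distrib)
      show "\<exists>g. integrable lborel g \<and> (LINT x|lborel. \<bar>indicator A x *\<^sub>R c - g x\<bar>) < e \<and>
          (\<lambda>n. LINT x|lborel. \<bar>g (x + h n) - g x\<bar>) \<longlonglongrightarrow> 0"
        using 1 2 iU by (intro exI[of _ "\<lambda>x. indicator U x *\<^sub>R c"]) auto
    qed (use A in auto)
  next
    case (add f g)
    show ?case
    proof (rule tendsto_sandwich[OF _ _ tendsto_const])
      show "(\<lambda>n. (LINT x|lborel. \<bar>f (x + h n) - f x\<bar>) + (LINT x|lborel. \<bar>g (x + h n) - g x\<bar>)) \<longlonglongrightarrow> 0"
        using tendsto_add[OF add.IH] by simp
      have "(LINT x|lborel. \<bar>f (x + h n) + g (x + h n) - (f x + g x)\<bar>) \<le>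
          (LINT x|lborel. \<bar>f (x + h n) - f x\<bar> + \<bar>g (x + h n) - g x\<bar>)" for n
        using add.hyps by (intro integral_mono Bochner_Integration.integrable_add integrable_abs Bochner_Integration.integrable_diff ish) auto
      then show "\<forall>\<^sub>F n in sequentially. (LINT x|lborel. \<bar>f (x + h n) + g (x + h n) - (f x + g x)\<bar>) \<le>
          (LINT x|lborel. \<bar>f (x + h n) - f x\<bar>) + (LINT x|lborel. \<bar>g (x + h n) - g x\<bar>)"
        using add.hyps by (auto simp: ish)
    qed (auto intro!: always_eventually integral_nonneg)
  next
    case (lim f s)
    show ?case
    proof (rule approx[OF lim(4)])
      fix e :: real assume "e > 0"
      have "(\<lambda>i. LINT x|lborel. \<bar>f x - s i x\<bar>) \<longlonglongrightarrow> integral\<^sup>L (lborel :: real measure) (\<lambda>_. 0::real)"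
      proof (rule integral_dominated_convergence[where w="\<lambda>x. 3 * \<bar>f x\<bar>"])
        show "AE x in lborel. (\<lambda>i. \<bar>f x - s i x\<bar>) \<longlonglongrightarrow> 0"
        proof (rule AE_I2)
          fix x :: real
          have "(\<lambda>i. \<bar>f x - s i x\<bar>) \<longlonglongrightarrow> \<bar>f x - f x\<bar>" by (intro tendsto_intros lim(2)) simp
          then show "(\<lambda>i. \<bar>f x - s i x\<bar>) \<longlonglongrightarrow> 0" by simp
        qed
        show "AE x in lborel. norm \<bar>f x - s i x\<bar> \<le> 3 * \<bar>f x\<bar>" for i
        proof (rule AE_I2)
          fix x :: real
          have "\<bar>s i x\<bar> \<le> 2 * \<bar>f x\<bar>" using lim(3)[of x i] by simp
          then show "norm \<bar>f x - s i x\<bar> \<le> 3 * \<bar>f x\<bar>" by simp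
        qed
      qed (use lim in auto)
      then obtain i where "\<bar>LINT x|lborel. \<bar>f x - s i x\<bar>\<bar> < e"
        using LIMSEQ_D[of _ 0 e] \<open>e > 0\<close> by force
      then show "\<exists>g. integrable lborel g \<and> (LINT x|lborel. \<bar>f x - g x\<bar>) < e \<and>
          (\<lambda>n. LINT x|lborel. \<bar>g (x + h n) - g x\<bar>) \<longlonglongrightarrow> 0"
        using lim(1,5) by (intro exI[of _ "s i"]) auto
    qed
  qed
qed

text \<open>
  The map \<open>y \<mapsto> y \<bar>y\<bar>\<close> turns square integrable functions into
  integrable ones; this inequality transfers continuity of translations from the
  \<open>L\<^sup>1\<close> to the \<open>L\<^sup>2\<close> setting.
\<close>

lemma square_diff_le: "(y - z)\<^sup>2 \<le> 2 * \<bar>y * \<bar>y\<bar> - z * \<bar>z\<bar>\<bar>" for y z :: real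
proof -
  have *: "(y - z)\<^sup>2 \<le> 2 * (y\<^sup>2 + z\<^sup>2)" using sum_squares_bound[of y "-z"] by (simp add: power2_diff)
  have "(y - z)\<^sup>2 \<le> 2 * (y\<^sup>2 - z\<^sup>2)" if "z \<le> y" "0 \<le> z" for y z :: real
  proof -
    have "(y - z) * (y - z) \<le> (y - z) * (2 * (y + z))" using that by (intro mult_left_mono) auto
    then show ?thesis by (simp add: power2_eq_square algebra_simps)
  qed
  note ** = this[of z y] this[of y z] this[of "-z" "-y"] this[of "-y" "-z"]
  have c: "(- y - - z)\<^sup>2 = (y - z)\<^sup>2" "(- z - - y)\<^sup>2 = (y - z)\<^sup>2" "(z - y)\<^sup>2 = (y - z)\<^sup>2"
    by (auto simp: power2_commute)
  have a: "w * \<bar>w\<bar> = (if 0 \<le> w then w\<^sup>2 else - w\<^sup>2)" for w :: real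
    by (auto simp: power2_eq_square)
  consider "0 \<le> y" "0 \<le> z" | "y < 0" "z < 0" | "0 \<le> y" "z < 0" | "y < 0" "0 \<le> z" by linarith
  then show ?thesis
  proof cases
    case 1
    then show ?thesis using **(1,2) unfolding a c by (cases "z \<le> y") auto
  next
    case 2
    then show ?thesis using **(3,4) unfolding a c power2_minus by (cases "z \<le> y") (auto simp: abs_if)
  qed (use * a[of y] a[of z] in auto)
qed

lemma L2loc_translation_seq:
  assumes A: "L2loc A" and s: "s \<longlonglongrightarrow> t"
  shows "(\<lambda>n. LINT x:{a..b}|lborel. (A (s n + x) - A (t + x))\<^sup>2) \<longlonglongrightarrow> 0"
proof -
  define J where "J = {t + a - 1..t + b + 1}"
  define \<phi> where "\<phi> = (\<lambda>x. indicator J x * (A x * \<bar>A x\<bar>))"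
  have m[measurable]: "A \<in> borel_measurable borel" "J \<in> sets borel" by (auto simp: L2loc_measurable[OF A] J_def)
  have i\<phi>: "integrable lborel \<phi>"
    by (rule Bochner_Integration.integrable_bound[OF L2loc_square_integrable[OF A, of "t + a - 1" "t + b + 1", unfolded set_integrable_def]])
       (auto simp: \<phi>_def J_def indicator_def power2_eq_square abs_mult)
  have "(\<lambda>n. s n - t) \<longlonglongrightarrow> t - t" by (intro tendsto_intros s)
  then have h: "(\<lambda>n. s n - t) \<longlonglongrightarrow> 0" by simp
  have ev: "\<forall>\<^sub>F n in sequentially. \<bar>s n - t\<bar> < 1"
    using LIMSEQ_D[OF h, of 1] by (auto simp: eventually_sequentially)
  show ?thesis
  proof (rule tendsto_sandwich[OF _ _ tendsto_const])
    show "(\<lambda>n. 2 * (LINT x|lborel. \<bar>\<phi> (x + (s n - t)) - \<phi> x\<bar>)) \<longlonglongrightarrow> 0"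
      using tendsto_mult_right_zero[OF L1_translation_continuous[OF i\<phi> h], of 2] by simp
    show "\<forall>\<^sub>F n in sequentially. (LINT x:{a..b}|lborel. (A (s n + x) - A (t + x))\<^sup>2)
        \<le> 2 * (LINT x|lborel. \<bar>\<phi> (x + (s n - t)) - \<phi> x\<bar>)"
      using ev
    proof eventually_elim
      case (elim n)
      have ii: "integrable lborel (\<lambda>x. \<bar>\<phi> (x + (s n - t)) - \<phi> x\<bar>)"
        using lborel_integrable_real_affine[OF i\<phi>, of 1 "s n - t"] i\<phi> by (simp add: add.commute)
      then have i2: "integrable lborel (\<lambda>x. \<bar>\<phi> (s n + x) - \<phi> (t + x)\<bar>)"
        using lborel_integrable_real_affine[OF ii, of 1 t] by (simp add: algebra_simps)
      have e: "(LINT x|lborel. \<bar>\<phi> (s n + x) - \<phi> (t + x)\<bar>) = (LINT x|lborel. \<bar>\<phi> (x + (s n - t)) - \<phi> x\<bar>)"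
        using lborel_integral_real_affine[of 1 "\<lambda>x. \<bar>\<phi> (x + (s n - t)) - \<phi> x\<bar>" t] by (simp add: algebra_simps)
      have "(LINT x:{a..b}|lborel. (A (s n + x) - A (t + x))\<^sup>2) \<le> (LINT x|lborel. 2 * \<bar>\<phi> (s n + x) - \<phi> (t + x)\<bar>)"
        unfolding set_lebesgue_integral_def
      proof (rule integral_mono)
        show "integrable lborel (\<lambda>x. indicator {a..b} x *\<^sub>R (A (s n + x) - A (t + x))\<^sup>2)"
          using L2loc_square_integrable[OF L2loc_diff[OF L2loc_shift[OF A] L2loc_shift[OF A]]]
          by (simp add: set_integrable_def)
        fix x
        show "indicator {a..b} x *\<^sub>R (A (s n + x) - A (t + x))\<^sup>2 \<le> 2 * \<bar>\<phi> (s n + x) - \<phi> (t + x)\<bar>"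
          using square_diff_le[of "A (s n + x)" "A (t + x)"] elim
          by (auto simp: indicator_def \<phi>_def J_def)
      qed (use i2 in auto)
      then show ?case using e by simp
    qed
    show "\<forall>\<^sub>F n in sequentially. 0 \<le> (LINT x:{a..b}|lborel. (A (s n + x) - A (t + x))\<^sup>2)"
      by (auto intro!: always_eventually integral_nonneg simp: set_lebesgue_integral_def)
  qed
qed

lemma L2loc_translation:
  assumes "L2loc A"
  shows "((\<lambda>s. LINT x:{a..b}|lborel. (A (s + x) - A (t + x))\<^sup>2) \<longlongrightarrow> 0) (at t within T)"
    and "((\<lambda>s. LINT x:{a..b}|lborel. (A (s - x) - A (t - x))\<^sup>2) \<longlongrightarrow> 0) (at t within T)"
proof -
  show "((\<lambda>s. LINT x:{a..b}|lborel. (A (s + x) - A (t + x))\<^sup>2) \<longlongrightarrow> 0) (at t within T)"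
    unfolding tendsto_at_iff_sequentially comp_def using L2loc_translation_seq[OF assms] by blast
  have B: "L2loc (\<lambda>x. A (0 - x))" by (rule L2loc_flip[OF assms])
  show "((\<lambda>s. LINT x:{a..b}|lborel. (A (s - x) - A (t - x))\<^sup>2) \<longlongrightarrow> 0) (at t within T)"
    unfolding tendsto_at_iff_sequentially comp_def
  proof (intro allI impI)
    fix X :: "nat \<Rightarrow> real" assume "X \<longlonglongrightarrow> t"
    from L2loc_translation_seq[OF B tendsto_minus[OF this], of a b]
    show "(\<lambda>n. LINT x:{a..b}|lborel. (A (X n - x) - A (t - x))\<^sup>2) \<longlonglongrightarrow> 0" by simp
  qed
qed

section \<open>The delay system for the wave profiles\<close>

text \<open>
  For a wave \<open>u = f (t + x) + g (t - x)\<close> the first relation is the boundary condition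
  \<open>u\<^sub>x = \<alpha> u + \<kappa> u\<^sub>t + d0\<close> at \<open>x = 0\<close>. The
  second is a reflection at \<open>x = 1\<close> with coefficient \<open>\<rho>\<close>:
  \<open>\<rho> = 1\<close> stands for a free end, \<open>\<rho> = -1\<close> for a clamped end,
  and \<open>\<rho> = (1 - c) / (1 + c)\<close> for \<open>u\<^sub>x = - c u\<^sub>t\<close>.
\<close>

definition delay_system ::
  "real \<Rightarrow> real \<Rightarrow> real \<Rightarrow> (real \<Rightarrow> real) \<Rightarrow> (real \<Rightarrow> real) \<Rightarrow>
   (real \<Rightarrow> real) \<Rightarrow> (real \<Rightarrow> real) \<Rightarrow> (real \<Rightarrow> real) \<Rightarrow> (real \<Rightarrow> real) \<Rightarrow> bool" where
  "delay_system \<alpha> \<kappa> \<rho> d0 d1 f f' g g' \<longleftrightarrow> prim f f' \<and> prim g g' \<and>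
     (AE t in lborel. 0 < t \<longrightarrow> f' t - g' t = \<alpha> * (f t + g t) + \<kappa> * (f' t + g' t) + d0 t) \<and>
     (AE t in lborel. 0 < t \<longrightarrow> f' (t + 1) = \<rho> * g' (t - 1) + d1 t)"

lemma AE_shift:
  assumes "AE t in lborel. P (t :: real)" shows "AE t in lborel. P (c + t)"
proof -
  have "AE t in distr lborel borel ((+) c). P t"
    unfolding lborel_distr_plus by (rule assms)
  from AE_distrD[OF _ this] show ?thesis by simp
qed

lemma L2loc_if:
  assumes "L2loc u" "L2loc v" shows "L2loc (\<lambda>t. if t < c then u t else v t)"
  unfolding L2loc_def
proof (intro conjI allI)
  note [measurable] = L2loc_measurable[OF assms(1)] L2loc_measurable[OF assms(2)]
  show m: "(\<lambda>t. if t < c then u t else v t) \<in> borel_measurable borel" by measurable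
  fix a b
  show "set_integrable lborel {a..b} (\<lambda>t. (if t < c then u t else v t)\<^sup>2)"
  proof (rule set_integrable_bound)
    show "set_integrable lborel {a..b} (\<lambda>t. (u t)\<^sup>2 + (v t)\<^sup>2)"
      using assms by (auto intro: L2loc_square_integrable)
    show "set_borel_measurable lborel {a..b} (\<lambda>t. (if t < c then u t else v t)\<^sup>2)"
      unfolding set_borel_measurable_def by measurable
  qed auto
qed

lemma prim_zero_deriv:
  assumes f: "prim f f'" and "a \<le> b" and z: "AE t in lborel. t \<in> {a<..<b} \<longrightarrow> f' t = 0"
  shows "f b = f a"
proof -
  have "(LINT t:{a..b}|lborel. f' t) = (LINT t:{a..b}|lborel. 0)"
  proof (rule set_lebesgue_integral_cong_AE)
    show "AE t\<in>{a..b} in lborel. f' t = 0"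
      using z AE_lborel_singleton[of a] AE_lborel_singleton[of b] by eventually_elim auto
  qed (use L2loc_measurable[OF prim_L2loc[OF f]] in auto)
  then show ?thesis using prim_eq[OF f \<open>a \<le> b\<close>] by simp
qed

definition primitive :: "(real \<Rightarrow> real) \<Rightarrow> real \<Rightarrow> real" where
  "primitive u = (SOME f. prim f u \<and> f 0 = 0)"

lemma primitive: assumes "L2loc u" shows "prim (primitive u) u" "primitive u 0 = 0"
proof -
  have "\<exists>f. prim f u \<and> f 0 = 0" using prim_of_integral[OF assms, of 0] by metis
  from someI_ex[OF this] show "prim (primitive u) u" "primitive u 0 = 0" by (simp_all add: primitive_def)
qed

text \<open>
  Suppose \<open>f'\<close> is known up to time \<open>T\<close>. The relation at \<open>x =
  0\<close> is a linear differential equation for the boundary value \<open>h = f + g\<close>,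
  namely \<open>(1 + \<kappa>) h' + \<alpha> h = 2 f' - d0\<close>; it determines
  \<open>h\<close>, hence \<open>g'\<close>, up to time \<open>T\<close>. The relation at \<open>x
  = 1\<close> then determines \<open>f'\<close> up to time \<open>T + 2\<close>. The function
  \<open>iterate\<close> below performs this step, \<open>endpoint\<close> being \<open>h\<close>
  by variation of constants.
\<close>

context
  fixes \<alpha> \<kappa> \<rho> c :: real and d0 d1 \<phi>0 \<gamma>0 :: "real \<Rightarrow> real"
  assumes \<kappa>: "\<kappa> \<ge> 0" and L: "L2loc d0" "L2loc d1" "L2loc \<phi>0" "L2loc \<gamma>0"
begin

private definition "k0 = \<alpha> / (1 + \<kappa>)"

private definition drive :: "(real \<Rightarrow> real) \<Rightarrow> real \<Rightarrow> real" where
  "drive \<Phi> s = (2 * \<Phi> s - d0 s) / (1 + \<kappa>)"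

private definition endpoint :: "(real \<Rightarrow> real) \<Rightarrow> real \<Rightarrow> real" where
  "endpoint \<Phi> t = (primitive (\<lambda>s. drive \<Phi> s * exp (k0 * s)) t + c) * exp (- k0 * t)"

private definition reflect :: "(real \<Rightarrow> real) \<Rightarrow> real \<Rightarrow> real" where
  "reflect \<Phi> t = (if t < 0 then \<gamma>0 t else drive \<Phi> t - k0 * endpoint \<Phi> t - \<Phi> t)"

private definition iterate :: "(real \<Rightarrow> real) \<Rightarrow> real \<Rightarrow> real" where
  "iterate \<Phi> t = (if t < 1 then \<phi>0 t else \<rho> * reflect \<Phi> (-2 + t) + d1 (-1 + t))"

private lemma L2loc_drive: "L2loc \<Phi> \<Longrightarrow> L2loc (drive \<Phi>)"
  using L2loc_cmult[OF L2loc_diff[OF L2loc_cmult[of \<Phi> 2] L(1)], of "1 / (1 + \<kappa>)"]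
  by (simp add: drive_def[abs_def])

private lemma L2loc_drive_exp: "L2loc \<Phi> \<Longrightarrow> L2loc (\<lambda>s. drive \<Phi> s * exp (k0 * s))"
  by (intro L2loc_continuous_mult L2loc_drive continuous_intros)

private lemma prim_endpoint:
  assumes "L2loc \<Phi>" shows "prim (endpoint \<Phi>) (\<lambda>t. drive \<Phi> t - k0 * endpoint \<Phi> t)"
proof -
  let ?I = "primitive (\<lambda>s. drive \<Phi> s * exp (k0 * s))"
  have "prim (\<lambda>t. ?I t + c) (\<lambda>s. drive \<Phi> s * exp (k0 * s) + 0)"
    by (intro prim_add prim_const primitive L2loc_drive_exp assms)
  moreover have "prim (\<lambda>t. exp (- k0 * t)) (\<lambda>t. - k0 * exp (- k0 * t))"
    by (rule prim_C1) (auto intro!: derivative_eq_intros continuous_intros)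
  ultimately have "prim (\<lambda>t. (?I t + c) * exp (- k0 * t))
     (\<lambda>t. (?I t + c) * (- k0 * exp (- k0 * t)) + (drive \<Phi> t * exp (k0 * t) + 0) * exp (- k0 * t))"
    by (rule prim_mult)
  moreover have "exp (k0 * t) * exp (- k0 * t) = 1" for t by (simp flip: exp_add)
  ultimately show ?thesis unfolding endpoint_def by (simp add: mult.assoc algebra_simps)
qed

private lemma L2loc_reflect: "L2loc \<Phi> \<Longrightarrow> L2loc (reflect \<Phi>)"
  unfolding reflect_def[abs_def]
  by (intro L2loc_if L L2loc_diff prim_L2loc[OF prim_endpoint])

private lemma L2loc_iterate: "L2loc \<Phi> \<Longrightarrow> L2loc (iterate \<Phi>)"
  unfolding iterate_def[abs_def]
  by (intro L2loc_if L L2loc_add L2loc_cmult L2loc_shift[of "reflect _"] L2loc_shift[of d1] L2loc_reflect)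

text \<open>
  What \<open>\<Phi>\<close> does after time \<open>T\<close> has no influence on the reflected
  profile before \<open>T\<close>.
\<close>

private lemma reflect_causal:
  assumes "L2loc \<Phi>" "L2loc \<Psi>" "\<And>s. s < T \<Longrightarrow> \<Phi> s = \<Psi> s" "t < T"
  shows "reflect \<Phi> t = reflect \<Psi> t"
proof (cases "t < 0")
  case False
  have d: "drive \<Phi> s = drive \<Psi> s" if "s < T" for s using assms(3)[OF that] by (simp add: drive_def)
  have "(LINT s:{0..t}|lborel. drive \<Phi> s * exp (k0 * s)) = (LINT s:{0..t}|lborel. drive \<Psi> s * exp (k0 * s))"
    using d assms(4) by (intro set_lebesgue_integral_cong) auto
  then have "endpoint \<Phi> t = endpoint \<Psi> t"
    using prim_eq[OF primitive(1)[OF L2loc_drive_exp[OF assms(1)]], of 0 t] primitive(2)[OF L2loc_drive_exp[OF assms(1)]]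
      prim_eq[OF primitive(1)[OF L2loc_drive_exp[OF assms(2)]], of 0 t] primitive(2)[OF L2loc_drive_exp[OF assms(2)]] False
    by (simp add: endpoint_def)
  then show ?thesis using False d[OF assms(4)] assms(3)[OF assms(4)] by (simp add: reflect_def)
qed (simp add: reflect_def)

private lemma iterate_causal:
  assumes "L2loc \<Phi>" "L2loc \<Psi>" "\<And>s. s < T \<Longrightarrow> \<Phi> s = \<Psi> s" "t < T + 2"
  shows "iterate \<Phi> t = iterate \<Psi> t"
  using reflect_causal[OF assms(1,2), of T "-2 + t"] assms(3,4) by (simp add: iterate_def)

lemma delay_system_exists:
  obtains f f' g g' where "delay_system \<alpha> \<kappa> \<rho> d0 d1 f f' g g'" "f 0 = 0" "g 0 = c"
    "\<And>t. t < 1 \<Longrightarrow> f' t = \<phi>0 t" "\<And>t. t < 0 \<Longrightarrow> g' t = \<gamma>0 t"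
proof -
  \<comment> \<open>By causality the iterates are eventually constant on every bounded interval,
    so their limit is a fixed point without any contraction estimate.\<close>
  define \<Phi> where "\<Phi> = (\<lambda>n. (iterate ^^ n) \<phi>0)"
  have L\<Phi>: "L2loc (\<Phi> n)" for n by (induction n) (auto simp: \<Phi>_def L L2loc_iterate)
  have stab: "\<Phi> (Suc n) t = \<Phi> n t" if "t < 1 + 2 * real n" for n t using that
  proof (induction n arbitrary: t)
    case 0
    then show ?case by (simp add: \<Phi>_def iterate_def)
  next
    case (Suc n)
    have "iterate (\<Phi> (Suc n)) t = iterate (\<Phi> n) t"
      by (rule iterate_causal[OF L\<Phi> L\<Phi> Suc.IH]) (use Suc.prems in auto)
    then show ?case by (simp add: \<Phi>_def)
  qed
  have stab2: "\<Phi> m t = \<Phi> n t" if "n \<le> m" "t < 1 + 2 * real n" for m n t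
    using that(1)
  proof (induction m rule: dec_induct)
    case (step m)
    then show ?case using stab[of t m] that(2) by simp
  qed simp
  define f' where "f' = (\<lambda>t. \<Phi> (nat \<lceil>t\<rceil>) t)"
  have f': "f' t = \<Phi> n t" if "t < 1 + 2 * real n" for n t
  proof -
    have "t < 1 + 2 * real (nat \<lceil>t\<rceil>)" by linarith
    then show ?thesis unfolding f'_def
      using stab2[OF _ that, of "nat \<lceil>t\<rceil>"] stab2[of "nat \<lceil>t\<rceil>" n t] nat_le_linear[of n "nat \<lceil>t\<rceil>"] by metis
  qed
  have Lf: "L2loc f'"
    unfolding L2loc_def
  proof (intro conjI allI)
    have [measurable]: "(\<lambda>t::real. nat \<lceil>t\<rceil>) \<in> measurable borel (count_space UNIV)" by measurable
    show "f' \<in> borel_measurable borel"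
      unfolding f'_def by (rule measurable_compose_countable[OF L2loc_measurable[OF L\<Phi>]]) measurable
    fix a b :: real
    have "set_integrable lborel {a..b} (\<lambda>x. (f' x)\<^sup>2) = set_integrable lborel {a..b} (\<lambda>x. (\<Phi> (nat \<lceil>b\<rceil>) x)\<^sup>2)"
    proof (rule set_integrable_cong[OF refl refl])
      fix x assume "x \<in> {a..b}"
      then have "x < 1 + 2 * real (nat \<lceil>b\<rceil>)" by (simp, linarith)
      then show "(f' x)\<^sup>2 = (\<Phi> (nat \<lceil>b\<rceil>) x)\<^sup>2" using f' by simp
    qed
    then show "set_integrable lborel {a..b} (\<lambda>x. (f' x)\<^sup>2)" using L2loc_square_integrable[OF L\<Phi>] by simp
  qed
  have fixpt: "f' t = iterate f' t" for t
  proof -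
    define n where "n = nat \<lceil>t\<rceil>"
    have n: "t < 1 + 2 * real n" unfolding n_def by linarith
    have "f' t = \<Phi> (Suc n) t" using f'[of t "Suc n"] n by simp
    also have "\<dots> = iterate (\<Phi> n) t" by (simp add: \<Phi>_def)
    also have "\<dots> = iterate f' t"
      by (rule iterate_causal[OF L\<Phi> Lf, of "1 + 2 * real n"]) (use n f' in auto)
    finally show ?thesis .
  qed
  define g' where "g' = reflect f'"
  have Lg: "L2loc g'" unfolding g'_def by (rule L2loc_reflect[OF Lf])
  define g where "g = (\<lambda>t. primitive g' t + c)"
  have pf: "prim (primitive f') f'" by (rule primitive[OF Lf])
  have pg: "prim g g'" using prim_add[OF primitive(1)[OF Lg] prim_const[of c]] by (simp add: g_def)
  let ?h = "endpoint f'"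
  have h0: "?h 0 = c" by (simp add: endpoint_def primitive(2)[OF L2loc_drive_exp[OF Lf]])
  have h: "primitive f' t + g t = ?h t" if "t \<ge> 0" for t
  proof -
    have p: "prim (\<lambda>t. primitive f' t + g t - ?h t) (\<lambda>t. f' t + g' t - (drive f' t - k0 * ?h t))"
      by (intro prim_diff prim_add pf pg prim_endpoint Lf)
    have "primitive f' t + g t - ?h t = primitive f' 0 + g 0 - ?h 0"
      by (rule prim_zero_deriv[OF p that]) (auto simp: g'_def reflect_def)
    then show ?thesis using h0 by (simp add: g_def primitive(2)[OF Lf] primitive(2)[OF Lg])
  qed
  show ?thesis
  proof (rule that)
    show "delay_system \<alpha> \<kappa> \<rho> d0 d1 (primitive f') f' g g'"
      unfolding delay_system_def
    proof (intro conjI pf pg AE_I2 impI)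
      fix t :: real assume t: "0 < t"
      have s: "f' t + g' t = drive f' t - k0 * ?h t" using t by (simp add: g'_def reflect_def)
      have "(1 + \<kappa>) * drive f' t = 2 * f' t - d0 t" "(1 + \<kappa>) * k0 = \<alpha>" using \<kappa> by (simp_all add: drive_def k0_def)
      then have "(1 + \<kappa>) * (f' t + g' t) = 2 * f' t - d0 t - \<alpha> * ?h t"
        unfolding s by (simp only: right_diff_distrib mult.assoc[symmetric])
      then show "f' t - g' t = \<alpha> * (primitive f' t + g t) + \<kappa> * (f' t + g' t) + d0 t"
        using h[of t] t by (simp add: algebra_simps)
      have "iterate f' (t + 1) = \<rho> * g' (t - 1) + d1 t" using t by (simp add: iterate_def g'_def)
      then show "f' (t + 1) = \<rho> * g' (t - 1) + d1 t" using fixpt[of "t + 1"] by simp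
    qed
    show "primitive f' 0 = 0" "g 0 = c" by (simp_all add: g_def primitive(2)[OF Lf] primitive(2)[OF Lg])
    show "f' t = \<phi>0 t" if "t < 1" for t using fixpt[of t] that by (simp add: iterate_def)
    show "g' t = \<gamma>0 t" if "t < 0" for t using that by (simp add: g'_def reflect_def)
  qed
qed

end

lemma delay_system_diff:
  assumes "delay_system \<alpha> \<kappa> \<rho> d0 d1 f f' g g'" "delay_system \<alpha> \<kappa> \<rho> e0 e1 F F' G G'"
  shows "delay_system \<alpha> \<kappa> \<rho> (\<lambda>t. d0 t - e0 t) (\<lambda>t. d1 t - e1 t) (\<lambda>t. f t - F t) (\<lambda>t. f' t - F' t) (\<lambda>t. g t - G t) (\<lambda>t. g' t - G' t)"
  unfolding delay_system_def
proof (intro conjI)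
  show "prim (\<lambda>t. f t - F t) (\<lambda>t. f' t - F' t)" "prim (\<lambda>t. g t - G t) (\<lambda>t. g' t - G' t)"
    using assms by (auto simp: delay_system_def intro: prim_diff)
  have 1: "AE t in lborel. 0 < t \<longrightarrow> f' t - g' t = \<alpha> * (f t + g t) + \<kappa> * (f' t + g' t) + d0 t"
    "AE t in lborel. 0 < t \<longrightarrow> F' t - G' t = \<alpha> * (F t + G t) + \<kappa> * (F' t + G' t) + e0 t"
    using assms by (auto simp: delay_system_def)
  then show "AE t in lborel. 0 < t \<longrightarrow> f' t - F' t - (g' t - G' t) =
     \<alpha> * (f t - F t + (g t - G t)) + \<kappa> * (f' t - F' t + (g' t - G' t)) + (d0 t - e0 t)"
    by eventually_elim (simp add: algebra_simps)
  have 2: "AE t in lborel. 0 < t \<longrightarrow> f' (t + 1) = \<rho> * g' (t - 1) + d1 t"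
    "AE t in lborel. 0 < t \<longrightarrow> F' (t + 1) = \<rho> * G' (t - 1) + e1 t"
    using assms by (auto simp: delay_system_def)
  then show "AE t in lborel. 0 < t \<longrightarrow> f' (t + 1) - F' (t + 1) = \<rho> * (g' (t - 1) - G' (t - 1)) + (d1 t - e1 t)"
    by eventually_elim (simp add: algebra_simps)
qed

text \<open>
  The same stepping as in the construction: if \<open>f\<close> vanishes up to time
  \<open>T\<close>, then \<open>f + g\<close> solves a homogeneous linear equation with initial
  value 0, so \<open>g\<close> vanishes up to \<open>T\<close>, and the reflection carries this to
  \<open>f\<close> up to \<open>T + 2\<close>.
\<close>

lemma delay_system_zero:
  assumes sys: "delay_system \<alpha> \<kappa> \<rho> (\<lambda>_. 0) (\<lambda>_. 0) f f' g g'" and \<kappa>: "\<kappa> \<ge> 0"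
    and f0: "\<And>t. t \<in> {0..1} \<Longrightarrow> f t = 0" and g0: "\<And>t. t \<in> {-1..0} \<Longrightarrow> g t = 0"
  shows "t \<ge> 0 \<Longrightarrow> f t = 0" and "t \<ge> -1 \<Longrightarrow> g t = 0"
proof -
  have pf: "prim f f'" and pg: "prim g g'"
    and b0: "AE t in lborel. 0 < t \<longrightarrow> f' t - g' t = \<alpha> * (f t + g t) + \<kappa> * (f' t + g' t)"
    and b1: "AE t in lborel. 0 < t \<longrightarrow> f' (t + 1) = \<rho> * g' (t - 1)"
    using sys by (auto simp: delay_system_def)
  define k0 where "k0 = \<alpha> / (1 + \<kappa>)"
  have G: "g t = 0" if F: "\<And>t. t \<in> {0..T} \<Longrightarrow> f t = 0" and t: "t \<in> {-1..T}" "T > 0" for T t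
  proof (cases "t \<le> 0")
    case True
    then show ?thesis using g0 t by simp
  next
    case False
    then have t0: "0 \<le> t" by simp
    \<comment> \<open>The integrating factor \<open>exp (k0 * t)\<close> makes \<open>f +
      g\<close> constant.\<close>
    have p: "prim (\<lambda>t. (f t + g t) * exp (k0 * t)) (\<lambda>t. (f t + g t) * (k0 * exp (k0 * t)) + (f' t + g' t) * exp (k0 * t))"
      by (rule prim_mult[OF prim_add[OF pf pg] prim_C1]) (auto intro!: derivative_eq_intros continuous_intros)
    have "AE t in lborel. t \<in> {0<..<T} \<longrightarrow> f' t = 0"
      using prim_AE_unique[OF pf prim_const[of 0] t(2)] F by simp
    then have z: "AE s in lborel. s \<in> {0<..<t} \<longrightarrow> (f s + g s) * (k0 * exp (k0 * s)) + (f' s + g' s) * exp (k0 * s) = 0"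
      using b0
    proof eventually_elim
      case (elim s)
      show ?case
      proof
        assume s: "s \<in> {0<..<t}"
        then have "f' s = 0" using elim t by auto
        then have "(1 + \<kappa>) * (f' s + g' s) = - \<alpha> * (f s + g s)" using elim s by (simp add: algebra_simps)
        moreover have "(1 + \<kappa>) * k0 = \<alpha>" using \<kappa> by (simp add: k0_def)
        moreover have "(1 + \<kappa>) * (k0 * (f s + g s) + (f' s + g' s)) = ((1 + \<kappa>) * k0) * (f s + g s) + (1 + \<kappa>) * (f' s + g' s)"
          by (simp add: algebra_simps)
        ultimately have "(1 + \<kappa>) * (k0 * (f s + g s) + (f' s + g' s)) = 0" by simp
        then have "k0 * (f s + g s) + (f' s + g' s) = 0" using \<kappa> by simp
        then have "(k0 * (f s + g s) + (f' s + g' s)) * exp (k0 * s) = 0" by simp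
        then show "(f s + g s) * (k0 * exp (k0 * s)) + (f' s + g' s) * exp (k0 * s) = 0"
          by (simp add: algebra_simps)
      qed
    qed
    have "(f t + g t) * exp (k0 * t) = (f 0 + g 0) * exp (k0 * 0)"
      by (rule prim_zero_deriv[OF p t0 z])
    then show ?thesis using f0[of 0] g0[of 0] F[of t] t0 t by simp
  qed
  have F: "f t = 0" if "t \<in> {0..1 + 2 * real n}" for n t using that
  proof (induction n arbitrary: t)
    case (Suc n)
    show ?case
    proof (cases "t \<le> 1 + 2 * real n")
      case True
      then show ?thesis using Suc by auto
    next
      case False
      have gz: "g s = 0" if "s \<in> {-1..1 + 2 * real n}" for s
        by (rule G[OF Suc.IH that]) auto
      have "AE s in lborel. s \<in> {-1<..<1 + 2 * real n} \<longrightarrow> g' s = 0"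
        using prim_AE_unique[OF pg prim_const[of 0], of "-1" "1 + 2 * real n"] gz by simp
      from AE_shift[OF this, of "-1"] b1
      have "AE s in lborel. s \<in> {0<..<2 + 2 * real n} \<longrightarrow> f' (s + 1) = 0"
        by eventually_elim (auto simp: add.commute)
      from AE_shift[OF this, of "-1"] have "AE s in lborel. s \<in> {1<..<t} \<longrightarrow> f' s = 0"
        by eventually_elim (use Suc.prems in auto)
      then have "f t = f 1" using prim_zero_deriv[OF pf, of 1 t] False by simp
      then show ?thesis using f0[of 1] by simp
    qed
  qed (use f0 in simp)
  have F': "f t = 0" if "t \<ge> 0" for t
  proof (rule F[of t "nat \<lceil>t\<rceil>"])
    show "t \<in> {0..1 + 2 * real (nat \<lceil>t\<rceil>)}" using that by (simp, linarith)
  qed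
  show "t \<ge> 0 \<Longrightarrow> f t = 0" by (rule F')
  show "t \<ge> -1 \<Longrightarrow> g t = 0" by (rule G[of "max 1 t"]) (auto intro: F')
qed

section \<open>Exponential decay of the profiles\<close>

definition exp_decays :: "(real \<Rightarrow> real) \<Rightarrow> bool" where
  "exp_decays E \<longleftrightarrow> (\<exists>M \<mu>. 0 \<le> M \<and> 0 < \<mu> \<and> (\<forall>t\<ge>0. E t \<le> M * exp (- \<mu> * t)))"

definition geo_decays :: "(nat \<Rightarrow> real) \<Rightarrow> bool" where
  "geo_decays V \<longleftrightarrow> (\<exists>C \<theta>. 0 \<le> C \<and> 0 < \<theta> \<and> \<theta> < 1 \<and> (\<forall>n. V n \<le> C * \<theta> ^ n))"

lemma exp_decaysI: "0 \<le> M \<Longrightarrow> 0 < \<mu> \<Longrightarrow> (\<And>t. t \<ge> 0 \<Longrightarrow> E t \<le> M * exp (- \<mu> * t)) \<Longrightarrow> exp_decays E"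
  unfolding exp_decays_def by blast

lemma exp_decays_mono: "exp_decays F \<Longrightarrow> (\<And>t. t \<ge> 0 \<Longrightarrow> E t \<le> F t) \<Longrightarrow> exp_decays E"
  unfolding exp_decays_def by (meson order_trans)

lemma exp_decays_add:
  assumes "exp_decays E" "exp_decays F" shows "exp_decays (\<lambda>t. E t + F t)"
proof -
  obtain M \<mu> where M: "0 \<le> M" "0 < \<mu>" "\<And>t. t \<ge> 0 \<Longrightarrow> E t \<le> M * exp (- \<mu> * t)" using assms(1) by (auto simp: exp_decays_def)
  obtain N \<nu> where N: "0 \<le> N" "0 < \<nu>" "\<And>t. t \<ge> 0 \<Longrightarrow> F t \<le> N * exp (- \<nu> * t)" using assms(2) by (auto simp: exp_decays_def)
  show ?thesis
  proof (rule exp_decaysI)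
    fix t :: real assume t: "t \<ge> 0"
    have "M * exp (- \<mu> * t) \<le> M * exp (- min \<mu> \<nu> * t)" "N * exp (- \<nu> * t) \<le> N * exp (- min \<mu> \<nu> * t)"
      using M N t by (auto intro!: mult_left_mono mult_right_mono)
    then show "E t + F t \<le> (M + N) * exp (- min \<mu> \<nu> * t)" using M(3)[OF t] N(3)[OF t] by (simp add: distrib_right)
  qed (use M N in auto)
qed

lemma exp_decays_cmult:
  assumes "exp_decays E" "0 \<le> c" shows "exp_decays (\<lambda>t. c * E t)"
proof -
  obtain M \<mu> where M: "0 \<le> M" "0 < \<mu>" "\<And>t. t \<ge> 0 \<Longrightarrow> E t \<le> M * exp (- \<mu> * t)" using assms(1) by (auto simp: exp_decays_def)
  show ?thesis
    by (rule exp_decaysI[of "c * M" \<mu>]) (use M assms(2) in \<open>auto simp: mult.assoc intro: mult_left_mono\<close>)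
qed

lemma geo_decays_mono: "geo_decays W \<Longrightarrow> (\<And>n. V n \<le> W n) \<Longrightarrow> geo_decays V"
  unfolding geo_decays_def by (meson order_trans)

lemma geo_decays_add:
  assumes "geo_decays V" "geo_decays W" shows "geo_decays (\<lambda>n. V n + W n)"
proof -
  obtain C \<theta> where C: "0 \<le> C" "0 < \<theta>" "\<theta> < 1" "\<And>n. V n \<le> C * \<theta> ^ n" using assms(1) by (auto simp: geo_decays_def)
  obtain D \<eta> where D: "0 \<le> D" "0 < \<eta>" "\<eta> < 1" "\<And>n. W n \<le> D * \<eta> ^ n" using assms(2) by (auto simp: geo_decays_def)
  have "V n + W n \<le> (C + D) * max \<theta> \<eta> ^ n" for n
  proof -
    have "C * \<theta> ^ n \<le> C * max \<theta> \<eta> ^ n" "D * \<eta> ^ n \<le> D * max \<theta> \<eta> ^ n"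
      using C D by (auto intro!: mult_left_mono power_mono)
    then show ?thesis using C(4)[of n] D(4)[of n] by (simp add: distrib_right)
  qed
  then show ?thesis unfolding geo_decays_def using C D
    by (intro exI[of _ "C + D"] exI[of _ "max \<theta> \<eta>"]) auto
qed

lemma geo_decays_cmult:
  assumes "geo_decays V" "0 \<le> c" shows "geo_decays (\<lambda>n. c * V n)"
proof -
  obtain C \<theta> where C: "0 \<le> C" "0 < \<theta>" "\<theta> < 1" "\<And>n. V n \<le> C * \<theta> ^ n" using assms(1) by (auto simp: geo_decays_def)
  then show ?thesis unfolding geo_decays_def using assms(2)
    by (intro exI[of _ "c * C"] exI[of _ \<theta>]) (auto simp: mult.assoc intro: mult_left_mono)
qed

lemma geo_decays_Suc: "geo_decays V \<Longrightarrow> geo_decays (\<lambda>n. V (Suc n))"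
  unfolding geo_decays_def
proof (elim exE conjE)
  fix C \<theta> :: real assume C: "0 \<le> C" "0 < \<theta>" "\<theta> < 1" "\<forall>n. V n \<le> C * \<theta> ^ n"
  have "V (Suc n) \<le> (C * \<theta>) * \<theta> ^ n" for n using C(4) by (metis mult.assoc power_Suc)
  then show "\<exists>C \<theta>. 0 \<le> C \<and> 0 < \<theta> \<and> \<theta> < 1 \<and> (\<forall>n. V (Suc n) \<le> C * \<theta> ^ n)"
    using C by (intro exI[of _ "C * \<theta>"] exI[of _ \<theta>]) auto
qed

lemma geo_decays_of_Suc: "geo_decays (\<lambda>n. V (Suc n)) \<Longrightarrow> geo_decays V"
  unfolding geo_decays_def
proof (elim exE conjE)
  fix C \<theta> :: real assume C: "0 \<le> C" "0 < \<theta>" "\<theta> < 1" "\<forall>n. V (Suc n) \<le> C * \<theta> ^ n"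
  have "V n \<le> max \<bar>V 0\<bar> (C / \<theta>) * \<theta> ^ n" for n
  proof (cases n)
    case (Suc m)
    have "C * \<theta> ^ m = C / \<theta> * \<theta> ^ n" using C(2) by (simp add: Suc)
    also have "\<dots> \<le> max \<bar>V 0\<bar> (C / \<theta>) * \<theta> ^ n" using C by (intro mult_right_mono) auto
    finally show ?thesis using C(4) Suc by (metis order_trans)
  qed auto
  then show "\<exists>C \<theta>. 0 \<le> C \<and> 0 < \<theta> \<and> \<theta> < 1 \<and> (\<forall>n. V n \<le> C * \<theta> ^ n)"
    using C by (intro exI[of _ "max \<bar>V 0\<bar> (C / \<theta>)"] exI[of _ \<theta>]) auto
qed

lemma exp_decays_of_geo:
  assumes "geo_decays V" "\<And>n t. 2 * real n \<le> t \<Longrightarrow> t \<le> 2 * real n + 2 \<Longrightarrow> E t \<le> V n"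
  shows "exp_decays E"
proof -
  obtain C \<theta> where C: "0 \<le> C" "0 < \<theta>" "\<theta> < 1" "\<And>n. V n \<le> C * \<theta> ^ n" using assms(1) by (auto simp: geo_decays_def)
  show ?thesis
  proof (rule exp_decaysI)
    show "0 < - ln \<theta> / 2" using C by simp
    show "0 \<le> C / \<theta>" using C by simp
    fix t :: real assume t: "t \<ge> 0"
    define n where "n = nat \<lfloor>t / 2\<rfloor>"
    have rn: "real n = of_int \<lfloor>t / 2\<rfloor>" using t by (simp add: n_def)
    have n: "2 * real n \<le> t" "t \<le> 2 * real n + 2" unfolding rn by linarith+
    have "\<theta> ^ n = exp (real n * ln \<theta>)" using C by (simp add: exp_of_nat_mult)
    also have "\<dots> \<le> exp ((t / 2 - 1) * ln \<theta>)" using n C by (intro exp_le_cancel_iff[THEN iffD2] mult_right_mono_neg) auto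
    also have "\<dots> = exp (- (- ln \<theta> / 2) * t) / \<theta>" using C by (simp add: exp_diff algebra_simps)
    finally have "C * \<theta> ^ n \<le> C / \<theta> * exp (- (- ln \<theta> / 2) * t)" using C(1) mult_left_mono by fastforce
    then show "E t \<le> C / \<theta> * exp (- (- ln \<theta> / 2) * t)" using assms(2)[OF n] C(4)[of n] by linarith
  qed
qed

lemma geo_decays_of_exp:
  assumes "exp_decays E" shows "geo_decays (\<lambda>n. E (2 * real n))"
proof -
  obtain M \<mu> where M: "0 \<le> M" "0 < \<mu>" "\<And>t. t \<ge> 0 \<Longrightarrow> E t \<le> M * exp (- \<mu> * t)" using assms(1) by (auto simp: exp_decays_def)
  have "E (2 * real n) \<le> M * exp (- 2 * \<mu>) ^ n" for n
    using M(3)[of "2 * real n"] by (simp add: exp_of_nat_mult[symmetric] mult.commute mult.left_commute)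
  then show ?thesis unfolding geo_decays_def using M by (intro exI[of _ M] exI[of _ "exp (- 2 * \<mu>)"]) auto
qed

lemma geo_decays_two_step:
  assumes V: "\<And>n. 0 \<le> V n" "\<And>n. V (Suc n) \<le> V n" "\<And>n. V (Suc (Suc n)) \<le> \<theta> * V n" and \<theta>: "0 < \<theta>" "\<theta> < 1"
  shows "geo_decays V"
proof -
  define s where "s = sqrt \<theta>"
  have s: "0 < s" "s < 1" "s * s = \<theta>" using \<theta> by (auto simp: s_def)
  have "V n \<le> V 0 / s * s ^ n \<and> V (Suc n) \<le> V 0 / s * s ^ Suc n" for n
  proof (induction n)
    case 0
    have "V 0 * s \<le> V 0" using V(1)[of 0] s by (simp add: mult_left_le)
    then show ?case using s V(2)[of 0] by (simp add: field_simps)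
  next
    case (Suc n)
    have "V (Suc (Suc n)) \<le> \<theta> * (V 0 / s * s ^ n)"
      using V(3)[of n] Suc mult_left_mono[of "V n" "V 0 / s * s ^ n" \<theta>] \<theta> by linarith
    also have "\<theta> * (V 0 / s * s ^ n) = V 0 / s * s ^ Suc (Suc n)" by (simp add: s(3)[symmetric])
    finally show ?case using Suc by simp
  qed
  then show ?thesis unfolding geo_decays_def using s V(1)[of 0]
    by (intro exI[of _ "V 0 / s"] exI[of _ s]) auto
qed

text \<open>
  Any ratio strictly between \<open>\<theta>\<close> and 1 that is at least the ratio of the
  forcing works; the midpoint is a convenient choice.
\<close>

lemma geo_decays_recursion:
  assumes D: "geo_decays D" and W: "\<And>n. W (Suc n) \<le> \<theta> * W n + D n" and \<theta>: "0 \<le> \<theta>" "\<theta> < 1"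
  shows "geo_decays W"
proof -
  obtain C \<eta> where C: "0 \<le> C" "0 < \<eta>" "\<eta> < 1" "\<And>n. D n \<le> C * \<eta> ^ n" using D by (auto simp: geo_decays_def)
  define s where "s = (1 + max \<theta> \<eta>) / 2"
  have s: "0 < s" "s < 1" "\<theta> < s" "\<eta> \<le> s" using \<theta> C by (auto simp: s_def max_def)
  define K where "K = max \<bar>W 0\<bar> (C / (s - \<theta>))"
  have K: "K \<ge> 0" "C \<le> K * (s - \<theta>)"
    using s unfolding K_def by (auto simp: pos_divide_le_eq[symmetric])
  have "W n \<le> K * s ^ n" for n
  proof (induction n)
    case (Suc n)
    have "D n \<le> C * s ^ n" using C(4)[of n] C s mult_left_mono[OF power_mono[of \<eta> s n], of C] by linarith
    also have "\<dots> \<le> K * (s - \<theta>) * s ^ n" using K s by (intro mult_right_mono) auto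
    finally have "W (Suc n) \<le> \<theta> * (K * s ^ n) + K * (s - \<theta>) * s ^ n"
      using W[of n] mult_left_mono[OF Suc \<theta>(1)] by linarith
    then show ?case by (simp add: algebra_simps)
  qed (simp add: K_def)
  then show ?thesis unfolding geo_decays_def using s K by (intro exI[of _ K] exI[of _ s]) auto
qed

text \<open>
  The length 2 is the travel time to the far end and back, so that the reflection maps one window
  onto the next.
\<close>

definition window :: "(real \<Rightarrow> real) \<Rightarrow> nat \<Rightarrow> real" where
  "window u n = (LINT x:{2 * real n..2 * real n + 2}|lborel. (u x)\<^sup>2)"

text \<open>
  At time \<open>t\<close> a wave on \<open>(0,1)\<close> only involves its profiles at the
  arguments \<open>t + x\<close> and \<open>t - x\<close>, all of which lie in \<open>[t - 1, t +
  1]\<close>.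
\<close>

definition energy_decays :: "(real \<Rightarrow> real) \<Rightarrow> bool" where
  "energy_decays u \<longleftrightarrow> exp_decays (\<lambda>t. LINT x:{t - 1..t + 1}|lborel. (u x)\<^sup>2)"

lemma set_integral_square_nonneg: "0 \<le> (LINT x:A|lborel. (u x :: real)\<^sup>2)"
  by (auto simp: set_lebesgue_integral_def intro!: integral_nonneg)

lemma window_nonneg: "0 \<le> window u n"
  by (simp add: window_def set_integral_square_nonneg)

lemma set_integral_square_mono:
  assumes "L2loc u" "{a..b} \<subseteq> {c..d}"
  shows "(LINT x:{a..b}|lborel. (u x)\<^sup>2) \<le> (LINT x:{c..d}|lborel. (u x)\<^sup>2)"
  unfolding set_lebesgue_integral_def
proof (rule integral_mono)
  show "integrable lborel (\<lambda>x. indicator {a..b} x *\<^sub>R (u x)\<^sup>2)" "integrable lborel (\<lambda>x. indicator {c..d} x *\<^sub>R (u x)\<^sup>2)"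
    using L2loc_square_integrable[OF assms(1)] by (auto simp: set_integrable_def)
  show "indicator {a..b} x *\<^sub>R (u x)\<^sup>2 \<le> indicator {c..d} x *\<^sub>R (u x)\<^sup>2" for x
    using assms(2) by (auto simp: indicator_def)
qed

lemma set_integral_square_split:
  assumes "L2loc u" "a \<le> b" "b \<le> c"
  shows "(LINT x:{a..c}|lborel. (u x)\<^sup>2) = (LINT x:{a..b}|lborel. (u x)\<^sup>2) + (LINT x:{b..c}|lborel. (u x)\<^sup>2)"
proof -
  have "{a..c} = {a..b} \<union> {b..c}" using assms by auto
  moreover have "(LINT x:{a..b} \<union> {b..c}|lborel. (u x)\<^sup>2) = (LINT x:{a..b}|lborel. (u x)\<^sup>2) + (LINT x:{b..c}|lborel. (u x)\<^sup>2)"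
  proof (rule set_integral_Un_AE)
    show "AE x in lborel. \<not> (x \<in> {a..b} \<and> x \<in> {b..c})"
      using AE_lborel_singleton[of b] by eventually_elim auto
  qed (auto intro: L2loc_square_integrable[OF assms(1)])
  ultimately show ?thesis by simp
qed

lemma energy_decays_of_window:
  assumes u: "L2loc u" and geo: "geo_decays (window u)"
  shows "energy_decays u"
proof -
  define W where "W = (\<lambda>n. case n of 0 \<Rightarrow> (LINT x:{-1..0}|lborel. (u x)\<^sup>2) + window u 0 + window u 1
    | Suc m \<Rightarrow> window u m + window u (Suc m) + window u (Suc (Suc m)))"
  have "geo_decays (\<lambda>n. W (Suc n))"
    using geo_decays_add[OF geo_decays_add[OF geo geo_decays_Suc[OF geo]] geo_decays_Suc[OF geo_decays_Suc[OF geo]]]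
    by (simp add: W_def)
  then have W: "geo_decays W" by (rule geo_decays_of_Suc)
  show ?thesis unfolding energy_decays_def
  proof (rule exp_decays_of_geo[OF W])
    fix n t assume t: "2 * real n \<le> t" "t \<le> 2 * real n + 2"
    show "(LINT x:{t - 1..t + 1}|lborel. (u x)\<^sup>2) \<le> W n"
    proof (cases n)
      case 0
      have "(LINT x:{t - 1..t + 1}|lborel. (u x)\<^sup>2) \<le> (LINT x:{-1..4}|lborel. (u x)\<^sup>2)"
        by (rule set_integral_square_mono[OF u]) (use t 0 in auto)
      also have "\<dots> = W n"
        using set_integral_square_split[OF u, of "-1" 0 4] set_integral_square_split[OF u, of 0 2 4]
        by (simp add: W_def 0 window_def)
      finally show ?thesis .
    next
      case (Suc m)
      have "(LINT x:{t - 1..t + 1}|lborel. (u x)\<^sup>2) \<le> (LINT x:{2 * real m..2 * real m + 6}|lborel. (u x)\<^sup>2)"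
        by (rule set_integral_square_mono[OF u]) (use t Suc in auto)
      also have "\<dots> = W n"
        using set_integral_square_split[OF u, of "2 * real m" "2 * real m + 2" "2 * real m + 6"]
          set_integral_square_split[OF u, of "2 * real m + 2" "2 * real m + 4" "2 * real m + 6"]
        by (simp add: W_def Suc window_def algebra_simps)
      finally show ?thesis .
    qed
  qed
qed

lemma energy_decays_add:
  assumes "L2loc u" "L2loc v" "energy_decays u" "energy_decays v"
  shows "energy_decays (\<lambda>x. u x + v x)"
  unfolding energy_decays_def
proof (rule exp_decays_mono)
  show "exp_decays (\<lambda>t. 2 * (LINT x:{t - 1..t + 1}|lborel. (u x)\<^sup>2) + 2 * (LINT x:{t - 1..t + 1}|lborel. (v x)\<^sup>2))"
    using assms(3,4) by (intro exp_decays_add exp_decays_cmult) (auto simp: energy_decays_def)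
  fix t :: real
  note i = L2loc_square_integrable[OF assms(1), of "t-1" "t+1"] L2loc_square_integrable[OF assms(2), of "t-1" "t+1"]
  have "(LINT x:{t - 1..t + 1}|lborel. (u x + v x)\<^sup>2) \<le> (LINT x:{t - 1..t + 1}|lborel. 2 * (u x)\<^sup>2 + 2 * (v x)\<^sup>2)"
  proof (rule set_integral_mono)
    show "(u x + v x)\<^sup>2 \<le> 2 * (u x)\<^sup>2 + 2 * (v x)\<^sup>2" for x
      using sum_squares_bound[of "u x" "v x"] by (simp add: power2_sum)
  qed (use i L2loc_square_integrable[OF L2loc_add[OF assms(1,2)]] in auto)
  also have "\<dots> = 2 * (LINT x:{t - 1..t + 1}|lborel. (u x)\<^sup>2) + 2 * (LINT x:{t - 1..t + 1}|lborel. (v x)\<^sup>2)"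
    using i by simp
  finally show "(LINT x:{t - 1..t + 1}|lborel. (u x + v x)\<^sup>2) \<le> 2 * (LINT x:{t - 1..t + 1}|lborel. (u x)\<^sup>2) + 2 * (LINT x:{t - 1..t + 1}|lborel. (v x)\<^sup>2)" .
qed

lemma energy_decays_cmult: assumes "energy_decays u" shows "energy_decays (\<lambda>x. c * u x)"
  using exp_decays_cmult[OF assms[unfolded energy_decays_def], of "c\<^sup>2"]
  by (simp add: energy_decays_def power_mult_distrib)

lemma window_of_pointwise:
  assumes "L2loc u" "\<And>t. t \<ge> 0 \<Longrightarrow> (u t)\<^sup>2 \<le> E t" "exp_decays E"
  shows "geo_decays (window u)"
proof -
  obtain M \<mu> where M: "0 \<le> M" "0 < \<mu>" "\<And>t. t \<ge> 0 \<Longrightarrow> E t \<le> M * exp (- \<mu> * t)" using assms(3) by (auto simp: exp_decays_def)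
  have "exp_decays (\<lambda>t. 2 * (M * exp (- \<mu> * t)))"
    by (rule exp_decaysI[of "2 * M" \<mu>]) (use M in auto)
  from geo_decays_of_exp[OF this] show ?thesis
  proof (rule geo_decays_mono)
    fix n
    have "window u n \<le> (LINT x:{2 * real n..2 * real n + 2}|lborel. M * exp (- \<mu> * (2 * real n)))"
      unfolding window_def
    proof (rule set_integral_mono)
      fix x :: real assume x: "x \<in> {2 * real n..2 * real n + 2}"
      then have "(u x)\<^sup>2 \<le> M * exp (- \<mu> * x)" using assms(2)[of x] M(3)[of x] by (auto intro: order_trans)
      also have "\<dots> \<le> M * exp (- \<mu> * (2 * real n))" using x M by (intro mult_left_mono) auto
      finally show "(u x)\<^sup>2 \<le> M * exp (- \<mu> * (2 * real n))" .
    qed (auto intro: L2loc_square_integrable[OF assms(1)] set_integrable_continuous)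
    then show "window u n \<le> 2 * (M * exp (- \<mu> * (2 * real n)))"
      by (simp add: set_lebesgue_integral_def)
  qed
qed

section \<open>Decay of the delay system\<close>

text \<open>
  Multiply the relation at \<open>x = 0\<close> by \<open>f' + g'\<close>: the left hand side
  becomes \<open>f'\<^sup>2 - g'\<^sup>2\<close>, and \<open>(f + g) (f' + g')\<close> is the
  derivative of \<open>(f + g)\<^sup>2 / 2\<close>.
\<close>

lemma boundary_energy_balance:
  assumes sys: "delay_system \<alpha> \<kappa> \<rho> d0 d1 f f' g g'" and d0: "continuous_on UNIV d0" and AB: "0 \<le> A" "A \<le> B"
  shows "(LINT x:{A..B}|lborel. (g' x)\<^sup>2) = (LINT x:{A..B}|lborel. (f' x)\<^sup>2)
    - \<alpha> / 2 * ((f B + g B)\<^sup>2 - (f A + g A)\<^sup>2) - \<kappa> * (LINT x:{A..B}|lborel. (f' x + g' x)\<^sup>2)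
    - (LINT x:{A..B}|lborel. (f' x + g' x) * d0 x)"
proof -
  have pf: "prim f f'" and pg: "prim g g'"
    and b0: "AE t in lborel. 0 < t \<longrightarrow> f' t - g' t = \<alpha> * (f t + g t) + \<kappa> * (f' t + g' t) + d0 t"
    using sys by (auto simp: delay_system_def)
  note ph = prim_add[OF pf pg]
  note Lf = prim_L2loc[OF pf] and Lg = prim_L2loc[OF pg] and Lh = prim_L2loc[OF ph]
  note [measurable] = L2loc_measurable[OF Lf] L2loc_measurable[OF Lg]
  have [measurable]: "f \<in> borel_measurable borel" "g \<in> borel_measurable borel" "d0 \<in> borel_measurable borel"
    by (auto intro!: borel_measurable_continuous_onI d0 prim_continuous_on[OF pf] prim_continuous_on[OF pg])
  have i: "set_integrable lborel {A..B} (\<lambda>x. (f' x)\<^sup>2)" "set_integrable lborel {A..B} (\<lambda>x. (f' x + g' x)\<^sup>2)"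
    "set_integrable lborel {A..B} (\<lambda>x. (f' x + g' x) * d0 x)" "set_integrable lborel {A..B} (\<lambda>x. (f' x + g' x) * (f x + g x))"
    by (intro L2loc_square_integrable Lf Lh L2loc_integrable L2loc_continuous_mult d0 prim_continuous_on[OF ph])+
  have "(LINT x:{A..B}|lborel. (g' x)\<^sup>2) = (LINT x:{A..B}|lborel. (f' x)\<^sup>2 - \<alpha> * ((f' x + g' x) * (f x + g x))
      - \<kappa> * (f' x + g' x)\<^sup>2 - (f' x + g' x) * d0 x)"
  proof (rule set_lebesgue_integral_cong_AE)
    show "AE x\<in>{A..B} in lborel. (g' x)\<^sup>2 = (f' x)\<^sup>2 - \<alpha> * ((f' x + g' x) * (f x + g x)) - \<kappa> * (f' x + g' x)\<^sup>2 - (f' x + g' x) * d0 x"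
      using b0 AE_lborel_singleton[of 0]
    proof eventually_elim
      case (elim x)
      show ?case
      proof
        assume "x \<in> {A..B}"
        then have e: "f' x - g' x = \<alpha> * (f x + g x) + \<kappa> * (f' x + g' x) + d0 x" using elim AB by auto
        have "(f' x)\<^sup>2 - (g' x)\<^sup>2 = (f' x + g' x) * (f' x - g' x)" by (simp add: power2_eq_square algebra_simps)
        also have "\<dots> = \<alpha> * ((f' x + g' x) * (f x + g x)) + \<kappa> * (f' x + g' x)\<^sup>2 + (f' x + g' x) * d0 x"
          unfolding e by (simp add: power2_eq_square algebra_simps)
        finally show "(g' x)\<^sup>2 = (f' x)\<^sup>2 - \<alpha> * ((f' x + g' x) * (f x + g x)) - \<kappa> * (f' x + g' x)\<^sup>2 - (f' x + g' x) * d0 x"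
          by linarith
      qed
    qed
  qed measurable
  also have "\<dots> = (LINT x:{A..B}|lborel. (f' x)\<^sup>2) - \<alpha> * (LINT x:{A..B}|lborel. (f' x + g' x) * (f x + g x))
      - \<kappa> * (LINT x:{A..B}|lborel. (f' x + g' x)\<^sup>2) - (LINT x:{A..B}|lborel. (f' x + g' x) * d0 x)"
    using i by (subst set_integral_diff, auto)+
  also have "(LINT x:{A..B}|lborel. (f' x + g' x) * (f x + g x)) = ((f B + g B)\<^sup>2 - (f A + g A)\<^sup>2) / 2"
  proof -
    have "(LINT x:{A..B}|lborel. (f x + g x) * (f' x + g' x) + (f' x + g' x) * (f x + g x)) = 2 * (LINT x:{A..B}|lborel. (f' x + g' x) * (f x + g x))"
      by (simp add: mult.commute[of "f _ + g _"] flip: mult_2)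
    then show ?thesis using prim_product_integral[OF ph ph AB(2)] by (simp add: power2_eq_square)
  qed
  finally show ?thesis by (simp add: algebra_simps diff_divide_distrib)
qed

lemma reflected_at_1:
  assumes sys: "delay_system \<alpha> \<kappa> \<rho> d0 d1 f f' g g'"
  shows "AE t in lborel. -1 < t \<longrightarrow> f' (2 + t) = \<rho> * g' t + d1 (1 + t)"
proof -
  have "AE t in lborel. 0 < t \<longrightarrow> f' (t + 1) = \<rho> * g' (t - 1) + d1 t"
    using sys by (simp add: delay_system_def)
  from AE_shift[OF this, of 1] show ?thesis by eventually_elim (simp add: add.commute add.left_commute)
qed

lemma window_Suc_reflected:
  assumes sys: "delay_system \<alpha> \<kappa> \<rho> d0 d1 f f' g g'" and d1: "L2loc d1"
  shows "window f' (Suc n) = window (\<lambda>t. \<rho> * g' t + d1 (1 + t)) n"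
proof -
  have pf: "prim f f'" and pg: "prim g g'" using sys by (auto simp: delay_system_def)
  note [measurable] = L2loc_measurable[OF prim_L2loc[OF pf]] L2loc_measurable[OF prim_L2loc[OF pg]] L2loc_measurable[OF d1]
  have "window f' (Suc n) = (LINT t:{2 * real n..2 * real n + 2}|lborel. (f' (2 + t))\<^sup>2)"
    using set_integral_shift[of "2 * real n" "2 * real n + 2" "\<lambda>t. (f' t)\<^sup>2" 2] by (simp add: window_def algebra_simps)
  also have "\<dots> = window (\<lambda>t. \<rho> * g' t + d1 (1 + t)) n"
    unfolding window_def
  proof (rule set_lebesgue_integral_cong_AE)
    show "AE t\<in>{2 * real n..2 * real n + 2} in lborel. (f' (2 + t))\<^sup>2 = (\<rho> * g' t + d1 (1 + t))\<^sup>2"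
      using reflected_at_1[OF sys] by eventually_elim auto
  qed measurable
  finally show ?thesis .
qed

text \<open>
  Two consecutive windows have total length 4, whence the factor \<open>2 = sqrt 4\<close>.
\<close>

lemma oscillation_bound:
  assumes p: "prim h h'" and st: "s \<in> {2 * real n..2 * real n + 4}" "t \<in> {2 * real n..2 * real n + 4}"
  shows "\<bar>h t - h s\<bar> \<le> 2 * sqrt (window h' n + window h' (Suc n))"
proof -
  have *: "\<bar>h t - h s\<bar> \<le> 2 * sqrt (window h' n + window h' (Suc n))"
    if st: "s \<in> {2 * real n..2 * real n + 4}" "t \<in> {2 * real n..2 * real n + 4}" "s \<le> t" for s t
  proof -
    have "(h t - h s)\<^sup>2 = (LINT x:{s..t}|lborel. h' x)\<^sup>2" using prim_eq[OF p st(3)] by simp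
    also have "\<dots> \<le> (t - s) * (LINT x:{s..t}|lborel. (h' x)\<^sup>2)" by (rule L2loc_cauchy_schwarz[OF prim_L2loc[OF p] st(3)])
    also have "\<dots> \<le> 4 * (LINT x:{2 * real n..2 * real n + 4}|lborel. (h' x)\<^sup>2)"
      using st by (intro mult_mono set_integral_square_mono prim_L2loc[OF p] set_integral_square_nonneg) auto
    also have "\<dots> = 4 * (window h' n + window h' (Suc n))"
      using set_integral_square_split[OF prim_L2loc[OF p], of "2 * real n" "2 * real n + 2" "2 * real n + 4"]
      by (simp add: window_def algebra_simps)
    finally have "\<bar>h t - h s\<bar> \<le> sqrt (4 * (window h' n + window h' (Suc n)))"
      by (intro real_le_rsqrt) simp
    then show ?thesis by (simp only: real_sqrt_mult real_sqrt_four)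
  qed
  show ?thesis using *[OF st] *[OF st(2,1)] by (cases "s \<le> t") (auto simp: abs_minus_commute)
qed

lemma integral_oscillation_bound:
  assumes p: "prim h h'" and AB: "A \<le> B" "{A..B} \<subseteq> {2 * real n..2 * real n + 4}" and s: "s \<in> {2 * real n..2 * real n + 4}"
  shows "\<bar>(LINT x:{A..B}|lborel. h x) - (B - A) * h s\<bar> \<le> (B - A) * (2 * sqrt (window h' n + window h' (Suc n)))"
proof -
  let ?\<omega> = "2 * sqrt (window h' n + window h' (Suc n))"
  have ih: "set_integrable lborel {A..B} h" by (intro set_integrable_continuous prim_continuous_on[OF p])
  have o: "h x \<le> h s + ?\<omega>" "h s - ?\<omega> \<le> h x" if "x \<in> {A..B}" for x
  proof -
    have "x \<in> {2 * real n..2 * real n + 4}" using AB(2) that by blast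
    from oscillation_bound[OF p s this] show "h x \<le> h s + ?\<omega>" "h s - ?\<omega> \<le> h x" by linarith+
  qed
  have c: "(LINT x:{A..B}|lborel. c) = (B - A) * c" for c using AB(1) by (simp add: set_lebesgue_integral_def)
  have "(LINT x:{A..B}|lborel. h x) \<le> (LINT x:{A..B}|lborel. h s + ?\<omega>)"
    by (intro set_integral_mono ih set_integrable_continuous continuous_intros) (rule o)
  moreover have "(LINT x:{A..B}|lborel. h s - ?\<omega>) \<le> (LINT x:{A..B}|lborel. h x)"
    by (intro set_integral_mono ih set_integrable_continuous continuous_intros) (rule o)
  ultimately show ?thesis unfolding c abs_le_iff by (simp add: algebra_simps)
qed

text \<open>
  The integrated relation at \<open>x = 0\<close> solved for the increments of \<open>f\<close>
  and of \<open>g\<close>.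
\<close>

lemma profile_increments:
  assumes sys: "delay_system \<alpha> \<kappa> \<rho> (\<lambda>_. 0) d1 f f' g g'" and AB: "0 \<le> A" "A \<le> B"
  shows "2 * (f B - f A) = (1 + \<kappa>) * ((f B + g B) - (f A + g A)) + \<alpha> * (LINT x:{A..B}|lborel. f x + g x)"
    and "2 * (g B - g A) = (1 - \<kappa>) * ((f B + g B) - (f A + g A)) - \<alpha> * (LINT x:{A..B}|lborel. f x + g x)"
proof -
  have pf: "prim f f'" and pg: "prim g g'"
    and b0: "AE t in lborel. 0 < t \<longrightarrow> f' t - g' t = \<alpha> * (f t + g t) + \<kappa> * (f' t + g' t)"
    using sys by (auto simp: delay_system_def)
  note ph = prim_add[OF pf pg]
  note [measurable] = L2loc_measurable[OF prim_L2loc[OF pf]] L2loc_measurable[OF prim_L2loc[OF pg]]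
  have [measurable]: "f \<in> borel_measurable borel" "g \<in> borel_measurable borel"
    by (auto intro!: borel_measurable_continuous_onI prim_continuous_on[OF pf] prim_continuous_on[OF pg])
  have i: "set_integrable lborel {A..B} (\<lambda>x. f x + g x)" by (intro set_integrable_continuous prim_continuous_on[OF ph])
  have j: "set_integrable lborel {A..B} (\<lambda>x. f' x + g' x)" by (rule prim_integrable[OF ph])
  have "(LINT x:{A..B}|lborel. f' x - g' x) = (LINT x:{A..B}|lborel. \<alpha> * (f x + g x) + \<kappa> * (f' x + g' x))"
  proof (rule set_lebesgue_integral_cong_AE)
    show "AE x\<in>{A..B} in lborel. f' x - g' x = \<alpha> * (f x + g x) + \<kappa> * (f' x + g' x)"
      using b0 AE_lborel_singleton[of 0] by eventually_elim (use AB in auto)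
  qed measurable
  also have "\<dots> = \<alpha> * (LINT x:{A..B}|lborel. f x + g x) + \<kappa> * (LINT x:{A..B}|lborel. f' x + g' x)"
    using i j by (subst set_integral_add) auto
  finally have e: "(f B - g B) - (f A - g A) = \<alpha> * (LINT x:{A..B}|lborel. f x + g x) + \<kappa> * ((f B + g B) - (f A + g A))"
    using prim_eq[OF prim_diff[OF pf pg] AB(2)] prim_eq[OF ph AB(2)] by simp
  have "2 * (f B - f A) = ((f B - g B) - (f A - g A)) + ((f B + g B) - (f A + g A))" by simp
  then show "2 * (f B - f A) = (1 + \<kappa>) * ((f B + g B) - (f A + g A)) + \<alpha> * (LINT x:{A..B}|lborel. f x + g x)"
    unfolding e by (simp add: algebra_simps)
  have "2 * (g B - g A) = ((f B + g B) - (f A + g A)) - ((f B - g B) - (f A - g A))" by simp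
  then show "2 * (g B - g A) = (1 - \<kappa>) * ((f B + g B) - (f A + g A)) - \<alpha> * (LINT x:{A..B}|lborel. f x + g x)"
    unfolding e by (simp add: algebra_simps)
qed

text \<open>
  The damping only sees \<open>h' = f' + g'\<close> at \<open>x = 0\<close>, and a constant
  \<open>h\<close> would not be damped. A free far end excludes this: the increment of
  \<open>f\<close> over one window equals that of \<open>g\<close> over the preceding one, so the
  increments of both profiles, expressed by \<open>h\<close>, force \<open>4 \<alpha> h\<close> to
  be a combination of oscillations of \<open>h\<close>.
\<close>

lemma endpoint_control_free:
  assumes sys: "delay_system \<alpha> \<kappa> 1 (\<lambda>_. 0) (\<lambda>_. 0) f f' g g'" and \<alpha>: "\<alpha> > 0" and \<kappa>: "\<kappa> \<ge> 0"
    and t: "t \<in> {2 * real n..2 * real n + 2}"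
  shows "(f t + g t)\<^sup>2 \<le> (2 * ((1 + \<kappa>) / (2 * \<alpha>) + 1))\<^sup>2
    * (window (\<lambda>x. f' x + g' x) n + window (\<lambda>x. f' x + g' x) (Suc n))"
proof -
  have pf: "prim f f'" and pg: "prim g g'" using sys by (auto simp: delay_system_def)
  note ph = prim_add[OF pf pg]
  define h where "h = (\<lambda>x. f x + g x)"
  define K where "K = window (\<lambda>x. f' x + g' x) n + window (\<lambda>x. f' x + g' x) (Suc n)"
  have K0: "K \<ge> 0" by (simp add: K_def window_nonneg)
  define \<omega> where "\<omega> = 2 * sqrt K"
  let ?a = "2 * real n" and ?b = "2 * real n + 2" and ?c = "2 * real n + 4"
  have "f ?c - f ?b = (LINT x:{2 + ?a..2 + ?b}|lborel. f' x)"
    using prim_eq[OF pf, of ?b ?c] by (simp add: add.commute add.left_commute)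
  also have "\<dots> = (LINT x:{?a..?b}|lborel. f' (2 + x))" by (rule set_integral_shift[symmetric])
  also have "\<dots> = (LINT x:{?a..?b}|lborel. g' x)"
  proof (rule set_lebesgue_integral_cong_AE)
    note [measurable] = L2loc_measurable[OF prim_L2loc[OF pf]] L2loc_measurable[OF prim_L2loc[OF pg]]
    show "(\<lambda>x. f' (2 + x)) \<in> borel_measurable lborel" "g' \<in> borel_measurable lborel" by measurable
    show "AE x\<in>{?a..?b} in lborel. f' (2 + x) = g' x"
      using reflected_at_1[OF sys] by eventually_elim auto
  qed simp
  also have "\<dots> = g ?b - g ?a" using prim_eq[OF pg, of ?a ?b] by simp
  finally have "2 * (f ?c - f ?b) = 2 * (g ?b - g ?a)" by simp
  then have e: "(1 + \<kappa>) * (h ?c - h ?b) + \<alpha> * (LINT x:{?b..?c}|lborel. h x) = (1 - \<kappa>) * (h ?b - h ?a) - \<alpha> * (LINT x:{?a..?b}|lborel. h x)"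
    unfolding h_def using profile_increments(1)[OF sys, of ?b ?c] profile_increments(2)[OF sys, of ?a ?b] by simp
  define I where "I = (LINT x:{?b..?c}|lborel. h x) - 2 * h t"
  define J where "J = (LINT x:{?a..?b}|lborel. h x) - 2 * h t"
  have t4: "t \<in> {?a..?c}" using t by auto
  have I: "\<bar>I\<bar> \<le> 2 * \<omega>" "\<bar>J\<bar> \<le> 2 * \<omega>"
    using integral_oscillation_bound[OF ph, of ?b ?c n t] integral_oscillation_bound[OF ph, of ?a ?b n t] t4
    by (auto simp: I_def J_def h_def \<omega>_def K_def)
  have X: "\<bar>h ?c - h ?b\<bar> \<le> \<omega>" "\<bar>h ?b - h ?a\<bar> \<le> \<omega>"
    using oscillation_bound[OF ph, of ?b n ?c] oscillation_bound[OF ph, of ?a n ?b] by (auto simp: h_def \<omega>_def K_def)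
  have "4 * \<alpha> * h t = (1 - \<kappa>) * (h ?b - h ?a) - (1 + \<kappa>) * (h ?c - h ?b) - \<alpha> * I - \<alpha> * J"
    using e unfolding I_def J_def by (simp add: algebra_simps)
  then have "\<bar>4 * \<alpha> * h t\<bar> \<le> \<bar>(1 - \<kappa>) * (h ?b - h ?a)\<bar> + \<bar>(1 + \<kappa>) * (h ?c - h ?b)\<bar> + \<bar>\<alpha> * I\<bar> + \<bar>\<alpha> * J\<bar>" by linarith
  also have "\<dots> \<le> (1 + \<kappa>) * \<omega> + (1 + \<kappa>) * \<omega> + \<alpha> * (2 * \<omega>) + \<alpha> * (2 * \<omega>)"
    unfolding abs_mult using X I \<kappa> \<alpha> by (intro add_mono mult_mono) auto
  finally have "4 * \<alpha> * \<bar>h t\<bar> \<le> (2 * (1 + \<kappa>) + 4 * \<alpha>) * \<omega>" using \<alpha> by (simp add: abs_mult algebra_simps)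
  then have "\<bar>h t\<bar> \<le> ((1 + \<kappa>) / (2 * \<alpha>) + 1) * \<omega>" using \<alpha> by (simp add: field_simps)
  then have "\<bar>h t\<bar>\<^sup>2 \<le> (((1 + \<kappa>) / (2 * \<alpha>) + 1) * \<omega>)\<^sup>2" by (rule power_mono) simp
  also have "\<dots> = (2 * ((1 + \<kappa>) / (2 * \<alpha>) + 1))\<^sup>2 * K"
    unfolding power_mult_distrib using K0 by (simp add: \<omega>_def power_mult_distrib)
  finally show ?thesis by (simp add: h_def K_def)
qed

text \<open>
  The counterpart for a clamped far end, where \<open>f (t + 2) = - g t\<close> expresses \<open>h
  t\<close> as an increment of \<open>f\<close>. That increment is \<open>\<alpha> h t\<close>
  plus oscillations of \<open>h\<close>, up to a factor, and the signs do not cancel because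
  \<open>\<alpha> > 0\<close>.
\<close>

lemma endpoint_control_clamped:
  assumes sys: "delay_system \<alpha> \<kappa> \<rho> (\<lambda>_. 0) (\<lambda>_. 0) f f' g g'" and \<alpha>: "\<alpha> > 0" and \<kappa>: "\<kappa> \<ge> 0"
    and clamp: "\<And>t. t \<ge> 0 \<Longrightarrow> f (t + 1) + g (t - 1) = 0"
    and t: "t \<in> {2 * real n..2 * real n + 2}"
  shows "(f t + g t)\<^sup>2 \<le> (2 * (1 + \<kappa> + 2 * \<alpha>))\<^sup>2
    * (window (\<lambda>x. f' x + g' x) n + window (\<lambda>x. f' x + g' x) (Suc n))"
proof -
  have pf: "prim f f'" and pg: "prim g g'" using sys by (auto simp: delay_system_def)
  note ph = prim_add[OF pf pg]
  define h where "h = (\<lambda>x. f x + g x)"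
  define K where "K = window (\<lambda>x. f' x + g' x) n + window (\<lambda>x. f' x + g' x) (Suc n)"
  have K0: "K \<ge> 0" by (simp add: K_def window_nonneg)
  define \<omega> where "\<omega> = 2 * sqrt K"
  have t0: "0 \<le> t" by (rule order_trans[of _ "2 * real n"]) (use t in auto)
  have "f (t + 2) + g t = 0" using clamp[of "t + 1"] t0 by (simp add: add.assoc)
  then have ht: "h t = - (f (t + 2) - f t)" by (simp add: h_def)
  define I where "I = (LINT x:{t..t + 2}|lborel. h x) - 2 * h t"
  have sub: "{t..t + 2} \<subseteq> {2 * real n..2 * real n + 4}" "t \<in> {2 * real n..2 * real n + 4}" "t + 2 \<in> {2 * real n..2 * real n + 4}"
    using t by auto
  have I: "\<bar>I\<bar> \<le> 2 * \<omega>"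
    using integral_oscillation_bound[OF ph _ sub(1,2)] by (auto simp: I_def h_def \<omega>_def K_def)
  have X: "\<bar>h (t + 2) - h t\<bar> \<le> \<omega>"
    using oscillation_bound[OF ph sub(2,3)] by (auto simp: h_def \<omega>_def K_def)
  have inc: "f (t + 2) - f t = - h t" using ht by simp
  have "2 * (f (t + 2) - f t) = (1 + \<kappa>) * (h (t + 2) - h t) + \<alpha> * (LINT x:{t..t + 2}|lborel. h x)"
    using profile_increments(1)[OF sys t0, of "t + 2"] by (simp add: h_def)
  then have "2 * (- h t) = (1 + \<kappa>) * (h (t + 2) - h t) + \<alpha> * (LINT x:{t..t + 2}|lborel. h x)"
    unfolding inc .
  then have "2 * (1 + \<alpha>) * h t = - ((1 + \<kappa>) * (h (t + 2) - h t)) - \<alpha> * I"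
    unfolding I_def by (simp add: algebra_simps)
  then have "\<bar>2 * (1 + \<alpha>) * h t\<bar> \<le> \<bar>(1 + \<kappa>) * (h (t + 2) - h t)\<bar> + \<bar>\<alpha> * I\<bar>" by linarith
  also have "\<dots> \<le> (1 + \<kappa>) * \<omega> + \<alpha> * (2 * \<omega>)"
    unfolding abs_mult using X I \<kappa> \<alpha> by (intro add_mono mult_mono) auto
  finally have "2 * (1 + \<alpha>) * \<bar>h t\<bar> \<le> (1 + \<kappa> + 2 * \<alpha>) * \<omega>" using \<alpha> by (simp add: abs_mult algebra_simps)
  moreover have "1 * \<bar>h t\<bar> \<le> 2 * (1 + \<alpha>) * \<bar>h t\<bar>" using \<alpha> by (intro mult_right_mono) auto
  ultimately have "\<bar>h t\<bar> \<le> (1 + \<kappa> + 2 * \<alpha>) * \<omega>" by simp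
  then have "\<bar>h t\<bar>\<^sup>2 \<le> ((1 + \<kappa> + 2 * \<alpha>) * \<omega>)\<^sup>2" by (rule power_mono) simp
  also have "\<dots> = (2 * (1 + \<kappa> + 2 * \<alpha>))\<^sup>2 * K"
    unfolding power_mult_distrib using K0 by (simp add: \<omega>_def power_mult_distrib)
  finally show ?thesis by (simp add: h_def K_def)
qed

text \<open>
  The energy \<open>V n\<close> at time \<open>2n\<close> consists of the incoming profile over
  the next window and of the boundary term \<open>\<alpha> / 2 h\<^sup>2\<close>. A reflection
  with \<open>\<rho> = \<plusminus> 1\<close> preserves energy, so a window costs exactly
  \<open>\<kappa> J n\<close>, where \<open>J n\<close> is the window of \<open>h'\<close>. The
  control of \<open>h\<close> by two windows of \<open>h'\<close> bounds \<open>V n\<close> by a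
  multiple of \<open>J n + J (n + 1)\<close>, which is the loss over two steps.
\<close>

lemma boundary_damping_decay:
  assumes sys: "delay_system \<alpha> \<kappa> \<rho> (\<lambda>_. 0) (\<lambda>_. 0) f f' g g'" and \<alpha>: "\<alpha> > 0" and \<kappa>: "\<kappa> > 0" and \<rho>: "\<rho>\<^sup>2 = 1"
    and C: "C \<ge> 0" and control: "\<And>n t. t \<in> {2 * real n..2 * real n + 2} \<Longrightarrow>
      (f t + g t)\<^sup>2 \<le> C * (window (\<lambda>x. f' x + g' x) n + window (\<lambda>x. f' x + g' x) (Suc n))"
  shows "geo_decays (window f')" "geo_decays (window g')" "exp_decays (\<lambda>t. (f t + g t)\<^sup>2)"
proof -
  have pf: "prim f f'" and pg: "prim g g'"
    and b0: "AE t in lborel. 0 < t \<longrightarrow> f' t - g' t = \<alpha> * (f t + g t) + \<kappa> * (f' t + g' t)"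
    using sys by (auto simp: delay_system_def)
  note ph = prim_add[OF pf pg]
  define J where "J = window (\<lambda>x. f' x + g' x)"
  define h where "h = (\<lambda>x. f x + g x)"
  define V where "V = (\<lambda>n. window f' n + \<alpha> / 2 * (h (2 * real n))\<^sup>2)"
  have V0: "V n \<ge> 0" for n using \<alpha> by (simp add: V_def window_nonneg)
  have J0: "J n \<ge> 0" for n by (simp add: J_def window_nonneg)
  have shift: "window f' (Suc n) = window g' n" for n
    using window_Suc_reflected[OF sys L2loc_continuous, of n] \<rho> by (simp add: window_def power_mult_distrib)
  have VS: "V (Suc n) = V n - \<kappa> * J n" for n
    using boundary_energy_balance[OF sys, of "2 * real n" "2 * real n + 2"] shift[of n]
    by (simp add: V_def h_def J_def window_def algebra_simps)
  \<comment> \<open>The first term comes from \<open>2 f' = (1 + \<kappa>) h' + \<alpha>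
    h\<close>, and it ensures \<open>C2 \<ge> 2 \<kappa>\<close>, so that \<open>1 - \<kappa> /
    C2\<close> below is positive.\<close>
  define C2 where "C2 = (1 + \<kappa>)\<^sup>2 / 2 + \<alpha>\<^sup>2 * C + \<alpha> / 2 * C"
  have "4 * \<kappa> \<le> (1 + \<kappa>)\<^sup>2" using sum_squares_bound[of 1 \<kappa>] by (simp add: power2_eq_square algebra_simps)
  moreover have "0 \<le> \<alpha>\<^sup>2 * C" "0 \<le> \<alpha> / 2 * C" using \<alpha> C by auto
  ultimately have C2: "2 * \<kappa> \<le> C2" by (simp add: C2_def)
  have VK: "V n \<le> C2 * (J n + J (Suc n))" for n
  proof -
    let ?K = "J n + J (Suc n)"
    note i = L2loc_square_integrable[OF prim_L2loc[OF ph], of "2 * real n" "2 * real n + 2"]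
    have "window f' n \<le> (LINT x:{2 * real n..2 * real n + 2}|lborel. (1 + \<kappa>)\<^sup>2 / 2 * (f' x + g' x)\<^sup>2 + \<alpha>\<^sup>2 / 2 * (C * ?K))"
      unfolding window_def
    proof (rule set_integral_mono_AE)
      show "set_integrable lborel {2 * real n..2 * real n + 2} (\<lambda>x. (1 + \<kappa>)\<^sup>2 / 2 * (f' x + g' x)\<^sup>2 + \<alpha>\<^sup>2 / 2 * (C * ?K))"
        by (intro set_integral_add(1) set_integrable_mult_right i set_integrable_continuous continuous_intros)
      show "AE x\<in>{2 * real n..2 * real n + 2} in lborel. (f' x)\<^sup>2 \<le> (1 + \<kappa>)\<^sup>2 / 2 * (f' x + g' x)\<^sup>2 + \<alpha>\<^sup>2 / 2 * (C * ?K)"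
        using b0 AE_lborel_singleton[of 0]
      proof eventually_elim
        case (elim x)
        show ?case
        proof
          assume x: "x \<in> {2 * real n..2 * real n + 2}"
          have "0 \<le> x" by (rule order_trans[of _ "2 * real n"]) (use x in auto)
          then have e: "f' x - g' x = \<alpha> * h x + \<kappa> * (f' x + g' x)" using elim by (auto simp: h_def)
          then have e2: "2 * f' x = (1 + \<kappa>) * (f' x + g' x) + \<alpha> * h x" by (simp add: algebra_simps)
          have "(2 * f' x)\<^sup>2 \<le> 2 * ((1 + \<kappa>) * (f' x + g' x))\<^sup>2 + 2 * (\<alpha> * h x)\<^sup>2"
            unfolding e2 using sum_squares_bound[of "(1 + \<kappa>) * (f' x + g' x)" "\<alpha> * h x"] by (simp add: power2_sum)
          then have "(f' x)\<^sup>2 \<le> (1 + \<kappa>)\<^sup>2 / 2 * (f' x + g' x)\<^sup>2 + \<alpha>\<^sup>2 / 2 * (h x)\<^sup>2"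
            by (simp add: power_mult_distrib)
          moreover have "\<alpha>\<^sup>2 / 2 * (h x)\<^sup>2 \<le> \<alpha>\<^sup>2 / 2 * (C * ?K)"
            using control[OF x] by (intro mult_left_mono) (auto simp: h_def J_def)
          ultimately show "(f' x)\<^sup>2 \<le> (1 + \<kappa>)\<^sup>2 / 2 * (f' x + g' x)\<^sup>2 + \<alpha>\<^sup>2 / 2 * (C * ?K)" by linarith
        qed
      qed
    qed (auto intro: L2loc_square_integrable[OF prim_L2loc[OF pf]])
    also have "\<dots> = (1 + \<kappa>)\<^sup>2 / 2 * J n + \<alpha>\<^sup>2 * C * ?K"
    proof -
      have "set_integrable lborel {2 * real n..2 * real n + 2} (\<lambda>x. (1 + \<kappa>)\<^sup>2 / 2 * (f' x + g' x)\<^sup>2)"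
        "set_integrable lborel {2 * real n..2 * real n + 2} (\<lambda>x. \<alpha>\<^sup>2 / 2 * (C * ?K))"
        by (intro set_integrable_mult_right i set_integrable_continuous continuous_intros)+
      from set_integral_add(2)[OF this] show ?thesis by (simp add: J_def window_def set_lebesgue_integral_def)
    qed
    also have "\<dots> \<le> (1 + \<kappa>)\<^sup>2 / 2 * ?K + \<alpha>\<^sup>2 * C * ?K"
      using J0[of "Suc n"] by (intro add_right_mono mult_left_mono) auto
    finally have "window f' n \<le> (1 + \<kappa>)\<^sup>2 / 2 * ?K + \<alpha>\<^sup>2 * C * ?K" .
    moreover have "\<alpha> / 2 * (h (2 * real n))\<^sup>2 \<le> \<alpha> / 2 * (C * ?K)"
      using control[of "2 * real n" n] \<alpha> by (intro mult_left_mono) (auto simp: h_def J_def)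
    ultimately have "V n \<le> (1 + \<kappa>)\<^sup>2 / 2 * ?K + \<alpha>\<^sup>2 * C * ?K + \<alpha> / 2 * (C * ?K)" unfolding V_def by linarith
    also have "\<dots> = C2 * ?K" by (simp add: C2_def algebra_simps)
    finally show ?thesis .
  qed
  have VK2: "\<kappa> * (J n + J (Suc n)) = V n - V (Suc (Suc n))" for n
    using VS[of n] VS[of "Suc n"] by (simp add: algebra_simps)
  have c2: "C2 > 0" using C2 \<kappa> by simp
  have geoV: "geo_decays V"
  proof (rule geo_decays_two_step[where \<theta> = "1 - \<kappa> / C2"])
    fix n
    show "V (Suc n) \<le> V n" using VS[of n] J0[of n] \<kappa> by simp
    have "\<kappa> / C2 * V n \<le> \<kappa> / C2 * (C2 * (J n + J (Suc n)))" using VK[of n] \<kappa> c2 by (intro mult_left_mono) auto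
    also have "\<dots> = V n - V (Suc (Suc n))" using VK2[of n] c2 by simp
    finally show "V (Suc (Suc n)) \<le> (1 - \<kappa> / C2) * V n" by (simp add: algebra_simps)
    show "0 < 1 - \<kappa> / C2" "1 - \<kappa> / C2 < 1" using C2 c2 \<kappa> by (auto simp: field_simps)
  qed (rule V0)
  show gf: "geo_decays (window f')" by (rule geo_decays_mono[OF geoV]) (use \<alpha> in \<open>simp add: V_def\<close>)
  show "geo_decays (window g')" using geo_decays_Suc[OF gf] by (simp add: shift)
  show "exp_decays (\<lambda>t. (f t + g t)\<^sup>2)"
  proof (rule exp_decays_of_geo[OF geo_decays_cmult[OF geoV, of "C / \<kappa>"]])
    show "0 \<le> C / \<kappa>" using C \<kappa> by simp
    fix n t assume t: "2 * real n \<le> t" "t \<le> 2 * real n + 2"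
    have "(f t + g t)\<^sup>2 \<le> C * (J n + J (Suc n))" using control[of t n] t by (simp add: J_def)
    also have "\<dots> = C / \<kappa> * (V n - V (Suc (Suc n)))" unfolding VK2[symmetric] using \<kappa> by simp
    also have "\<dots> \<le> C / \<kappa> * V n" using V0[of "Suc (Suc n)"] C \<kappa> by (intro mult_left_mono) auto
    finally show "(f t + g t)\<^sup>2 \<le> C / \<kappa> * V n" .
  qed
qed

text \<open>
  The room that \<open>\<bar>\<rho>\<bar> < 1\<close> leaves for absorbing the error terms of
  Young's inequality.
\<close>

lemma contraction_margin:
  assumes "\<bar>\<rho>\<bar> < (1::real)"
  obtains \<eta> where "0 < \<eta>" "\<eta> < 1" "\<rho>\<^sup>2 * (1 + \<eta>)\<^sup>2 < 1 - \<eta>"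
proof -
  define s where "s = 1 - \<rho>\<^sup>2"
  have "\<rho>\<^sup>2 < 1" using assms by (simp add: abs_square_less_1)
  then have s: "0 < s" "s \<le> 1" by (auto simp: s_def)
  have "(1 - s) * (1 + s / 4)\<^sup>2 \<le> (1 - s) * (1 + s)"
  proof (rule mult_left_mono)
    have "s * s \<le> s * 1" using s by (intro mult_left_mono) auto
    then show "(1 + s / 4)\<^sup>2 \<le> 1 + s" using s by (simp add: power2_eq_square field_simps)
  qed (use s in auto)
  also have "\<dots> = 1 - s * s" by (simp add: algebra_simps)
  finally have *: "(1 - s) * (1 + s / 4)\<^sup>2 \<le> 1 - s * s" .
  have F: "(1 - s) * (1 + s / 4)\<^sup>2 < 1 - s / 4"
  proof (cases "s > 1 / 4")
    case True
    then have "1 - s * s < 1 - s / 4" using s mult_strict_left_mono[of "1 / 4" s s] by simp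
    then show ?thesis using * by linarith
  next
    case False
    have "(1 - s) * (1 + s / 4)\<^sup>2 = 1 - s / 2 - 7 / 16 * (s * s) - s * s * s / 16"
      by (simp add: power2_eq_square field_simps)
    also have "\<dots> < 1 - s / 4"
    proof -
      have "0 < s * s" "0 < s * s * s" using s by auto
      then show ?thesis using s by linarith
    qed
    finally show ?thesis .
  qed
  have rs: "\<rho>\<^sup>2 = 1 - s" by (simp add: s_def)
  show ?thesis
  proof (rule that[of "s / 4"])
    show "\<rho>\<^sup>2 * (1 + s / 4)\<^sup>2 < 1 - s / 4" unfolding rs by (rule F)
  qed (use s in auto)
qed

lemma young: "0 < \<eta> \<Longrightarrow> \<bar>x * y\<bar> \<le> \<eta> / 2 * x\<^sup>2 + y\<^sup>2 / (2 * \<eta>)" for x y \<eta> :: real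
proof -
  assume \<eta>: "0 < \<eta>"
  have "2 * \<bar>\<eta> * x\<bar> * \<bar>y\<bar> \<le> \<bar>\<eta> * x\<bar>\<^sup>2 + \<bar>y\<bar>\<^sup>2" by (rule sum_squares_bound)
  then have "2 * \<eta> * \<bar>x * y\<bar> \<le> 2 * \<eta> * (\<eta> / 2 * x\<^sup>2 + y\<^sup>2 / (2 * \<eta>))"
    using \<eta> by (simp add: abs_mult power_mult_distrib algebra_simps power2_eq_square)
  then show ?thesis using \<eta> by (simp only: mult_le_cancel_left_pos)
qed

text \<open>
  Let \<open>a\<close>, \<open>b\<close> be the windows of \<open>f'\<close>, \<open>g'\<close>
  and \<open>H n\<close> the square of the boundary value \<open>f + g\<close> at time
  \<open>2n\<close>. The reflection gives \<open>a (n + 1) \<le> \<rho>\<^sup>2 b n\<close>, the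
  energy balance gives \<open>b n \<le> a n\<close> up to the increment of \<open>H\<close>, and
  the relation at \<open>x = 0\<close>, which reads \<open>h' = 2 f' - \<alpha> h - d0\<close>, is
  stable and gives a contraction of \<open>H\<close> driven by \<open>a\<close>. Up to small
  errors and the decaying forcing, a suitable combination \<open>a n + (k + \<delta>) H n\<close>
  is therefore contracted.
\<close>

lemma far_end_damping_decay:
  assumes sys: "delay_system \<alpha> 0 \<rho> d0 d1 f f' g g'" and \<alpha>: "\<alpha> > 0" and \<rho>: "\<bar>\<rho>\<bar> < 1"
    and d: "continuous_on UNIV d0" "continuous_on UNIV d1"
    and dec: "exp_decays (\<lambda>t. (d0 t)\<^sup>2)" "exp_decays (\<lambda>t. (d1 (1 + t))\<^sup>2)"
  shows "geo_decays (window f')" "geo_decays (window g')" "exp_decays (\<lambda>t. (f t + g t)\<^sup>2)"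
proof -
  have pf: "prim f f'" and pg: "prim g g'"
    and b0: "AE t in lborel. 0 < t \<longrightarrow> f' t - g' t = \<alpha> * (f t + g t) + d0 t"
    using sys by (auto simp: delay_system_def)
  note ph = prim_add[OF pf pg]
  note Lf = prim_L2loc[OF pf] and Lg = prim_L2loc[OF pg] and Lh = prim_L2loc[OF ph]
  have Ld0: "L2loc d0" by (rule L2loc_continuous[OF d(1)])
  have Ld1: "L2loc d1" "L2loc (\<lambda>t. d1 (1 + t))" using L2loc_continuous[OF d(2)] L2loc_shift by auto
  define h where "h = (\<lambda>x. f x + g x)"
  define D where "D = (\<lambda>n. window d0 n + window (\<lambda>t. d1 (1 + t)) n)"
  have D: "geo_decays D" unfolding D_def
    by (intro geo_decays_add window_of_pointwise[OF Ld0 _ dec(1)] window_of_pointwise[OF Ld1(2) _ dec(2)]) auto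
  have D0: "window d0 n \<le> D n" "window (\<lambda>t. d1 (1 + t)) n \<le> D n" "0 \<le> D n" for n
    by (auto simp: D_def window_nonneg)
  define a where "a = window f'"
  define b where "b = window g'"
  define H where "H = (\<lambda>n. (h (2 * real n))\<^sup>2)"
  have nn: "0 \<le> a n" "0 \<le> b n" "0 \<le> H n" for n by (auto simp: a_def b_def H_def window_nonneg)
  obtain \<eta> where \<eta>: "0 < \<eta>" "\<eta> < 1" "\<rho>\<^sup>2 * (1 + \<eta>)\<^sup>2 < 1 - \<eta>" using contraction_margin[OF \<rho>] .
  note isq = L2loc_square_integrable
  have hw: "window (\<lambda>x. f' x + g' x) n \<le> 2 * a n + 2 * b n" for n
  proof -
    have "window (\<lambda>x. f' x + g' x) n \<le> (LINT x:{2 * real n..2 * real n + 2}|lborel. 2 * (f' x)\<^sup>2 + 2 * (g' x)\<^sup>2)"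
      unfolding window_def
    proof (rule set_integral_mono)
      show "(f' x + g' x)\<^sup>2 \<le> 2 * (f' x)\<^sup>2 + 2 * (g' x)\<^sup>2" for x
        using sum_squares_bound[of "f' x" "g' x"] by (simp add: power2_sum)
    qed (use isq[OF Lf] isq[OF Lg] isq[OF Lh] in auto)
    also have "\<dots> = 2 * a n + 2 * b n" using isq[OF Lf] isq[OF Lg] by (simp add: a_def b_def window_def)
    finally show ?thesis .
  qed
  \<comment> \<open>Reflection at the far end, the forcing being split off by Young's inequality.\<close>
  have s1: "a (Suc n) \<le> \<rho>\<^sup>2 * (1 + \<eta>) * b n + (1 + 1 / \<eta>) * D n" for n
  proof -
    have "a (Suc n) = window (\<lambda>t. \<rho> * g' t + d1 (1 + t)) n"
      unfolding a_def by (rule window_Suc_reflected[OF sys Ld1(1)])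
    also have "\<dots> \<le> (LINT x:{2 * real n..2 * real n + 2}|lborel. \<rho>\<^sup>2 * (1 + \<eta>) * (g' x)\<^sup>2 + (1 + 1 / \<eta>) * (d1 (1 + x))\<^sup>2)"
      unfolding window_def
    proof (rule set_integral_mono)
      show "set_integrable lborel {2 * real n..2 * real n + 2} (\<lambda>x. (\<rho> * g' x + d1 (1 + x))\<^sup>2)"
        by (intro isq L2loc_add L2loc_cmult Lg Ld1)
      show "(\<rho> * g' x + d1 (1 + x))\<^sup>2 \<le> \<rho>\<^sup>2 * (1 + \<eta>) * (g' x)\<^sup>2 + (1 + 1 / \<eta>) * (d1 (1 + x))\<^sup>2" for x
      proof -
        have "2 * \<bar>(\<rho> * g' x) * d1 (1 + x)\<bar> \<le> \<eta> * (\<rho> * g' x)\<^sup>2 + (d1 (1 + x))\<^sup>2 / \<eta>"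
          using young[OF \<eta>(1), of "\<rho> * g' x" "d1 (1 + x)"] by (simp add: field_simps)
        then have "(\<rho> * g' x + d1 (1 + x))\<^sup>2 \<le> (\<rho> * g' x)\<^sup>2 + (d1 (1 + x))\<^sup>2 + \<eta> * (\<rho> * g' x)\<^sup>2 + (d1 (1 + x))\<^sup>2 / \<eta>"
          unfolding power2_sum by linarith
        then show ?thesis by (simp add: algebra_simps power_mult_distrib)
      qed
    qed (use isq[OF Lg] isq[OF Ld1(2)] in auto)
    also have "\<dots> = \<rho>\<^sup>2 * (1 + \<eta>) * b n + (1 + 1 / \<eta>) * window (\<lambda>t. d1 (1 + t)) n"
      using isq[OF Lg] isq[OF Ld1(2)] by (simp add: b_def window_def)
    also have "\<dots> \<le> \<rho>\<^sup>2 * (1 + \<eta>) * b n + (1 + 1 / \<eta>) * D n"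
      using D0(2)[of n] \<eta> by (intro add_left_mono mult_left_mono) auto
    finally show ?thesis .
  qed
  \<comment> \<open>Energy balance at \<open>x = 0\<close>.\<close>
  have s2: "(1 - \<eta>) * b n + \<alpha> / 2 * H (Suc n) \<le> (1 + \<eta>) * a n + \<alpha> / 2 * H n + D n / (2 * \<eta>)" for n
  proof -
    have "b n = a n - \<alpha> / 2 * (H (Suc n) - H n) - (LINT x:{2 * real n..2 * real n + 2}|lborel. (f' x + g' x) * d0 x)"
      using boundary_energy_balance[OF sys d(1), of "2 * real n" "2 * real n + 2"]
      by (simp add: a_def b_def H_def h_def window_def add.commute)
    moreover have "- (LINT x:{2 * real n..2 * real n + 2}|lborel. (f' x + g' x) * d0 x)
        \<le> (LINT x:{2 * real n..2 * real n + 2}|lborel. \<eta> / 2 * (f' x + g' x)\<^sup>2 + (d0 x)\<^sup>2 / (2 * \<eta>))"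
    proof -
      have i: "set_integrable lborel {2 * real n..2 * real n + 2} (\<lambda>x. (f' x + g' x) * d0 x)"
        by (intro L2loc_integrable L2loc_continuous_mult Lh d)
      have "(LINT x:{2 * real n..2 * real n + 2}|lborel. - ((f' x + g' x) * d0 x))
        \<le> (LINT x:{2 * real n..2 * real n + 2}|lborel. \<eta> / 2 * (f' x + g' x)\<^sup>2 + (d0 x)\<^sup>2 / (2 * \<eta>))"
      proof (rule set_integral_mono)
        show "- ((f' x + g' x) * d0 x) \<le> \<eta> / 2 * (f' x + g' x)\<^sup>2 + (d0 x)\<^sup>2 / (2 * \<eta>)" for x
          using young[OF \<eta>(1), of "f' x + g' x" "d0 x"] by linarith
        show "set_integrable lborel {2 * real n..2 * real n + 2} (\<lambda>x. - ((f' x + g' x) * d0 x))"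
          using set_integrable_mult_right[of "-1", OF i] by simp
      qed (use isq[OF Lh] isq[OF Ld0] in auto)
      then show ?thesis by (subst (asm) set_integral_uminus[OF i])
    qed
    moreover have "(LINT x:{2 * real n..2 * real n + 2}|lborel. \<eta> / 2 * (f' x + g' x)\<^sup>2 + (d0 x)\<^sup>2 / (2 * \<eta>))
        = \<eta> / 2 * window (\<lambda>x. f' x + g' x) n + window d0 n / (2 * \<eta>)"
      using isq[OF Lh, of "2 * real n" "2 * real n + 2"] isq[OF Ld0, of "2 * real n" "2 * real n + 2"]
      by (subst set_integral_add) (auto simp: window_def)
    moreover have "\<eta> / 2 * window (\<lambda>x. f' x + g' x) n \<le> \<eta> * (a n + b n)"
      using mult_left_mono[OF hw[of n], of "\<eta> / 2"] \<eta> by (simp add: algebra_simps)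
    moreover have "window d0 n / (2 * \<eta>) \<le> D n / (2 * \<eta>)" using D0(1)[of n] \<eta> by (intro divide_right_mono) auto
    ultimately have "b n \<le> a n - \<alpha> / 2 * (H (Suc n) - H n) + \<eta> * (a n + b n) + D n / (2 * \<eta>)" by linarith
    then show ?thesis by (simp add: algebra_simps)
  qed
  \<comment> \<open>Stability of the boundary equation, with the weight \<open>w\<close>
    normalised to 1 at the end of the window.\<close>
  have s3: "H (Suc n) \<le> exp (- 2 * \<alpha>) * H n + 8 / \<alpha> * a n + 2 / \<alpha> * D n" for n
  proof -
    let ?A = "2 * real n" and ?B = "2 * real n + 2"
    have pE: "prim (\<lambda>x. exp (\<alpha> * (x - ?B))) (\<lambda>x. \<alpha> * exp (\<alpha> * (x - ?B)))"
      by (rule prim_C1) (auto intro!: derivative_eq_intros continuous_intros)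
    note p = prim_mult[OF prim_mult[OF ph ph] pE]
    define w where "w = (\<lambda>x. exp (\<alpha> * (x - ?B)))"
    have "(h ?B)\<^sup>2 * w ?B - (h ?A)\<^sup>2 * w ?A = (LINT x:{?A..?B}|lborel. h x * h x * (\<alpha> * w x) + (h x * (f' x + g' x) + (f' x + g' x) * h x) * w x)"
      using prim_eq[OF p, of ?A ?B] by (simp add: h_def w_def power2_eq_square)
    also have "\<dots> \<le> (LINT x:{?A..?B}|lborel. 8 / \<alpha> * (f' x)\<^sup>2 + 2 / \<alpha> * (d0 x)\<^sup>2)"
    proof (rule set_integral_mono_AE)
      show "set_integrable lborel {?A..?B} (\<lambda>x. h x * h x * (\<alpha> * w x) + (h x * (f' x + g' x) + (f' x + g' x) * h x) * w x)"
        using prim_integrable[OF p] by (simp add: h_def w_def)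
      show "AE x\<in>{?A..?B} in lborel. h x * h x * (\<alpha> * w x) + (h x * (f' x + g' x) + (f' x + g' x) * h x) * w x \<le> 8 / \<alpha> * (f' x)\<^sup>2 + 2 / \<alpha> * (d0 x)\<^sup>2"
        using b0 AE_lborel_singleton[of 0]
      proof eventually_elim
        case (elim x)
        show ?case
        proof
          assume x: "x \<in> {?A..?B}"
          have "0 \<le> x" by (rule order_trans[of _ "2 * real n"]) (use x in auto)
          then have e: "f' x - g' x = \<alpha> * h x + d0 x" using elim by (auto simp: h_def)
          then have e2: "f' x + g' x = 2 * f' x - \<alpha> * h x - d0 x" by simp
          have w: "0 \<le> w x" "w x \<le> 1" using x \<alpha> by (auto simp: w_def mult_le_0_iff)
          have y1: "\<bar>h x * f' x\<bar> \<le> \<alpha> / 8 * (h x)\<^sup>2 + 2 / \<alpha> * (f' x)\<^sup>2"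
            using young[of "\<alpha> / 4" "h x" "f' x"] \<alpha> by simp
          have y2: "\<bar>h x * d0 x\<bar> \<le> \<alpha> / 4 * (h x)\<^sup>2 + (d0 x)\<^sup>2 / \<alpha>"
            using young[of "\<alpha> / 2" "h x" "d0 x"] \<alpha> by simp
          have "h x * h x * \<alpha> + (h x * (f' x + g' x) + (f' x + g' x) * h x) = 4 * (h x * f' x) - \<alpha> * (h x)\<^sup>2 - 2 * (h x * d0 x)"
            unfolding e2 by (simp add: power2_eq_square algebra_simps)
          also have "\<dots> \<le> 8 / \<alpha> * (f' x)\<^sup>2 + 2 / \<alpha> * (d0 x)\<^sup>2"
            using y1 y2 \<alpha> by (simp add: abs_le_iff field_simps)
          finally have "(h x * h x * \<alpha> + (h x * (f' x + g' x) + (f' x + g' x) * h x)) * w x \<le> (8 / \<alpha> * (f' x)\<^sup>2 + 2 / \<alpha> * (d0 x)\<^sup>2) * w x"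
            using w by (intro mult_right_mono)
          also have "\<dots> \<le> 8 / \<alpha> * (f' x)\<^sup>2 + 2 / \<alpha> * (d0 x)\<^sup>2"
            using w \<alpha> by (intro mult_left_le) auto
          finally show "h x * h x * (\<alpha> * w x) + (h x * (f' x + g' x) + (f' x + g' x) * h x) * w x \<le> 8 / \<alpha> * (f' x)\<^sup>2 + 2 / \<alpha> * (d0 x)\<^sup>2"
            by (simp add: algebra_simps)
        qed
      qed
    qed (use isq[OF Lf] isq[OF Ld0] in auto)
    also have "\<dots> = 8 / \<alpha> * a n + 2 / \<alpha> * window d0 n"
      using isq[OF Lf, of ?A ?B] isq[OF Ld0, of ?A ?B] by (subst set_integral_add) (auto simp: a_def window_def)
    also have "\<dots> \<le> 8 / \<alpha> * a n + 2 / \<alpha> * D n"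
      using D0(1)[of n] \<alpha> by (intro add_left_mono mult_left_mono) auto
    finally show ?thesis by (simp add: H_def w_def mult.commute add.commute)
  qed
  \<comment> \<open>The weight \<open>k\<close> makes the terms \<open>H (n + 1)\<close> and
    \<open>H n\<close> of the energy balance fit the left and the right hand side; the small extra
    weight \<open>\<delta>\<close> brings in the contraction of \<open>H\<close> at the price of
    half the gap \<open>1 - r'\<close>.\<close>
  define r where "r = \<rho>\<^sup>2 * (1 + \<eta>) / (1 - \<eta>)"
  define r' where "r' = r * (1 + \<eta>)"
  have r: "0 \<le> r" "0 \<le> r'" "r' < 1" using \<eta> by (auto simp: r_def r'_def power2_eq_square field_simps)
  define \<delta> where "\<delta> = \<alpha> * (1 - r') / 16"
  have \<delta>: "0 < \<delta>" "8 / \<alpha> * \<delta> = (1 - r') / 2" using \<alpha> r by (auto simp: \<delta>_def)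
  define k where "k = r * \<alpha> / 2"
  have k: "0 \<le> k" using r \<alpha> by (simp add: k_def)
  define C1 where "C1 = r / (2 * \<eta>) + (1 + 1 / \<eta>) + 2 / \<alpha> * \<delta>"
  have C1: "0 \<le> C1" using r \<eta> \<alpha> \<delta> by (simp add: C1_def)
  define \<theta> where "\<theta> = max ((1 + r') / 2) ((k + \<delta> * exp (- 2 * \<alpha>)) / (k + \<delta>))"
  have \<theta>: "0 \<le> \<theta>" "\<theta> < 1" using r \<delta> k \<alpha> by (auto simp: \<theta>_def max_def)
  have W: "a (Suc n) + (k + \<delta>) * H (Suc n) \<le> \<theta> * (a n + (k + \<delta>) * H n) + C1 * D n" for n
  proof -
    have "r * ((1 - \<eta>) * b n + \<alpha> / 2 * H (Suc n)) \<le> r * ((1 + \<eta>) * a n + \<alpha> / 2 * H n + D n / (2 * \<eta>))"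
      by (rule mult_left_mono[OF s2 r(1)])
    moreover have "r * (1 - \<eta>) = \<rho>\<^sup>2 * (1 + \<eta>)" using \<eta> by (simp add: r_def)
    ultimately have "\<rho>\<^sup>2 * (1 + \<eta>) * b n + k * H (Suc n) \<le> r' * a n + k * H n + r / (2 * \<eta>) * D n"
      by (simp add: distrib_left mult.assoc[symmetric] r'_def k_def)
    moreover have "\<delta> * H (Suc n) \<le> \<delta> * (exp (- 2 * \<alpha>) * H n + 8 / \<alpha> * a n + 2 / \<alpha> * D n)"
      using s3[of n] \<delta>(1) by (intro mult_left_mono) auto
    moreover have "\<delta> * (exp (- 2 * \<alpha>) * H n + 8 / \<alpha> * a n + 2 / \<alpha> * D n)
      = \<delta> * (exp (- 2 * \<alpha>) * H n) + (8 / \<alpha> * \<delta>) * a n + 2 / \<alpha> * \<delta> * D n" by (simp add: algebra_simps)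
    moreover have "(k + \<delta>) * H (Suc n) = k * H (Suc n) + \<delta> * H (Suc n)" by (rule distrib_right)
    moreover have "C1 * D n = r / (2 * \<eta>) * D n + (1 + 1 / \<eta>) * D n + 2 / \<alpha> * \<delta> * D n"
      by (simp only: C1_def distrib_right)
    ultimately have "a (Suc n) + (k + \<delta>) * H (Suc n) \<le> (r' * a n + (1 - r') / 2 * a n) + (k * H n + \<delta> * (exp (- 2 * \<alpha>) * H n)) + C1 * D n"
      using s1[of n] unfolding \<delta>(2) by linarith
    also have "r' * a n + (1 - r') / 2 * a n = (1 + r') / 2 * a n" by (simp add: field_simps)
    also have "(1 + r') / 2 * a n \<le> \<theta> * a n" by (intro mult_right_mono nn) (simp add: \<theta>_def)
    also have "k * H n + \<delta> * (exp (- 2 * \<alpha>) * H n) = ((k + \<delta> * exp (- 2 * \<alpha>)) / (k + \<delta>)) * ((k + \<delta>) * H n)"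
    proof -
      have "k + \<delta> \<noteq> 0" using k \<delta> by simp
      then have "((k + \<delta> * exp (- 2 * \<alpha>)) / (k + \<delta>)) * ((k + \<delta>) * H n) = (k + \<delta> * exp (- 2 * \<alpha>)) * H n" by simp
      then show ?thesis by (simp add: distrib_right mult.assoc)
    qed
    also have "\<dots> \<le> \<theta> * ((k + \<delta>) * H n)" using k \<delta> nn by (intro mult_right_mono) (auto simp: \<theta>_def)
    finally show ?thesis by (simp add: distrib_left)
  qed
  have geoW: "geo_decays (\<lambda>n. a n + (k + \<delta>) * H n)"
    by (rule geo_decays_recursion[OF geo_decays_cmult[OF D C1] W \<theta>])
  have ga: "geo_decays a" by (rule geo_decays_mono[OF geoW]) (use k \<delta> nn in auto)
  have gH: "geo_decays H"
  proof (rule geo_decays_mono[OF geo_decays_cmult[OF geoW, of "1 / (k + \<delta>)"]])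
    show "H n \<le> 1 / (k + \<delta>) * (a n + (k + \<delta>) * H n)" for n using k \<delta> nn[of n] by (simp add: field_simps)
  qed (use k \<delta> in auto)
  have gb: "geo_decays b"
  proof (rule geo_decays_mono)
    show "geo_decays (\<lambda>n. 1 / (1 - \<eta>) * ((1 + \<eta>) * a n + \<alpha> / 2 * H n + 1 / (2 * \<eta>) * D n))"
      using \<eta> \<alpha> by (intro geo_decays_cmult geo_decays_add ga gH D) auto
    fix n
    have "(1 - \<eta>) * b n \<le> (1 + \<eta>) * a n + \<alpha> / 2 * H n + 1 / (2 * \<eta>) * D n"
    proof -
      have "0 \<le> \<alpha> / 2 * H (Suc n)" using nn(3)[of "Suc n"] \<alpha> by simp
      moreover have "1 / (2 * \<eta>) * D n = D n / (2 * \<eta>)" by simp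
      ultimately show ?thesis using s2[of n] by linarith
    qed
    then show "b n \<le> 1 / (1 - \<eta>) * ((1 + \<eta>) * a n + \<alpha> / 2 * H n + 1 / (2 * \<eta>) * D n)"
      using \<eta> by (simp add: pos_le_divide_eq mult.commute)
  qed
  show "geo_decays (window f')" "geo_decays (window g')" using ga gb by (simp_all add: a_def b_def)
  show "exp_decays (\<lambda>t. (f t + g t)\<^sup>2)"
  proof (rule exp_decays_of_geo)
    show "geo_decays (\<lambda>n. 2 * H n + 4 * (2 * (a n + b n)))"
      by (intro geo_decays_add geo_decays_cmult ga gb gH) auto
    fix n t assume t: "2 * real n \<le> t" "t \<le> 2 * real n + 2"
    have "(h t - h (2 * real n))\<^sup>2 = (LINT x:{2 * real n..t}|lborel. f' x + g' x)\<^sup>2"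
      using prim_eq[OF ph t(1)] by (simp add: h_def)
    also have "\<dots> \<le> (t - 2 * real n) * (LINT x:{2 * real n..t}|lborel. (f' x + g' x)\<^sup>2)"
      by (rule L2loc_cauchy_schwarz[OF Lh t(1)])
    also have "\<dots> \<le> 2 * window (\<lambda>x. f' x + g' x) n"
      unfolding window_def using t by (intro mult_mono set_integral_square_mono Lh set_integral_square_nonneg) auto
    also have "\<dots> \<le> 2 * (2 * (a n + b n))" using hw[of n] by simp
    finally have "2 * (h t - h (2 * real n))\<^sup>2 \<le> 4 * (2 * (a n + b n))" by simp
    moreover have "(h t)\<^sup>2 \<le> 2 * (h (2 * real n))\<^sup>2 + 2 * (h t - h (2 * real n))\<^sup>2"
      using sum_squares_bound[of "h (2 * real n)" "h t - h (2 * real n)"] by (simp add: power2_eq_square algebra_simps)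
    ultimately show "(f t + g t)\<^sup>2 \<le> 2 * H n + 4 * (2 * (a n + b n))" by (simp add: h_def H_def)
  qed
qed

section \<open>A decaying particular solution\<close>

lemma exp_decays_square:
  assumes "0 \<le> M" "0 < \<mu>" "\<And>t. t \<ge> 0 \<Longrightarrow> \<bar>u t\<bar> \<le> M * exp (- \<mu> * t)"
  shows "exp_decays (\<lambda>t. (u t)\<^sup>2)"
proof (rule exp_decaysI[of "M\<^sup>2" "2 * \<mu>"])
  fix t :: real assume "t \<ge> 0"
  from assms(3)[OF this] have "\<bar>u t\<bar>\<^sup>2 \<le> (M * exp (- \<mu> * t))\<^sup>2" by (rule power_mono) simp
  then show "(u t)\<^sup>2 \<le> M\<^sup>2 * exp (- (2 * \<mu>) * t)"
    by (simp add: power_mult_distrib power2_eq_square[of "exp _"] mult.assoc flip: exp_add)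
qed (use assms in auto)

lemma exp_decays_sqrt:
  assumes "exp_decays E"
  obtains M \<mu> where "0 \<le> M" "0 < \<mu>" "\<And>t x. t \<ge> 0 \<Longrightarrow> x\<^sup>2 \<le> E t \<Longrightarrow> \<bar>x\<bar> \<le> M * exp (- \<mu> * t)"
proof -
  obtain M \<mu> where M: "0 \<le> M" "0 < \<mu>" "\<And>t. t \<ge> 0 \<Longrightarrow> E t \<le> M * exp (- \<mu> * t)" using assms by (auto simp: exp_decays_def)
  have "\<bar>x\<bar> \<le> sqrt M * exp (- (\<mu> / 2) * t)" if "t \<ge> 0" "x\<^sup>2 \<le> E t" for t x
  proof (rule power2_le_imp_le)
    have "(sqrt M * exp (- (\<mu> / 2) * t))\<^sup>2 = M * exp (- \<mu> * t)"
      using M(1) by (simp add: power_mult_distrib power2_eq_square[of "exp _"] flip: exp_add)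
    then show "\<bar>x\<bar>\<^sup>2 \<le> (sqrt M * exp (- (\<mu> / 2) * t))\<^sup>2" using M(3)[OF that(1)] that(2) by simp
  qed (use M in auto)
  then show ?thesis using M by (intro that[of "sqrt M" "\<mu> / 2"]) auto
qed

lemma continuous_antiderivative:
  fixes u :: "real \<Rightarrow> real"
  assumes "continuous_on UNIV u"
  obtains G where "\<And>t. (G has_real_derivative u t) (at t)" "G 0 = 0"
proof -
  have "\<exists>G. \<forall>z. - \<infinity> < ereal z \<longrightarrow> ereal z < \<infinity> \<longrightarrow> (G has_vector_derivative u z) (at z)"
    by (rule einterval_antiderivative) (use assms in \<open>auto simp: continuous_on_eq_continuous_at\<close>)
  then obtain G where G: "\<And>z. (G has_real_derivative u z) (at z)"
    by (auto simp: has_real_derivative_iff_has_vector_derivative)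
  show ?thesis
  proof (rule that)
    show "((\<lambda>t. G t - G 0) has_real_derivative u t) (at t)" for t
      using DERIV_diff[OF G DERIV_const[of "G 0"]] by simp
  qed simp
qed

lemma antiderivative_bound:
  fixes G u B b :: "real \<Rightarrow> real"
  assumes G: "\<And>t. (G has_real_derivative u t) (at t)" and B: "\<And>t. (B has_real_derivative b t) (at t)"
    and le: "\<And>t. t \<ge> 0 \<Longrightarrow> \<bar>u t\<bar> \<le> b t" and st: "0 \<le> s" "s \<le> t"
  shows "\<bar>G t - G s\<bar> \<le> B t - B s"
proof -
  have u: "u x \<le> b x" "- u x \<le> b x" if "s \<le> x" for x using le[of x] st(1) that by (linarith, linarith)
  have "B s - G s \<le> B t - G t"
  proof (rule DERIV_nonneg_imp_nondecreasing[OF st(2), of "\<lambda>t. B t - G t"])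
    show "\<exists>y. ((\<lambda>t. B t - G t) has_real_derivative y) (at x) \<and> 0 \<le> y" if "s \<le> x" for x
      using DERIV_diff[OF B[of x] G[of x]] u(1)[OF that] by (intro exI[of _ "b x - u x"]) simp
  qed
  moreover have "B s + G s \<le> B t + G t"
  proof (rule DERIV_nonneg_imp_nondecreasing[OF st(2), of "\<lambda>t. B t + G t"])
    show "\<exists>y. ((\<lambda>t. B t + G t) has_real_derivative y) (at x) \<and> 0 \<le> y" if "s \<le> x" for x
      using DERIV_add[OF B[of x] G[of x]] u(2)[OF that] by (intro exI[of _ "b x + u x"]) simp
  qed
  ultimately show ?thesis by (simp add: abs_le_iff)
qed

text \<open>
  The operator factors as \<open>r'' - q\<^sup>2 r = (D + q) (D - q) r\<close>. The equation
  \<open>k' + q k = g\<close> is stable and can be solved from 0, whereas \<open>r' - q r =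
  k\<close> is unstable: its only decaying solution is found by integrating from infinity, where
  \<open>L\<close> below is the limit of the integral \<open>K\<close>.
\<close>

lemma decaying_particular_solution:
  fixes g :: "real \<Rightarrow> real"
  assumes q: "q > 0" and g: "continuous_on UNIV g" and dec: "exp_decays (\<lambda>t. (g t)\<^sup>2)"
  obtains r r1 where "\<And>t. (r has_real_derivative r1 t) (at t)"
    "\<And>t. (r1 has_real_derivative q\<^sup>2 * r t + g t) (at t)"
    "exp_decays (\<lambda>t. (r t)\<^sup>2)" "exp_decays (\<lambda>t. (r1 t)\<^sup>2)"
proof -
  obtain M \<mu> where M: "0 \<le> M" "0 < \<mu>" "\<And>t x. t \<ge> 0 \<Longrightarrow> x\<^sup>2 \<le> (g t)\<^sup>2 \<Longrightarrow> \<bar>x\<bar> \<le> M * exp (- \<mu> * t)"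
    using exp_decays_sqrt[OF dec] by metis
  \<comment> \<open>A rate smaller than \<open>q\<close> avoids the resonant case, in which the
    bound on \<open>k\<close> would need a factor \<open>t\<close>.\<close>
  define \<nu> where "\<nu> = min \<mu> (q / 2)"
  have \<nu>: "0 < \<nu>" "\<nu> \<le> \<mu>" "\<nu> < q" using M q by (auto simp: \<nu>_def)
  have gb: "\<bar>g t\<bar> \<le> M * exp (- \<nu> * t)" if "t \<ge> 0" for t
  proof -
    have "\<bar>g t\<bar> \<le> M * exp (- \<mu> * t)" using M(3)[OF that, of "g t"] by simp
    also have "\<dots> \<le> M * exp (- \<nu> * t)" using M \<nu> that by (intro mult_left_mono) (auto intro: mult_right_mono)
    finally show ?thesis .
  qed
  have "continuous_on UNIV (\<lambda>t. exp (q * t) * g t)" by (intro continuous_intros g)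
  from continuous_antiderivative[OF this] obtain G
    where G: "\<And>t. (G has_real_derivative exp (q * t) * g t) (at t)" "G 0 = 0" by blast
  define k where "k = (\<lambda>t. exp (- q * t) * G t)"
  have ee: "exp (- q * t) * exp (q * t) = 1" "exp (q * t) * exp (- q * t) = 1" for t by (simp_all flip: exp_add)
  have dk: "(k has_real_derivative - q * k t + g t) (at t)" for t
  proof -
    have D: "(k has_real_derivative exp (- q * t) * (exp (q * t) * g t) + (- q * exp (- q * t)) * G t) (at t)"
      unfolding k_def by (auto intro!: derivative_eq_intros G)
    have e: "exp (- q * t) * (exp (q * t) * g t) = g t" using ee(1)[of t] by (simp only: mult.assoc[symmetric] mult_1)
    have "- q * k t + g t = g t + (- q * exp (- q * t)) * G t" by (simp add: k_def)
    then show ?thesis using D unfolding e by (simp only:)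
  qed
  define C where "C = M / (q - \<nu>)"
  have C: "C \<ge> 0" using M \<nu> by (simp add: C_def)
  have kb: "\<bar>k t\<bar> \<le> C * exp (- \<nu> * t)" if t: "t \<ge> 0" for t
  proof -
    have "\<bar>G t - G 0\<bar> \<le> C * exp ((q - \<nu>) * t) - C * exp ((q - \<nu>) * 0)"
    proof (rule antiderivative_bound[OF G(1) _ _ order_refl t])
      show "((\<lambda>t. C * exp ((q - \<nu>) * t)) has_real_derivative M * exp ((q - \<nu>) * t)) (at t)" for t
        using \<nu> by (auto intro!: derivative_eq_intros simp: C_def)
      fix t :: real assume "t \<ge> 0"
      then have "exp (q * t) * \<bar>g t\<bar> \<le> exp (q * t) * (M * exp (- \<nu> * t))" by (intro mult_left_mono gb) auto
      also have "\<dots> = M * exp ((q - \<nu>) * t)" by (simp add: algebra_simps flip: exp_add)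
      finally show "\<bar>exp (q * t) * g t\<bar> \<le> M * exp ((q - \<nu>) * t)" by (simp add: abs_mult)
    qed
    then have "\<bar>G t\<bar> \<le> C * exp ((q - \<nu>) * t)" using G(2) C by simp
    then have "exp (- q * t) * \<bar>G t\<bar> \<le> exp (- q * t) * (C * exp ((q - \<nu>) * t))" by (intro mult_left_mono) auto
    also have "\<dots> = C * exp (- \<nu> * t)" by (simp add: algebra_simps flip: exp_add)
    finally show ?thesis by (simp add: k_def abs_mult)
  qed
  have ck: "continuous_on UNIV k" by (intro continuous_at_imp_continuous_on ballI DERIV_isCont[OF dk])
  have "continuous_on UNIV (\<lambda>t. exp (- q * t) * k t)" by (intro continuous_intros ck)
  from continuous_antiderivative[OF this] obtain K
    where K: "\<And>t. (K has_real_derivative exp (- q * t) * k t) (at t)" "K 0 = 0" by blast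
  define B where "B = (\<lambda>t. C / (q + \<nu>) * exp (- (q + \<nu>) * t))"
  have B0: "B t \<ge> 0" for t using C \<nu> q by (simp add: B_def)
  have KB: "\<bar>K t - K s\<bar> \<le> B s - B t" if "0 \<le> s" "s \<le> t" for s t
  proof -
    have "\<bar>K t - K s\<bar> \<le> (- B t) - (- B s)"
    proof (rule antiderivative_bound[OF K(1) _ _ that])
      show "((\<lambda>t. - B t) has_real_derivative C * exp (- (q + \<nu>) * t)) (at t)" for t
      proof -
        have "q + \<nu> \<noteq> 0" using \<nu>(1) q by linarith
        moreover have "- (C / d * (E * (- d))) = C * E" if "d \<noteq> 0" for d E :: real using that by simp
        ultimately have e: "- (C / (q + \<nu>) * (exp (- (q + \<nu>) * t) * (- (q + \<nu>)))) = C * exp (- (q + \<nu>) * t)" by blast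
        have "((\<lambda>t. - B t) has_real_derivative - (C / (q + \<nu>) * (exp (- (q + \<nu>) * t) * (- (q + \<nu>))))) (at t)"
        proof -
          have "((\<lambda>t. exp (- (q + \<nu>) * t)) has_real_derivative exp (- (q + \<nu>) * t) * (- (q + \<nu>))) (at t)"
            by (auto intro!: derivative_eq_intros)
          from DERIV_minus[OF DERIV_cmult[OF this, of "C / (q + \<nu>)"]] show ?thesis unfolding B_def .
        qed
        then show ?thesis unfolding e .
      qed
      fix t :: real assume "t \<ge> 0"
      from mult_left_mono[OF kb[OF this], of "exp (- q * t)"]
      show "\<bar>exp (- q * t) * k t\<bar> \<le> C * exp (- (q + \<nu>) * t)"
        by (simp add: abs_mult algebra_simps exp_add[symmetric])
    qed
    then show ?thesis by simp
  qed
  \<comment> \<open>The intervals \<open>[K t - B t, K t + B t]\<close> pairwise intersect and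
    shrink to the limit of \<open>K\<close>, so \<open>L\<close> lies in each of them.\<close>
  define L where "L = (SUP t\<in>{0..}. K t - B t)"
  have le: "K s - B s \<le> K t + B t" if "0 \<le> s" "0 \<le> t" for s t
    using KB[of s t] KB[of t s] that B0[of s] B0[of t] by (cases "s \<le> t") auto
  have L1: "L \<le> K t + B t" if "t \<ge> 0" for t
    unfolding L_def using le that by (intro cSUP_least) auto
  have L2: "K t - B t \<le> L" if "t \<ge> 0" for t
    unfolding L_def using le[of _ 0] that by (intro cSUP_upper) (auto intro!: bdd_aboveI[of _ "K 0 + B 0"])
  define r where "r = (\<lambda>t. exp (q * t) * (K t - L))"
  define r1 where "r1 = (\<lambda>t. q * r t + k t)"
  have dr: "(r has_real_derivative r1 t) (at t)" for t
  proof -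
    have D: "(r has_real_derivative exp (q * t) * (exp (- q * t) * k t) + (q * exp (q * t)) * (K t - L)) (at t)"
      unfolding r_def by (auto intro!: derivative_eq_intros K)
    have e: "exp (q * t) * (exp (- q * t) * k t) = k t" using ee(2)[of t] by (simp only: mult.assoc[symmetric] mult_1)
    have "r1 t = k t + (q * exp (q * t)) * (K t - L)" by (simp add: r1_def r_def)
    then show ?thesis using D unfolding e by (simp only:)
  qed
  have dr1: "(r1 has_real_derivative q\<^sup>2 * r t + g t) (at t)" for t
  proof -
    have "(r1 has_real_derivative q * r1 t + (- q * k t + g t)) (at t)"
      unfolding r1_def[abs_def] by (intro DERIV_add DERIV_cmult dr[unfolded r1_def] dk)
    then show ?thesis by (simp add: r1_def power2_eq_square algebra_simps)
  qed
  have rb: "\<bar>r t\<bar> \<le> C / (q + \<nu>) * exp (- \<nu> * t)" if "t \<ge> 0" for t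
  proof -
    have "\<bar>K t - L\<bar> \<le> B t" using L1[OF that] L2[OF that] by (simp add: abs_le_iff)
    then have "exp (q * t) * \<bar>K t - L\<bar> \<le> exp (q * t) * B t" by (intro mult_left_mono) auto
    also have "\<dots> = C / (q + \<nu>) * exp (- \<nu> * t)" by (simp add: B_def algebra_simps flip: exp_add)
    finally show ?thesis by (simp add: r_def abs_mult)
  qed
  have r1b: "\<bar>r1 t\<bar> \<le> (q * (C / (q + \<nu>)) + C) * exp (- \<nu> * t)" if "t \<ge> 0" for t
  proof -
    have "\<bar>r1 t\<bar> \<le> q * \<bar>r t\<bar> + \<bar>k t\<bar>" using q abs_triangle_ineq[of "q * r t" "k t"] by (simp add: r1_def abs_mult)
    also have "\<dots> \<le> q * (C / (q + \<nu>) * exp (- \<nu> * t)) + C * exp (- \<nu> * t)"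
      using rb[OF that] kb[OF that] q by (intro add_mono mult_left_mono) auto
    finally show ?thesis by (simp add: distrib_right mult.assoc)
  qed
  show ?thesis
    by (rule that[OF dr dr1 exp_decays_square[OF _ \<nu>(1) rb] exp_decays_square[OF _ \<nu>(1) r1b]])
       (use C q \<nu> in auto)
qed

section \<open>The cascade behind the first three equations\<close>

lemma AE_all_nat:
  assumes "\<And>n::nat. AE t in lborel. 0 < t \<longrightarrow> t < real n \<longrightarrow> P t"
  shows "AE t in lborel. 0 < t \<longrightarrow> P (t :: real)"
proof -
  have "AE t in lborel. \<forall>n::nat. 0 < t \<longrightarrow> t < real n \<longrightarrow> P t" by (rule AE_all_countable[THEN iffD2]) (use assms in blast)
  then show ?thesis by eventually_elim (meson reals_Archimedean2)
qed

lemma prim_AE_unique_positive: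
  assumes "prim f f'" "prim g g'" "\<And>t. t > 0 \<Longrightarrow> f t = g t"
  shows "AE t in lborel. 0 < t \<longrightarrow> f' t = g' t"
proof (rule AE_all_nat)
  fix n :: nat
  show "AE t in lborel. 0 < t \<longrightarrow> t < real n \<longrightarrow> f' t = g' t"
  proof (cases "n = 0")
    case False
    then have "AE t in lborel. t \<in> {0<..<real n} \<longrightarrow> f' t = g' t"
      by (intro prim_AE_unique[OF assms(1,2)] assms(3)) auto
    then show ?thesis by eventually_elim auto
  qed auto
qed

lemma continuous_AE_zero:
  assumes c: "continuous_on UNIV (u :: real \<Rightarrow> real)" and ae: "AE t in lborel. 0 < t \<longrightarrow> u t = 0" and t: "t \<ge> 0"
  shows "u t = 0"
proof (rule ccontr)
  assume "u t \<noteq> 0"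
  have o: "open {s. u s \<noteq> 0}" by (rule open_Collect_neq[OF c continuous_on_const])
  have "t \<in> {s. u s \<noteq> 0}" using \<open>u t \<noteq> 0\<close> by simp
  from openE[OF o this] obtain \<delta> where \<delta>: "\<delta> > 0" "ball t \<delta> \<subseteq> {s. u s \<noteq> 0}" by blast
  have "AE s in lborel. s \<notin> {t<..<t + \<delta>}"
    using ae
  proof eventually_elim
    case (elim s)
    show ?case
    proof
      assume s: "s \<in> {t<..<t + \<delta>}"
      then have "s \<in> ball t \<delta>" by (auto simp: dist_real_def)
      then show False using \<delta>(2) elim s t by auto
    qed
  qed
  then have "emeasure lborel {t<..<t + \<delta>} = 0" by (subst (asm) AE_iff_measurable[of "{t<..<t + \<delta>}"]) auto
  then show False using \<delta>(1) by simp
qed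

text \<open>
  The conditions of the system on the profiles, for \<open>\<epsilon> = fe (t + x) + ge (t -
  x)\<close>, \<open>\<beta> = fb (t + x) + gb (t - x)\<close> and \<open>Y = y (t - x)\<close>.
\<close>

definition boundary_conditions ::
  "real \<Rightarrow> real \<Rightarrow> (real \<Rightarrow> real) \<Rightarrow> (real \<Rightarrow> real) \<Rightarrow> (real \<Rightarrow> real) \<Rightarrow> (real \<Rightarrow> real) \<Rightarrow>
   (real \<Rightarrow> real) \<Rightarrow> (real \<Rightarrow> real) \<Rightarrow> (real \<Rightarrow> real) \<Rightarrow> (real \<Rightarrow> real) \<Rightarrow> (real \<Rightarrow> real) \<Rightarrow> (real \<Rightarrow> real) \<Rightarrow> bool" where
  "boundary_conditions c0 c1 fe fe' ge ge' fb fb' gb gb' y y' \<longleftrightarrow>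
     prim fe fe' \<and> prim ge ge' \<and> prim fb fb' \<and> prim gb gb' \<and> prim y y' \<and>
     (AE t in lborel. 0 < t \<longrightarrow> fe' t - ge' t = c1 * (fe t + ge t)) \<and>
     (AE t in lborel. 0 < t \<longrightarrow> fe' (t + 1) - ge' (t - 1) = fb' (t + 1) - gb' (t - 1) + y' (t - 1)) \<and>
     (AE t in lborel. 0 < t \<longrightarrow> fb' t - gb' t = c1 / (1 - c0) * (fb t + gb t) + c0 / (1 - c0) * (fb' t + gb' t)) \<and>
     (\<forall>t\<ge>0. fb (t + 1) + gb (t - 1) = 0) \<and> (\<forall>t\<ge>0. y t = - c0 * (fe t + ge t))"

text \<open>
  The second delay system is the one of \<open>z = \<epsilon> + Y - \<beta>\<close>.
\<close>

definition cascade ::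
  "real \<Rightarrow> real \<Rightarrow> (real \<Rightarrow> real) \<Rightarrow> (real \<Rightarrow> real) \<Rightarrow> (real \<Rightarrow> real) \<Rightarrow> (real \<Rightarrow> real) \<Rightarrow>
   (real \<Rightarrow> real) \<Rightarrow> (real \<Rightarrow> real) \<Rightarrow> (real \<Rightarrow> real) \<Rightarrow> (real \<Rightarrow> real) \<Rightarrow> (real \<Rightarrow> real) \<Rightarrow> (real \<Rightarrow> real) \<Rightarrow> bool" where
  "cascade c0 c1 fe fe' ge ge' fb fb' gb gb' y y' \<longleftrightarrow>
     prim fe fe' \<and> prim ge ge' \<and> prim y y' \<and>
     delay_system (c1 / (1 - c0)) (c0 / (1 - c0)) (-1) (\<lambda>_. 0) (\<lambda>_. 0) fb fb' gb gb' \<and>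
     delay_system (c1 / (1 - c0)) (c0 / (1 - c0)) 1 (\<lambda>_. 0) (\<lambda>_. 0)
       (\<lambda>t. fe t - fb t) (\<lambda>t. fe' t - fb' t) (\<lambda>t. ge t + y t - gb t) (\<lambda>t. ge' t + y' t - gb' t) \<and>
     (\<forall>t\<ge>0. fb (t + 1) + gb (t - 1) = 0) \<and> (\<forall>t\<ge>0. y t = - c0 * (fe t + ge t))"

text \<open>
  At \<open>x = 0\<close> one has \<open>\<epsilon> + Y = (1 - c\<^sub>0) \<epsilon>\<close>, so
  \<open>(\<epsilon> + Y)\<^sub>x = c\<^sub>1 \<epsilon> - Y\<^sub>t = c\<^sub>1 \<epsilon> +
  c\<^sub>0 \<epsilon>\<^sub>t\<close> is \<open>\<alpha> (\<epsilon> + Y) + \<kappa> (\<epsilon>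
  + Y)\<^sub>t\<close> with the coefficients \<open>\<alpha>\<close>, \<open>\<kappa>\<close> of
  the condition for \<open>\<beta>\<close>. At \<open>x = 1\<close> the condition
  \<open>\<epsilon>\<^sub>x = \<beta>\<^sub>x - Y\<^sub>x\<close> says \<open>z\<^sub>x =
  0\<close>.
\<close>

lemma boundary_conditions_iff_cascade:
  assumes c0: "0 < c0" "c0 < 1"
  shows "boundary_conditions c0 c1 fe fe' ge ge' fb fb' gb gb' y y' \<longleftrightarrow> cascade c0 c1 fe fe' ge ge' fb fb' gb gb' y y'"
    (is "?B \<longleftrightarrow> ?C")
proof -
  define \<alpha> where "\<alpha> = c1 / (1 - c0)"
  define \<kappa> where "\<kappa> = c0 / (1 - c0)"
  have ak: "\<alpha> * (1 - c0) = c1" "\<kappa> * (1 - c0) = c0" using c0 by (simp_all add: \<alpha>_def \<kappa>_def)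
  have y': "AE t in lborel. 0 < t \<longrightarrow> y' t = - c0 * (fe' t + ge' t)"
    if "prim fe fe'" "prim ge ge'" "prim y y'" "\<forall>t\<ge>0. y t = - c0 * (fe t + ge t)"
    using prim_AE_unique_positive[OF that(3) prim_cmult[OF prim_add[OF that(1,2)], of "- c0"]] that(4) by simp
  show ?thesis
  proof
    assume B: ?B
    then have p: "prim fe fe'" "prim ge ge'" "prim fb fb'" "prim gb gb'" "prim y y'"
      and b: "AE t in lborel. 0 < t \<longrightarrow> fe' t - ge' t = c1 * (fe t + ge t)"
        "AE t in lborel. 0 < t \<longrightarrow> fe' (t + 1) - ge' (t - 1) = fb' (t + 1) - gb' (t - 1) + y' (t - 1)"
        "AE t in lborel. 0 < t \<longrightarrow> fb' t - gb' t = \<alpha> * (fb t + gb t) + \<kappa> * (fb' t + gb' t)"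
      and cl: "\<forall>t\<ge>0. fb (t + 1) + gb (t - 1) = 0" and y: "\<forall>t\<ge>0. y t = - c0 * (fe t + ge t)"
      by (auto simp: boundary_conditions_def \<alpha>_def \<kappa>_def)
    have "AE t in lborel. 0 < t \<longrightarrow> fb' (1 + t) + gb' (-1 + t) = 0"
      using prim_AE_unique_positive[OF prim_add[OF prim_shift[OF p(3), of 1] prim_shift[OF p(4), of "-1"]] prim_const[of 0]] cl
      by (simp add: add.commute)
    then have rb: "AE t in lborel. 0 < t \<longrightarrow> fb' (t + 1) = -1 * gb' (t - 1) + 0"
      by eventually_elim (auto simp: add.commute eq_neg_iff_add_eq_0)
    have z0: "AE t in lborel. 0 < t \<longrightarrow> (fe' t - fb' t) - (ge' t + y' t - gb' t) =
        \<alpha> * ((fe t - fb t) + (ge t + y t - gb t)) + \<kappa> * ((fe' t - fb' t) + (ge' t + y' t - gb' t)) + 0"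
      using b(1,3) y'[OF p(1,2,5) y]
    proof eventually_elim
      case (elim t)
      show ?case
      proof
        assume t: "0 < t"
        have yt: "y t = - c0 * (fe t + ge t)" using y t by simp
        have y't: "y' t = - c0 * (fe' t + ge' t)" using elim t by simp
        have "\<alpha> * (fe t + ge t + y t) = (\<alpha> * (1 - c0)) * (fe t + ge t)" unfolding yt by (simp add: algebra_simps)
        moreover have "\<kappa> * (fe' t + ge' t + y' t) = (\<kappa> * (1 - c0)) * (fe' t + ge' t)" unfolding y't by (simp add: algebra_simps)
        moreover have "y' t = - (c0 * (fe' t + ge' t))" using y't by simp
        moreover have "fe' t - ge' t = c1 * (fe t + ge t)" using elim(1) t by simp
        ultimately have "fe' t - ge' t - y' t = \<alpha> * (fe t + ge t + y t) + \<kappa> * (fe' t + ge' t + y' t)"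
          unfolding ak by linarith
        then show "(fe' t - fb' t) - (ge' t + y' t - gb' t) =
          \<alpha> * ((fe t - fb t) + (ge t + y t - gb t)) + \<kappa> * ((fe' t - fb' t) + (ge' t + y' t - gb' t)) + 0"
          using elim(2) t by (simp add: algebra_simps)
      qed
    qed
    have z1: "AE t in lborel. 0 < t \<longrightarrow> fe' (t + 1) - fb' (t + 1) = 1 * (ge' (t - 1) + y' (t - 1) - gb' (t - 1)) + 0"
      using b(2) by eventually_elim (simp add: algebra_simps)
    have b0: "AE t in lborel. 0 < t \<longrightarrow> fb' t - gb' t = \<alpha> * (fb t + gb t) + \<kappa> * (fb' t + gb' t) + 0"
      using b(3) by simp
    have pz: "prim (\<lambda>t. fe t - fb t) (\<lambda>t. fe' t - fb' t)" "prim (\<lambda>t. ge t + y t - gb t) (\<lambda>t. ge' t + y' t - gb' t)"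
      by (intro prim_add prim_diff p)+
    show ?C
      unfolding cascade_def delay_system_def \<alpha>_def[symmetric] \<kappa>_def[symmetric]
      by (intro conjI p pz b0 rb z0 z1 cl y)
  next
    assume C: ?C
    then have p: "prim fe fe'" "prim ge ge'" "prim fb fb'" "prim gb gb'" "prim y y'"
      and b3: "AE t in lborel. 0 < t \<longrightarrow> fb' t - gb' t = \<alpha> * (fb t + gb t) + \<kappa> * (fb' t + gb' t)"
      and z: "AE t in lborel. 0 < t \<longrightarrow> (fe' t - fb' t) - (ge' t + y' t - gb' t) =
        \<alpha> * ((fe t - fb t) + (ge t + y t - gb t)) + \<kappa> * ((fe' t - fb' t) + (ge' t + y' t - gb' t))"
      and z1: "AE t in lborel. 0 < t \<longrightarrow> fe' (t + 1) - fb' (t + 1) = ge' (t - 1) + y' (t - 1) - gb' (t - 1)"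
      and cl: "\<forall>t\<ge>0. fb (t + 1) + gb (t - 1) = 0" and y: "\<forall>t\<ge>0. y t = - c0 * (fe t + ge t)"
      using C[unfolded cascade_def delay_system_def add_0_right mult_1 \<alpha>_def[symmetric] \<kappa>_def[symmetric]] by blast+
    have e0: "AE t in lborel. 0 < t \<longrightarrow> fe' t - ge' t = c1 * (fe t + ge t)"
      using b3 z y'[OF p(1,2,5) y]
    proof eventually_elim
      case (elim t)
      show ?case
      proof
        assume t: "0 < t"
        have yt: "y t = - c0 * (fe t + ge t)" using y t by simp
        have y't: "y' t = - c0 * (fe' t + ge' t)" using elim t by simp
        have 1: "\<alpha> * (fe t + ge t + y t) = (\<alpha> * (1 - c0)) * (fe t + ge t)" unfolding yt by (simp add: algebra_simps)
        have 2: "\<kappa> * (fe' t + ge' t + y' t) = (\<kappa> * (1 - c0)) * (fe' t + ge' t)" unfolding y't by (simp add: algebra_simps)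
        have "fe' t - ge' t - y' t = \<alpha> * (fe t + ge t + y t) + \<kappa> * (fe' t + ge' t + y' t)"
          using elim(1,2) t by (simp add: algebra_simps)
        then show "fe' t - ge' t = c1 * (fe t + ge t)" unfolding 1 2 ak using y't by (simp add: algebra_simps)
      qed
    qed
    have e1: "AE t in lborel. 0 < t \<longrightarrow> fe' (t + 1) - ge' (t - 1) = fb' (t + 1) - gb' (t - 1) + y' (t - 1)"
      using z1 by eventually_elim (simp add: algebra_simps)
    show ?B
      unfolding boundary_conditions_def \<alpha>_def[symmetric] \<kappa>_def[symmetric]
      by (intro conjI p e0 e1 b3 cl y)
  qed
qed

text \<open>
  The two delay systems determine \<open>\<beta>\<close> and \<open>z\<close>, and
  \<open>\<epsilon> + Y = (1 - c\<^sub>0) \<epsilon>\<close> at \<open>x = 0\<close> separates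
  \<open>\<epsilon>\<close> from \<open>Y\<close>.
\<close>

lemma cascade_unique:
  assumes c0: "0 < c0" "c0 < 1"
    and 1: "cascade c0 c1 fe fe' ge ge' fb fb' gb gb' y y'" and 2: "cascade c0 c1 Fe Fe' Ge Ge' Fb Fb' Gb Gb' Y Y'"
    and init: "\<And>t. t \<in> {0..1} \<Longrightarrow> fe t = Fe t" "\<And>t. t \<in> {-1..0} \<Longrightarrow> ge t = Ge t"
      "\<And>t. t \<in> {0..1} \<Longrightarrow> fb t = Fb t" "\<And>t. t \<in> {-1..0} \<Longrightarrow> gb t = Gb t" "\<And>t. t \<in> {-1..0} \<Longrightarrow> y t = Y t"
  shows "t \<ge> 0 \<Longrightarrow> fe t = Fe t" "t \<ge> -1 \<Longrightarrow> ge t = Ge t" "t \<ge> 0 \<Longrightarrow> fb t = Fb t" "t \<ge> -1 \<Longrightarrow> gb t = Gb t" "t \<ge> -1 \<Longrightarrow> y t = Y t"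
proof -
  have \<kappa>: "c0 / (1 - c0) \<ge> 0" using c0 by simp
  have b: "delay_system (c1 / (1 - c0)) (c0 / (1 - c0)) (-1) (\<lambda>_. 0) (\<lambda>_. 0) (\<lambda>t. fb t - Fb t) (\<lambda>t. fb' t - Fb' t) (\<lambda>t. gb t - Gb t) (\<lambda>t. gb' t - Gb' t)"
    using delay_system_diff[of "c1 / (1 - c0)" "c0 / (1 - c0)" "-1" "\<lambda>_. 0" "\<lambda>_. 0" fb fb' gb gb' "\<lambda>_. 0" "\<lambda>_. 0" Fb Fb' Gb Gb'] 1 2
    by (simp add: cascade_def)
  have fb: "fb t = Fb t" if "t \<ge> 0" for t
    using delay_system_zero(1)[OF b \<kappa> _ _ that] init(3,4) by auto
  have gb: "gb t = Gb t" if "t \<ge> -1" for t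
    using delay_system_zero(2)[OF b \<kappa> _ _ that] init(3,4) by auto
  have z: "delay_system (c1 / (1 - c0)) (c0 / (1 - c0)) 1 (\<lambda>_. 0) (\<lambda>_. 0)
    (\<lambda>t. (fe t - fb t) - (Fe t - Fb t)) (\<lambda>t. (fe' t - fb' t) - (Fe' t - Fb' t))
    (\<lambda>t. (ge t + y t - gb t) - (Ge t + Y t - Gb t)) (\<lambda>t. (ge' t + y' t - gb' t) - (Ge' t + Y' t - Gb' t))"
    using delay_system_diff[of "c1 / (1 - c0)" "c0 / (1 - c0)" 1 "\<lambda>_. 0" "\<lambda>_. 0" "\<lambda>t. fe t - fb t" "\<lambda>t. fe' t - fb' t" "\<lambda>t. ge t + y t - gb t" "\<lambda>t. ge' t + y' t - gb' t"
      "\<lambda>_. 0" "\<lambda>_. 0" "\<lambda>t. Fe t - Fb t" "\<lambda>t. Fe' t - Fb' t" "\<lambda>t. Ge t + Y t - Gb t" "\<lambda>t. Ge' t + Y' t - Gb' t"] 1 2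
    by (simp add: cascade_def)
  have fz: "(fe t - fb t) - (Fe t - Fb t) = 0" if "t \<ge> 0" for t
    using delay_system_zero(1)[OF z \<kappa> _ _ that] init by auto
  have gz: "(ge t + y t - gb t) - (Ge t + Y t - Gb t) = 0" if "t \<ge> -1" for t
    using delay_system_zero(2)[OF z \<kappa> _ _ that] init by auto
  have fe: "fe t = Fe t" if "t \<ge> 0" for t using fz[OF that] fb[OF that] by simp
  have gy: "ge t + y t = Ge t + Y t" if "t \<ge> -1" for t using gz[OF that] gb[OF that] by simp
  have ge: "ge t = Ge t" if "t \<ge> -1" for t
  proof (cases "t \<le> 0")
    case False
    then have "y t = - c0 * (fe t + ge t)" "Y t = - c0 * (Fe t + Ge t)" using 1 2 by (simp_all add: cascade_def)
    then have "(1 - c0) * ge t = (1 - c0) * Ge t" using gy[OF that] fe[of t] False by (simp add: algebra_simps)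
    then show ?thesis using c0 by simp
  qed (use init(2) that in auto)
  show "t \<ge> 0 \<Longrightarrow> fe t = Fe t" "t \<ge> -1 \<Longrightarrow> ge t = Ge t" "t \<ge> 0 \<Longrightarrow> fb t = Fb t" "t \<ge> -1 \<Longrightarrow> gb t = Gb t" "t \<ge> -1 \<Longrightarrow> y t = Y t"
    using fe ge fb gb gy[of t] by auto
qed

section \<open>Trajectories that are continuous in time with values in L2\<close>

lemma L2_add: "f \<in> L2 \<Longrightarrow> g \<in> L2 \<Longrightarrow> (\<lambda>x. f x + g x) \<in> L2"
  unfolding L2_def using set_integrable_square_bound[of "{0<..<1}" f g]
  by (auto simp: set_borel_measurable_def algebra_simps)

lemma L2_cmult: "f \<in> L2 \<Longrightarrow> (\<lambda>x. c * f x) \<in> L2"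
  unfolding L2_def
  by (auto simp: set_borel_measurable_def power_mult_distrib algebra_simps)

lemma L2_uminus: "f \<in> L2 \<Longrightarrow> (\<lambda>x. - f x) \<in> L2"
  using L2_cmult[of f "-1"] by simp

lemma L2_diff: "f \<in> L2 \<Longrightarrow> g \<in> L2 \<Longrightarrow> (\<lambda>x. f x - g x) \<in> L2"
  using L2_add[of f "\<lambda>x. - g x"] L2_uminus[of g] by simp

lemma L2_square_integrable: "f \<in> L2 \<Longrightarrow> set_integrable lborel {0<..<1} (\<lambda>x. (f x)\<^sup>2)"
  by (auto simp: L2_def)

lemma L2_continuous_mult_integrable:
  assumes "f \<in> L2" "continuous_on UNIV h"
  shows "set_integrable lborel {0<..<1} (\<lambda>x. f x * h x)"
proof -
  obtain g where g: "L2loc g" "\<And>x. x \<in> {0<..<1} \<Longrightarrow> g x = f x" using L2_repr[OF assms(1)] by metis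
  have "set_integrable lborel {0<..<1} (\<lambda>x. g x * h x)"
    unfolding set_integrable_Ioo_Icc by (intro L2loc_integrable L2loc_continuous_mult g assms)
  moreover have "set_integrable lborel {0<..<1} (\<lambda>x. g x * h x) = set_integrable lborel {0<..<1} (\<lambda>x. f x * h x)"
    by (rule set_integrable_cong) (auto simp: g)
  ultimately show ?thesis by simp
qed

lemma L2_pairing_bound:
  assumes f: "f \<in> L2" and h: "continuous_on UNIV h" "\<And>x. x \<in> {0<..<1} \<Longrightarrow> \<bar>h x\<bar> \<le> C"
  shows "\<bar>LINT x:{0<..<1}|lborel. f x * h x\<bar> \<le> C * sqrt (LINT x:{0<..<1}|lborel. (f x)\<^sup>2)"
proof -
  obtain g where g: "L2loc g" "\<And>x. x \<in> {0<..<1} \<Longrightarrow> g x = f x" using L2_repr[OF f] by metis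
  have C: "C \<ge> 0" using h(2)[of "1/2"] by simp
  have e: "(LINT x:{0<..<1}|lborel. f x * h x) = (LINT x:{0..1}|lborel. g x * h x)"
    "(LINT x:{0<..<1}|lborel. (f x)\<^sup>2) = (LINT x:{0..1}|lborel. (g x)\<^sup>2)"
    unfolding set_integral_Ioo_Icc[symmetric] by (auto intro!: set_lebesgue_integral_cong simp: g)
  have L: "L2loc (\<lambda>x. g x * h x)" by (intro L2loc_continuous_mult g h)
  have h01: "\<bar>h x\<bar> \<le> C" if "x \<in> {0..1}" for x
    by (rule continuous_le_on_closure[of "{0<..<1}" "\<lambda>x. \<bar>h x\<bar>"])
       (use that h in \<open>auto intro!: continuous_intros intro: continuous_on_subset\<close>)
  have "(LINT x:{0..1}|lborel. g x * h x)\<^sup>2 \<le> (LINT x:{0..1}|lborel. (g x * h x)\<^sup>2)"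
    using L2loc_cauchy_schwarz[OF L, of 0 1] by simp
  also have "\<dots> \<le> (LINT x:{0..1}|lborel. C\<^sup>2 * (g x)\<^sup>2)"
  proof (rule set_integral_mono)
    fix x :: real assume "x \<in> {0..1}"
    then have "(h x)\<^sup>2 \<le> C\<^sup>2" using h01[of x] by (simp add: abs_le_square_iff[symmetric] C)
    then show "(g x * h x)\<^sup>2 \<le> C\<^sup>2 * (g x)\<^sup>2"
      using mult_left_mono[of "(h x)\<^sup>2" "C\<^sup>2" "(g x)\<^sup>2"] by (simp add: power_mult_distrib mult.commute)
  qed (auto intro: L2loc_square_integrable L L2loc_square_integrable[OF g(1)])
  finally have "\<bar>LINT x:{0..1}|lborel. g x * h x\<bar> \<le> sqrt (C\<^sup>2 * (LINT x:{0..1}|lborel. (g x)\<^sup>2))"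
    by (intro real_le_rsqrt) simp
  then show ?thesis unfolding e using C by (simp add: real_sqrt_mult)
qed

text \<open>
  Continuity of \<open>t \<mapsto> F t\<close> on \<open>[0,\<infinity>)\<close> in the norm of
  \<open>L\<^sup>2(0,1)\<close>: this is the regularity in time of the components of a trajectory.
\<close>

definition CL2 :: "(real \<Rightarrow> real \<Rightarrow> real) \<Rightarrow> bool" where
  "CL2 F \<longleftrightarrow> (\<forall>t\<ge>0. F t \<in> L2) \<and>
     (\<forall>s\<ge>0. ((\<lambda>t. LINT x:{0<..<1}|lborel. (F t x - F s x)\<^sup>2) \<longlongrightarrow> 0) (at s within {0..}))"

lemma CL2_L2: "CL2 F \<Longrightarrow> t \<ge> 0 \<Longrightarrow> F t \<in> L2"
  and CL2_tendsto: "CL2 F \<Longrightarrow> s \<ge> 0 \<Longrightarrow>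
     ((\<lambda>t. LINT x:{0<..<1}|lborel. (F t x - F s x)\<^sup>2) \<longlongrightarrow> 0) (at s within {0..})"
  by (auto simp: CL2_def)

lemma square_integral_sum_le:
  assumes "f \<in> L2" "g \<in> L2"
  shows "(LINT x:{0<..<1}|lborel. (f x + g x)\<^sup>2)
    \<le> 2 * (LINT x:{0<..<1}|lborel. (f x)\<^sup>2) + 2 * (LINT x:{0<..<1}|lborel. (g x)\<^sup>2)"
proof -
  have "(LINT x:{0<..<1}|lborel. (f x + g x)\<^sup>2) \<le> (LINT x:{0<..<1}|lborel. 2 * (f x)\<^sup>2 + 2 * (g x)\<^sup>2)"
  proof (rule set_integral_mono)
    show "(f x + g x)\<^sup>2 \<le> 2 * (f x)\<^sup>2 + 2 * (g x)\<^sup>2" for x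
      using sum_squares_bound[of "f x" "g x"] by (simp add: power2_sum)
  qed (use assms L2_square_integrable L2_square_integrable[OF L2_add[OF assms]] in auto)
  also have "\<dots> = 2 * (LINT x:{0<..<1}|lborel. (f x)\<^sup>2) + 2 * (LINT x:{0<..<1}|lborel. (g x)\<^sup>2)"
    using assms by (subst set_integral_add) (auto simp: L2_square_integrable)
  finally show ?thesis .
qed

lemma CL2_add:
  assumes "CL2 F" "CL2 G" shows "CL2 (\<lambda>t x. F t x + G t x)"
  unfolding CL2_def
proof (intro conjI allI impI)
  show "(\<lambda>x. F t x + G t x) \<in> L2" if "t \<ge> 0" for t by (intro L2_add CL2_L2 assms that)
  fix s :: real assume s: "s \<ge> 0"
  show "((\<lambda>t. LINT x:{0<..<1}|lborel. (F t x + G t x - (F s x + G s x))\<^sup>2) \<longlongrightarrow> 0) (at s within {0..})"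
  proof (rule tendsto_sandwich[OF _ _ tendsto_const])
    show "((\<lambda>t. 2 * (LINT x:{0<..<1}|lborel. (F t x - F s x)\<^sup>2) + 2 * (LINT x:{0<..<1}|lborel. (G t x - G s x)\<^sup>2)) \<longlongrightarrow> 0) (at s within {0..})"
      using tendsto_add[OF tendsto_mult_right_zero[OF CL2_tendsto[OF assms(1) s]] tendsto_mult_right_zero[OF CL2_tendsto[OF assms(2) s]]]
      by fastforce
    show "\<forall>\<^sub>F t in at s within {0..}. (LINT x:{0<..<1}|lborel. (F t x + G t x - (F s x + G s x))\<^sup>2)
       \<le> 2 * (LINT x:{0<..<1}|lborel. (F t x - F s x)\<^sup>2) + 2 * (LINT x:{0<..<1}|lborel. (G t x - G s x)\<^sup>2)"
      unfolding eventually_at_filter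
    proof (intro always_eventually allI impI)
      fix t :: real assume "t \<in> {0..}"
      then show "(LINT x:{0<..<1}|lborel. (F t x + G t x - (F s x + G s x))\<^sup>2)
       \<le> 2 * (LINT x:{0<..<1}|lborel. (F t x - F s x)\<^sup>2) + 2 * (LINT x:{0<..<1}|lborel. (G t x - G s x)\<^sup>2)"
        using square_integral_sum_le[of "\<lambda>x. F t x - F s x" "\<lambda>x. G t x - G s x"]
        by (simp add: L2_diff CL2_L2[OF assms(1)] CL2_L2[OF assms(2)] s add_diff_add)
    qed
  qed (auto intro!: always_eventually set_integral_square_nonneg)
qed

lemma CL2_cmult: assumes "CL2 F" shows "CL2 (\<lambda>t x. c * F t x)"
  unfolding CL2_def
proof (intro conjI allI impI)
  show "(\<lambda>x. c * F t x) \<in> L2" if "t \<ge> 0" for t by (intro L2_cmult CL2_L2 assms that)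
  fix s :: real assume s: "s \<ge> 0"
  have "(LINT x:{0<..<1}|lborel. (c * F t x - c * F s x)\<^sup>2) = c\<^sup>2 * (LINT x:{0<..<1}|lborel. (F t x - F s x)\<^sup>2)" for t
    by (simp add: power_mult_distrib flip: right_diff_distrib)
  then show "((\<lambda>t. LINT x:{0<..<1}|lborel. (c * F t x - c * F s x)\<^sup>2) \<longlongrightarrow> 0) (at s within {0..})"
    using tendsto_mult_right_zero[OF CL2_tendsto[OF assms s], of "c\<^sup>2"] by simp
qed

lemma CL2_uminus: "CL2 F \<Longrightarrow> CL2 (\<lambda>t x. - F t x)"
  using CL2_cmult[of F "-1"] by simp

lemma CL2_diff: "CL2 F \<Longrightarrow> CL2 G \<Longrightarrow> CL2 (\<lambda>t x. F t x - G t x)"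
  using CL2_add[of F "\<lambda>t x. - G t x"] CL2_uminus[of G] by simp

text \<open>
  Here continuity of translations enters.
\<close>

lemma CL2_shift: assumes "L2loc a" shows "CL2 (\<lambda>t x. a (t + x))" "CL2 (\<lambda>t x. a (t - x))"
  unfolding CL2_def set_integral_Ioo_Icc
  using L2loc_translation[OF assms] L2loc_imp_L2[OF L2loc_shift[OF assms]] L2loc_imp_L2[OF L2loc_flip[OF assms]]
  by auto

lemma continuous_square_tendsto:
  fixes F :: "real \<Rightarrow> real \<Rightarrow> real"
  assumes F: "continuous_on UNIV (\<lambda>(t, x). F t x)"
  shows "((\<lambda>t. LINT x:{a..b}|lborel. (F t x - F s x)\<^sup>2) \<longlongrightarrow> 0) (at s within S)"
proof -
  define g where "g = (\<lambda>(t, x). (F t x - F s x)\<^sup>2)"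
  have g: "continuous_on UNIV g"
    unfolding g_def case_prod_unfold
    by (intro continuous_intros continuous_on_compose2[OF F[unfolded case_prod_unfold], of UNIV "\<lambda>p. (s, snd p)", simplified]
        F[unfolded case_prod_unfold])
  have "continuous_on {s-1..s+1} (\<lambda>t. integral (cbox a b) (\<lambda>x. g (t, x)))"
    using integral_continuous_on_param[of "{s-1..s+1}" a b "\<lambda>t x. g (t, x)"] continuous_on_subset[OF g]
    by auto
  then have "isCont (\<lambda>t. integral (cbox a b) (\<lambda>x. g (t, x))) s"
    by (rule continuous_on_interior) auto
  moreover have "integral (cbox a b) (\<lambda>x. g (t, x)) = (LINT x:{a..b}|lborel. (F t x - F s x)\<^sup>2)" for t
  proof -
    have "set_integrable lborel {a..b} (\<lambda>x. g (t, x))"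
      by (intro set_integrable_continuous continuous_on_compose2[OF g, of _ "\<lambda>x. (t, x)"] continuous_intros) auto
    from set_borel_integral_eq_integral(2)[OF this] show ?thesis by (simp add: g_def)
  qed
  ultimately have "((\<lambda>t. LINT x:{a..b}|lborel. (F t x - F s x)\<^sup>2) \<longlongrightarrow> (LINT x:{a..b}|lborel. (F s x - F s x)\<^sup>2)) (at s)"
    by (simp add: isCont_def)
  then show ?thesis by (auto intro: tendsto_within_subset)
qed

lemma CL2_continuous:
  assumes F: "continuous_on UNIV (\<lambda>(t, x). F t x)" shows "CL2 F"
  unfolding CL2_def set_integral_Ioo_Icc
proof (intro conjI allI impI continuous_square_tendsto[OF F])
  fix t :: real
  have "continuous_on UNIV (\<lambda>x::real. (t, x))" by (intro continuous_intros)
  from continuous_on_compose2[OF F this] show "F t \<in> L2"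
    by (intro L2loc_imp_L2 L2loc_continuous) simp
qed

text \<open>
  Split \<open>F t \<psi>(t) - F s \<psi>(s)\<close> into \<open>(F t - F s) \<psi>(t)\<close> and
  \<open>F s (\<psi>(t) - \<psi>(s))\<close>. This makes the inner integrals in the pairing with
  test functions continuous in time, hence measurable.
\<close>

lemma CL2_pairing_continuous:
  assumes F: "CL2 F" and \<psi>: "continuous_on UNIV (\<psi> :: real \<times> real \<Rightarrow> real)"
  shows "continuous_on {0..} (\<lambda>t. LINT x:{0<..<1}|lborel. F t x * \<psi> (x, t))"
  unfolding continuous_on_def
proof
  fix s :: real assume "s \<in> {0..}" then have s: "s \<ge> 0" by simp
  have c: "continuous_on UNIV (\<lambda>x. \<psi> (x, t))" for t
    by (intro continuous_on_compose2[OF \<psi>] continuous_intros) auto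
  have "bounded (\<psi> ` ({0..1} \<times> {s-1..s+1}))"
    by (intro compact_imp_bounded compact_continuous_image continuous_on_subset[OF \<psi>] compact_Times) auto
  then obtain C where C: "\<And>x t. x \<in> {0..1} \<Longrightarrow> t \<in> {s-1..s+1} \<Longrightarrow> \<bar>\<psi> (x, t)\<bar> \<le> C"
    unfolding bounded_iff by force
  define S where "S = sqrt (LINT x:{0<..<1}|lborel. (F s x)\<^sup>2)"
  have uc: "uniformly_continuous_on ({0..1} \<times> {s-1..s+1}) \<psi>"
    by (intro compact_uniformly_continuous continuous_on_subset[OF \<psi>] compact_Times) auto
  have 2: "((\<lambda>t. LINT x:{0<..<1}|lborel. F s x * (\<psi> (x, t) - \<psi> (x, s))) \<longlongrightarrow> 0) (at s within {0..})"
  proof (rule tendstoI)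
    fix e :: real assume "e > 0"
    define e' where "e' = e / (S + 1)"
    have S: "S \<ge> 0" by (simp add: S_def set_integral_square_nonneg)
    then have e': "e' > 0" "e' * S < e" using \<open>e > 0\<close> by (auto simp: e'_def field_simps)
    obtain d where d: "d > 0" "\<And>z w. z \<in> {0..1} \<times> {s-1..s+1} \<Longrightarrow> w \<in> {0..1} \<times> {s-1..s+1} \<Longrightarrow> dist w z < d \<Longrightarrow> dist (\<psi> w) (\<psi> z) < e'"
      using uc e'(1) unfolding uniformly_continuous_on_def by metis
    show "\<forall>\<^sub>F t in at s within {0..}. dist (LINT x:{0<..<1}|lborel. F s x * (\<psi> (x, t) - \<psi> (x, s))) 0 < e"
      unfolding eventually_at
    proof (intro exI[of _ "min d 1"] conjI ballI impI)
      fix t :: real assume "t \<in> {0..}" "t \<noteq> s \<and> dist t s < min d 1"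
      then have "\<bar>\<psi> (x, t) - \<psi> (x, s)\<bar> \<le> e'" if "x \<in> {0<..<1}" for x
        using d(2)[of "(x, s)" "(x, t)"] that by (fastforce simp: dist_real_def dist_Pair_Pair)
      then have "\<bar>LINT x:{0<..<1}|lborel. F s x * (\<psi> (x, t) - \<psi> (x, s))\<bar> \<le> e' * S"
        unfolding S_def by (intro L2_pairing_bound CL2_L2[OF F s] continuous_intros c)
      then show "dist (LINT x:{0<..<1}|lborel. F s x * (\<psi> (x, t) - \<psi> (x, s))) 0 < e"
        using e'(2) by simp
    qed (use d in auto)
  qed
  have 1: "((\<lambda>t. LINT x:{0<..<1}|lborel. (F t x - F s x) * \<psi> (x, t)) \<longlongrightarrow> 0) (at s within {0..})"
  proof (rule tendsto_rabs_zero_cancel, rule tendsto_sandwich[OF _ _ tendsto_const])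
    show "((\<lambda>t. C * sqrt (LINT x:{0<..<1}|lborel. (F t x - F s x)\<^sup>2)) \<longlongrightarrow> 0) (at s within {0..})"
      using tendsto_mult_right_zero[OF tendsto_real_sqrt[OF CL2_tendsto[OF F s], simplified]] by simp
    show "\<forall>\<^sub>F t in at s within {0..}. \<bar>LINT x:{0<..<1}|lborel. (F t x - F s x) * \<psi> (x, t)\<bar>
        \<le> C * sqrt (LINT x:{0<..<1}|lborel. (F t x - F s x)\<^sup>2)"
      unfolding eventually_at
    proof (intro exI[of _ 1] conjI ballI impI)
      fix t :: real assume t: "t \<in> {0..}" "t \<noteq> s \<and> dist t s < 1"
      show "\<bar>LINT x:{0<..<1}|lborel. (F t x - F s x) * \<psi> (x, t)\<bar>
        \<le> C * sqrt (LINT x:{0<..<1}|lborel. (F t x - F s x)\<^sup>2)"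
        using t by (intro L2_pairing_bound L2_diff CL2_L2[OF F] c C s) (auto simp: dist_real_def)
    qed simp
  qed auto
  have "((\<lambda>t. (LINT x:{0<..<1}|lborel. (F t x - F s x) * \<psi> (x, t)) + (LINT x:{0<..<1}|lborel. F s x * (\<psi> (x, t) - \<psi> (x, s)))
      + (LINT x:{0<..<1}|lborel. F s x * \<psi> (x, s))) \<longlongrightarrow> 0 + 0 + (LINT x:{0<..<1}|lborel. F s x * \<psi> (x, s))) (at s within {0..})"
    by (intro tendsto_add 1 2 tendsto_const)
  then have "((\<lambda>t. (LINT x:{0<..<1}|lborel. (F t x - F s x) * \<psi> (x, t)) + (LINT x:{0<..<1}|lborel. F s x * (\<psi> (x, t) - \<psi> (x, s)))
      + (LINT x:{0<..<1}|lborel. F s x * \<psi> (x, s))) \<longlongrightarrow> (LINT x:{0<..<1}|lborel. F s x * \<psi> (x, s))) (at s within {0..})"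
    by simp
  then show "((\<lambda>t. LINT x:{0<..<1}|lborel. F t x * \<psi> (x, t)) \<longlongrightarrow> (LINT x:{0<..<1}|lborel. F s x * \<psi> (x, s))) (at s within {0..})"
  proof (rule Lim_transform_eventually)
    show "\<forall>\<^sub>F t in at s within {0..}. (LINT x:{0<..<1}|lborel. (F t x - F s x) * \<psi> (x, t)) + (LINT x:{0<..<1}|lborel. F s x * (\<psi> (x, t) - \<psi> (x, s)))
      + (LINT x:{0<..<1}|lborel. F s x * \<psi> (x, s)) = (LINT x:{0<..<1}|lborel. F t x * \<psi> (x, t))"
      unfolding eventually_at_filter
    proof (intro always_eventually allI impI)
      fix t :: real assume "t \<in> {0..}"
      then have F': "F t \<in> L2" "F s \<in> L2" using CL2_L2[OF F] s by auto
      have i: "set_integrable lborel {0<..<1} (\<lambda>x. F t x * \<psi> (x, t))" "set_integrable lborel {0<..<1} (\<lambda>x. F s x * \<psi> (x, t))"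
         "set_integrable lborel {0<..<1} (\<lambda>x. F s x * \<psi> (x, s))"
        by (intro L2_continuous_mult_integrable F' c)+
      show "(LINT x:{0<..<1}|lborel. (F t x - F s x) * \<psi> (x, t)) + (LINT x:{0<..<1}|lborel. F s x * (\<psi> (x, t) - \<psi> (x, s)))
      + (LINT x:{0<..<1}|lborel. F s x * \<psi> (x, s)) = (LINT x:{0<..<1}|lborel. F t x * \<psi> (x, t))"
        using i by (simp add: left_diff_distrib right_diff_distrib set_integral_diff(2))
    qed
  qed
qed

section \<open>Test functions of space and time\<close>

lemma test_xt_smooth: "test_xt \<phi> \<Longrightarrow> smooth \<phi>"
  by (simp add: test_xt_def test_function_def)

lemma test_xt_continuous: "test_xt \<phi> \<Longrightarrow> continuous_on A \<phi>"
  by (simp add: smooth_continuous test_xt_smooth)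

text \<open>
  A compact subset of the open strip stays away from its boundary and is bounded in time.
\<close>

lemma test_xt_support:
  assumes "test_xt \<phi>"
  obtains \<delta> T where "0 < \<delta>" "\<delta> < T" "\<And>x t. \<phi> (x, t) \<noteq> 0 \<Longrightarrow> x \<in> {\<delta>..1 - \<delta>} \<and> t \<in> {\<delta>..T}"
proof -
  let ?S = "closure {z. \<phi> z \<noteq> 0}"
  have S: "compact ?S" "?S \<subseteq> {0<..<1} \<times> {0<..}" using assms by (auto simp: test_xt_def test_function_def)
  have sub: "z \<in> ?S" if "\<phi> z \<noteq> 0" for z using that closure_subset[of "{z. \<phi> z \<noteq> 0}"] by auto
  show ?thesis
  proof (cases "?S = {}")
    case True
    then have "\<phi> z = 0" for z using sub[of z] by blast
    then show ?thesis using that[of 1 2] by auto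
  next
    case False
    define h where "h = (\<lambda>z :: real \<times> real. min (fst z) (min (1 - fst z) (snd z)))"
    have "continuous_on ?S h" unfolding h_def by (intro continuous_intros)
    then obtain m where m: "m \<in> ?S" "\<And>z. z \<in> ?S \<Longrightarrow> h m \<le> h z"
      using continuous_attains_inf[OF S(1) False] by blast
    have hm: "h m > 0" using m(1) S(2) by (auto simp: h_def)
    obtain B where B: "\<And>z. z \<in> ?S \<Longrightarrow> norm z \<le> B" using compact_imp_bounded[OF S(1)] by (auto simp: bounded_iff)
    show ?thesis
    proof (rule that[of "h m" "max B 1 + h m + 1"])
      fix x t assume nz: "\<phi> (x, t) \<noteq> 0"
      have "norm t \<le> norm (x, t)" by (metis norm_snd_le snd_conv)
      then show "x \<in> {h m..1 - h m} \<and> t \<in> {h m..max B 1 + h m + 1}"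
        using m(2)[OF sub[OF nz]] B[OF sub[OF nz]] hm by (auto simp: h_def)
    qed (use hm in auto)
  qed
qed

lemma frechet_zero_outside:
  assumes "\<phi> = (\<lambda>_. 0) \<or> z \<notin> closure {z. \<phi> z \<noteq> 0}"
  shows "frechet_derivative \<phi> (at z) b = 0"
proof -
  have "(\<phi> has_derivative (\<lambda>_. 0)) (at z)"
  proof (cases "\<phi> = (\<lambda>_. 0)")
    case False
    then have "z \<in> - closure {z. \<phi> z \<noteq> 0}" using assms by simp
    moreover have "open (- closure {z. \<phi> z \<noteq> 0})" by (intro open_Compl closed_closure)
    ultimately show ?thesis
      using closure_subset[of "{z. \<phi> z \<noteq> 0}"]
      by (intro has_derivative_transform_within_open[of "\<lambda>_. 0" "\<lambda>_. 0" z UNIV "- closure {z. \<phi> z \<noteq> 0}" \<phi>]) auto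
  qed simp
  from fun_cong[OF frechet_derivative_at[OF this], of b] show ?thesis by simp
qed

lemma test_xt_frechet:
  assumes "test_xt \<phi>" "b \<in> Basis" shows "test_xt (\<lambda>z. frechet_derivative \<phi> (at z) b)"
  unfolding test_xt_def
proof (rule test_functionI)
  show "smooth (\<lambda>z. frechet_derivative \<phi> (at z) b)"
    by (rule smooth_frechet[OF test_xt_smooth[OF assms(1)] assms(2)])
  show "compact (closure {z. \<phi> z \<noteq> 0})" "closure {z. \<phi> z \<noteq> 0} \<subseteq> {0<..<1} \<times> {0<..}"
    using assms(1) by (auto simp: test_xt_def test_function_def)
  show "z \<in> closure {z. \<phi> z \<noteq> 0}" if "frechet_derivative \<phi> (at z) b \<noteq> 0" for z
    using frechet_zero_outside that by blast
qed

lemma test_xt_D: assumes "test_xt \<phi>" shows "test_xt (D_x \<phi>)" "test_xt (D_t \<phi>)"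
proof -
  have "(1, 0) \<in> (Basis :: (real \<times> real) set)" "(0, 1) \<in> (Basis :: (real \<times> real) set)"
    by (auto simp: Basis_prod_def)
  from this[THEN test_xt_frechet[OF assms]] show "test_xt (D_x \<phi>)" "test_xt (D_t \<phi>)"
    by (simp_all add: D_x_def[abs_def] D_t_def[abs_def])
qed

lemma smooth_line_derivative:
  fixes \<phi> :: "real \<times> real \<Rightarrow> real"
  assumes "smooth \<phi>"
  shows "((\<lambda>s. \<phi> (x + a * s, t + b * s)) has_real_derivative
      a * D_x \<phi> (x + a * s, t + b * s) + b * D_t \<phi> (x + a * s, t + b * s)) (at s)"
proof -
  let ?z = "(x + a * s, t + b * s)"
  let ?L = "frechet_derivative \<phi> (at ?z)"
  have d: "(\<phi> has_derivative ?L) (at ?z)" by (rule smooth_has_derivative[OF assms])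
  have l: "((\<lambda>s. (x + a * s, t + b * s)) has_derivative (\<lambda>h. (a * h, b * h))) (at s)"
    by (auto intro!: derivative_eq_intros)
  have "((\<lambda>s. \<phi> (x + a * s, t + b * s)) has_derivative (\<lambda>h. ?L (a * h, b * h))) (at s)"
    using has_derivative_compose[OF l, of \<phi> ?L] d by simp
  moreover have "?L (a * h, b * h) = (a * D_x \<phi> ?z + b * D_t \<phi> ?z) * h" for h
  proof -
    interpret L: linear ?L using d by (rule has_derivative_linear)
    have "(a * h, b * h) = (a * h) *\<^sub>R (1, 0) + (b * h) *\<^sub>R (0, 1)" by simp
    then have "?L (a * h, b * h) = (a * h) *\<^sub>R ?L (1, 0) + (b * h) *\<^sub>R ?L (0, 1)"
      by (simp only: L.add L.scaleR)
    then show ?thesis by (simp add: D_x_def D_t_def algebra_simps)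
  qed
  ultimately show ?thesis by (simp add: has_field_derivative_def)
qed

lemma partial_derivatives:
  assumes "smooth \<phi>"
  shows D_x_DERIV: "((\<lambda>x. \<phi> (x, t)) has_real_derivative D_x \<phi> (x, t)) (at x)"
    and D_t_DERIV: "((\<lambda>t. \<phi> (x, t)) has_real_derivative D_t \<phi> (x, t)) (at t)"
  using smooth_line_derivative[OF assms, of 0 1 t 0 x] smooth_line_derivative[OF assms, of x 0 0 1 t] by simp_all

lemma test_xt_slice:
  assumes "test_xt \<phi>"
  shows "test_function {0<..<1} (\<lambda>x. \<phi> (x, t))" and "deriv (\<lambda>x. \<phi> (x, t)) = (\<lambda>x. D_x \<phi> (x, t))"
proof -
  obtain \<delta> T where d: "0 < \<delta>" "\<delta> < T" "\<And>x t. \<phi> (x, t) \<noteq> 0 \<Longrightarrow> x \<in> {\<delta>..1 - \<delta>} \<and> t \<in> {\<delta>..T}"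
    using test_xt_support[OF assms] by metis
  have "C_k k (\<lambda>x. \<phi> (x, t))" if "test_xt \<phi>" for k \<phi> using that
  proof (induction k arbitrary: \<phi>)
    case 0
    show ?case
      by (simp, rule continuous_on_compose2[OF test_xt_continuous[OF 0, of UNIV]]) (auto intro!: continuous_intros)
  next
    case (Suc k)
    show ?case by (rule C_k_real_SucI[OF D_x_DERIV[OF test_xt_smooth[OF Suc.prems]] Suc.IH[OF test_xt_D(1)[OF Suc.prems]]])
  qed
  then have "smooth (\<lambda>x. \<phi> (x, t))" using assms by (simp add: smooth_def)
  then show "test_function {0<..<1} (\<lambda>x. \<phi> (x, t))"
    by (rule test_functionI[where K="{\<delta>..1-\<delta>}"]) (use d in auto)
  show "deriv (\<lambda>x. \<phi> (x, t)) = (\<lambda>x. D_x \<phi> (x, t))"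
    using D_x_DERIV[OF test_xt_smooth[OF assms]] DERIV_imp_deriv by blast
qed

section \<open>The pairing with test functions\<close>

lemma dpair_integrable:
  assumes F: "CL2 F" and \<psi>: "test_xt \<psi>"
  shows "set_integrable lborel {0<..} (\<lambda>t. LINT x:{0<..<1}|lborel. F t x * \<psi> (x, t))"
proof -
  obtain \<delta> T where d: "0 < \<delta>" "\<delta> < T" "\<And>x t. \<psi> (x, t) \<noteq> 0 \<Longrightarrow> x \<in> {\<delta>..1 - \<delta>} \<and> t \<in> {\<delta>..T}"
    using test_xt_support[OF \<psi>] by metis
  let ?h = "\<lambda>t. LINT x:{0<..<1}|lborel. F t x * \<psi> (x, t)"
  have "set_integrable lborel {0..T} ?h"
    by (intro set_integrable_continuous continuous_on_subset[OF CL2_pairing_continuous[OF F test_xt_continuous[OF \<psi>]]]) auto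
  moreover have eq: "indicator {0<..} t *\<^sub>R ?h t = indicator {0..T} t *\<^sub>R ?h t" for t
  proof -
    have "\<psi> (x, t) = 0" if "\<not> (0 < t \<and> t \<le> T)" for x using d(3)[of x t] d(1,2) that by fastforce
    then show ?thesis by (auto simp: indicator_def)
  qed
  ultimately show ?thesis unfolding set_integrable_def eq by simp
qed

lemma dpair_add:
  assumes "CL2 F" "CL2 G" "test_xt \<psi>"
  shows "dpair (\<lambda>t x. F t x + G t x) \<psi> = dpair F \<psi> + dpair G \<psi>"
proof -
  have c: "continuous_on UNIV (\<lambda>x. \<psi> (x, t))" for t
    by (intro continuous_on_compose2[OF test_xt_continuous[OF assms(3), of UNIV]] continuous_intros) auto
  have "dpair (\<lambda>t x. F t x + G t x) \<psi> = (LINT t:{0<..}|lborel.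
      (LINT x:{0<..<1}|lborel. F t x * \<psi> (x, t)) + (LINT x:{0<..<1}|lborel. G t x * \<psi> (x, t)))"
    unfolding dpair_def
  proof (rule set_lebesgue_integral_cong)
    show "\<forall>t. t \<in> {0<..} \<longrightarrow> (LINT x:{0<..<1}|lborel. (F t x + G t x) * \<psi> (x, t)) =
       (LINT x:{0<..<1}|lborel. F t x * \<psi> (x, t)) + (LINT x:{0<..<1}|lborel. G t x * \<psi> (x, t))"
    proof (intro allI impI)
      fix t :: real assume "t \<in> {0<..}"
      then have "set_integrable lborel {0<..<1} (\<lambda>x. F t x * \<psi> (x, t))" "set_integrable lborel {0<..<1} (\<lambda>x. G t x * \<psi> (x, t))"
        by (auto intro!: L2_continuous_mult_integrable c CL2_L2[OF assms(1)] CL2_L2[OF assms(2)])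
      then show "(LINT x:{0<..<1}|lborel. (F t x + G t x) * \<psi> (x, t)) =
       (LINT x:{0<..<1}|lborel. F t x * \<psi> (x, t)) + (LINT x:{0<..<1}|lborel. G t x * \<psi> (x, t))"
        by (simp add: distrib_right set_integral_add)
    qed
  qed simp
  also have "\<dots> = dpair F \<psi> + dpair G \<psi>"
    unfolding dpair_def by (intro set_integral_add(2) dpair_integrable assms)
  finally show ?thesis .
qed

lemma dpair_cmult: "dpair (\<lambda>t x. c * F t x) \<psi> = c * dpair F \<psi>"
  by (simp add: dpair_def mult.assoc)

lemma dpair_uminus: "dpair (\<lambda>t x. - F t x) \<psi> = - dpair F \<psi>"
  using dpair_cmult[of "-1" F \<psi>] by simp

lemma dpair_diff:
  assumes "CL2 F" "CL2 G" "test_xt \<psi>"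
  shows "dpair (\<lambda>t x. F t x - G t x) \<psi> = dpair F \<psi> - dpair G \<psi>"
  using dpair_add[OF assms(1) CL2_uminus[OF assms(2)] assms(3)] by (simp add: dpair_uminus)

lemma dpair_cong_AE:
  assumes "CL2 F" "CL2 G" "test_xt \<psi>" "\<And>t. t > 0 \<Longrightarrow> AE x\<in>{0<..<1} in lborel. F t x = G t x"
  shows "dpair F \<psi> = dpair G \<psi>"
  unfolding dpair_def
proof (rule set_lebesgue_integral_cong)
  have c: "continuous_on UNIV (\<lambda>x. \<psi> (x, t))" for t
    by (intro continuous_on_compose2[OF test_xt_continuous[OF assms(3), of UNIV]] continuous_intros) auto
  show "\<forall>t. t \<in> {0<..} \<longrightarrow> (LINT x:{0<..<1}|lborel. F t x * \<psi> (x, t)) = (LINT x:{0<..<1}|lborel. G t x * \<psi> (x, t))"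
  proof (intro allI impI)
    fix t :: real assume t: "t \<in> {0<..}"
    then have "set_integrable lborel {0<..<1} (\<lambda>x. F t x * \<psi> (x, t))" "set_integrable lborel {0<..<1} (\<lambda>x. G t x * \<psi> (x, t))"
      by (auto intro!: L2_continuous_mult_integrable c CL2_L2[OF assms(1)] CL2_L2[OF assms(2)])
    then show "(LINT x:{0<..<1}|lborel. F t x * \<psi> (x, t)) = (LINT x:{0<..<1}|lborel. G t x * \<psi> (x, t))"
      unfolding set_lebesgue_integral_def set_integrable_def
      using assms(4)[of t] t by (intro integral_cong_AE) (auto simp: indicator_def)
  qed
qed simp

lemma dpair_cong:
  assumes "\<And>t x. t > 0 \<Longrightarrow> x \<in> {0<..<1} \<Longrightarrow> F t x * \<phi> (x, t) = G t x * \<psi> (x, t)"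
  shows "dpair F \<phi> = dpair G \<psi>"
  unfolding dpair_def by (intro set_lebesgue_integral_cong allI impI) (use assms in auto)

lemma dpair_test_diff:
  assumes "CL2 F" "test_xt \<phi>" "test_xt \<psi>"
  shows "dpair F (\<lambda>z. c * \<phi> z + d * \<psi> z) = c * dpair F \<phi> + d * dpair F \<psi>"
proof -
  have c1: "continuous_on UNIV (\<lambda>x. \<phi> (x, t))" and c2: "continuous_on UNIV (\<lambda>x. \<psi> (x, t))" for t
    by (intro continuous_on_compose2[OF test_xt_continuous[OF assms(2), of UNIV]]
        continuous_on_compose2[OF test_xt_continuous[OF assms(3), of UNIV]] continuous_intros; auto)+
  have "dpair F (\<lambda>z. c * \<phi> z + d * \<psi> z) = (LINT t:{0<..}|lborel.
      c * (LINT x:{0<..<1}|lborel. F t x * \<phi> (x, t)) + d * (LINT x:{0<..<1}|lborel. F t x * \<psi> (x, t)))"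
    unfolding dpair_def
  proof (rule set_lebesgue_integral_cong)
    show "\<forall>t. t \<in> {0<..} \<longrightarrow> (LINT x:{0<..<1}|lborel. F t x * (c * \<phi> (x, t) + d * \<psi> (x, t))) =
       c * (LINT x:{0<..<1}|lborel. F t x * \<phi> (x, t)) + d * (LINT x:{0<..<1}|lborel. F t x * \<psi> (x, t))"
    proof (intro allI impI)
      fix t :: real assume "t \<in> {0<..}"
      then have i: "set_integrable lborel {0<..<1} (\<lambda>x. c * (F t x * \<phi> (x, t)))" "set_integrable lborel {0<..<1} (\<lambda>x. d * (F t x * \<psi> (x, t)))"
        by (auto intro!: set_integrable_mult_right L2_continuous_mult_integrable c1 c2 CL2_L2[OF assms(1)])
      have "(LINT x:{0<..<1}|lborel. F t x * (c * \<phi> (x, t) + d * \<psi> (x, t))) =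
        (LINT x:{0<..<1}|lborel. c * (F t x * \<phi> (x, t)) + d * (F t x * \<psi> (x, t)))"
        by (simp add: algebra_simps)
      then show "(LINT x:{0<..<1}|lborel. F t x * (c * \<phi> (x, t) + d * \<psi> (x, t))) =
       c * (LINT x:{0<..<1}|lborel. F t x * \<phi> (x, t)) + d * (LINT x:{0<..<1}|lborel. F t x * \<psi> (x, t))"
        using set_integral_add(2)[OF i] by simp
    qed
  qed simp
  also have "\<dots> = c * dpair F \<phi> + d * dpair F \<psi>"
    unfolding dpair_def
    by (subst set_integral_add(2)) (auto intro!: set_integrable_mult_right dpair_integrable assms)
  finally show ?thesis .
qed

lemma dpair_D_x:
  assumes "\<And>t. t > 0 \<Longrightarrow> has_weak_deriv (F t) (G t)" "test_xt \<phi>"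
  shows "dpair F (D_x \<phi>) = - dpair G \<phi>"
proof -
  have "dpair F (D_x \<phi>) = (LINT t:{0<..}|lborel. - (LINT x:{0<..<1}|lborel. G t x * \<phi> (x, t)))"
    unfolding dpair_def
  proof (intro set_lebesgue_integral_cong allI impI)
    fix t :: real assume "t \<in> {0<..}"
    then have "has_weak_deriv (F t) (G t)" using assms(1) by simp
    then show "(LINT x:{0<..<1}|lborel. F t x * D_x \<phi> (x, t)) = - (LINT x:{0<..<1}|lborel. G t x * \<phi> (x, t))"
      using test_xt_slice[OF assms(2), of t] unfolding has_weak_deriv_def by metis
  qed simp
  also have "\<dots> = - dpair G \<phi>" by (simp add: dpair_def set_lebesgue_integral_def)
  finally show ?thesis .
qed

section \<open>Exchanging the order of integration\<close>

text \<open>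
  The measurability and integrability in both variables under which the iterated integrals against
  test functions may be interchanged.
\<close>

definition box_integrable :: "(real \<Rightarrow> real \<Rightarrow> real) \<Rightarrow> bool" where
  "box_integrable F \<longleftrightarrow> (\<lambda>(x, t). F t x) \<in> borel_measurable (lborel \<Otimes>\<^sub>M lborel) \<and>
     (\<forall>T. integrable (lborel \<Otimes>\<^sub>M lborel) (\<lambda>(x, t). indicator {0..1} x * indicator {-T..T} t * F t x))"

lemma box_integrable_add:
  assumes "box_integrable F" "box_integrable G" shows "box_integrable (\<lambda>t x. F t x + G t x)"
proof -
  have "integrable (lborel \<Otimes>\<^sub>M lborel) (\<lambda>(x, t). indicator {0..1} x * indicator {-T..T} t * (F t x + G t x) :: real)" for T
  proof -
    have "integrable (lborel \<Otimes>\<^sub>M lborel) (\<lambda>z. (case z of (x, t) \<Rightarrow> indicator {0..1} x * indicator {-T..T} t * F t x)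
       + (case z of (x, t) \<Rightarrow> indicator {0..1} x * indicator {-T..T} t * G t x))"
      using assms by (intro Bochner_Integration.integrable_add) (auto simp: box_integrable_def)
    then show ?thesis by (simp add: case_prod_unfold distrib_left)
  qed
  then show ?thesis using assms unfolding box_integrable_def
    by (auto simp: case_prod_unfold)
qed

lemma box_integrable_swap:
  assumes F: "box_integrable F" and \<psi>: "continuous_on UNIV (\<psi> :: real \<times> real \<Rightarrow> real)"
    and supp: "\<And>x t. \<psi> (x, t) \<noteq> 0 \<Longrightarrow> x \<in> {0..1} \<and> t \<in> {-T..T}"
  shows "(LINT t|lborel. LINT x|lborel. F t x * \<psi> (x, t)) = (LINT x|lborel. LINT t|lborel. F t x * \<psi> (x, t))"
proof -
  have "bounded (\<psi> ` ({0..1} \<times> {-T..T}))"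
    by (intro compact_imp_bounded compact_continuous_image continuous_on_subset[OF \<psi>] compact_Times) auto
  then obtain C where C: "\<And>x t. x \<in> {0..1} \<Longrightarrow> t \<in> {-T..T} \<Longrightarrow> \<bar>\<psi> (x, t)\<bar> \<le> C"
    unfolding bounded_iff by force
  have m\<psi>: "\<psi> \<in> borel_measurable (lborel \<Otimes>\<^sub>M lborel)"
    unfolding lborel_prod using borel_measurable_continuous_onI[OF \<psi>] by simp
  have mF: "(\<lambda>(x, t). F t x) \<in> borel_measurable (lborel \<Otimes>\<^sub>M lborel)" using F by (simp add: box_integrable_def)
  have "integrable (lborel \<Otimes>\<^sub>M lborel) (\<lambda>(x, t). F t x * \<psi> (x, t))"
  proof (rule Bochner_Integration.integrable_bound)
    show "integrable (lborel \<Otimes>\<^sub>M lborel) (\<lambda>z. C * (case z of (x, t) \<Rightarrow> indicator {0..1} x * indicator {-T..T} t * F t x))"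
      using F by (intro integrable_mult_right) (simp add: box_integrable_def)
    show "(\<lambda>(x, t). F t x * \<psi> (x, t)) \<in> borel_measurable (lborel \<Otimes>\<^sub>M lborel)"
      using borel_measurable_times[OF mF m\<psi>] by (simp add: case_prod_unfold)
    show "AE z in lborel \<Otimes>\<^sub>M lborel. norm (case z of (x, t) \<Rightarrow> F t x * \<psi> (x, t))
        \<le> norm (C * (case z of (x, t) \<Rightarrow> indicator {0..1} x * indicator {-T..T} t * F t x))"
    proof (rule AE_I2)
      fix z :: "real \<times> real"
      obtain x t where z: "z = (x, t)" by force
      show "norm (case z of (x, t) \<Rightarrow> F t x * \<psi> (x, t))
        \<le> norm (C * (case z of (x, t) \<Rightarrow> indicator {0..1} x * indicator {-T..T} t * F t x))"
      proof (cases "\<psi> (x, t) = 0")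
        case False
        then have xt: "x \<in> {0..1}" "t \<in> {-T..T}" using supp by auto
        then have "\<bar>F t x\<bar> * \<bar>\<psi> (x, t)\<bar> \<le> \<bar>F t x\<bar> * \<bar>C\<bar>"
          using C[OF xt] by (intro mult_left_mono) auto
        then show ?thesis using xt by (simp add: z abs_mult mult.commute)
      qed (simp add: z)
    qed
  qed
  then have "integrable (lborel \<Otimes>\<^sub>M lborel) (case_prod (\<lambda>x t. F t x * \<psi> (x, t)))" .
  from lborel_pair.Fubini_integral[OF this] show ?thesis .
qed

lemma box_integrable_travelling:
  assumes a: "L2loc a" shows "box_integrable (\<lambda>t x. a (t + \<sigma> * x))"
  unfolding box_integrable_def
proof (intro conjI allI)
  note [measurable] = L2loc_measurable[OF a]
  show "(\<lambda>(x, t). a (t + \<sigma> * x)) \<in> borel_measurable (lborel \<Otimes>\<^sub>M lborel)" by measurable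
  fix T :: real
  obtain \<Phi> where \<Phi>: "prim \<Phi> (\<lambda>x. \<bar>a x\<bar>)" using prim_of_integral[OF L2loc_abs[OF a]] by metis
  show "integrable (lborel \<Otimes>\<^sub>M lborel) (\<lambda>(x, t). indicator {0..1} x * indicator {-T..T} t * a (t + \<sigma> * x))"
  proof (rule lborel_pair.Fubini_integrable)
    show "(\<lambda>(x, t). indicator {0..1} x * indicator {-T..T} t * a (t + \<sigma> * x)) \<in> borel_measurable (lborel \<Otimes>\<^sub>M lborel)"
      by measurable
    have s: "set_integrable lborel {-T..T} (\<lambda>t. a (t + \<sigma> * x))" for x
      using L2loc_integrable[OF L2loc_shift[OF a, of "\<sigma> * x"]] by (simp add: add.commute)
    show "AE x in lborel. integrable lborel (\<lambda>t. case (x, t) of (x, t) \<Rightarrow> indicator {0..1} x * indicator {-T..T} t * a (t + \<sigma> * x))"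
      using s by (auto simp: set_integrable_def mult.assoc)
    have "(LINT t|lborel. norm (case (x, t) of (x, t) \<Rightarrow> indicator {0..1} x * indicator {-T..T} t * a (t + \<sigma> * x)))
        = indicator {0..1} x *\<^sub>R (if T \<ge> 0 then \<Phi> (\<sigma> * x + T) - \<Phi> (\<sigma> * x - T) else 0)" for x
    proof -
      have "(LINT t|lborel. norm (case (x, t) of (x, t) \<Rightarrow> indicator {0..1} x * indicator {-T..T} t * a (t + \<sigma> * x)))
        = indicator {0..1} x * (LINT t:{-T..T}|lborel. \<bar>a (\<sigma> * x + t)\<bar>)"
        by (simp add: abs_mult mult.assoc set_lebesgue_integral_def add.commute)
      also have "(LINT t:{-T..T}|lborel. \<bar>a (\<sigma> * x + t)\<bar>) = (if T \<ge> 0 then \<Phi> (\<sigma> * x + T) - \<Phi> (\<sigma> * x - T) else 0)"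
        using prim_eq[OF \<Phi>, of "\<sigma> * x - T" "\<sigma> * x + T"] set_integral_shift[of "-T" T "\<lambda>x. \<bar>a x\<bar>" "\<sigma> * x"]
        by (auto simp: set_lebesgue_integral_def)
      finally show ?thesis by simp
    qed
    moreover have "set_integrable lborel {0..1} (\<lambda>x. if T \<ge> 0 then \<Phi> (\<sigma> * x + T) - \<Phi> (\<sigma> * x - T) else 0)"
      by (cases "T \<ge> 0") (auto intro!: set_integrable_continuous continuous_intros
          continuous_on_compose2[OF prim_continuous_on[OF \<Phi>, of UNIV]])
    ultimately show "integrable lborel (\<lambda>x. LINT t|lborel. norm (case (x, t) of (x, t) \<Rightarrow> indicator {0..1} x * indicator {-T..T} t * a (t + \<sigma> * x)))"
      by (simp only: set_integrable_def)
  qed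
qed

lemma box_integrable_continuous:
  assumes F: "continuous_on UNIV (\<lambda>(t, x). F t x :: real)" shows "box_integrable F"
  unfolding box_integrable_def
proof (intro conjI allI)
  have c: "continuous_on UNIV (\<lambda>z. F (snd z) (fst z))"
  proof -
    have "continuous_on UNIV (\<lambda>z :: real \<times> real. (snd z, fst z))" by (intro continuous_intros)
    from continuous_on_compose2[OF F this] show ?thesis by simp
  qed
  show "(\<lambda>(x, t). F t x) \<in> borel_measurable (lborel \<Otimes>\<^sub>M lborel)"
    unfolding lborel_prod using borel_measurable_continuous_onI[OF c] by (simp add: case_prod_unfold)
  fix T :: real
  have "integrable (lborel :: (real \<times> real) measure) (\<lambda>z. indicator ({0..1} \<times> {-T..T}) z *\<^sub>R F (snd z) (fst z))"
    by (rule borel_integrable_compact) (auto intro: compact_Times continuous_on_subset[OF c])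
  then show "integrable (lborel \<Otimes>\<^sub>M lborel) (\<lambda>(x, t). indicator {0..1} x * indicator {-T..T} t * F t x)"
    unfolding lborel_prod by (simp add: case_prod_unfold indicator_times)
qed

lemma dpair_eq_iterated:
  assumes "test_xt \<psi>"
  shows "dpair F \<psi> = (LINT t|lborel. LINT x|lborel. F t x * \<psi> (x, t))"
proof -
  obtain \<delta> T where d: "0 < \<delta>" "\<delta> < T" "\<And>x t. \<psi> (x, t) \<noteq> 0 \<Longrightarrow> x \<in> {\<delta>..1 - \<delta>} \<and> t \<in> {\<delta>..T}"
    using test_xt_support[OF assms] by metis
  have e: "F t x * \<psi> (x, t) = indicator {0<..} t *\<^sub>R (indicator {0<..<1} x *\<^sub>R (F t x * \<psi> (x, t)))" for t x
    using d(3)[of x t] d(1) by (cases "\<psi> (x, t) = 0") (auto simp: indicator_def)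
  have "(LINT x|lborel. F t x * \<psi> (x, t)) = indicator {0<..} t *\<^sub>R (LINT x|lborel. indicator {0<..<1} x *\<^sub>R (F t x * \<psi> (x, t)))" for t
    unfolding integral_scaleR_right[symmetric] by (rule Bochner_Integration.integral_cong[OF refl e])
  then show ?thesis by (simp add: dpair_def set_lebesgue_integral_def)
qed

text \<open>
  For fixed \<open>s = t + \<sigma> x\<close> the bracket is the derivative of
  \<open>\<phi>\<close> along the characteristic \<open>x \<mapsto> (x, s - \<sigma> x)\<close>,
  whose integral vanishes as \<open>\<phi>\<close> has compact support. The change of variables
  from \<open>t\<close> to \<open>s\<close> puts all derivatives on \<open>\<phi>\<close>, so that
  \<open>a\<close> can be any square integrable profile.
\<close>

lemma transport_weak_iterated:
  assumes a: "L2loc a" and \<phi>: "test_xt \<phi>"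
  shows "(LINT t|lborel. LINT x|lborel. a (t + \<sigma> * x) * (D_x \<phi> (x, t) - \<sigma> * D_t \<phi> (x, t))) = 0"
proof -
  obtain \<delta> T where d: "0 < \<delta>" "\<delta> < T" "\<And>x t. \<phi> (x, t) \<noteq> 0 \<Longrightarrow> x \<in> {\<delta>..1 - \<delta>} \<and> t \<in> {\<delta>..T}"
    using test_xt_support[OF \<phi>] by metis
  define \<psi> where "\<psi> = (\<lambda>z. D_x \<phi> z - \<sigma> * D_t \<phi> z)"
  obtain \<delta>1 T1 where d1: "0 < \<delta>1" "\<delta>1 < T1" "\<And>x t. D_x \<phi> (x, t) \<noteq> 0 \<Longrightarrow> x \<in> {\<delta>1..1 - \<delta>1} \<and> t \<in> {\<delta>1..T1}"
    using test_xt_support[OF test_xt_D(1)[OF \<phi>]] by metis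
  obtain \<delta>2 T2 where d2: "0 < \<delta>2" "\<delta>2 < T2" "\<And>x t. D_t \<phi> (x, t) \<noteq> 0 \<Longrightarrow> x \<in> {\<delta>2..1 - \<delta>2} \<and> t \<in> {\<delta>2..T2}"
    using test_xt_support[OF test_xt_D(2)[OF \<phi>]] by metis
  define S where "S = T1 + T2 + \<bar>\<sigma>\<bar>"
  have c: "continuous_on UNIV \<psi>" unfolding \<psi>_def
    by (intro continuous_intros test_xt_continuous test_xt_D \<phi>)
  have supp: "x \<in> {0..1} \<and> t \<in> {0..T1 + T2}" if "\<psi> (x, t) \<noteq> 0" for x t
  proof -
    have "D_x \<phi> (x, t) \<noteq> 0 \<or> D_t \<phi> (x, t) \<noteq> 0" using that by (auto simp: \<psi>_def)
    then show ?thesis using d1 d2 by fastforce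
  qed
  have S: "0 \<le> T1 + T2" "0 \<le> \<bar>\<sigma>\<bar>" using d1 d2 by auto
  define \<psi>' where "\<psi>' = (\<lambda>(x, s). \<psi> (x, s - \<sigma> * x))"
  have c': "continuous_on UNIV \<psi>'" unfolding \<psi>'_def case_prod_unfold
    by (intro continuous_on_compose2[OF c] continuous_intros) auto
  have supp': "x \<in> {0..1} \<and> s \<in> {-S..S}" if "\<psi>' (x, s) \<noteq> 0" for x s
  proof -
    have x: "x \<in> {0..1}" "s - \<sigma> * x \<in> {0..T1 + T2}" using supp[of x "s - \<sigma> * x"] that by (auto simp: \<psi>'_def)
    have "\<bar>\<sigma> * x\<bar> \<le> \<bar>\<sigma>\<bar>" using x(1) by (simp add: abs_mult mult_left_le)
    then show ?thesis using x S unfolding S_def by (auto simp: abs_le_iff)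
  qed
  have "(LINT t|lborel. LINT x|lborel. a (t + \<sigma> * x) * \<psi> (x, t)) = (LINT x|lborel. LINT t|lborel. a (t + \<sigma> * x) * \<psi> (x, t))"
    by (rule box_integrable_swap[OF box_integrable_travelling[OF a] c, where T="S"])
       (use supp S in \<open>fastforce simp: S_def\<close>)
  also have "\<dots> = (LINT x|lborel. LINT s|lborel. a s * \<psi>' (x, s))"
  proof (rule Bochner_Integration.integral_cong[OF refl])
    fix x :: real
    show "(LINT t|lborel. a (t + \<sigma> * x) * \<psi> (x, t)) = (LINT s|lborel. a s * \<psi>' (x, s))"
      using lborel_integral_real_affine[of 1 "\<lambda>s. a s * \<psi>' (x, s)" "\<sigma> * x"] by (simp add: \<psi>'_def add.commute)
  qed
  also have "\<dots> = (LINT s|lborel. LINT x|lborel. a s * \<psi>' (x, s))"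
    using box_integrable_swap[OF box_integrable_travelling[OF a, of 0] c' supp'] by simp
  also have "\<dots> = integral\<^sup>L (lborel :: real measure) (\<lambda>s. 0)"
  proof (intro Bochner_Integration.integral_cong refl)
    fix s :: real
    have D: "((\<lambda>x. \<phi> (x, s - \<sigma> * x)) has_real_derivative \<psi>' (x, s)) (at x)" for x
      using smooth_line_derivative[OF test_xt_smooth[OF \<phi>], of 0 1 s "-\<sigma>" x] by (simp add: \<psi>'_def \<psi>_def)
    have cx: "continuous_on UNIV (\<lambda>x. \<psi>' (x, s))"
      by (intro continuous_on_compose2[OF c'] continuous_intros) auto
    have "(LINT x:{0..1}|lborel. \<psi>' (x, s)) = \<phi> (1, s - \<sigma> * 1) - \<phi> (0, s - \<sigma> * 0)"
      using prim_eq[OF prim_C1[OF D cx], of 0 1] by simp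
    also have "\<dots> = 0" using d(3)[of 1 "s - \<sigma> * 1"] d(3)[of 0 "s - \<sigma> * 0"] d(1) by fastforce
    finally have "(LINT x:{0..1}|lborel. \<psi>' (x, s)) = 0" .
    moreover have e: "\<psi>' (x, s) = indicator {0..1} x *\<^sub>R \<psi>' (x, s)" for x
      using supp'[of x s] by (auto simp: indicator_def)
    have "(LINT x|lborel. \<psi>' (x, s)) = (LINT x:{0..1}|lborel. \<psi>' (x, s))"
      unfolding set_lebesgue_integral_def by (rule Bochner_Integration.integral_cong[OF refl e])
    ultimately show "(LINT x|lborel. a s * \<psi>' (x, s)) = 0" by simp
  qed
  finally show ?thesis by (simp add: \<psi>_def)
qed

lemma transport_weak:
  assumes a: "L2loc a" and \<phi>: "test_xt \<phi>"
  shows "dpair (\<lambda>t x. a (t + x)) (D_t \<phi>) = dpair (\<lambda>t x. a (t + x)) (D_x \<phi>)"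
    and "- dpair (\<lambda>t x. a (t - x)) (D_t \<phi>) = dpair (\<lambda>t x. a (t - x)) (D_x \<phi>)"
proof -
  have t: "test_xt (\<lambda>z. 1 * D_x \<phi> z + c * D_t \<phi> z)" for c
  proof -
    have "smooth (\<lambda>z. 1 * D_x \<phi> z + c * D_t \<phi> z)"
      by (intro smooth_add smooth_mult smooth_const test_xt_smooth test_xt_D \<phi>)
    moreover have "compact (closure {z. \<phi> z \<noteq> 0})" "closure {z. \<phi> z \<noteq> 0} \<subseteq> {0<..<1} \<times> {0<..}"
      using \<phi> by (auto simp: test_xt_def test_function_def)
    moreover have "z \<in> closure {z. \<phi> z \<noteq> 0}" if "1 * D_x \<phi> z + c * D_t \<phi> z \<noteq> 0" for z
      by (rule ccontr) (use frechet_zero_outside[of \<phi> z] that in \<open>auto simp: D_x_def D_t_def\<close>)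
    ultimately show ?thesis unfolding test_xt_def by (rule test_functionI)
  qed
  have "dpair (\<lambda>t x. a (t + x)) (\<lambda>z. 1 * D_x \<phi> z + (-1) * D_t \<phi> z) = 0"
    using transport_weak_iterated[OF a \<phi>, of 1] dpair_eq_iterated[OF t[of "-1"], of "\<lambda>t x. a (t + x)"] by simp
  then show "dpair (\<lambda>t x. a (t + x)) (D_t \<phi>) = dpair (\<lambda>t x. a (t + x)) (D_x \<phi>)"
    by (subst (asm) dpair_test_diff) (auto intro: CL2_shift a test_xt_D \<phi>)
  have "dpair (\<lambda>t x. a (t - x)) (\<lambda>z. 1 * D_x \<phi> z + 1 * D_t \<phi> z) = 0"
    using transport_weak_iterated[OF a \<phi>, of "-1"] dpair_eq_iterated[OF t[of 1], of "\<lambda>t x. a (t - x)"] by simp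
  then show "- dpair (\<lambda>t x. a (t - x)) (D_t \<phi>) = dpair (\<lambda>t x. a (t - x)) (D_x \<phi>)"
    by (subst (asm) dpair_test_diff) (auto intro: CL2_shift a test_xt_D \<phi>)
qed

lemma time_derivI:
  assumes p: "\<And>x. prim (\<lambda>t. F t x) (\<lambda>t. F' t x)" and F: "box_integrable F" "box_integrable F'"
  shows "time_deriv F F'"
  unfolding time_deriv_def
proof (intro allI impI)
  fix \<phi> :: "real \<times> real \<Rightarrow> real" assume \<phi>: "test_xt \<phi>"
  obtain \<delta> T where d: "0 < \<delta>" "\<delta> < T" "\<And>x t. \<phi> (x, t) \<noteq> 0 \<Longrightarrow> x \<in> {\<delta>..1 - \<delta>} \<and> t \<in> {\<delta>..T}"
    using test_xt_support[OF \<phi>] by metis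
  obtain \<delta>2 T2 where d2: "0 < \<delta>2" "\<delta>2 < T2" "\<And>x t. D_t \<phi> (x, t) \<noteq> 0 \<Longrightarrow> x \<in> {\<delta>2..1 - \<delta>2} \<and> t \<in> {\<delta>2..T2}"
    using test_xt_support[OF test_xt_D(2)[OF \<phi>]] by metis
  define S where "S = T + T2"
  have S: "0 < S" "T < S" "T2 < S" using d d2 by (auto simp: S_def)
  have "dpair F (D_t \<phi>) = (LINT x|lborel. LINT t|lborel. F t x * D_t \<phi> (x, t))"
    unfolding dpair_eq_iterated[OF test_xt_D(2)[OF \<phi>]]
    by (rule box_integrable_swap[OF F(1) test_xt_continuous[OF test_xt_D(2)[OF \<phi>]], where T=S]) (use d2 S in fastforce)
  also have "\<dots> = (LINT x|lborel. - (LINT t|lborel. F' t x * \<phi> (x, t)))"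
  proof (intro Bochner_Integration.integral_cong refl)
    fix x :: real
    have c: "continuous_on UNIV (\<lambda>t. D_t \<phi> (x, t))"
      by (intro continuous_on_compose2[OF test_xt_continuous[OF test_xt_D(2)[OF \<phi>], of UNIV]] continuous_intros) auto
    have c2: "continuous_on UNIV (\<lambda>t. \<phi> (x, t))"
      by (intro continuous_on_compose2[OF test_xt_continuous[OF \<phi>, of UNIV]] continuous_intros) auto
    have "\<phi> (x, 0) = 0" "\<phi> (x, S) = 0" using d(3)[of x 0] d(3)[of x S] d S by fastforce+
    then have "(LINT t:{0..S}|lborel. F t x * D_t \<phi> (x, t) + F' t x * \<phi> (x, t)) = 0"
      using prim_by_parts[OF p D_t_DERIV[OF test_xt_smooth[OF \<phi>]] c, of 0 S x] S by simp
    moreover have "set_integrable lborel {0..S} (\<lambda>t. F t x * D_t \<phi> (x, t))"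
      by (intro set_integrable_continuous continuous_intros prim_continuous_on[OF p] continuous_on_subset[OF c]) auto
    moreover have "set_integrable lborel {0..S} (\<lambda>t. F' t x * \<phi> (x, t))"
      by (intro L2loc_integrable L2loc_continuous_mult prim_L2loc[OF p] c2)
    ultimately have "(LINT t:{0..S}|lborel. F t x * D_t \<phi> (x, t)) = - (LINT t:{0..S}|lborel. F' t x * \<phi> (x, t))"
      by (simp add: set_integral_add)
    moreover have "indicator {0..S} t *\<^sub>R (F t x * D_t \<phi> (x, t)) = F t x * D_t \<phi> (x, t)"
        "indicator {0..S} t *\<^sub>R (F' t x * \<phi> (x, t)) = F' t x * \<phi> (x, t)" for t
      using d(3)[of x t] d2(3)[of x t] d(1) d2(1) S by (auto simp: indicator_def)
    ultimately show "(LINT t|lborel. F t x * D_t \<phi> (x, t)) = - (LINT t|lborel. F' t x * \<phi> (x, t))"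
      by (simp only: set_lebesgue_integral_def)
  qed
  also have "\<dots> = - (LINT x|lborel. LINT t|lborel. F' t x * \<phi> (x, t))" by simp
  also have "(LINT x|lborel. LINT t|lborel. F' t x * \<phi> (x, t)) = dpair F' \<phi>"
    unfolding dpair_eq_iterated[OF \<phi>]
    by (rule box_integrable_swap[OF F(2) test_xt_continuous[OF \<phi>], where T=S, symmetric]) (use d S in fastforce)
  finally show "- dpair F (D_t \<phi>) = dpair F' \<phi>" by simp
qed

section \<open>Travelling waves\<close>

text \<open>
  The d'Alembert solution with profiles \<open>f\<close>, \<open>g\<close>, together with a
  separated solution \<open>exp (q x) * r t\<close>; the latter produces the source term
  \<open>exp (q x) * (r'' - q\<^sup>2 r)\<close>.
\<close>

locale dalembert =
  fixes q :: real and f f' g g' r r1 r2 :: "real \<Rightarrow> real"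
  assumes f: "prim f f'" and g: "prim g g'"
    and r: "\<And>t. (r has_real_derivative r1 t) (at t)" and r1: "\<And>t. (r1 has_real_derivative r2 t) (at t)"
    and r2: "continuous_on UNIV r2"
begin

definition "U = (\<lambda>t x. f (t + x) + g (t - x) + exp (q * x) * r t)"
definition "Ut = (\<lambda>t x. f' (t + x) + g' (t - x) + exp (q * x) * r1 t)"
definition "Ux = (\<lambda>t x. f' (t + x) - g' (t - x) + q * exp (q * x) * r t)"

lemma continuous_r: "continuous_on A r" "continuous_on A r1"
  by (auto intro!: continuous_at_imp_continuous_on DERIV_isCont[OF r] DERIV_isCont[OF r1])

lemma continuous_exp_mult:
  assumes "continuous_on UNIV s" shows "continuous_on UNIV (\<lambda>(t, x). c * (exp (q * x) * s t) :: real)"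
  unfolding case_prod_unfold
  by (intro continuous_intros continuous_on_compose2[OF assms]) auto

lemma prim_U_x: "prim (U t) (Ux t)"
proof -
  have "prim (\<lambda>x. exp (q * x) * r t) (\<lambda>x. q * exp (q * x) * r t)"
    by (rule prim_C1) (auto intro!: derivative_eq_intros continuous_intros)
  from prim_add[OF prim_add[OF prim_shift[OF f] prim_flip[OF g]] this]
  show ?thesis by (simp add: U_def Ux_def)
qed

lemma prim_U_t: "prim (\<lambda>t. U t x) (\<lambda>t. Ut t x)"
proof -
  have 1: "prim (\<lambda>t. exp (q * x) * r t) (\<lambda>t. exp (q * x) * r1 t)"
    by (rule prim_cmult[OF prim_C1[OF r continuous_r(2)]])
  have 2: "prim (\<lambda>t. f (t + x)) (\<lambda>t. f' (t + x))" using prim_shift[OF f, of x] by (simp add: add.commute)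
  have 3: "prim (\<lambda>t. g (t - x)) (\<lambda>t. g' (t - x))" using prim_shift[OF g, of "-x"] by (simp add: algebra_simps)
  from prim_add[OF prim_add[OF 2 3] 1] show ?thesis by (simp add: U_def Ut_def)
qed

lemma CL2_exp: "continuous_on UNIV s \<Longrightarrow> CL2 (\<lambda>t x. c * (exp (q * x) * s t))"
  by (rule CL2_continuous[OF continuous_exp_mult])

lemma CL2_Ut: "CL2 Ut" and CL2_Ux: "CL2 Ux"
  unfolding Ut_def Ux_def
  using CL2_exp[OF continuous_r(2), of 1] CL2_exp[OF continuous_r(1), of q]
  by (auto intro!: CL2_add CL2_diff CL2_shift prim_L2loc[OF f] prim_L2loc[OF g] simp: mult.assoc)

lemma continuous_U: "continuous_on UNIV (\<lambda>(t, x). U t x)"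
  unfolding U_def case_prod_unfold
  by (intro continuous_intros continuous_on_compose2[OF prim_continuous_on[OF f, of UNIV]]
      continuous_on_compose2[OF prim_continuous_on[OF g, of UNIV]]
      continuous_on_compose2[OF continuous_r(1)[of UNIV]]) auto

lemma CL2_U: "CL2 U"
  using CL2_continuous[OF continuous_U] .

lemma Ut_L2loc: "L2loc (Ut t)"
  unfolding Ut_def
  by (intro L2loc_add L2loc_shift L2loc_flip prim_L2loc[OF f] prim_L2loc[OF g] L2loc_continuous continuous_intros)

lemma U_H1: "U t \<in> H1" and wderiv_U: "AE x\<in>{0<..<1} in lborel. wderiv (U t) x = Ux t x"
  using H1_of_prim[OF prim_U_x, of "U t"] by auto

lemma time_deriv_U: "time_deriv U Ut"
proof (rule time_derivI[OF prim_U_t])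
  show "box_integrable U" by (rule box_integrable_continuous[OF continuous_U])
  show "box_integrable Ut"
    unfolding Ut_def
    using box_integrable_continuous[OF continuous_exp_mult[OF continuous_r(2), of 1]]
      box_integrable_travelling[OF prim_L2loc[OF f], of 1] box_integrable_travelling[OF prim_L2loc[OF g], of "-1"]
    by (intro box_integrable_add) auto
qed

lemma time_deriv_exp:
  assumes "\<And>t. (s has_real_derivative s' t) (at t)" "continuous_on UNIV s'"
  shows "time_deriv (\<lambda>t x. exp (q * x) * s t) (\<lambda>t x. exp (q * x) * s' t)"
proof (rule time_derivI)
  have "continuous_on UNIV s" using assms(1) DERIV_isCont continuous_at_imp_continuous_on by blast
  then show "box_integrable (\<lambda>t x. exp (q * x) * s t)" "box_integrable (\<lambda>t x. exp (q * x) * s' t)"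
    using box_integrable_continuous[OF continuous_exp_mult[of _ 1]] assms(2) by auto
qed (intro prim_cmult prim_C1 assms)

lemma wave_eq_U: "wave_eq U (\<lambda>t x. exp (q * x) * (r2 t - q\<^sup>2 * r t))"
  unfolding wave_eq_def
proof (intro allI impI)
  fix \<phi> :: "real \<times> real \<Rightarrow> real" assume \<phi>: "test_xt \<phi>"
  note t = test_xt_D[OF \<phi>]
  let ?A = "\<lambda>t x. f' (t + x)" and ?B = "\<lambda>t x. g' (t - x)"
  let ?E = "\<lambda>s t x. exp (q * x) * s t"
  have A: "CL2 ?A" and B: "CL2 ?B" by (auto intro: CL2_shift prim_L2loc[OF f] prim_L2loc[OF g])
  have E: "CL2 (?E s)" if "continuous_on UNIV s" for s using CL2_exp[OF that, of 1] by simp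
  have "dpair U (D_t (D_t \<phi>)) = - dpair Ut (D_t \<phi>)"
  proof -
    have "- dpair U (D_t (D_t \<phi>)) = dpair Ut (D_t \<phi>)" using time_deriv_U t unfolding time_deriv_def by blast
    then show ?thesis by linarith
  qed
  also have "dpair Ut (D_t \<phi>) = dpair ?A (D_t \<phi>) + dpair ?B (D_t \<phi>) + dpair (?E r1) (D_t \<phi>)"
    unfolding Ut_def by (simp add: dpair_add CL2_add A B E continuous_r t)
  also have "dpair (?E r1) (D_t \<phi>) = - dpair (?E r2) \<phi>"
    using time_deriv_exp[OF r1 r2] \<phi> by (auto simp: time_deriv_def)
  finally have 1: "dpair U (D_t (D_t \<phi>)) = - dpair ?A (D_t \<phi>) - dpair ?B (D_t \<phi>) + dpair (?E r2) \<phi>" by simp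
  have "dpair U (D_x (D_x \<phi>)) = - dpair Ux (D_x \<phi>)"
    using dpair_D_x[OF prim_has_weak_deriv[OF prim_U_x] t(1)] by simp
  also have "dpair Ux (D_x \<phi>) = dpair ?A (D_x \<phi>) - dpair ?B (D_x \<phi>) + dpair (\<lambda>t x. q * ?E r t x) (D_x \<phi>)"
    unfolding Ux_def mult.assoc
    by (simp add: dpair_add dpair_diff CL2_diff CL2_exp A B continuous_r t)
  also have "dpair (\<lambda>t x. q * ?E r t x) (D_x \<phi>) = - dpair (\<lambda>t x. q\<^sup>2 * ?E r t x) \<phi>"
  proof (rule dpair_D_x[OF _ \<phi>])
    fix t :: real
    have "prim (\<lambda>x. q * (exp (q * x) * r t)) (\<lambda>x. q\<^sup>2 * (exp (q * x) * r t))"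
      by (rule prim_C1) (auto intro!: derivative_eq_intros continuous_intros simp: power2_eq_square)
    then show "has_weak_deriv (\<lambda>x. q * (exp (q * x) * r t)) (\<lambda>x. q\<^sup>2 * (exp (q * x) * r t))"
      by (rule prim_has_weak_deriv)
  qed
  finally have 2: "dpair U (D_x (D_x \<phi>)) = - dpair ?A (D_x \<phi>) + dpair ?B (D_x \<phi>) + dpair (\<lambda>t x. q\<^sup>2 * ?E r t x) \<phi>"
    by simp
  have 3: "dpair (\<lambda>t x. exp (q * x) * (r2 t - q\<^sup>2 * r t)) \<phi> = dpair (?E r2) \<phi> - dpair (\<lambda>t x. q\<^sup>2 * ?E r t x) \<phi>"
    using dpair_diff[OF E[OF r2] CL2_exp[OF continuous_r(1), of "q\<^sup>2"] \<phi>] by (simp add: algebra_simps)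
  show "dpair U (D_t (D_t \<phi>)) = dpair U (D_x (D_x \<phi>)) + dpair (\<lambda>t x. exp (q * x) * (r2 t - q\<^sup>2 * r t)) \<phi>"
    unfolding 1 2 3 using transport_weak(1)[OF prim_L2loc[OF f] \<phi>] transport_weak(2)[OF prim_L2loc[OF g] \<phi>] by simp
qed

end

section \<open>Weak solutions are travelling waves\<close>

text \<open>
  A test function which is transported with velocity \<open>- \<sigma>\<close> up to the amplitude
  \<open>\<eta> t\<close>. The derivative \<open>D\<^sub>t - \<sigma> D\<^sub>x\<close> only acts
  on \<open>\<eta>\<close>.
\<close>

definition moving_product :: "real \<Rightarrow> (real \<Rightarrow> real) \<Rightarrow> (real \<Rightarrow> real) \<Rightarrow> real \<times> real \<Rightarrow> real" where
  "moving_product \<sigma> \<theta> \<eta> = (\<lambda>(x, t). \<theta> (x + \<sigma> * t) * \<eta> t)"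

lemma smooth_moving_product:
  assumes "smooth \<theta>" "smooth \<eta>" shows "smooth (moving_product \<sigma> \<theta> \<eta>)"
proof -
  have "smooth (\<lambda>z :: real \<times> real. \<theta> (inner (1, \<sigma>) z + 0) * \<eta> (inner (0, 1) z + 0))"
    by (intro smooth_mult smooth_compose_affine assms)
  then show ?thesis
    by (rule back_subst[where P=smooth]) (auto simp: moving_product_def fun_eq_iff)
qed

lemma D_moving_product:
  assumes "smooth \<theta>" "smooth \<eta>"
  shows "D_x (moving_product \<sigma> \<theta> \<eta>) = moving_product \<sigma> (deriv \<theta>) \<eta>"
    and "D_t (moving_product \<sigma> \<theta> \<eta>) =
      (\<lambda>z. \<sigma> * moving_product \<sigma> (deriv \<theta>) \<eta> z + moving_product \<sigma> \<theta> (deriv \<eta>) z)"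
proof -
  note s = smooth_moving_product[OF assms, of \<sigma>]
  have "D_x (moving_product \<sigma> \<theta> \<eta>) (x, t) = moving_product \<sigma> (deriv \<theta>) \<eta> (x, t)" for x t
  proof (rule DERIV_unique[OF D_x_DERIV[OF s]])
    have "((\<lambda>x. \<theta> (x + \<sigma> * t)) has_real_derivative deriv \<theta> (x + \<sigma> * t)) (at x)"
      using DERIV_shift[of \<theta> "deriv \<theta> (x + \<sigma> * t)" x "\<sigma> * t"] smooth_deriv(1)[OF assms(1)] by simp
    from DERIV_cmult_right[OF this, of "\<eta> t"]
    show "((\<lambda>x. moving_product \<sigma> \<theta> \<eta> (x, t)) has_real_derivative moving_product \<sigma> (deriv \<theta>) \<eta> (x, t)) (at x)"
      by (simp add: moving_product_def)
  qed
  then show "D_x (moving_product \<sigma> \<theta> \<eta>) = moving_product \<sigma> (deriv \<theta>) \<eta>" by auto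
  have "D_t (moving_product \<sigma> \<theta> \<eta>) (x, t) =
      \<sigma> * moving_product \<sigma> (deriv \<theta>) \<eta> (x, t) + moving_product \<sigma> \<theta> (deriv \<eta>) (x, t)" for x t
  proof (rule DERIV_unique[OF D_t_DERIV[OF s]])
    have l: "((\<lambda>t. x + \<sigma> * t) has_real_derivative \<sigma>) (at t)" by (auto intro!: derivative_eq_intros)
    have "((\<lambda>t. \<theta> (x + \<sigma> * t)) has_real_derivative deriv \<theta> (x + \<sigma> * t) * \<sigma>) (at t)"
      by (rule DERIV_chain2[OF smooth_deriv(1)[OF assms(1)] l])
    from DERIV_mult[OF this smooth_deriv(1)[OF assms(2)]]
    show "((\<lambda>t. moving_product \<sigma> \<theta> \<eta> (x, t)) has_real_derivative
      \<sigma> * moving_product \<sigma> (deriv \<theta>) \<eta> (x, t) + moving_product \<sigma> \<theta> (deriv \<eta>) (x, t)) (at t)"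
      by (simp add: moving_product_def algebra_simps)
  qed
  then show "D_t (moving_product \<sigma> \<theta> \<eta>) =
      (\<lambda>z. \<sigma> * moving_product \<sigma> (deriv \<theta>) \<eta> z + moving_product \<sigma> \<theta> (deriv \<eta>) z)" by auto
qed

lemma deriv_zero_outside:
  fixes \<theta> :: "real \<Rightarrow> real"
  assumes "\<And>y. y \<notin> {c..d} \<Longrightarrow> \<theta> y = 0" "y \<notin> {c..d}" shows "deriv \<theta> y = 0"
proof -
  have "(\<theta> has_field_derivative 0) (at y)"
  proof (rule has_field_derivative_transform_within_open[of "\<lambda>_. 0" 0 y "- {c..d}"])
    show "open (- {c..d})" by (intro open_Compl closed_atLeastAtMost)
  qed (use assms in auto)
  then show ?thesis by (rule DERIV_imp_deriv)
qed

lemma test_xt_moving_product: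
  assumes "smooth \<theta>" "smooth \<eta>" and "\<And>y. y \<notin> {c..d} \<Longrightarrow> \<theta> y = 0" "\<And>t. t \<notin> {\<alpha>..\<beta>} \<Longrightarrow> \<eta> t = 0"
    and "0 < \<alpha>" "\<And>t. t \<in> {\<alpha>..\<beta>} \<Longrightarrow> 0 < c - \<sigma> * t \<and> d - \<sigma> * t < 1"
  shows "test_xt (moving_product \<sigma> \<theta> \<eta>)"
  unfolding test_xt_def
proof (rule test_functionI[where K="(\<lambda>(y, t). (y - \<sigma> * t, t)) ` ({c..d} \<times> {\<alpha>..\<beta>})"])
  show "smooth (moving_product \<sigma> \<theta> \<eta>)" by (rule smooth_moving_product[OF assms(1,2)])
  show "compact ((\<lambda>(y, t). (y - \<sigma> * t, t)) ` ({c..d} \<times> {\<alpha>..\<beta>}))"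
    unfolding case_prod_unfold by (intro compact_continuous_image compact_Times continuous_intros) auto
  show "(\<lambda>(y, t). (y - \<sigma> * t, t)) ` ({c..d} \<times> {\<alpha>..\<beta>}) \<subseteq> {0<..<1} \<times> {0<..}"
    using assms(5) assms(6) by fastforce
  show "z \<in> (\<lambda>(y, t). (y - \<sigma> * t, t)) ` ({c..d} \<times> {\<alpha>..\<beta>})" if "moving_product \<sigma> \<theta> \<eta> z \<noteq> 0" for z
  proof -
    obtain x t where z: "z = (x, t)" by force
    have "x + \<sigma> * t \<in> {c..d}" "t \<in> {\<alpha>..\<beta>}"
      using that assms(3)[of "x + \<sigma> * t"] assms(4)[of t] by (auto simp: moving_product_def z)
    then show ?thesis unfolding z by (intro image_eqI[of _ _ "(x + \<sigma> * t, t)"]) auto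
  qed
qed

definition extend0 :: "(real \<Rightarrow> real) \<Rightarrow> real \<Rightarrow> real" where
  "extend0 h = (\<lambda>x. indicator {0<..<1} x * h x)"

lemma L2loc_extend0: "h \<in> L2 \<Longrightarrow> L2loc (extend0 h)"
  unfolding extend0_def by (rule L2_imp_L2loc)

text \<open>
  In the moving coordinate \<open>y = x + \<sigma> t\<close> the hypothesis says that the pairing
  of \<open>a t\<close> with a fixed test function \<open>\<theta>\<close> of \<open>y\<close> has
  derivative 0 in the sense of distributions. The pairing is continuous, hence constant, as long
  as the support of \<open>\<theta>\<close> stays inside the moving interval; this forces \<open>a
  s\<close> and \<open>a t\<close> to agree where their moving intervals overlap.
\<close>

lemma transported_overlap:
  fixes \<sigma> :: real
  assumes a: "CL2 a" and \<sigma>: "\<bar>\<sigma>\<bar> = 1"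
    and weak: "\<And>\<theta> \<eta>. smooth \<theta> \<Longrightarrow> smooth \<eta> \<Longrightarrow> test_xt (moving_product \<sigma> \<theta> \<eta>) \<Longrightarrow>
      dpair a (moving_product \<sigma> \<theta> (deriv \<eta>)) = 0"
    and st: "0 \<le> s" "s < t"
  shows "AE y in lborel. y \<in> {max (\<sigma> * s) (\<sigma> * t)<..<1 + min (\<sigma> * s) (\<sigma> * t)} \<longrightarrow>
    extend0 (a t) (y - \<sigma> * t) = extend0 (a s) (y - \<sigma> * s)"
proof (cases "max (\<sigma> * s) (\<sigma> * t) < 1 + min (\<sigma> * s) (\<sigma> * t)")
  case True
  let ?lo = "max (\<sigma> * s) (\<sigma> * t)" and ?hi = "1 + min (\<sigma> * s) (\<sigma> * t)"
  have L: "L2loc (\<lambda>y. extend0 (a \<tau>) (y - \<sigma> * \<tau>))" if "\<tau> \<ge> 0" for \<tau>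
    using L2loc_shift[OF L2loc_extend0[OF CL2_L2[OF a that]], of "- \<sigma> * \<tau>"] by (simp add: algebra_simps)
  have bd: "?lo \<ge> \<sigma> * \<tau> \<and> ?hi \<le> 1 + \<sigma> * \<tau>" if "\<tau> \<in> {s..t}" for \<tau>
  proof -
    have "\<sigma> = 1 \<or> \<sigma> = -1" using \<sigma> by linarith
    then show ?thesis using that by auto
  qed
  have "AE y in lborel. y \<in> {?lo<..<?hi} \<longrightarrow> extend0 (a t) (y - \<sigma> * t) - extend0 (a s) (y - \<sigma> * s) = 0"
  proof (rule AE_zero_if_orthogonal[OF _ True])
    show "L2loc (\<lambda>y. extend0 (a t) (y - \<sigma> * t) - extend0 (a s) (y - \<sigma> * s))"
      using st by (intro L2loc_diff L) auto
    fix \<theta> :: "real \<Rightarrow> real" assume \<theta>: "test_function {?lo<..<?hi} \<theta>"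
    obtain c d where cd: "?lo < c" "c < d" "d < ?hi" "\<And>y. y \<notin> {c..d} \<Longrightarrow> \<theta> y = 0"
      using test_function_real_support[OF \<theta> True] by metis
    have s\<theta>: "smooth \<theta>" using \<theta> by (simp add: test_function_def)
    have c\<theta>: "continuous_on UNIV (\<lambda>z :: real \<times> real. \<theta> (fst z + \<sigma> * snd z))"
      by (intro continuous_on_compose2[OF smooth_continuous[OF s\<theta>, of UNIV]] continuous_intros) auto
    define M where "M = (\<lambda>\<tau>. LINT x:{0<..<1}|lborel. a \<tau> x * \<theta> (x + \<sigma> * \<tau>))"
    have cM: "continuous_on {0..} M" using CL2_pairing_continuous[OF a c\<theta>] by (simp add: M_def)
    have "M t = M s"
    proof (rule du_bois_reymond[where k=M and a=s and b=t])
      show "continuous_on {s..t} M" by (rule continuous_on_subset[OF cM]) (use st in auto)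
      fix \<eta> :: "real \<Rightarrow> real" assume \<eta>: "test_function {s<..<t} \<eta>"
      obtain \<alpha> \<beta> where ab: "s < \<alpha>" "\<alpha> < \<beta>" "\<beta> < t" "\<And>y. y \<notin> {\<alpha>..\<beta>} \<Longrightarrow> \<eta> y = 0"
        using test_function_real_support[OF \<eta> st(2)] by metis
      have s\<eta>: "smooth \<eta>" using \<eta> by (simp add: test_function_def)
      have "test_xt (moving_product \<sigma> \<theta> \<eta>)"
      proof (rule test_xt_moving_product[OF s\<theta> s\<eta> cd(4) ab(4)])
        fix \<tau> assume "\<tau> \<in> {\<alpha>..\<beta>}"
        then have "?lo \<ge> \<sigma> * \<tau> \<and> ?hi \<le> 1 + \<sigma> * \<tau>" using bd[of \<tau>] ab by auto
        then show "0 < c - \<sigma> * \<tau> \<and> d - \<sigma> * \<tau> < 1" using cd by linarith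
      qed (use st ab in auto)
      from weak[OF s\<theta> s\<eta> this] have "0 = (LINT \<tau>:{0<..}|lborel. M \<tau> * deriv \<eta> \<tau>)"
        by (simp add: dpair_def moving_product_def M_def mult.assoc[symmetric])
      also have "\<dots> = (LINT \<tau>:{s<..<t}|lborel. M \<tau> * deriv \<eta> \<tau>)"
        unfolding set_lebesgue_integral_def
      proof (rule Bochner_Integration.integral_cong[OF refl])
        fix \<tau> :: real
        have "deriv \<eta> \<tau> = 0" if "\<tau> \<notin> {\<alpha>..\<beta>}" by (rule deriv_zero_outside[OF ab(4) that])
        then show "indicator {0<..} \<tau> *\<^sub>R (M \<tau> * deriv \<eta> \<tau>) = indicator {s<..<t} \<tau> *\<^sub>R (M \<tau> * deriv \<eta> \<tau>)"
          using ab st by (cases "\<tau> \<in> {\<alpha>..\<beta>}") (auto simp: indicator_def)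
      qed
      finally show "(LINT \<tau>:{s<..<t}|lborel. M \<tau> * deriv \<eta> \<tau>) = 0" by simp
    qed (use st in auto)
    have M': "M \<tau> = (LINT y:{?lo<..<?hi}|lborel. extend0 (a \<tau>) (y - \<sigma> * \<tau>) * \<theta> y)"
      and i: "set_integrable lborel {?lo<..<?hi} (\<lambda>y. extend0 (a \<tau>) (y - \<sigma> * \<tau>) * \<theta> y)"
      if \<tau>: "\<tau> \<in> {s, t}" for \<tau>
    proof -
      have "M \<tau> = (LINT x|lborel. extend0 (a \<tau>) x * \<theta> (x + \<sigma> * \<tau>))"
        by (simp add: M_def extend0_def set_lebesgue_integral_def mult.assoc)
      also have "\<dots> = (LINT y|lborel. extend0 (a \<tau>) (y - \<sigma> * \<tau>) * \<theta> y)"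
        using lborel_integral_real_affine[of 1 "\<lambda>y. extend0 (a \<tau>) (y - \<sigma> * \<tau>) * \<theta> y" "\<sigma> * \<tau>"]
        by (simp add: add.commute)
      also have "\<dots> = (LINT y:{?lo<..<?hi}|lborel. extend0 (a \<tau>) (y - \<sigma> * \<tau>) * \<theta> y)"
        unfolding set_lebesgue_integral_def
      proof (rule Bochner_Integration.integral_cong[OF refl])
        fix y :: real
        show "extend0 (a \<tau>) (y - \<sigma> * \<tau>) * \<theta> y = indicator {?lo<..<?hi} y *\<^sub>R (extend0 (a \<tau>) (y - \<sigma> * \<tau>) * \<theta> y)"
          using cd by (cases "y \<in> {c..d}") (auto simp: indicator_def)
      qed
      finally show "M \<tau> = (LINT y:{?lo<..<?hi}|lborel. extend0 (a \<tau>) (y - \<sigma> * \<tau>) * \<theta> y)" .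
      show "set_integrable lborel {?lo<..<?hi} (\<lambda>y. extend0 (a \<tau>) (y - \<sigma> * \<tau>) * \<theta> y)"
        unfolding set_integrable_Ioo_Icc
        using that st by (intro L2loc_integrable L2loc_continuous_mult L smooth_continuous[OF s\<theta>]) auto
    qed
    show "(LINT y:{?lo<..<?hi}|lborel. (extend0 (a t) (y - \<sigma> * t) - extend0 (a s) (y - \<sigma> * s)) * \<theta> y) = 0"
      using set_integral_diff(2)[OF i[of t] i[of s]] M'[of t] M'[of s] \<open>M t = M s\<close>
      by (simp add: left_diff_distrib)
  qed
  then show ?thesis by simp
next
  case False
  then show ?thesis by (intro AE_I2 impI) (use False in force)
qed

text \<open>
  The profile is glued from the integer times: \<open>A\<close> takes on the \<open>n\<close>-th
  unit interval, moving left or right with \<open>\<sigma>\<close>, the values of \<open>a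
  n\<close>. Every interval at time \<open>t\<close> is covered, up to a point, by two of these,
  and the overlaps are consistent.
\<close>

lemma transported:
  fixes \<sigma> :: real
  assumes a: "CL2 a" and \<sigma>: "\<bar>\<sigma>\<bar> = 1"
    and weak: "\<And>\<theta> \<eta>. smooth \<theta> \<Longrightarrow> smooth \<eta> \<Longrightarrow> test_xt (moving_product \<sigma> \<theta> \<eta>) \<Longrightarrow>
      dpair a (moving_product \<sigma> \<theta> (deriv \<eta>)) = 0"
  obtains A where "L2loc A" "\<And>t. t \<ge> 0 \<Longrightarrow> AE x\<in>{0<..<1} in lborel. a t x = A (x + \<sigma> * t)"
proof -
  define k where "k = (\<lambda>y :: real. if \<sigma> = 1 then nat \<lfloor>y\<rfloor> else nat \<lceil>- y\<rceil>)"
  have \<sigma>': "\<sigma> = 1 \<or> \<sigma> = -1" using \<sigma> by linarith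
  have k: "k y = n" if "y \<in> {\<sigma> * real n<..<\<sigma> * real n + 1}" for y n
  proof (cases "\<sigma> = 1")
    case True
    then have "\<lfloor>y\<rfloor> = int n" using that by (intro floor_unique) auto
    then show ?thesis by (simp add: k_def True)
  next
    case False
    then have "\<lceil>- y\<rceil> = int n" using that \<sigma>' by (intro ceiling_unique) auto
    then show ?thesis using False by (simp add: k_def)
  qed
  have kb: "k y \<le> nat \<lceil>\<bar>y\<bar>\<rceil>" for y
  proof -
    have "\<lfloor>y\<rfloor> \<le> \<lceil>\<bar>y\<bar>\<rceil>" "\<lceil>- y\<rceil> \<le> \<lceil>\<bar>y\<bar>\<rceil>" by (linarith, rule ceiling_mono, simp)
    then show ?thesis unfolding k_def by (metis nat_mono)
  qed
  have mk[measurable]: "k \<in> measurable borel (count_space UNIV)"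
    unfolding k_def by (cases "\<sigma> = 1") (auto, measurable)
  define \<alpha> where "\<alpha> = (\<lambda>n y. extend0 (a (real n)) (y - \<sigma> * real n))"
  have L: "L2loc (\<alpha> n)" for n
    using L2loc_shift[OF L2loc_extend0[OF CL2_L2[OF a, of "real n"]], of "- \<sigma> * real n"]
    by (simp add: \<alpha>_def algebra_simps)
  define A where "A = (\<lambda>y. \<alpha> (k y) y)"
  have mA: "A \<in> borel_measurable borel"
    unfolding A_def by (rule measurable_compose_countable[OF L2loc_measurable[OF L] mk])
  have "L2loc A"
    unfolding L2loc_def
  proof (intro conjI mA allI)
    fix l u :: real
    define N where "N = nat \<lceil>max \<bar>l\<bar> \<bar>u\<bar>\<rceil>"
    have kN: "k y \<in> {..N}" if "y \<in> {l..u}" for y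
      using kb[of y] that unfolding N_def by (auto intro!: order_trans[OF kb] nat_mono ceiling_mono)
    have "set_integrable lborel {l..u} (\<lambda>y. \<Sum>n\<le>N. (\<alpha> n y)\<^sup>2)"
      unfolding set_integrable_def scaleR_sum_right
      by (intro Bochner_Integration.integrable_sum) (use L2loc_square_integrable[OF L] in \<open>simp add: set_integrable_def\<close>)
    then show "set_integrable lborel {l..u} (\<lambda>y. (A y)\<^sup>2)"
    proof (rule set_integrable_bound)
      show "set_borel_measurable lborel {l..u} (\<lambda>y. (A y)\<^sup>2)"
        using mA unfolding set_borel_measurable_def by measurable
      show "AE y in lborel. y \<in> {l..u} \<longrightarrow> norm ((A y)\<^sup>2) \<le> norm (\<Sum>n\<le>N. (\<alpha> n y)\<^sup>2)"
      proof (intro AE_I2 impI)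
        fix y assume "y \<in> {l..u}"
        from member_le_sum[OF kN[OF this], of "\<lambda>n. (\<alpha> n y)\<^sup>2"]
        show "norm ((A y)\<^sup>2) \<le> norm (\<Sum>n\<le>N. (\<alpha> n y)\<^sup>2)" by (simp add: A_def sum_nonneg)
      qed
    qed
  qed
  moreover have "AE x\<in>{0<..<1} in lborel. a t x = A (x + \<sigma> * t)" if t: "t \<ge> 0" for t
  proof -
    have ov: "AE y in lborel. y \<in> {\<sigma> * t<..<\<sigma> * t + 1} \<inter> {\<sigma> * real n<..<\<sigma> * real n + 1} \<longrightarrow> extend0 (a t) (y - \<sigma> * t) = \<alpha> n y" for n
    proof (cases "t = real n")
      case False
      then consider "t < real n" | "real n < t" by linarith
      then show ?thesis
      proof cases
        case 1
        have "AE y in lborel. y \<in> {max (\<sigma> * t) (\<sigma> * real n)<..<1 + min (\<sigma> * t) (\<sigma> * real n)} \<longrightarrow>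
          extend0 (a (real n)) (y - \<sigma> * real n) = extend0 (a t) (y - \<sigma> * t)"
          by (rule transported_overlap[OF a \<sigma> _ t 1]) (rule weak)
        then show ?thesis
          by eventually_elim (auto simp: \<alpha>_def min_def max_def split: if_splits)
      next
        case 2
        have "AE y in lborel. y \<in> {max (\<sigma> * real n) (\<sigma> * t)<..<1 + min (\<sigma> * real n) (\<sigma> * t)} \<longrightarrow>
          extend0 (a t) (y - \<sigma> * t) = extend0 (a (real n)) (y - \<sigma> * real n)"
          by (rule transported_overlap[OF a \<sigma> _ of_nat_0_le_iff 2]) (rule weak)
        then show ?thesis
          by eventually_elim (auto simp: \<alpha>_def min_def max_def split: if_splits)
      qed
    qed (simp add: \<alpha>_def)
    define n where "n = nat \<lfloor>t\<rfloor>"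
    have n: "real n \<le> t" "t < real n + 1" using t by (auto simp: n_def)
    have "AE y in lborel. y \<in> {\<sigma> * t<..<\<sigma> * t + 1} \<longrightarrow> extend0 (a t) (y - \<sigma> * t) = A y"
      using ov[of n] ov[of "Suc n"] AE_lborel_singleton[of "\<sigma> * real n"] AE_lborel_singleton[of "\<sigma> * real n + 1"]
    proof eventually_elim
      case (elim y)
      show ?case
      proof
        assume y: "y \<in> {\<sigma> * t<..<\<sigma> * t + 1}"
        have "y \<in> {\<sigma> * real n<..<\<sigma> * real n + 1} \<or> y \<in> {\<sigma> * real (Suc n)<..<\<sigma> * real (Suc n) + 1}"
          using \<sigma>' y elim(3,4) n by auto
        then show "extend0 (a t) (y - \<sigma> * t) = A y"
        proof
          assume "y \<in> {\<sigma> * real n<..<\<sigma> * real n + 1}"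
          then show ?thesis using elim(1) y k[of y n] by (auto simp: A_def)
        next
          assume "y \<in> {\<sigma> * real (Suc n)<..<\<sigma> * real (Suc n) + 1}"
          then show ?thesis using elim(2) y k[of y "Suc n"] by (auto simp: A_def)
        qed
      qed
    qed
    then have "AE x in lborel. x + \<sigma> * t \<in> {\<sigma> * t<..<\<sigma> * t + 1} \<longrightarrow> extend0 (a t) (x + \<sigma> * t - \<sigma> * t) = A (x + \<sigma> * t)"
    proof -
      assume *: "AE y in lborel. y \<in> {\<sigma> * t<..<\<sigma> * t + 1} \<longrightarrow> extend0 (a t) (y - \<sigma> * t) = A y"
      have d: "distr lborel borel (\<lambda>x. \<sigma> * t + x) = (lborel :: real measure)"
        by (rule lborel_distr_plus)
      have m: "(\<lambda>x. \<sigma> * t + x) \<in> measurable lborel borel" by simp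
      have "extend0 (a t) \<in> borel_measurable borel"
        using L2loc_measurable[OF L2loc_extend0[OF CL2_L2[OF a t]]] .
      then have s: "{y. y \<in> {\<sigma> * t<..<\<sigma> * t + 1} \<longrightarrow> extend0 (a t) (y - \<sigma> * t) = A y} \<in> sets borel"
        using mA by measurable
      show ?thesis
        using * AE_distr_iff[OF m, of "\<lambda>y. y \<in> {\<sigma> * t<..<\<sigma> * t + 1} \<longrightarrow> extend0 (a t) (y - \<sigma> * t) = A y"] s
        unfolding d by (simp add: add.commute)
    qed
    then show ?thesis by eventually_elim (auto simp: extend0_def)
  qed
  ultimately show ?thesis using that by blast
qed

lemma D_x_linear:
  assumes "smooth \<phi>" "smooth \<psi>"
  shows "D_x (\<lambda>z. c * \<phi> z + \<psi> z) = (\<lambda>z. c * D_x \<phi> z + D_x \<psi> z)"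
proof -
  have "D_x (\<lambda>z. c * \<phi> z + \<psi> z) (x, t) = c * D_x \<phi> (x, t) + D_x \<psi> (x, t)" for x t
  proof (rule DERIV_unique[OF D_x_DERIV])
    show "smooth (\<lambda>z. c * \<phi> z + \<psi> z)" by (intro smooth_add smooth_mult smooth_const assms)
    show "((\<lambda>x. c * \<phi> (x, t) + \<psi> (x, t)) has_real_derivative c * D_x \<phi> (x, t) + D_x \<psi> (x, t)) (at x)"
      by (intro DERIV_add DERIV_cmult D_x_DERIV assms)
  qed
  then show ?thesis by auto
qed

lemma D_t_D_x_moving_product:
  assumes "smooth \<theta>" "smooth \<eta>"
  shows "D_t (D_x (moving_product \<sigma> \<theta> \<eta>)) = D_x (D_t (moving_product \<sigma> \<theta> \<eta>))"
  using assms smooth_deriv(2)[OF assms(1)] smooth_deriv(2)[OF assms(2)]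
  by (simp add: D_moving_product D_x_linear smooth_moving_product)

text \<open>
  The functions \<open>F' \<plusminus> F\<^sub>x\<close> are transported to the left and to the
  right, and half their profiles are the derivatives of \<open>f\<close> and of \<open>g\<close>.
  This determines \<open>F\<close> up to a function of time, which is constant because
  \<open>F'\<close> is the time derivative of \<open>F\<close>. The hypothesis on the wave
  equation is restricted to products of the form \<open>moving_product\<close>, whose mixed
  derivatives visibly commute.
\<close>

lemma weak_wave_is_travelling:
  assumes H1: "\<And>t. t \<ge> 0 \<Longrightarrow> F t \<in> H1"
    and CF: "CL2 F" "CL2 (\<lambda>t. wderiv (F t))" "CL2 F'"
    and c0: "continuous_on {0..} (\<lambda>t. F t 0)"
    and td: "time_deriv F F'"
    and wave: "\<And>\<sigma> \<theta> \<eta>. smooth \<theta> \<Longrightarrow> smooth \<eta> \<Longrightarrow> test_xt (moving_product \<sigma> \<theta> \<eta>) \<Longrightarrow>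
      dpair F (D_t (D_t (moving_product \<sigma> \<theta> \<eta>))) = dpair F (D_x (D_x (moving_product \<sigma> \<theta> \<eta>)))"
  obtains f f' g g' where "prim f f'" "prim g g'" "f 0 = 0"
    "\<And>t x. t \<ge> 0 \<Longrightarrow> x \<in> {0..1} \<Longrightarrow> F t x = f (t + x) + g (t - x)"
    "\<And>t. t \<ge> 0 \<Longrightarrow> AE x\<in>{0<..<1} in lborel. F' t x = f' (t + x) + g' (t - x)"
proof -
  let ?Fx = "\<lambda>t. wderiv (F t)"
  have wd: "has_weak_deriv (F t) (?Fx t)" if "t > 0" for t using wderiv_H1[OF H1[of t]] that by simp
  have weak: "dpair (\<lambda>t x. F' t x + \<sigma> * ?Fx t x) (moving_product \<sigma> \<theta> (deriv \<eta>)) = 0"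
    if \<sigma>: "\<bar>\<sigma>\<bar> = 1" and s: "smooth \<theta>" "smooth \<eta>" and t: "test_xt (moving_product \<sigma> \<theta> \<eta>)" for \<sigma> \<theta> \<eta>
  proof -
    let ?\<phi> = "moving_product \<sigma> \<theta> \<eta>"
    note tD = test_xt_D[OF t]
    have e: "moving_product \<sigma> \<theta> (deriv \<eta>) = (\<lambda>z. 1 * D_t ?\<phi> z + (-\<sigma>) * D_x ?\<phi> z)"
      by (auto simp: D_moving_product[OF s] fun_eq_iff)
    have comm: "D_t (D_x ?\<phi>) = D_x (D_t ?\<phi>)" by (rule D_t_D_x_moving_product[OF s])
    have 1: "dpair F' (D_t ?\<phi>) = dpair ?Fx (D_x ?\<phi>)"
      using td tD wave[OF s t] dpair_D_x[OF wd tD(1)] by (auto simp: time_deriv_def dest: spec[of _ "D_t ?\<phi>"])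
    have "- dpair F (D_t (D_x ?\<phi>)) = dpair F' (D_x ?\<phi>)"
      using td tD(1) unfolding time_deriv_def by blast
    then have 2: "dpair F' (D_x ?\<phi>) = dpair ?Fx (D_t ?\<phi>)"
      using dpair_D_x[OF wd tD(2)] comm by simp
    have C: "CL2 (\<lambda>t x. \<sigma> * ?Fx t x)" by (rule CL2_cmult[OF CF(2)])
    have "dpair (\<lambda>t x. F' t x + \<sigma> * ?Fx t x) \<psi> = dpair F' \<psi> + \<sigma> * dpair ?Fx \<psi>" if "test_xt \<psi>" for \<psi>
      using dpair_add[OF CF(3) C that] by (simp add: dpair_cmult)
    then have "dpair (\<lambda>t x. F' t x + \<sigma> * ?Fx t x) (moving_product \<sigma> \<theta> (deriv \<eta>))
      = dpair F' (D_t ?\<phi>) + \<sigma> * dpair ?Fx (D_t ?\<phi>) - \<sigma> * (dpair F' (D_x ?\<phi>) + \<sigma> * dpair ?Fx (D_x ?\<phi>))"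
      unfolding e by (subst dpair_test_diff[OF CL2_add[OF CF(3) C] tD(2,1)]) (simp add: tD)
    also have "\<dots> = dpair ?Fx (D_x ?\<phi>) - (\<sigma> * \<sigma>) * dpair ?Fx (D_x ?\<phi>)"
      unfolding 1 2 by (simp add: algebra_simps)
    also have "\<sigma> * \<sigma> = 1" using \<sigma> by (metis abs_mult_self_eq mult_1)
    finally show ?thesis by simp
  qed
  obtain A where A: "L2loc A" "\<And>t. t \<ge> 0 \<Longrightarrow> AE x\<in>{0<..<1} in lborel. F' t x + 1 * ?Fx t x = A (x + 1 * t)"
    using transported[of "\<lambda>t x. F' t x + 1 * ?Fx t x" 1] weak[of 1] CL2_add[OF CF(3) CL2_cmult[OF CF(2), of 1]] by auto
  obtain B where B: "L2loc B" "\<And>t. t \<ge> 0 \<Longrightarrow> AE x\<in>{0<..<1} in lborel. F' t x + (-1) * ?Fx t x = B (x + (-1) * t)"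
    using transported[of "\<lambda>t x. F' t x + (-1) * ?Fx t x" "-1"] weak[of "-1"] CL2_add[OF CF(3) CL2_cmult[OF CF(2), of "-1"]] by auto
  define f' where "f' = (\<lambda>y. 1/2 * A y)"
  define g' where "g' = (\<lambda>y. 1/2 * B (0 - y))"
  have Lf: "L2loc f'" and Lg: "L2loc g'"
    unfolding f'_def g'_def by (intro L2loc_cmult L2loc_flip A B)+
  obtain f where f: "prim f f'" "f 0 = 0" using prim_of_integral[OF Lf] by metis
  obtain g0 where g0: "prim g0 g'" "g0 0 = 0" using prim_of_integral[OF Lg] by metis
  define g where "g = (\<lambda>y. g0 y + F 0 0)"
  have g: "prim g g'" "g 0 = F 0 0"
    using prim_add[OF g0(1) prim_const[of "F 0 0"]] g0(2) by (auto simp: g_def)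
  interpret U: dalembert 0 f f' g g' "\<lambda>_. 0" "\<lambda>_. 0" "\<lambda>_. 0"
    by unfold_locales (auto intro: f g)
  have ae: "AE x\<in>{0<..<1} in lborel. F' t x = U.Ut t x"
    and aex: "AE x\<in>{0<..<1} in lborel. ?Fx t x = U.Ux t x" if "t \<ge> 0" for t
  proof -
    note AB = A(2)[OF that] B(2)[OF that]
    have e: "U.Ut t x = f' (t + x) + g' (t - x)" "U.Ux t x = f' (t + x) - g' (t - x)" for x
      by (auto simp: U.Ut_def U.Ux_def)
    from AB show "AE x\<in>{0<..<1} in lborel. F' t x = U.Ut t x"
      unfolding e by eventually_elim (auto simp: f'_def g'_def add.commute)
    from AB show "AE x\<in>{0<..<1} in lborel. ?Fx t x = U.Ux t x"
      unfolding e by eventually_elim (auto simp: f'_def g'_def add.commute)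
  qed
  \<comment> \<open>The undetermined function of time.\<close>
  define \<rho> where "\<rho> = (\<lambda>t. F t 0 - U.U t 0)"
  have \<rho>: "F t x = U.U t x + \<rho> t" if t: "t \<ge> 0" and x: "x \<in> {0..1}" for t x
  proof -
    obtain Ft Gt where FG: "prim Ft Gt" "\<And>x. x \<in> {0..1} \<Longrightarrow> F t x = Ft x" "\<And>x. x \<in> {0<..<1} \<Longrightarrow> ?Fx t x = Gt x"
      using H1_repr[OF H1[OF t]] by metis
    have p: "prim (\<lambda>x. Ft x - U.U t x) (\<lambda>x. Gt x - U.Ux t x)" by (rule prim_diff[OF FG(1) U.prim_U_x])
    have z: "AE x\<in>{0<..<1} in lborel. Gt x - U.Ux t x = 0"
      using aex[OF t] by eventually_elim (use FG(3) in auto)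
    have "(LINT y:{0..x}|lborel. Gt y - U.Ux t y) = (LINT y:{0..x}|lborel. 0)"
    proof (rule set_lebesgue_integral_cong_AE)
      show "AE y\<in>{0..x} in lborel. Gt y - U.Ux t y = 0"
        using z AE_lborel_singleton[of 0] AE_lborel_singleton[of 1] by eventually_elim (use x in auto)
    qed (use L2loc_measurable[OF prim_L2loc[OF p]] in auto)
    then have "Ft x - U.U t x = Ft 0 - U.U t 0" using prim_eq[OF p, of 0 x] x by simp
    then show ?thesis using FG(2)[of x] FG(2)[of 0] x by (simp add: \<rho>_def)
  qed
  have c\<rho>: "continuous_on {0..} \<rho>"
    unfolding \<rho>_def
    by (intro continuous_intros c0 continuous_on_compose2[OF U.continuous_U, of _ "\<lambda>t. (t, 0)", simplified])
  have \<rho>0: "\<rho> t = 0" if t: "t \<ge> 0" for t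
  proof (cases "t = 0")
    case True
    then show ?thesis by (simp add: \<rho>_def U.U_def f g)
  next
    case False
    then have t: "t > 0" using t by simp
    have "\<rho> t = \<rho> 0"
    proof (rule du_bois_reymond[where k=\<rho> and a=0 and b=t])
      show "continuous_on {0..t} \<rho>" by (rule continuous_on_subset[OF c\<rho>]) auto
      fix \<eta> :: "real \<Rightarrow> real" assume \<eta>: "test_function {0<..<t} \<eta>"
      obtain \<alpha> \<beta> where ab: "0 < \<alpha>" "\<alpha> < \<beta>" "\<beta> < t" "\<And>y. y \<notin> {\<alpha>..\<beta>} \<Longrightarrow> \<eta> y = 0"
        using test_function_real_support[OF \<eta> t] by metis
      have s\<eta>: "smooth \<eta>" using \<eta> by (simp add: test_function_def)
      \<comment> \<open>Testing with a fixed bump in \<open>x\<close> times an arbitrary test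
        function of \<open>t\<close> isolates \<open>\<rho>\<close>.\<close>
      let ?\<theta> = "bump (1/2) (1/4)"
      let ?\<phi> = "moving_product 0 ?\<theta> \<eta>"
      have \<phi>: "test_xt ?\<phi>"
      proof (rule test_xt_moving_product[OF smooth_bump s\<eta> _ ab(4) ab(1)])
        show "bump (1/2) (1/4) y = 0" if "y \<notin> {1/4..3/4}" for y
          using that by (auto simp: bump_zero_iff abs_less_iff)
      qed auto
      have D: "D_t ?\<phi> = moving_product 0 ?\<theta> (deriv \<eta>)"
        by (simp add: D_moving_product[OF smooth_bump s\<eta>])
      have "dpair F (D_t ?\<phi>) = dpair U.U (D_t ?\<phi>)"
      proof -
        have "- dpair F (D_t ?\<phi>) = dpair F' ?\<phi>" "- dpair U.U (D_t ?\<phi>) = dpair U.Ut ?\<phi>"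
          using td U.time_deriv_U \<phi> unfolding time_deriv_def by blast+
        moreover have "dpair F' ?\<phi> = dpair U.Ut ?\<phi>" by (rule dpair_cong_AE[OF CF(3) U.CL2_Ut \<phi> ae]) simp
        ultimately show ?thesis by linarith
      qed
      then have "dpair (\<lambda>t x. F t x - U.U t x) (D_t ?\<phi>) = 0"
        using dpair_diff[OF CF(1) U.CL2_U test_xt_D(2)[OF \<phi>]] by simp
      then have "0 = (LINT \<tau>:{0<..}|lborel. LINT x:{0<..<1}|lborel. (F \<tau> x - U.U \<tau> x) * (?\<theta> x * deriv \<eta> \<tau>))"
        unfolding D by (simp add: dpair_def moving_product_def)
      also have "\<dots> = (LINT \<tau>:{0<..<t}|lborel. (\<rho> \<tau> * deriv \<eta> \<tau>) * (LINT x:{0<..<1}|lborel. ?\<theta> x))"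
        unfolding set_lebesgue_integral_def[of lborel "{0<..}"] set_lebesgue_integral_def[of lborel "{0<..<t}"]
      proof (rule Bochner_Integration.integral_cong[OF refl])
        fix \<tau> :: real
        have "deriv \<eta> \<tau> = 0" if "\<tau> \<notin> {\<alpha>..\<beta>}" by (rule deriv_zero_outside[OF ab(4) that])
        moreover have "(LINT x:{0<..<1}|lborel. (F \<tau> x - U.U \<tau> x) * (?\<theta> x * deriv \<eta> \<tau>)) = (\<rho> \<tau> * deriv \<eta> \<tau>) * (LINT x:{0<..<1}|lborel. ?\<theta> x)"
          if "\<tau> \<in> {\<alpha>..\<beta>}"
        proof -
          have "(LINT x:{0<..<1}|lborel. (F \<tau> x - U.U \<tau> x) * (?\<theta> x * deriv \<eta> \<tau>)) = (LINT x:{0<..<1}|lborel. (\<rho> \<tau> * deriv \<eta> \<tau>) * ?\<theta> x)"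
            by (intro set_lebesgue_integral_cong) (use \<rho>[of \<tau>] that ab in auto)
          then show ?thesis by simp
        qed
        ultimately show "indicator {0<..} \<tau> *\<^sub>R (LINT x:{0<..<1}|lborel. (F \<tau> x - U.U \<tau> x) * (?\<theta> x * deriv \<eta> \<tau>))
            = indicator {0<..<t} \<tau> *\<^sub>R ((\<rho> \<tau> * deriv \<eta> \<tau>) * (LINT x:{0<..<1}|lborel. ?\<theta> x))"
          using ab by (cases "\<tau> \<in> {\<alpha>..\<beta>}") (auto simp: indicator_def)
      qed
      also have "\<dots> = (LINT \<tau>:{0<..<t}|lborel. \<rho> \<tau> * deriv \<eta> \<tau>) * (LINT x:{0<..<1}|lborel. ?\<theta> x)" by simp
      finally have "(LINT \<tau>:{0<..<t}|lborel. \<rho> \<tau> * deriv \<eta> \<tau>) = 0 \<or> (LINT x:{0<..<1}|lborel. ?\<theta> x) = 0" by simp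
      moreover have "(LINT x:{0<..<1}|lborel. ?\<theta> x) \<noteq> 0"
      proof
        assume z: "(LINT x:{0<..<1}|lborel. ?\<theta> x) = 0"
        have i: "integrable lborel (\<lambda>x. indicator {0..1} x *\<^sub>R ?\<theta> x)"
          using set_integrable_continuous[OF smooth_continuous[OF smooth_bump]] by (simp add: set_integrable_def)
        have "AE x in lborel. indicator {0..1} x *\<^sub>R ?\<theta> x = 0"
          using integral_nonneg_eq_0_iff_AE[OF i] z[unfolded set_integral_Ioo_Icc] unfolding set_lebesgue_integral_def
          by (simp add: bump_nonneg)
        then have "AE x in lborel. x \<notin> {1/4<..<3/4::real}"
        proof eventually_elim
          case (elim x)
          show ?case
          proof
            assume x: "x \<in> {1/4<..<3/4::real}"
            then have "\<bar>x - 1/2\<bar> < 1/4" unfolding abs_less_iff by auto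
            then have "bump (1/2) (1/4) x > 0" by (simp only: bump_pos_iff)
            then show False using elim x by (simp add: indicator_def)
          qed
        qed
        then have "emeasure lborel {1/4<..<3/4::real} = 0"
          by (subst (asm) AE_iff_measurable[of "{1/4<..<3/4::real}"]) auto
        then show False by simp
      qed
      ultimately show "(LINT \<tau>:{0<..<t}|lborel. \<rho> \<tau> * deriv \<eta> \<tau>) = 0" by simp
    qed (use t in auto)
    then show ?thesis by (simp add: \<rho>_def U.U_def f g)
  qed
  show ?thesis
  proof (rule that[OF f(1) g(1) f(2)])
    show "F t x = f (t + x) + g (t - x)" if "t \<ge> 0" "x \<in> {0..1}" for t x
      using \<rho>[OF that] \<rho>0[OF that(1)] by (simp add: U.U_def)
    show "AE x\<in>{0<..<1} in lborel. F' t x = f' (t + x) + g' (t - x)" if "t \<ge> 0" for t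
      using ae[OF that] by (simp add: U.Ut_def)
  qed
qed

section \<open>Boundary traces\<close>

lemma nn_integral_square_eq:
  assumes "L2loc u"
  shows "(\<integral>\<^sup>+t\<in>{0..T}. ennreal ((u t)\<^sup>2) \<partial>lborel) = ennreal (LINT t:{0..T}|lborel. (u t)\<^sup>2)"
proof -
  have "(\<integral>\<^sup>+t\<in>{0..T}. ennreal ((u t)\<^sup>2) \<partial>lborel) = (\<integral>\<^sup>+t. ennreal (indicator {0..T} t *\<^sub>R (u t)\<^sup>2) \<partial>lborel)"
    by (intro nn_integral_cong) (auto simp: indicator_def)
  also have "\<dots> = ennreal (LINT t|lborel. indicator {0..T} t *\<^sub>R (u t)\<^sup>2)"
    by (rule nn_integral_eq_integral)
       (use L2loc_square_integrable[OF assms] in \<open>auto simp: set_integrable_def\<close>)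
  finally show ?thesis by (simp add: set_lebesgue_integral_def)
qed

text \<open>
  Continuity of translations, now in the space variable.
\<close>

lemma trace_profile_tendsto:
  assumes A: "L2loc A" and B: "L2loc B" and C: "continuous_on UNIV (\<lambda>(t, x). C t x)" and "e > 0"
  obtains \<delta> where "\<delta> > 0" "\<And>x. \<bar>x - \<xi>\<bar> < \<delta> \<Longrightarrow>
    (\<integral>\<^sup>+t\<in>{0..T}. ennreal ((A (t + x) + B (t - x) + C t x - (A (t + \<xi>) + B (t - \<xi>) + C t \<xi>))\<^sup>2) \<partial>lborel) < ennreal e"
proof -
  define a where "a = (\<lambda>x. LINT t:{0..T}|lborel. (A (x + t) - A (\<xi> + t))\<^sup>2)"
  define b where "b = (\<lambda>x. LINT t:{0..T}|lborel. (B (- x + t) - B (- \<xi> + t))\<^sup>2)"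
  define c where "c = (\<lambda>x. LINT t:{0..T}|lborel. (C t x - C t \<xi>)\<^sup>2)"
  have a: "(a \<longlongrightarrow> 0) (at \<xi>)" unfolding a_def by (rule L2loc_translation(1)[OF A])
  have "((\<lambda>s. LINT t:{0..T}|lborel. (B (s + t) - B (- \<xi> + t))\<^sup>2) \<longlongrightarrow> 0) (at (-\<xi>))"
    by (rule L2loc_translation(1)[OF B])
  moreover have "filterlim (\<lambda>x. - x) (at (-\<xi>)) (at \<xi>)"
    by (auto simp: filterlim_at eventually_at_filter intro!: tendsto_intros)
  ultimately have b: "(b \<longlongrightarrow> 0) (at \<xi>)" unfolding b_def by (rule filterlim_compose)
  have "continuous_on UNIV (\<lambda>(x, t). C t x)"
  proof -
    have "continuous_on UNIV (\<lambda>z :: real \<times> real. (snd z, fst z))" by (intro continuous_intros)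
    from continuous_on_compose2[OF C this] show ?thesis by (simp add: case_prod_unfold)
  qed
  from continuous_square_tendsto[OF this] have c: "(c \<longlongrightarrow> 0) (at \<xi>)" by (simp add: c_def)
  have "((\<lambda>x. 3 * (a x + b x + c x)) \<longlongrightarrow> 3 * (0 + 0 + 0)) (at \<xi>)" by (intro tendsto_intros a b c)
  then have "eventually (\<lambda>x. 3 * (a x + b x + c x) < e) (at \<xi>)"
    using order_tendstoD(2)[of _ "3 * (0 + 0 + 0)" _ e] \<open>e > 0\<close> by simp
  then obtain \<delta> where \<delta>: "\<delta> > 0" "\<And>x. x \<noteq> \<xi> \<Longrightarrow> \<bar>x - \<xi>\<bar> < \<delta> \<Longrightarrow> 3 * (a x + b x + c x) < e"
    unfolding eventually_at by (auto simp: dist_real_def)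
  have z: "a \<xi> = 0" "b \<xi> = 0" "c \<xi> = 0" by (auto simp: a_def b_def c_def)
  show ?thesis
  proof (rule that[OF \<delta>(1)])
    fix x assume "\<bar>x - \<xi>\<bar> < \<delta>"
    then have lt: "3 * (a x + b x + c x) < e" using \<delta>(2)[of x] z \<open>e > 0\<close> by (cases "x = \<xi>") auto
    define u where "u = (\<lambda>t. A (x + t) - A (\<xi> + t))"
    define v where "v = (\<lambda>t. B (- x + t) - B (- \<xi> + t))"
    define w where "w = (\<lambda>t. C t x - C t \<xi>)"
    have cC: "continuous_on UNIV (\<lambda>t. C t y)" for y
    proof -
      have "continuous_on UNIV (\<lambda>t::real. (t, y))" by (intro continuous_intros)
      from continuous_on_compose2[OF C this] show ?thesis by simp
    qed
    have L: "L2loc u" "L2loc v" "L2loc w" unfolding u_def v_def w_def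
      by (intro L2loc_diff L2loc_shift A B L2loc_continuous cC)+
    have Ls: "L2loc (\<lambda>t. u t + v t + w t)" by (intro L2loc_add L)
    note i = L[THEN L2loc_square_integrable, of 0 T]
    have "(LINT t:{0..T}|lborel. (u t + v t + w t)\<^sup>2) \<le> (LINT t:{0..T}|lborel. 3 * ((u t)\<^sup>2 + (v t)\<^sup>2 + (w t)\<^sup>2))"
    proof (rule set_integral_mono)
      show "(u t + v t + w t)\<^sup>2 \<le> 3 * ((u t)\<^sup>2 + (v t)\<^sup>2 + (w t)\<^sup>2)" for t
        using sum_squares_bound[of "u t" "v t"] sum_squares_bound[of "u t" "w t"] sum_squares_bound[of "v t" "w t"]
        by (simp add: power2_eq_square algebra_simps)
    qed (use i L2loc_square_integrable[OF Ls] in auto)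
    also have "\<dots> = 3 * (a x + b x + c x)"
      using i by (simp add: a_def b_def c_def u_def v_def w_def)
    also note lt
    finally have "(LINT t:{0..T}|lborel. (u t + v t + w t)\<^sup>2) < e" .
    then have "(\<integral>\<^sup>+t\<in>{0..T}. ennreal ((u t + v t + w t)\<^sup>2) \<partial>lborel) < ennreal e"
      unfolding nn_integral_square_eq[OF Ls] by (intro ennreal_lessI \<open>e > 0\<close>)
    also have "(\<lambda>t. (u t + v t + w t)\<^sup>2) = (\<lambda>t. (A (t + x) + B (t - x) + C t x - (A (t + \<xi>) + B (t - \<xi>) + C t \<xi>))\<^sup>2)"
      by (auto simp: u_def v_def w_def fun_eq_iff algebra_simps intro!: arg_cong[where f="\<lambda>x. x\<^sup>2"])
    finally show "(\<integral>\<^sup>+t\<in>{0..T}. ennreal ((A (t + x) + B (t - x) + C t x - (A (t + \<xi>) + B (t - \<xi>) + C t \<xi>))\<^sup>2) \<partial>lborel) < ennreal e"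
      by simp
  qed
qed

text \<open>
  A function that is almost everywhere a sum of travelling waves and a continuous function has a
  trace, and the trace is the value of this expression at the end point.
\<close>

lemma has_trace_iff:
  assumes A: "L2loc A" and B: "L2loc B" and C: "continuous_on UNIV (\<lambda>(t, x). C t x)" and \<xi>: "\<xi> \<in> {0, 1}"
    and G: "AE t in lborel. 0 < t \<longrightarrow> (AE x\<in>{0<..<1} in lborel. G t x = A (t + x) + B (t - x) + C t x)"
  shows "has_trace G \<xi> a \<longleftrightarrow> L2_loc a \<and> (AE t in lborel. 0 < t \<longrightarrow> a t = A (t + \<xi>) + B (t - \<xi>) + C t \<xi>)"
proof -
  note [measurable] = L2loc_measurable[OF A] L2loc_measurable[OF B]
  define P where "P = (\<lambda>t x. A (t + x) + B (t - x) + C t x)"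
  have mC[measurable]: "(\<lambda>(t, x). C t x) \<in> borel_measurable (lborel \<Otimes>\<^sub>M lborel)"
    unfolding lborel_prod using borel_measurable_continuous_onI[OF C] by simp
  have mP: "(\<lambda>(t, x). P t x) \<in> borel_measurable (lborel \<Otimes>\<^sub>M lborel)"
    unfolding P_def by measurable
  have mP1[measurable]: "(\<lambda>t. P t x) \<in> borel_measurable lborel" for x
    using measurable_compose[OF measurable_Pair1' mP, of x] mP by measurable
  have key: "\<exists>\<delta>>0. \<forall>x. \<bar>x - \<xi>\<bar> < \<delta> \<longrightarrow> (\<integral>\<^sup>+t\<in>{0..T}. ennreal ((P t x - P t \<xi>)\<^sup>2) \<partial>lborel) < ennreal e"
    if "e > 0" for T e
    using trace_profile_tendsto[OF A B C that, of \<xi> T] unfolding P_def by blast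
  show ?thesis
  proof
    assume R: "L2_loc a \<and> (AE t in lborel. 0 < t \<longrightarrow> a t = A (t + \<xi>) + B (t - \<xi>) + C t \<xi>)"
    then have ae: "AE t in lborel. 0 < t \<longrightarrow> a t = P t \<xi>" by (simp add: P_def)
    show "has_trace G \<xi> a"
      unfolding has_trace_def
    proof (intro conjI exI[of _ P] allI impI)
      show "L2_loc a" using R by simp
      show "(\<lambda>(t, x). P t x) \<in> borel_measurable (lborel \<Otimes>\<^sub>M lborel)" by (rule mP)
      show "AE t in lborel. 0 < t \<longrightarrow> (AE x\<in>{0<..<1} in lborel. P t x = G t x)"
        using G
      proof eventually_elim
        case (elim t)
        show ?case
        proof
          assume "0 < t"
          with elim have "AE x\<in>{0<..<1} in lborel. G t x = A (t + x) + B (t - x) + C t x" by simp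
          then show "AE x\<in>{0<..<1} in lborel. P t x = G t x" by eventually_elim (simp add: P_def)
        qed
      qed
      fix T e :: real assume "0 < T" "0 < e"
      obtain \<delta> where \<delta>: "\<delta> > 0" "\<And>x. \<bar>x - \<xi>\<bar> < \<delta> \<Longrightarrow> (\<integral>\<^sup>+t\<in>{0..T}. ennreal ((P t x - P t \<xi>)\<^sup>2) \<partial>lborel) < ennreal e"
        using key[OF \<open>0 < e\<close>] by blast
      have "(\<integral>\<^sup>+t\<in>{0..T}. ennreal ((P t x - a t)\<^sup>2) \<partial>lborel) = (\<integral>\<^sup>+t\<in>{0..T}. ennreal ((P t x - P t \<xi>)\<^sup>2) \<partial>lborel)" for x
      proof (rule nn_integral_cong_AE)
        show "AE t in lborel. ennreal ((P t x - a t)\<^sup>2) * indicator {0..T} t = ennreal ((P t x - P t \<xi>)\<^sup>2) * indicator {0..T} t"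
          using ae AE_lborel_singleton[of 0] by eventually_elim (auto simp: indicator_def)
      qed
      then show "\<exists>\<delta>>0. AE x in lborel. x \<in> {0<..<1} \<and> \<bar>x - \<xi>\<bar> < \<delta> \<longrightarrow>
          (\<integral>\<^sup>+t\<in>{0..T}. ennreal ((P t x - a t)\<^sup>2) \<partial>lborel) < ennreal e"
        using \<delta> by (intro exI[of _ \<delta>]) auto
    qed
  next
    assume L: "has_trace G \<xi> a"
    then obtain p where L2a: "L2_loc a" and mp: "(\<lambda>(t, x). p t x) \<in> borel_measurable (lborel \<Otimes>\<^sub>M lborel)"
      and pG: "AE t in lborel. 0 < t \<longrightarrow> (AE x\<in>{0<..<1} in lborel. p t x = G t x)"
      and pa: "\<And>T e. T > 0 \<Longrightarrow> e > 0 \<Longrightarrow> \<exists>\<delta>>0. AE x in lborel. x \<in> {0<..<1} \<and> \<bar>x - \<xi>\<bar> < \<delta> \<longrightarrow>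
           (\<integral>\<^sup>+t\<in>{0..T}. ennreal ((p t x - a t)\<^sup>2) \<partial>lborel) < ennreal e"
      unfolding has_trace_def by blast
    have "AE t in lborel. AE x in lborel. 0 < t \<longrightarrow> x \<in> {0<..<1} \<longrightarrow> p t x = P t x"
      using pG G
    proof eventually_elim
      case (elim t)
      show ?case
      proof (cases "0 < t")
        case True
        then have "AE x\<in>{0<..<1} in lborel. p t x = G t x"
          "AE x\<in>{0<..<1} in lborel. G t x = A (t + x) + B (t - x) + C t x" using elim by auto
        then show ?thesis by eventually_elim (auto simp: P_def)
      qed simp
    qed
    moreover have "Measurable.pred (lborel \<Otimes>\<^sub>M lborel) (\<lambda>z. 0 < fst z \<longrightarrow> snd z \<in> {0<..<1} \<longrightarrow> p (fst z) (snd z) = P (fst z) (snd z))"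
    proof -
      have [measurable]: "(\<lambda>z. p (fst z) (snd z)) \<in> borel_measurable (lborel \<Otimes>\<^sub>M lborel)"
        "(\<lambda>z. P (fst z) (snd z)) \<in> borel_measurable (lborel \<Otimes>\<^sub>M lborel)"
        using mp mP by (simp_all add: case_prod_unfold)
      show ?thesis by measurable
    qed
    ultimately have pP: "AE x in lborel. AE t in lborel. 0 < t \<longrightarrow> x \<in> {0<..<1} \<longrightarrow> p t x = P t x"
      using lborel_pair.AE_commute[of "\<lambda>t x. 0 < t \<longrightarrow> x \<in> {0<..<1} \<longrightarrow> p t x = P t x"]
      unfolding pred_def by blast
    define a' where "a' = (\<lambda>t. indicator {0..} t *\<^sub>R a t)"
    have [measurable]: "a' \<in> borel_measurable lborel"
      using L2a by (simp add: a'_def L2_loc_def set_borel_measurable_def)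
    \<comment> \<open>Compare both \<open>a\<close> and \<open>P\<close> at the end point with
      \<open>P\<close> at a common nearby \<open>x\<close>, chosen outside all exceptional null
      sets.\<close>
    have small: "(\<integral>\<^sup>+t\<in>{0..T}. ennreal ((a' t - P t \<xi>)\<^sup>2) \<partial>lborel) \<le> ennreal (4 * e)" if T: "T > 0" and e: "e > 0" for T e
    proof -
      obtain \<delta>1 where d1: "\<delta>1 > 0" "AE x in lborel. x \<in> {0<..<1} \<and> \<bar>x - \<xi>\<bar> < \<delta>1 \<longrightarrow>
           (\<integral>\<^sup>+t\<in>{0..T}. ennreal ((p t x - a t)\<^sup>2) \<partial>lborel) < ennreal e" using pa[OF T e] by blast
      obtain \<delta>2 where d2: "\<delta>2 > 0" "\<And>x. \<bar>x - \<xi>\<bar> < \<delta>2 \<Longrightarrow> (\<integral>\<^sup>+t\<in>{0..T}. ennreal ((P t x - P t \<xi>)\<^sup>2) \<partial>lborel) < ennreal e"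
        using key[OF e] by blast
      define \<delta> where "\<delta> = min 1 (min \<delta>1 \<delta>2)"
      have \<delta>: "\<delta> > 0" "\<delta> \<le> \<delta>1" "\<delta> \<le> \<delta>2" "\<delta> \<le> 1" using d1 d2 by (auto simp: \<delta>_def)
      have "\<exists>x. x \<in> {0<..<1} \<and> \<bar>x - \<xi>\<bar> < \<delta> \<and> (\<integral>\<^sup>+t\<in>{0..T}. ennreal ((p t x - a t)\<^sup>2) \<partial>lborel) < ennreal e
          \<and> (AE t in lborel. 0 < t \<longrightarrow> x \<in> {0<..<1} \<longrightarrow> p t x = P t x)"
      proof (rule ccontr)
        assume no: "\<not> ?thesis"
        define I where "I = (if \<xi> = 0 then {0<..<\<delta>} else {1-\<delta><..<1})"
        have I: "x \<in> {0<..<1} \<and> \<bar>x - \<xi>\<bar> < \<delta>" if "x \<in> I" for x using that \<xi> \<delta> by (auto simp: I_def split: if_splits)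
        have "AE x in lborel. x \<notin> I"
          using d1(2) pP
        proof eventually_elim
          case (elim x)
          show ?case using no elim I[of x] \<delta>(2) by force
        qed
        moreover have "I \<in> sets lborel" by (simp add: I_def)
        ultimately have "emeasure lborel I = 0" by (subst (asm) AE_iff_measurable[of I]) auto
        then show False using \<delta>(1) by (auto simp: I_def split: if_splits)
      qed
      then obtain x where x: "x \<in> {0<..<1}" "\<bar>x - \<xi>\<bar> < \<delta>" "(\<integral>\<^sup>+t\<in>{0..T}. ennreal ((p t x - a t)\<^sup>2) \<partial>lborel) < ennreal e"
          "AE t in lborel. 0 < t \<longrightarrow> x \<in> {0<..<1} \<longrightarrow> p t x = P t x" by blast
      have e1: "(\<integral>\<^sup>+t\<in>{0..T}. ennreal ((p t x - a t)\<^sup>2) \<partial>lborel) = (\<integral>\<^sup>+t\<in>{0..T}. ennreal ((P t x - a' t)\<^sup>2) \<partial>lborel)"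
      proof (rule nn_integral_cong_AE)
        show "AE t in lborel. ennreal ((p t x - a t)\<^sup>2) * indicator {0..T} t = ennreal ((P t x - a' t)\<^sup>2) * indicator {0..T} t"
          using x(4) AE_lborel_singleton[of 0] by eventually_elim (use x(1) in \<open>auto simp: indicator_def a'_def\<close>)
      qed
      have "(\<integral>\<^sup>+t\<in>{0..T}. ennreal ((a' t - P t \<xi>)\<^sup>2) \<partial>lborel)
          \<le> (\<integral>\<^sup>+t. 2 * (ennreal ((P t x - a' t)\<^sup>2) * indicator {0..T} t) + 2 * (ennreal ((P t x - P t \<xi>)\<^sup>2) * indicator {0..T} t) \<partial>lborel)"
      proof (rule nn_integral_mono)
        fix t
        have "(a' t - P t \<xi>)\<^sup>2 \<le> 2 * (P t x - a' t)\<^sup>2 + 2 * (P t x - P t \<xi>)\<^sup>2"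
          using sum_squares_bound[of "P t x - a' t" "P t \<xi> - P t x"] by (simp add: power2_eq_square algebra_simps)
        then have "ennreal ((a' t - P t \<xi>)\<^sup>2) \<le> ennreal (2 * (P t x - a' t)\<^sup>2 + 2 * (P t x - P t \<xi>)\<^sup>2)"
          by (rule ennreal_leI)
        also have "\<dots> = 2 * ennreal ((P t x - a' t)\<^sup>2) + 2 * ennreal ((P t x - P t \<xi>)\<^sup>2)"
          by (simp add: ennreal_mult)
        finally have "ennreal ((a' t - P t \<xi>)\<^sup>2) \<le> 2 * ennreal ((P t x - a' t)\<^sup>2) + 2 * ennreal ((P t x - P t \<xi>)\<^sup>2)" .
        then show "ennreal ((a' t - P t \<xi>)\<^sup>2) * indicator {0..T} t
          \<le> 2 * (ennreal ((P t x - a' t)\<^sup>2) * indicator {0..T} t) + 2 * (ennreal ((P t x - P t \<xi>)\<^sup>2) * indicator {0..T} t)"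
          by (auto simp: indicator_def)
      qed
      also have "\<dots> = 2 * (\<integral>\<^sup>+t\<in>{0..T}. ennreal ((P t x - a' t)\<^sup>2) \<partial>lborel) + 2 * (\<integral>\<^sup>+t\<in>{0..T}. ennreal ((P t x - P t \<xi>)\<^sup>2) \<partial>lborel)"
        by (subst nn_integral_add) (auto simp: nn_integral_cmult)
      also have "\<dots> \<le> 2 * ennreal e + 2 * ennreal e"
        using x(3) d2(2)[of x] x(2) \<delta>(3) unfolding e1
        by (intro add_mono mult_left_mono) (auto intro: less_imp_le)
      also have "\<dots> = ennreal (4 * e)"
        using e by (simp add: ennreal_mult'[symmetric] ennreal_plus[symmetric] flip: ennreal_numeral del: ennreal_plus)
      finally show ?thesis .
    qed
    have "AE t in lborel. 0 < t \<longrightarrow> t \<le> real n \<longrightarrow> a t = P t \<xi>" for n :: nat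
    proof (cases "n = 0")
      case False
      then have T: "real n > 0" by simp
      have "(\<integral>\<^sup>+t\<in>{0..real n}. ennreal ((a' t - P t \<xi>)\<^sup>2) \<partial>lborel) \<le> 0"
      proof (rule ennreal_le_epsilon)
        fix e :: real assume "e > 0"
        then show "(\<integral>\<^sup>+t\<in>{0..real n}. ennreal ((a' t - P t \<xi>)\<^sup>2) \<partial>lborel) \<le> 0 + ennreal e"
          using small[OF T, of "e / 4"] by simp
      qed
      then have "(\<integral>\<^sup>+t. ennreal ((a' t - P t \<xi>)\<^sup>2) * indicator {0..real n} t \<partial>lborel) = 0" by simp
      then have "AE t in lborel. ennreal ((a' t - P t \<xi>)\<^sup>2) * indicator {0..real n} t = 0"
        by (subst (asm) nn_integral_0_iff_AE) measurable
      then show ?thesis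
        by eventually_elim (auto simp: indicator_def a'_def split: if_splits)
    qed auto
    then have "AE t in lborel. \<forall>n::nat. 0 < t \<longrightarrow> t \<le> real n \<longrightarrow> a t = P t \<xi>"
      by (intro AE_all_countable[THEN iffD2] allI)
    then have "AE t in lborel. 0 < t \<longrightarrow> a t = P t \<xi>"
      by eventually_elim (meson real_arch_simple)
    then show "L2_loc a \<and> (AE t in lborel. 0 < t \<longrightarrow> a t = A (t + \<xi>) + B (t - \<xi>) + C t \<xi>)"
      using L2a by (simp add: P_def)
  qed
qed

lemma L2loc_imp_L2_loc: "L2loc a \<Longrightarrow> L2_loc a"
  by (auto simp: L2loc_def L2_loc_def set_borel_measurable_def)

section \<open>The norm of the state space\<close>

lemma norm_L2_sq: "(norm_L2 f)\<^sup>2 = (LINT x:{0<..<1}|lborel. (f x)\<^sup>2)"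
  by (simp add: norm_L2_def set_integral_square_nonneg)

lemma norm_L2_zero: assumes "AE x\<in>{0<..<1} in lborel. f x = 0" shows "norm_L2 f = 0"
proof -
  have "(LINT x:{0<..<1}|lborel. (f x)\<^sup>2) = 0"
    unfolding set_lebesgue_integral_def
    by (rule integral_eq_zero_AE) (use assms in eventually_elim, auto simp: indicator_def)
  then show ?thesis by (simp add: norm_L2_def)
qed

lemma norm_L2_zero_D: assumes "f \<in> L2" "norm_L2 f = 0" shows "AE x\<in>{0<..<1} in lborel. f x = 0"
proof -
  have i: "integrable lborel (\<lambda>x. indicator {0<..<1} x *\<^sub>R (f x)\<^sup>2)"
    using L2_square_integrable[OF assms(1)] by (simp add: set_integrable_def)
  have "(LINT x|lborel. indicator {0<..<1} x *\<^sub>R (f x)\<^sup>2) = 0"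
    using assms(2) norm_L2_sq[of f] by (simp add: set_lebesgue_integral_def)
  then have "AE x in lborel. indicator {0<..<1} x *\<^sub>R (f x)\<^sup>2 = 0"
    using integral_nonneg_eq_0_iff_AE[OF i] by simp
  then show ?thesis by eventually_elim (auto simp: indicator_def)
qed

lemma norm_L2_cong_AE:
  assumes "f \<in> L2" "g \<in> L2" "AE x\<in>{0<..<1} in lborel. f x = g x" shows "norm_L2 f = norm_L2 g"
proof -
  have "(LINT x:{0<..<1}|lborel. (f x)\<^sup>2) = (LINT x:{0<..<1}|lborel. (g x)\<^sup>2)"
    unfolding set_lebesgue_integral_def
  proof (rule integral_cong_AE)
    show "AE x in lborel. indicator {0<..<1} x *\<^sub>R (f x)\<^sup>2 = indicator {0<..<1} x *\<^sub>R (g x)\<^sup>2"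
      using assms(3) by eventually_elim (auto simp: indicator_def)
  qed (use L2_square_integrable[OF assms(1)] L2_square_integrable[OF assms(2)] in \<open>auto simp: set_integrable_def\<close>)
  then show ?thesis by (simp add: norm_L2_def)
qed

lemma H1_vanishing: assumes "\<And>x. x \<in> {0..1} \<Longrightarrow> f x = 0" shows "norm_L2 (wderiv f) = 0" "norm_L2 f = 0"
  using H1_of_prim(2)[OF prim_const[of 0], of f] assms by (auto intro!: norm_L2_zero)

lemma H1_minus:
  assumes "f \<in> H1" "g \<in> H1"
  shows "f - g \<in> H1" and "AE x\<in>{0<..<1} in lborel. wderiv (f - g) x = wderiv f x - wderiv g x"
proof -
  obtain F F' where F: "prim F F'" "\<And>x. x \<in> {0..1} \<Longrightarrow> f x = F x" "\<And>x. x \<in> {0<..<1} \<Longrightarrow> wderiv f x = F' x"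
    using H1_repr[OF assms(1)] by metis
  obtain G G' where G: "prim G G'" "\<And>x. x \<in> {0..1} \<Longrightarrow> g x = G x" "\<And>x. x \<in> {0<..<1} \<Longrightarrow> wderiv g x = G' x"
    using H1_repr[OF assms(2)] by metis
  note H = H1_of_prim[OF prim_diff[OF F(1) G(1)], of "f - g"]
  show "f - g \<in> H1" using H(1) F(2) G(2) by simp
  have "AE x\<in>{0<..<1} in lborel. wderiv (f - g) x = F' x - G' x" using H(2) F(2) G(2) by simp
  then show "AE x\<in>{0<..<1} in lborel. wderiv (f - g) x = wderiv f x - wderiv g x"
    by eventually_elim (use F(3) G(3) in auto)
qed

lemma norm_L2_wderiv_minus:
  assumes "f \<in> H1" "g \<in> H1"
  shows "norm_L2 (wderiv (f - g)) = norm_L2 (\<lambda>x. wderiv f x - wderiv g x)"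
  using wderiv_H1[OF assms(1)] wderiv_H1[OF assms(2)] wderiv_H1[OF H1_minus(1)[OF assms]] H1_minus(2)[OF assms]
  by (intro norm_L2_cong_AE L2_diff) auto

lemma H1_L2: "f \<in> H1 \<Longrightarrow> f \<in> L2"
proof -
  assume "f \<in> H1"
  then obtain F F' where F: "prim F F'" "\<And>x. x \<in> {0..1} \<Longrightarrow> f x = F x" "\<And>x. x \<in> {0<..<1} \<Longrightarrow> wderiv f x = F' x"
    using H1_repr by metis
  have L: "F \<in> L2" by (intro L2loc_imp_L2 L2loc_continuous prim_continuous_on[OF F(1)])
  have "set_borel_measurable lborel {0<..<1} F = set_borel_measurable lborel {0<..<1} f"
    unfolding set_borel_measurable_def by (rule measurable_cong) (use F(2) in \<open>auto simp: indicator_def\<close>)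
  moreover have "set_integrable lborel {0<..<1} (\<lambda>x. (F x)\<^sup>2) = set_integrable lborel {0<..<1} (\<lambda>x. (f x)\<^sup>2)"
    by (rule set_integrable_cong) (use F(2) in auto)
  ultimately show "f \<in> L2" using L by (simp add: L2_def)
qed

lemma H1_pointwise:
  assumes "f \<in> H1" "x \<in> {0..1}" "y \<in> {0..1}"
  shows "(f x)\<^sup>2 \<le> 2 * (f y)\<^sup>2 + 2 * (norm_L2 (wderiv f))\<^sup>2"
proof -
  obtain F F' where F: "prim F F'" "\<And>x. x \<in> {0..1} \<Longrightarrow> f x = F x" "\<And>x. x \<in> {0<..<1} \<Longrightarrow> wderiv f x = F' x"
    using H1_repr[OF assms(1)] by metis
  have n: "(norm_L2 (wderiv f))\<^sup>2 = (LINT x:{0..1}|lborel. (F' x)\<^sup>2)"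
    unfolding norm_L2_sq set_integral_Ioo_Icc[symmetric] by (intro set_lebesgue_integral_cong) (use F(3) in auto)
  have *: "(F b - F a)\<^sup>2 \<le> (norm_L2 (wderiv f))\<^sup>2" if "0 \<le> a" "a \<le> b" "b \<le> 1" for a b
  proof -
    have "(F b - F a)\<^sup>2 = (LINT x:{a..b}|lborel. F' x)\<^sup>2" using prim_eq[OF F(1) that(2)] by simp
    also have "\<dots> \<le> (b - a) * (LINT x:{a..b}|lborel. (F' x)\<^sup>2)" by (rule L2loc_cauchy_schwarz[OF prim_L2loc[OF F(1)] that(2)])
    also have "\<dots> \<le> 1 * (LINT x:{0..1}|lborel. (F' x)\<^sup>2)"
      using that by (intro mult_mono set_integral_square_mono prim_L2loc[OF F(1)] set_integral_square_nonneg) auto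
    finally show ?thesis using n by simp
  qed
  have "(F x - F y)\<^sup>2 \<le> (norm_L2 (wderiv f))\<^sup>2"
    using *[of x y] *[of y x] assms by (cases "x \<le> y") (auto simp: power2_commute)
  moreover have "(F x)\<^sup>2 \<le> 2 * (F y)\<^sup>2 + 2 * (F x - F y)\<^sup>2"
    using sum_squares_bound[of "F y" "F x - F y"] by (simp add: power2_eq_square algebra_simps)
  ultimately show ?thesis using F(2) assms by simp
qed

lemma H1_poincare: assumes "f \<in> H1" shows "(norm_L2 f)\<^sup>2 \<le> 2 * (f 0)\<^sup>2 + 2 * (norm_L2 (wderiv f))\<^sup>2"
proof -
  have "(norm_L2 f)\<^sup>2 \<le> (LINT x:{0<..<1::real}|lborel. 2 * (f 0)\<^sup>2 + 2 * (norm_L2 (wderiv f))\<^sup>2)"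
    unfolding norm_L2_sq
  proof (rule set_integral_mono)
    show "(f x)\<^sup>2 \<le> 2 * (f 0)\<^sup>2 + 2 * (LINT x:{0<..<1}|lborel. (wderiv f x)\<^sup>2)" if "x \<in> {0<..<1}" for x
      using H1_pointwise[OF assms, of x 0] that by (simp add: norm_L2_sq)
  qed (rule L2_square_integrable[OF H1_L2[OF assms]], simp add: set_integrable_Ioo_Icc set_integrable_continuous)
  then show ?thesis by (simp add: set_integral_Ioo_Icc set_integral_const_Icc)
qed

lemma H1_sobolev: assumes "f \<in> H1" shows "(f 0)\<^sup>2 \<le> 2 * (norm_L2 f)\<^sup>2 + 2 * (norm_L2 (wderiv f))\<^sup>2"
proof -
  have i: "set_integrable lborel {0<..<1} (\<lambda>x. 2 * (f x)\<^sup>2)"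
    using L2_square_integrable[OF H1_L2[OF assms]] by simp
  have j: "set_integrable lborel {0<..<1} (\<lambda>x::real. 2 * (norm_L2 (wderiv f))\<^sup>2)"
    by (simp add: set_integrable_Ioo_Icc set_integrable_continuous)
  have "(LINT x:{0<..<1::real}|lborel. (f 0)\<^sup>2) \<le> (LINT x:{0<..<1}|lborel. 2 * (f x)\<^sup>2 + 2 * (norm_L2 (wderiv f))\<^sup>2)"
  proof (rule set_integral_mono)
    show "(f 0)\<^sup>2 \<le> 2 * (f x)\<^sup>2 + 2 * (norm_L2 (wderiv f))\<^sup>2" if "x \<in> {0<..<1}" for x
      using H1_pointwise[OF assms, of 0 x] that by simp
    show "set_integrable lborel {0<..<1} (\<lambda>x. 2 * (f x)\<^sup>2 + 2 * (norm_L2 (wderiv f))\<^sup>2)"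
      by (rule set_integral_add(1)[OF i j])
  qed (auto simp: set_integrable_Ioo_Icc set_integrable_continuous)
  also have "\<dots> = 2 * (norm_L2 f)\<^sup>2 + 2 * (norm_L2 (wderiv f))\<^sup>2"
  proof -
    have "(LINT x:{0<..<1}|lborel. 2 * (f x)\<^sup>2 + 2 * (norm_L2 (wderiv f))\<^sup>2)
      = (LINT x:{0<..<1}|lborel. 2 * (f x)\<^sup>2) + (LINT x:{0<..<1::real}|lborel. 2 * (norm_L2 (wderiv f))\<^sup>2)"
      by (rule set_integral_add(2)[OF i j])
    then show ?thesis by (simp add: norm_L2_sq set_integral_Ioo_Icc[of 0 1 "\<lambda>_. _"] set_integral_const_Icc)
  qed
  finally show ?thesis by (simp add: set_integral_Ioo_Icc set_integral_const_Icc)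
qed

lemma norm_X_sq:
  "(norm_X (e, e', Y, b, b', w, w'))\<^sup>2 =
    (norm_L2 (wderiv e))\<^sup>2 + (norm_L2 e')\<^sup>2 + (e 0)\<^sup>2 + (norm_L2 Y)\<^sup>2 + (norm_L2 (wderiv Y))\<^sup>2 +
    (norm_L2 b)\<^sup>2 + (norm_L2 (wderiv b))\<^sup>2 + (norm_L2 b')\<^sup>2 + (norm_L2 (wderiv w))\<^sup>2 + (norm_L2 w')\<^sup>2 + (w 0)\<^sup>2"
  by (simp add: norm_X_def norm_HH_def norm_H1_def)

lemma norm_X_nonneg: "0 \<le> norm_X s"
  by (cases s) (auto simp: norm_X_def)

lemma eq_X_iff:
  "eq_X (e, e', Y, b, b', w, w') (E, E', Z, B, B', W, W') \<longleftrightarrow>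
    norm_L2 (wderiv (e - E)) = 0 \<and> norm_L2 (e' - E') = 0 \<and> e 0 = E 0 \<and> norm_L2 (Y - Z) = 0 \<and> norm_L2 (wderiv (Y - Z)) = 0 \<and>
    norm_L2 (b - B) = 0 \<and> norm_L2 (wderiv (b - B)) = 0 \<and> norm_L2 (b' - B') = 0 \<and>
    norm_L2 (wderiv (w - W)) = 0 \<and> norm_L2 (w' - W') = 0 \<and> w 0 = W 0"
proof -
  have "eq_X (e, e', Y, b, b', w, w') (E, E', Z, B, B', W, W') \<longleftrightarrow> (norm_X (e - E, e' - E', Y - Z, b - B, b' - B', w - W, w' - W'))\<^sup>2 = 0"
    by (simp add: eq_X_def)
  also have "\<dots> \<longleftrightarrow> norm_L2 (wderiv (e - E)) = 0 \<and> norm_L2 (e' - E') = 0 \<and> e 0 = E 0 \<and> norm_L2 (Y - Z) = 0 \<and> norm_L2 (wderiv (Y - Z)) = 0 \<and>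
    norm_L2 (b - B) = 0 \<and> norm_L2 (wderiv (b - B)) = 0 \<and> norm_L2 (b' - B') = 0 \<and>
    norm_L2 (wderiv (w - W)) = 0 \<and> norm_L2 (w' - W') = 0 \<and> w 0 = W 0"
    unfolding norm_X_sq by (simp add: add_nonneg_eq_0_iff add_nonneg_nonneg)
  finally show ?thesis .
qed

lemma H1_norm_L2_wderiv_zero:
  assumes "f \<in> H1" "norm_L2 (wderiv f) = 0" "f 0 = 0" "x \<in> {0..1}" shows "f x = 0"
  using H1_pointwise[OF assms(1,4), of 0] assms(2,3) by simp

text \<open>
  The seminorms occurring in the state space, the derivative and the value at 0, control the full
  \<open>H1\<close> norm.
\<close>

lemma H1_trajectory:
  assumes H: "\<And>t. t \<ge> 0 \<Longrightarrow> F t \<in> H1"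
    and d: "\<And>s. s \<ge> 0 \<Longrightarrow> ((\<lambda>t. (norm_L2 (wderiv (F t - F s)))\<^sup>2) \<longlongrightarrow> 0) (at s within {0..})"
    and z: "\<And>s. s \<ge> 0 \<Longrightarrow> ((\<lambda>t. (F t 0 - F s 0)\<^sup>2) \<longlongrightarrow> 0) (at s within {0..})"
  shows "CL2 (\<lambda>t. wderiv (F t))" "CL2 F" "continuous_on {0..} (\<lambda>t. F t 0)"
proof -
  show "CL2 (\<lambda>t. wderiv (F t))"
    unfolding CL2_def
  proof (intro conjI allI impI)
    show "wderiv (F t) \<in> L2" if "t \<ge> 0" for t using wderiv_H1[OF H[OF that]] by simp
    fix s :: real assume s: "s \<ge> 0"
    show "((\<lambda>t. LINT x:{0<..<1}|lborel. (wderiv (F t) x - wderiv (F s) x)\<^sup>2) \<longlongrightarrow> 0) (at s within {0..})"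
    proof (rule Lim_transform_eventually[OF d[OF s]])
      show "\<forall>\<^sub>F t in at s within {0..}. (norm_L2 (wderiv (F t - F s)))\<^sup>2 = (LINT x:{0<..<1}|lborel. (wderiv (F t) x - wderiv (F s) x)\<^sup>2)"
        unfolding eventually_at_filter
        by (intro always_eventually allI impI) (simp add: norm_L2_wderiv_minus H s norm_L2_sq)
    qed
  qed
  show "CL2 F"
    unfolding CL2_def
  proof (intro conjI allI impI)
    show "F t \<in> L2" if "t \<ge> 0" for t using H1_L2[OF H[OF that]] .
    fix s :: real assume s: "s \<ge> 0"
    show "((\<lambda>t. LINT x:{0<..<1}|lborel. (F t x - F s x)\<^sup>2) \<longlongrightarrow> 0) (at s within {0..})"
    proof (rule tendsto_sandwich[OF _ _ tendsto_const])
      show "((\<lambda>t. 2 * (F t 0 - F s 0)\<^sup>2 + 2 * (norm_L2 (wderiv (F t - F s)))\<^sup>2) \<longlongrightarrow> 0) (at s within {0..})"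
        using tendsto_add[OF tendsto_mult_right_zero[OF z[OF s], of 2] tendsto_mult_right_zero[OF d[OF s], of 2]] by simp
      show "\<forall>\<^sub>F t in at s within {0..}. (LINT x:{0<..<1}|lborel. (F t x - F s x)\<^sup>2) \<le> 2 * (F t 0 - F s 0)\<^sup>2 + 2 * (norm_L2 (wderiv (F t - F s)))\<^sup>2"
        unfolding eventually_at_filter
      proof (intro always_eventually allI impI)
        fix t :: real assume "t \<in> {0..}"
        then show "(LINT x:{0<..<1}|lborel. (F t x - F s x)\<^sup>2) \<le> 2 * (F t 0 - F s 0)\<^sup>2 + 2 * (norm_L2 (wderiv (F t - F s)))\<^sup>2"
          using H1_poincare[OF H1_minus(1)[OF H[of t] H[OF s]]] by (simp add: norm_L2_sq)
      qed
    qed (auto intro!: always_eventually set_integral_square_nonneg)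
  qed
  show "continuous_on {0..} (\<lambda>t. F t 0)"
    unfolding continuous_on_def
  proof
    fix s :: real assume "s \<in> {0..}"
    then have "((\<lambda>t. sqrt ((F t 0 - F s 0)\<^sup>2)) \<longlongrightarrow> sqrt 0) (at s within {0..})" by (intro tendsto_real_sqrt z) simp
    then have "((\<lambda>t. \<bar>F t 0 - F s 0\<bar>) \<longlongrightarrow> 0) (at s within {0..})" by simp
    then have "((\<lambda>t. F t 0 - F s 0) \<longlongrightarrow> 0) (at s within {0..})" by (rule tendsto_rabs_zero_cancel)
    then show "((\<lambda>t. F t 0) \<longlongrightarrow> F s 0) (at s within {0..})" by (simp add: LIM_zero_iff)
  qed
qed

lemma continuous_X_trajectories:
  assumes "continuous_X (\<lambda>t. (e t, e' t, Y t, b t, b' t, w t, w' t))"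
  shows "t \<ge> 0 \<Longrightarrow> e t \<in> H1 \<and> e' t \<in> L2 \<and> Y t \<in> H1 \<and> b t \<in> H1 \<and> b t 1 = 0 \<and> b' t \<in> L2 \<and> w t \<in> H1 \<and> w' t \<in> L2"
    and "CL2 (\<lambda>t. wderiv (e t))" "CL2 e" "continuous_on {0..} (\<lambda>t. e t 0)" "CL2 e'"
    and "CL2 (\<lambda>t. wderiv (Y t))" "CL2 Y" "continuous_on {0..} (\<lambda>t. Y t 0)"
    and "CL2 (\<lambda>t. wderiv (b t))" "CL2 b" "continuous_on {0..} (\<lambda>t. b t 0)" "CL2 b'"
    and "CL2 (\<lambda>t. wderiv (w t))" "CL2 w" "continuous_on {0..} (\<lambda>t. w t 0)" "CL2 w'"
proof -
  have sp: "e t \<in> H1 \<and> e' t \<in> L2 \<and> Y t \<in> H1 \<and> b t \<in> H1 \<and> b t 1 = 0 \<and> b' t \<in> L2 \<and> w t \<in> H1 \<and> w' t \<in> L2" if "t \<ge> 0" for t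
    using assms that by (auto simp: continuous_X_def X_space_def H1_R_def)
  show "t \<ge> 0 \<Longrightarrow> e t \<in> H1 \<and> e' t \<in> L2 \<and> Y t \<in> H1 \<and> b t \<in> H1 \<and> b t 1 = 0 \<and> b' t \<in> L2 \<and> w t \<in> H1 \<and> w' t \<in> L2" by (rule sp)
  have lim: "((\<lambda>t. T t) \<longlongrightarrow> 0) (at s within {0..})"
    if "s \<ge> 0" and "\<And>t. t \<ge> 0 \<Longrightarrow> 0 \<le> T t \<and> T t \<le> (norm_X (e t - e s, e' t - e' s, Y t - Y s, b t - b s, b' t - b' s, w t - w s, w' t - w' s))\<^sup>2" for T s
  proof (rule tendsto_sandwich[OF _ _ tendsto_const])
    have "((\<lambda>t. norm_X (e t - e s, e' t - e' s, Y t - Y s, b t - b s, b' t - b' s, w t - w s, w' t - w' s)) \<longlongrightarrow> 0) (at s within {0..})"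
      using assms that(1) by (simp add: continuous_X_def)
    from tendsto_power[OF this, of 2]
    show "((\<lambda>t. (norm_X (e t - e s, e' t - e' s, Y t - Y s, b t - b s, b' t - b' s, w t - w s, w' t - w' s))\<^sup>2) \<longlongrightarrow> 0) (at s within {0..})" by simp
  qed (use that(2) in \<open>auto simp: eventually_at_filter intro!: always_eventually\<close>)
  have pt: "((\<lambda>t. (F t 0 - F s 0)\<^sup>2) \<longlongrightarrow> 0) (at s within {0..})"
    if H: "\<And>t. t \<ge> 0 \<Longrightarrow> F t \<in> H1" and s: "s \<ge> 0" and 1: "((\<lambda>t. (norm_L2 (F t - F s))\<^sup>2) \<longlongrightarrow> 0) (at s within {0..})"
      and 2: "((\<lambda>t. (norm_L2 (wderiv (F t - F s)))\<^sup>2) \<longlongrightarrow> 0) (at s within {0..})" for F :: "real \<Rightarrow> real \<Rightarrow> real" and s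
  proof (rule tendsto_sandwich[OF _ _ tendsto_const])
    show "((\<lambda>t. 2 * (norm_L2 (F t - F s))\<^sup>2 + 2 * (norm_L2 (wderiv (F t - F s)))\<^sup>2) \<longlongrightarrow> 0) (at s within {0..})"
      using tendsto_add[OF tendsto_mult_right_zero[OF 1, of 2] tendsto_mult_right_zero[OF 2, of 2]] by simp
    show "\<forall>\<^sub>F t in at s within {0..}. (F t 0 - F s 0)\<^sup>2 \<le> 2 * (norm_L2 (F t - F s))\<^sup>2 + 2 * (norm_L2 (wderiv (F t - F s)))\<^sup>2"
      unfolding eventually_at_filter
    proof (intro always_eventually allI impI)
      fix t :: real assume "t \<in> {0..}"
      then show "(F t 0 - F s 0)\<^sup>2 \<le> 2 * (norm_L2 (F t - F s))\<^sup>2 + 2 * (norm_L2 (wderiv (F t - F s)))\<^sup>2"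
        using H1_sobolev[OF H1_minus(1)[OF H[of t] H[OF s]]] by simp
    qed
  qed auto
  have CL2: "CL2 G" if "\<And>t. t \<ge> 0 \<Longrightarrow> G t \<in> L2" and "\<And>s. s \<ge> 0 \<Longrightarrow> ((\<lambda>t. (norm_L2 (G t - G s))\<^sup>2) \<longlongrightarrow> 0) (at s within {0..})"
    for G :: "real \<Rightarrow> real \<Rightarrow> real"
    using that by (simp add: CL2_def norm_L2_sq)
  have e: "((\<lambda>t. (norm_L2 (wderiv (e t - e s)))\<^sup>2) \<longlongrightarrow> 0) (at s within {0..})" "((\<lambda>t. (e t 0 - e s 0)\<^sup>2) \<longlongrightarrow> 0) (at s within {0..})"
    and e': "((\<lambda>t. (norm_L2 (e' t - e' s))\<^sup>2) \<longlongrightarrow> 0) (at s within {0..})"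
    and w: "((\<lambda>t. (norm_L2 (wderiv (w t - w s)))\<^sup>2) \<longlongrightarrow> 0) (at s within {0..})" "((\<lambda>t. (w t 0 - w s 0)\<^sup>2) \<longlongrightarrow> 0) (at s within {0..})"
    and w': "((\<lambda>t. (norm_L2 (w' t - w' s))\<^sup>2) \<longlongrightarrow> 0) (at s within {0..})"
    and b: "((\<lambda>t. (norm_L2 (wderiv (b t - b s)))\<^sup>2) \<longlongrightarrow> 0) (at s within {0..})" "((\<lambda>t. (norm_L2 (b t - b s))\<^sup>2) \<longlongrightarrow> 0) (at s within {0..})"
    and b': "((\<lambda>t. (norm_L2 (b' t - b' s))\<^sup>2) \<longlongrightarrow> 0) (at s within {0..})"
    and Y: "((\<lambda>t. (norm_L2 (wderiv (Y t - Y s)))\<^sup>2) \<longlongrightarrow> 0) (at s within {0..})" "((\<lambda>t. (norm_L2 (Y t - Y s))\<^sup>2) \<longlongrightarrow> 0) (at s within {0..})"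
    if "s \<ge> 0" for s
    by (rule lim[OF that], simp add: norm_X_sq)+
  show "CL2 (\<lambda>t. wderiv (e t))" "CL2 e" "continuous_on {0..} (\<lambda>t. e t 0)"
    using H1_trajectory[of e] sp e by blast+
  show "CL2 (\<lambda>t. wderiv (w t))" "CL2 w" "continuous_on {0..} (\<lambda>t. w t 0)"
    using H1_trajectory[of w] sp w by blast+
  have b0: "((\<lambda>t. (b t 0 - b s 0)\<^sup>2) \<longlongrightarrow> 0) (at s within {0..})" if "s \<ge> 0" for s
    by (rule pt[OF _ that b(2)[OF that] b(1)[OF that]]) (use sp in auto)
  have Y0: "((\<lambda>t. (Y t 0 - Y s 0)\<^sup>2) \<longlongrightarrow> 0) (at s within {0..})" if "s \<ge> 0" for s
    by (rule pt[OF _ that Y(2)[OF that] Y(1)[OF that]]) (use sp in auto)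
  show "CL2 (\<lambda>t. wderiv (b t))" "CL2 b" "continuous_on {0..} (\<lambda>t. b t 0)"
    using H1_trajectory[of b] sp b(1) b0 by blast+
  show "CL2 (\<lambda>t. wderiv (Y t))" "CL2 Y" "continuous_on {0..} (\<lambda>t. Y t 0)"
    using H1_trajectory[of Y] sp Y(1) Y0 by blast+
  show "CL2 e'" "CL2 b'" "CL2 w'" by (rule CL2; use sp e' b' w' in blast)+
qed

context dalembert
begin

lemma tendsto_U:
  assumes s: "s \<ge> 0"
  shows "((\<lambda>t. (norm_L2 (wderiv (U t - U s)))\<^sup>2) \<longlongrightarrow> 0) (at s within {0..})"
    and "((\<lambda>t. (norm_L2 (U t - U s))\<^sup>2) \<longlongrightarrow> 0) (at s within {0..})"
    and "((\<lambda>t. (norm_L2 (Ut t - Ut s))\<^sup>2) \<longlongrightarrow> 0) (at s within {0..})"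
    and "((\<lambda>t. (U t 0 - U s 0)\<^sup>2) \<longlongrightarrow> 0) (at s within {0..})"
proof -
  have "norm_L2 (wderiv (U t - U s)) = norm_L2 (\<lambda>x. Ux t x - Ux s x)" for t
  proof (rule norm_L2_cong_AE)
    note H = H1_of_prim[OF prim_diff[OF prim_U_x prim_U_x], of "U t - U s" t s]
    show "wderiv (U t - U s) \<in> L2" using wderiv_H1 H(1) by simp
    show "(\<lambda>x. Ux t x - Ux s x) \<in> L2" by (intro L2loc_imp_L2 L2loc_diff prim_L2loc[OF prim_U_x])
    show "AE x\<in>{0<..<1} in lborel. wderiv (U t - U s) x = Ux t x - Ux s x" using H(2) by simp
  qed
  then show "((\<lambda>t. (norm_L2 (wderiv (U t - U s)))\<^sup>2) \<longlongrightarrow> 0) (at s within {0..})"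
    using CL2_tendsto[OF CL2_Ux s] by (simp add: norm_L2_sq)
  show "((\<lambda>t. (norm_L2 (U t - U s))\<^sup>2) \<longlongrightarrow> 0) (at s within {0..})"
    using CL2_tendsto[OF CL2_U s] by (simp add: norm_L2_sq)
  show "((\<lambda>t. (norm_L2 (Ut t - Ut s))\<^sup>2) \<longlongrightarrow> 0) (at s within {0..})"
    using CL2_tendsto[OF CL2_Ut s] by (simp add: norm_L2_sq)
  have "continuous_on UNIV (\<lambda>t. (U t 0 - U s 0)\<^sup>2)"
    by (intro continuous_intros prim_continuous_on[OF prim_U_t])
  then have "isCont (\<lambda>t. (U t 0 - U s 0)\<^sup>2) s" by (auto simp: continuous_on_eq_continuous_at)
  then have "((\<lambda>t. (U t 0 - U s 0)\<^sup>2) \<longlongrightarrow> (U s 0 - U s 0)\<^sup>2) (at s)" by (simp only: isCont_def)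
  then have "((\<lambda>t. (U t 0 - U s 0)\<^sup>2) \<longlongrightarrow> (U s 0 - U s 0)\<^sup>2) (at s within {0..})" by (rule tendsto_within_subset) simp
  then show "((\<lambda>t. (U t 0 - U s 0)\<^sup>2) \<longlongrightarrow> 0) (at s within {0..})" by (simp only: diff_self zero_power2)
qed

lemma continuous_Ux_part: "continuous_on UNIV (\<lambda>(t, x). q * exp (q * x) * r t)"
  using continuous_exp_mult[OF continuous_r(1), of q] by (simp add: mult.assoc)

lemma trace_Ux:
  assumes "\<xi> \<in> {0, 1}" "AE t in lborel. 0 < t \<longrightarrow> (AE x\<in>{0<..<1} in lborel. G t x = Ux t x)"
  shows "has_trace G \<xi> a \<longleftrightarrow> L2_loc a \<and> (AE t in lborel. 0 < t \<longrightarrow> a t = Ux t \<xi>)"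
  using has_trace_iff[OF prim_L2loc[OF f] L2loc_uminus[OF prim_L2loc[OF g]] continuous_Ux_part assms(1), of G a] assms(2)
  by (simp add: Ux_def)

lemma trace_Ut:
  assumes "\<xi> \<in> {0, 1}" "AE t in lborel. 0 < t \<longrightarrow> (AE x\<in>{0<..<1} in lborel. G t x = Ut t x)"
  shows "has_trace G \<xi> a \<longleftrightarrow> L2_loc a \<and> (AE t in lborel. 0 < t \<longrightarrow> a t = Ut t \<xi>)"
  using has_trace_iff[OF prim_L2loc[OF f] prim_L2loc[OF g] continuous_exp_mult[OF continuous_r(2), of 1] assms(1), of G a] assms(2)
  by (simp add: Ut_def)

lemma L2loc_trace: "L2loc (\<lambda>t. Ux t \<xi>)" "L2loc (\<lambda>t. Ut t \<xi>)"
proof -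
  have s: "L2loc (\<lambda>t. f' (t + \<xi>))" "L2loc (\<lambda>t. g' (t - \<xi>))"
    using L2loc_shift[OF prim_L2loc[OF f], of \<xi>] L2loc_shift[OF prim_L2loc[OF g], of "-\<xi>"] by (simp_all add: add.commute)
  show "L2loc (\<lambda>t. Ux t \<xi>)" "L2loc (\<lambda>t. Ut t \<xi>)"
    unfolding Ux_def Ut_def
    by (intro L2loc_add L2loc_diff s L2loc_continuous continuous_intros continuous_r)+
qed

lemma trace_U:
  assumes "\<xi> \<in> {0, 1}"
  shows "has_trace_x U \<xi> (\<lambda>t. Ux t \<xi>)" "has_trace Ut \<xi> (\<lambda>t. Ut t \<xi>)"
  using trace_Ux[OF assms, of "\<lambda>t. wderiv (U t)" "\<lambda>t. Ux t \<xi>"] trace_Ut[OF assms, of Ut "\<lambda>t. Ut t \<xi>"] wderiv_U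
    L2loc_trace[THEN L2loc_imp_L2_loc] by auto

lemma norm_wderiv_U: "norm_L2 (wderiv (U t)) = norm_L2 (Ux t)"
  using wderiv_H1[OF U_H1] wderiv_U L2loc_imp_L2[OF prim_L2loc[OF prim_U_x]] by (intro norm_L2_cong_AE) auto

lemma U_decays:
  assumes "energy_decays f'" "energy_decays g'" "exp_decays (\<lambda>t. (r t)\<^sup>2)" "exp_decays (\<lambda>t. (r1 t)\<^sup>2)"
  shows "exp_decays (\<lambda>t. (norm_L2 (wderiv (U t)))\<^sup>2)" "exp_decays (\<lambda>t. (norm_L2 (Ut t))\<^sup>2)"
proof -
  have three: "(norm_L2 (\<lambda>x. u x + v x + c x))\<^sup>2 \<le> 3 * (LINT x:{0..1}|lborel. (u x)\<^sup>2) + 3 * (LINT x:{0..1}|lborel. (v x)\<^sup>2) + 3 * C"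
    if "L2loc u" "L2loc v" "continuous_on UNIV c" "\<And>x. x \<in> {0..1} \<Longrightarrow> (c x)\<^sup>2 \<le> C" for u v c :: "real \<Rightarrow> real" and C
  proof -
    have "L2loc (\<lambda>x. u x + v x + c x)" by (rule L2loc_add[OF L2loc_add[OF that(1,2)] L2loc_continuous[OF that(3)]])
    note i = this[THEN L2loc_square_integrable, of 0 1] that(1)[THEN L2loc_square_integrable, of 0 1] that(2)[THEN L2loc_square_integrable, of 0 1]
    have "(norm_L2 (\<lambda>x. u x + v x + c x))\<^sup>2 \<le> (LINT x:{0..1}|lborel. 3 * (u x)\<^sup>2 + 3 * (v x)\<^sup>2 + 3 * C)"
      unfolding norm_L2_sq set_integral_Ioo_Icc
    proof (rule set_integral_mono)
      show "set_integrable lborel {0..1} (\<lambda>x. 3 * (u x)\<^sup>2 + 3 * (v x)\<^sup>2 + 3 * C)"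
        by (intro set_integral_add(1) set_integrable_mult_right i set_integrable_continuous continuous_intros)
      fix x :: real assume "x \<in> {0..1}"
      have "(u x + v x + c x)\<^sup>2 \<le> 3 * (u x)\<^sup>2 + 3 * (v x)\<^sup>2 + 3 * (c x)\<^sup>2"
        using sum_squares_bound[of "u x" "v x"] sum_squares_bound[of "u x" "c x"] sum_squares_bound[of "v x" "c x"]
        by (simp add: power2_eq_square algebra_simps)
      then show "(u x + v x + c x)\<^sup>2 \<le> 3 * (u x)\<^sup>2 + 3 * (v x)\<^sup>2 + 3 * C" using that(4)[OF \<open>x \<in> {0..1}\<close>] by linarith
    qed (rule i)
    also have "\<dots> = 3 * (LINT x:{0..1}|lborel. (u x)\<^sup>2) + 3 * (LINT x:{0..1}|lborel. (v x)\<^sup>2) + 3 * C"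
    proof -
      have j: "set_integrable lborel {0..1} (\<lambda>x. 3 * (u x)\<^sup>2)" "set_integrable lborel {0..1} (\<lambda>x. 3 * (v x)\<^sup>2)" "set_integrable lborel {0..1} (\<lambda>x::real. 3 * C)"
        by (intro set_integrable_mult_right i set_integrable_continuous continuous_intros)+
      show ?thesis
        unfolding set_integral_add(2)[OF set_integral_add(1)[OF j(1,2)] j(3)] set_integral_add(2)[OF j(1,2)]
        by (simp add: set_integral_const_Icc)
    qed
    finally show ?thesis .
  qed
  define m where "m = exp (2 * \<bar>q\<bar>)"
  have m: "(exp (q * x))\<^sup>2 \<le> m" if "x \<in> {0..1}" for x
  proof -
    have "q * x \<le> \<bar>q\<bar> * 1" using that 
    proof -
      have "q * x \<le> \<bar>q\<bar> * x" using that by (intro mult_right_mono) auto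
      also have "\<dots> \<le> \<bar>q\<bar> * 1" using that by (intro mult_left_mono) auto
      finally show ?thesis .
    qed
    then have "q * x + q * x \<le> 2 * \<bar>q\<bar>" by linarith
    then show ?thesis unfolding m_def power2_eq_square exp_add[symmetric] by simp
  qed
  have sf: "(LINT x:{0..1}|lborel. (f' (t + x))\<^sup>2) \<le> (LINT x:{t-1..t+1}|lborel. (f' x)\<^sup>2)" for t
    using set_integral_shift[of 0 1 "\<lambda>x. (f' x)\<^sup>2" t] set_integral_square_mono[OF prim_L2loc[OF f], of t "t+1" "t-1" "t+1"] by simp
  have sg: "(LINT x:{0..1}|lborel. (g' (t - x))\<^sup>2) \<le> (LINT x:{t-1..t+1}|lborel. (g' x)\<^sup>2)" for t
    using set_integral_flip[of 0 1 "\<lambda>x. (g' x)\<^sup>2" t] set_integral_square_mono[OF prim_L2loc[OF g], of "t-1" t "t-1" "t+1"] by simp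
  let ?E = "\<lambda>t. 3 * (LINT x:{t-1..t+1}|lborel. (f' x)\<^sup>2) + 3 * (LINT x:{t-1..t+1}|lborel. (g' x)\<^sup>2)"
  have E: "exp_decays ?E" using assms(1,2) by (intro exp_decays_add exp_decays_cmult) (auto simp: energy_decays_def)
  have m0: "0 \<le> m" by (simp add: m_def)
  show "exp_decays (\<lambda>t. (norm_L2 (wderiv (U t)))\<^sup>2)"
  proof (rule exp_decays_mono)
    show "exp_decays (\<lambda>t. ?E t + 3 * q\<^sup>2 * m * (r t)\<^sup>2)"
      using m0 by (intro exp_decays_add E exp_decays_cmult assms(3)) auto
    fix t :: real
    have "(norm_L2 (\<lambda>x. f' (t + x) + (- g' (t - x)) + q * exp (q * x) * r t))\<^sup>2
      \<le> 3 * (LINT x:{0..1}|lborel. (f' (t + x))\<^sup>2) + 3 * (LINT x:{0..1}|lborel. (- g' (t - x))\<^sup>2) + 3 * (q\<^sup>2 * m * (r t)\<^sup>2)"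
    proof (rule three)
      show "(q * exp (q * x) * r t)\<^sup>2 \<le> q\<^sup>2 * m * (r t)\<^sup>2" if "x \<in> {0..1}" for x
        unfolding power_mult_distrib using m[OF that] by (intro mult_right_mono mult_left_mono) auto
    qed (intro L2loc_shift L2loc_flip L2loc_uminus prim_L2loc[OF f] prim_L2loc[OF g] continuous_intros)+
    then show "(norm_L2 (wderiv (U t)))\<^sup>2 \<le> ?E t + 3 * q\<^sup>2 * m * (r t)\<^sup>2"
      unfolding norm_wderiv_U Ux_def using sf[of t] sg[of t] by simp
  qed
  show "exp_decays (\<lambda>t. (norm_L2 (Ut t))\<^sup>2)"
  proof (rule exp_decays_mono)
    show "exp_decays (\<lambda>t. ?E t + 3 * m * (r1 t)\<^sup>2)"
      using m0 by (intro exp_decays_add E exp_decays_cmult assms(4)) auto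
    fix t :: real
    have "(norm_L2 (\<lambda>x. f' (t + x) + g' (t - x) + exp (q * x) * r1 t))\<^sup>2
      \<le> 3 * (LINT x:{0..1}|lborel. (f' (t + x))\<^sup>2) + 3 * (LINT x:{0..1}|lborel. (g' (t - x))\<^sup>2) + 3 * (m * (r1 t)\<^sup>2)"
    proof (rule three)
      show "(exp (q * x) * r1 t)\<^sup>2 \<le> m * (r1 t)\<^sup>2" if "x \<in> {0..1}" for x
        unfolding power_mult_distrib using m[OF that] by (intro mult_right_mono) auto
    qed (intro L2loc_shift L2loc_flip prim_L2loc[OF f] prim_L2loc[OF g] continuous_intros)+
    then show "(norm_L2 (Ut t))\<^sup>2 \<le> ?E t + 3 * m * (r1 t)\<^sup>2"
      unfolding Ut_def using sf[of t] sg[of t] by simp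
  qed
qed

end

section \<open>Existence and decay of the profiles\<close>

text \<open>
  From \<open>f x + g (-x) = F0 x\<close> and \<open>f' x + g' (-x) = F1 x\<close> one gets
  \<open>f' = (F0' + F1) / 2\<close> on \<open>(0,1)\<close> and \<open>g' = (F1 - F0') /
  2\<close>, reflected, on \<open>(-1,0)\<close>. Outside these intervals the functions
  \<open>\<phi>\<close> and \<open>\<gamma>\<close> are arbitrary extensions.
\<close>

lemma initial_profiles:
  assumes F0: "F0 \<in> H1" and F1: "F1 \<in> L2"
  obtains \<phi> \<gamma> where "L2loc \<phi>" "L2loc \<gamma>"
    "\<And>f f' g g' x. prim f f' \<Longrightarrow> prim g g' \<Longrightarrow> f 0 = 0 \<Longrightarrow> g 0 = F0 0 \<Longrightarrow> (\<And>t. t < 1 \<Longrightarrow> f' t = \<phi> t) \<Longrightarrow>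
       (\<And>t. t < 0 \<Longrightarrow> g' t = \<gamma> t) \<Longrightarrow> x \<in> {0..1} \<Longrightarrow> f x + g (- x) = F0 x"
    "\<And>f' g' x. (\<And>t. t < 1 \<Longrightarrow> f' t = \<phi> t) \<Longrightarrow> (\<And>t. t < 0 \<Longrightarrow> g' t = \<gamma> t) \<Longrightarrow> x \<in> {0<..<1} \<Longrightarrow> f' x + g' (- x) = F1 x"
proof -
  obtain P Q where P: "prim P Q" "\<And>x. x \<in> {0..1} \<Longrightarrow> F0 x = P x" using H1_repr[OF F0] by metis
  obtain k where k: "L2loc k" "\<And>x. x \<in> {0<..<1} \<Longrightarrow> k x = F1 x" using L2_repr[OF F1] by metis
  define \<phi> where "\<phi> = (\<lambda>t. 1/2 * (Q t + k t))"
  define \<gamma> where "\<gamma> = (\<lambda>t. 1/2 * (k (0 - t) - Q (0 - t)))"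
  show ?thesis
  proof (rule that)
    show "L2loc \<phi>" "L2loc \<gamma>"
      unfolding \<phi>_def \<gamma>_def by (intro L2loc_cmult L2loc_add L2loc_diff L2loc_flip prim_L2loc[OF P(1)] k(1))+
    show "f' x + g' (- x) = F1 x" if "\<And>t. t < 1 \<Longrightarrow> f' t = \<phi> t" "\<And>t. t < 0 \<Longrightarrow> g' t = \<gamma> t" "x \<in> {0<..<1}" for f' g' x
      using that(1)[of x] that(2)[of "- x"] that(3) k(2)[of x] by (simp add: \<phi>_def \<gamma>_def)
    show "f x + g (- x) = F0 x"
      if p: "prim f f'" "prim g g'" and z: "f 0 = 0" "g 0 = F0 0" and d: "\<And>t. t < 1 \<Longrightarrow> f' t = \<phi> t" "\<And>t. t < 0 \<Longrightarrow> g' t = \<gamma> t"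
        and x: "x \<in> {0..1}" for f f' g g' x
    proof -
      have "prim (\<lambda>x. f x + g (0 - x) - P x) (\<lambda>x. f' x + - g' (0 - x) - Q x)"
        by (intro prim_diff prim_add prim_flip p P(1))
      moreover have "f' t + - g' (0 - t) - Q t = 0" if "t \<in> {0<..<x}" for t
        using d(1)[of t] d(2)[of "- t"] that x by (simp add: \<phi>_def \<gamma>_def field_simps)
      ultimately have "f x + g (0 - x) - P x = f 0 + g (0 - 0) - P 0"
        using prim_zero_deriv[of _ _ 0 x] x by (metis (mono_tags, lifting) AE_I2 atLeastAtMost_iff)
      then show ?thesis using z P(2)[of 0] P(2)[OF x] by simp
    qed
  qed
qed

lemma initial_profiles_unique:
  assumes p: "prim f f'" "prim g g'" "prim F F'" "prim G G'" and z: "f 0 = 0" "F 0 = 0"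
    and s: "\<And>x. x \<in> {0..1} \<Longrightarrow> f x + g (- x) = F x + G (- x)"
    and d: "AE x\<in>{0<..<1} in lborel. f' x + g' (- x) = F' x + G' (- x)"
  shows "t \<in> {0..1} \<Longrightarrow> f t = F t" "t \<in> {-1..0} \<Longrightarrow> g t = G t"
proof -
  have q: "prim (\<lambda>x. f x + g (0 - x)) (\<lambda>x. f' x + - g' (0 - x))" "prim (\<lambda>x. F x + G (0 - x)) (\<lambda>x. F' x + - G' (0 - x))"
    by (intro prim_add prim_flip p)+
  have "AE x\<in>{0<..<1} in lborel. f' x + - g' (0 - x) = F' x + - G' (0 - x)"
    by (rule prim_AE_unique[OF q]) (use s in auto)
  with d have ff: "AE x\<in>{0<..<1} in lborel. f' x - F' x = 0" by eventually_elim auto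
  have f: "f t = F t" if "t \<in> {0..1}" for t
  proof -
    have "AE x in lborel. x \<in> {0<..<t} \<longrightarrow> f' x - F' x = 0" using ff by eventually_elim (use that in auto)
    then have "f t - F t = f 0 - F 0" using prim_zero_deriv[OF prim_diff[OF p(1,3)], of 0 t] that by simp
    then show ?thesis using z by simp
  qed
  show "t \<in> {0..1} \<Longrightarrow> f t = F t" by (rule f)
  show "t \<in> {-1..0} \<Longrightarrow> g t = G t" using s[of "- t"] f[of "- t"] by simp
qed

lemma prim_zero_deriv_from:
  assumes f: "prim f f'" and "0 \<le> t" and z: "AE t in lborel. 0 < t \<longrightarrow> f' t = 0"
  shows "f t = f 0"
proof (rule prim_zero_deriv[OF f \<open>0 \<le> t\<close>])
  show "AE s in lborel. s \<in> {0<..<t} \<longrightarrow> f' s = 0" using z by eventually_elim auto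
qed

lemma energy_decays_cong_window:
  assumes "L2loc u" "L2loc v" "\<And>t. t \<ge> 0 \<Longrightarrow> u t = v t" "geo_decays (window v)"
  shows "energy_decays u"
proof (rule energy_decays_of_window[OF assms(1)])
  have "window u n = window v n" for n
    unfolding window_def
  proof (intro set_lebesgue_integral_cong allI impI)
    fix x :: real assume "x \<in> {2 * real n..2 * real n + 2}"
    then have "0 \<le> x" by (auto intro: order_trans[of _ "2 * real n"])
    then show "(u x)\<^sup>2 = (v x)\<^sup>2" using assms(3) by simp
  qed simp
  then have "window u = window v" by (rule ext)
  then show "geo_decays (window u)" using assms(4) by simp
qed

lemma geo_decays_window_add:
  assumes "L2loc u" "L2loc v" "geo_decays (window u)" "geo_decays (window v)"
  shows "geo_decays (window (\<lambda>x. u x + v x))"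
proof (rule geo_decays_mono)
  show "geo_decays (\<lambda>n. 2 * window u n + 2 * window v n)" by (intro geo_decays_add geo_decays_cmult assms) auto
  fix n
  note i = L2loc_square_integrable[OF assms(1), of "2 * real n" "2 * real n + 2"] L2loc_square_integrable[OF assms(2), of "2 * real n" "2 * real n + 2"]
  have "window (\<lambda>x. u x + v x) n \<le> (LINT x:{2 * real n..2 * real n + 2}|lborel. 2 * (u x)\<^sup>2 + 2 * (v x)\<^sup>2)"
    unfolding window_def
  proof (rule set_integral_mono)
    show "(u x + v x)\<^sup>2 \<le> 2 * (u x)\<^sup>2 + 2 * (v x)\<^sup>2" for x
      using sum_squares_bound[of "u x" "v x"] by (simp add: power2_sum)
  qed (use i L2loc_square_integrable[OF L2loc_add[OF assms(1,2)]] in auto)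
  also have "\<dots> = 2 * window u n + 2 * window v n" using i by (simp add: window_def)
  finally show "window (\<lambda>x. u x + v x) n \<le> 2 * window u n + 2 * window v n" .
qed

lemma geo_decays_window_cmult: "geo_decays (window u) \<Longrightarrow> geo_decays (window (\<lambda>x. c * u x))"
proof -
  assume "geo_decays (window u)"
  then have "geo_decays (\<lambda>n. c\<^sup>2 * window u n)" by (rule geo_decays_cmult) simp
  also have "(\<lambda>n. c\<^sup>2 * window u n) = window (\<lambda>x. c * u x)" by (auto simp: window_def power_mult_distrib)
  finally show ?thesis .
qed

lemma exp_decays_square_sum:
  assumes "exp_decays (\<lambda>t. (u t)\<^sup>2)" "exp_decays (\<lambda>t. (v t)\<^sup>2)" shows "exp_decays (\<lambda>t. (u t + v t)\<^sup>2)"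
proof (rule exp_decays_mono)
  show "exp_decays (\<lambda>t. 2 * (u t)\<^sup>2 + 2 * (v t)\<^sup>2)" by (intro exp_decays_add exp_decays_cmult assms) auto
  show "(u t + v t)\<^sup>2 \<le> 2 * (u t)\<^sup>2 + 2 * (v t)\<^sup>2" for t
    using sum_squares_bound[of "u t" "v t"] by (simp add: power2_sum)
qed

lemma exp_decays_square_cmult: "exp_decays (\<lambda>t. (u t)\<^sup>2) \<Longrightarrow> exp_decays (\<lambda>t. (c * u t)\<^sup>2)"
  using exp_decays_cmult[of "\<lambda>t. (u t)\<^sup>2" "c\<^sup>2"] by (simp add: power_mult_distrib)

text \<open>
  Solve the two delay systems for \<open>\<beta>\<close> and \<open>z\<close> with the initial
  values \<open>\<epsilon>\<^sub>0 + Y\<^sub>0 - \<beta>\<^sub>0\<close> and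
  \<open>\<epsilon>\<^sub>1 - Y\<^sub>0' - \<beta>\<^sub>1\<close> for \<open>z\<close>; then
  define \<open>y\<close> on the positive half line by \<open>y = - c\<^sub>0 / (1 - c\<^sub>0) (z
  + \<beta>)\<close> at \<open>x = 0\<close>, and on the negative one by \<open>Y\<^sub>0\<close>.
  The compatibility condition makes \<open>y\<close> continuous at 0.
\<close>

lemma cascade_exists:
  assumes c: "0 < c0" "c0 < 1" "c1 > 0"
    and H: "e0 \<in> H1" "e1 \<in> L2" "Y0 \<in> H1" "b0 \<in> H1" "b0 1 = 0" "b1 \<in> L2" and compat: "Y0 0 = - c0 * e0 0"
  obtains fe fe' ge ge' fb fb' gb gb' y y' where
    "cascade c0 c1 fe fe' ge ge' fb fb' gb gb' y y'" "fe 0 = 0" "fb 0 = 0"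
    "\<And>x. x \<in> {0..1} \<Longrightarrow> fe x + ge (- x) = e0 x" "AE x\<in>{0<..<1} in lborel. fe' x + ge' (- x) = e1 x"
    "\<And>x. x \<in> {0..1} \<Longrightarrow> fb x + gb (- x) = b0 x" "AE x\<in>{0<..<1} in lborel. fb' x + gb' (- x) = b1 x"
    "\<And>x. x \<in> {0..1} \<Longrightarrow> y (- x) = Y0 x"
    "energy_decays fe'" "energy_decays ge'" "energy_decays fb'" "energy_decays gb'" "energy_decays y'"
    "exp_decays (\<lambda>t. (fe t + ge t)\<^sup>2)" "exp_decays (\<lambda>t. (fb t + gb t)\<^sup>2)" "exp_decays (\<lambda>t. (y t)\<^sup>2)"
proof -
  define \<alpha> where "\<alpha> = c1 / (1 - c0)"
  define \<kappa> where "\<kappa> = c0 / (1 - c0)"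
  have ak: "\<alpha> > 0" "\<kappa> > 0" using c by (simp_all add: \<alpha>_def \<kappa>_def)
  have L0: "L2loc (\<lambda>_. 0)" by (rule L2loc_continuous) simp
  obtain FY GY where Y: "prim FY GY" "\<And>x. x \<in> {0..1} \<Longrightarrow> Y0 x = FY x" "\<And>x. x \<in> {0<..<1} \<Longrightarrow> wderiv Y0 x = GY x"
    using H1_repr[OF H(3)] by metis
  obtain \<phi>b \<gamma>b where ib: "L2loc \<phi>b" "L2loc \<gamma>b"
    "\<And>f f' g g' x. prim f f' \<Longrightarrow> prim g g' \<Longrightarrow> f 0 = 0 \<Longrightarrow> g 0 = b0 0 \<Longrightarrow> (\<And>t. t < 1 \<Longrightarrow> f' t = \<phi>b t) \<Longrightarrow>
       (\<And>t. t < 0 \<Longrightarrow> g' t = \<gamma>b t) \<Longrightarrow> x \<in> {0..1} \<Longrightarrow> f x + g (- x) = b0 x"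
    "\<And>f' g' x. (\<And>t. t < 1 \<Longrightarrow> f' t = \<phi>b t) \<Longrightarrow> (\<And>t. t < 0 \<Longrightarrow> g' t = \<gamma>b t) \<Longrightarrow> x \<in> {0<..<1} \<Longrightarrow> f' x + g' (- x) = b1 x"
    by (rule initial_profiles[OF H(4,6)]) blast
  define z0 where "z0 = (\<lambda>x. e0 x + Y0 x - b0 x)"
  define z1 where "z1 = (\<lambda>x. e1 x - wderiv Y0 x - b1 x)"
  obtain Fe Ge where E: "prim Fe Ge" "\<And>x. x \<in> {0..1} \<Longrightarrow> e0 x = Fe x" using H1_repr[OF H(1)] by metis
  obtain Fb Gb where Bp: "prim Fb Gb" "\<And>x. x \<in> {0..1} \<Longrightarrow> b0 x = Fb x" using H1_repr[OF H(4)] by metis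
  have z0: "z0 \<in> H1"
    by (rule H1_of_prim(1)[OF prim_diff[OF prim_add[OF E(1) Y(1)] Bp(1)]]) (simp add: z0_def E(2) Y(2) Bp(2))
  have z1: "z1 \<in> L2" unfolding z1_def using H wderiv_H1[OF H(3)] by (intro L2_diff) auto
  obtain \<phi>z \<gamma>z where iz: "L2loc \<phi>z" "L2loc \<gamma>z"
    "\<And>f f' g g' x. prim f f' \<Longrightarrow> prim g g' \<Longrightarrow> f 0 = 0 \<Longrightarrow> g 0 = z0 0 \<Longrightarrow> (\<And>t. t < 1 \<Longrightarrow> f' t = \<phi>z t) \<Longrightarrow>
       (\<And>t. t < 0 \<Longrightarrow> g' t = \<gamma>z t) \<Longrightarrow> x \<in> {0..1} \<Longrightarrow> f x + g (- x) = z0 x"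
    "\<And>f' g' x. (\<And>t. t < 1 \<Longrightarrow> f' t = \<phi>z t) \<Longrightarrow> (\<And>t. t < 0 \<Longrightarrow> g' t = \<gamma>z t) \<Longrightarrow> x \<in> {0<..<1} \<Longrightarrow> f' x + g' (- x) = z1 x"
    by (rule initial_profiles[OF z0 z1]) blast
  have k0: "0 \<le> \<kappa>" using ak by simp
  obtain fb fb' gb gb' where b: "delay_system \<alpha> \<kappa> (-1) (\<lambda>_. 0) (\<lambda>_. 0) fb fb' gb gb'" "fb 0 = 0" "gb 0 = b0 0"
    "\<And>t. t < 1 \<Longrightarrow> fb' t = \<phi>b t" "\<And>t. t < 0 \<Longrightarrow> gb' t = \<gamma>b t"
    by (rule delay_system_exists[OF k0 L0 L0 ib(1,2), of \<alpha> "-1" "b0 0"]) blast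
  obtain fz fz' gz gz' where z: "delay_system \<alpha> \<kappa> 1 (\<lambda>_. 0) (\<lambda>_. 0) fz fz' gz gz'" "fz 0 = 0" "gz 0 = z0 0"
    "\<And>t. t < 1 \<Longrightarrow> fz' t = \<phi>z t" "\<And>t. t < 0 \<Longrightarrow> gz' t = \<gamma>z t"
    by (rule delay_system_exists[OF k0 L0 L0 iz(1,2), of \<alpha> 1 "z0 0"]) blast
  have pb: "prim fb fb'" "prim gb gb'" and pz: "prim fz fz'" "prim gz gz'" using b(1) z(1) by (simp_all add: delay_system_def)
  note Lb = pb[THEN prim_L2loc] and Lz = pz[THEN prim_L2loc]
  have xb: "fb x + gb (- x) = b0 x" if "x \<in> {0..1}" for x using ib(3)[OF pb b(2,3,4,5) that] .
  have xz: "fz x + gz (- x) = z0 x" if "x \<in> {0..1}" for x using iz(3)[OF pz z(2,3,4,5) that] .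
  have xb': "fb' x + gb' (- x) = b1 x" if "x \<in> {0<..<1}" for x using ib(4)[OF b(4,5) that] .
  have xz': "fz' x + gz' (- x) = z1 x" if "x \<in> {0<..<1}" for x using iz(4)[OF z(4,5) that] .
  define hp' where "hp' = (\<lambda>t. fb' t + fz' t + (gb' t + gz' t))"
  define hp where "hp = (\<lambda>t. fb t + fz t + (gb t + gz t))"
  have php: "prim hp hp'" unfolding hp_def hp'_def by (intro prim_add pb pz)
  define s where "s = - (c0 / (1 - c0))"
  define y' where "y' = (\<lambda>t. if t < 0 then - GY (0 - t) else s * hp' t)"
  have Ly: "L2loc y'" unfolding y'_def
    by (intro L2loc_if L2loc_uminus L2loc_flip L2loc_cmult prim_L2loc[OF Y(1)] prim_L2loc[OF php])
  define y where "y = (\<lambda>t. primitive y' t + Y0 0)"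
  have py: "prim y y'" using prim_add[OF primitive(1)[OF Ly] prim_const[of "Y0 0"]] by (simp add: y_def)
  have y0: "y 0 = Y0 0" by (simp add: y_def primitive(2)[OF Ly])
  have yneg: "y (- x) = Y0 x" if x: "x \<in> {0..1}" for x
  proof -
    have "prim (\<lambda>x. y (0 - x) - FY x) (\<lambda>x. - y' (0 - x) - GY x)" by (intro prim_diff prim_flip py Y(1))
    then have "y (0 - x) - FY x = y (0 - 0) - FY 0"
      by (rule prim_zero_deriv) (use x in \<open>auto simp: y'_def\<close>)
    then show ?thesis using y0 Y(2)[of 0] Y(2)[OF x] by simp
  qed
  have ypos: "y t = s * hp t" if "t \<ge> 0" for t
  proof -
    have "prim (\<lambda>t. y t - s * hp t) (\<lambda>t. y' t - s * hp' t)" by (intro prim_diff prim_cmult py php)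
    then have "y t - s * hp t = y 0 - s * hp 0" by (rule prim_zero_deriv[OF _ that]) (auto simp: y'_def)
    moreover have "hp 0 = e0 0 + Y0 0" using b(2,3) z(2,3) by (simp add: hp_def z0_def)
    moreover have "s * (e0 0 + Y0 0) = Y0 0" using c compat by (simp add: s_def field_simps)
    ultimately show ?thesis using y0 by simp
  qed
  define fe where "fe = (\<lambda>t. fb t + fz t)"
  define fe' where "fe' = (\<lambda>t. fb' t + fz' t)"
  define ge where "ge = (\<lambda>t. gb t + gz t - y t)"
  define ge' where "ge' = (\<lambda>t. gb' t + gz' t - y' t)"
  have pe: "prim fe fe'" "prim ge ge'" unfolding fe_def fe'_def ge_def ge'_def by (intro prim_add prim_diff pb pz py)+
  have clamp: "fb (t + 1) + gb (t - 1) = 0" if "t \<ge> 0" for t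
  proof -
    have p: "prim (\<lambda>t. fb (1 + t) + gb (-1 + t)) (\<lambda>t. fb' (1 + t) + gb' (-1 + t))" by (intro prim_add prim_shift pb)
    have "AE t in lborel. 0 < t \<longrightarrow> fb' (t + 1) = -1 * gb' (t - 1) + 0" using b(1) by (simp add: delay_system_def)
    then have "AE t in lborel. 0 < t \<longrightarrow> fb' (1 + t) + gb' (-1 + t) = 0" by eventually_elim (simp add: add.commute)
    from prim_zero_deriv_from[OF p that this] have "fb (1 + t) + gb (-1 + t) = fb 1 + gb (-1)" by simp
    then show ?thesis using xb[of 1] H(5) by (simp add: add.commute)
  qed
  have hfe: "fe t + ge t = hp t - y t" for t by (simp add: fe_def ge_def hp_def)
  have yfe: "y t = - c0 * (fe t + ge t)" if "t \<ge> 0" for t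
    unfolding hfe using ypos[OF that] c by (simp add: s_def field_simps)
  have casc: "cascade c0 c1 fe fe' ge ge' fb fb' gb gb' y y'"
    unfolding cascade_def \<alpha>_def[symmetric] \<kappa>_def[symmetric]
    using pe py b(1) z(1) clamp yfe by (simp add: fe_def fe'_def ge_def ge'_def)
  have xe: "fe x + ge (- x) = e0 x" if "x \<in> {0..1}" for x
    using xb[OF that] xz[OF that] yneg[OF that] by (simp add: fe_def ge_def z0_def)
  have xe': "fe' x + ge' (- x) = e1 x" if "x \<in> {0<..<1}" for x
    using xb'[OF that] xz'[OF that] Y(3)[OF that] that by (simp add: fe'_def ge'_def z1_def y'_def)
  have "0 \<le> (2 * (1 + \<kappa> + 2 * \<alpha>))\<^sup>2" "(-1 :: real)\<^sup>2 = 1" by simp_all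
  note db = boundary_damping_decay[OF b(1) ak(1,2) this(2,1) endpoint_control_clamped[OF b(1) ak(1) k0 clamp]]
  have "0 \<le> (2 * ((1 + \<kappa>) / (2 * \<alpha>) + 1))\<^sup>2" "(1 :: real)\<^sup>2 = 1" by simp_all
  note dz = boundary_damping_decay[OF z(1) ak(1,2) this(2,1) endpoint_control_free[OF z(1) ak(1) k0]]
  have dfb: "energy_decays fb'" "energy_decays gb'" using energy_decays_of_window[OF Lb(1) db(1)] energy_decays_of_window[OF Lb(2) db(2)] by simp_all
  have dfz: "energy_decays fz'" "energy_decays gz'" using energy_decays_of_window[OF Lz(1) dz(1)] energy_decays_of_window[OF Lz(2) dz(2)] by simp_all
  have dhp: "exp_decays (\<lambda>t. (hp t)\<^sup>2)"
    using exp_decays_square_sum[OF db(3) dz(3)] by (simp add: hp_def algebra_simps)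
  have dy: "energy_decays y'"
  proof (rule energy_decays_cong_window[OF Ly])
    show "L2loc (\<lambda>t. s * hp' t)" by (intro L2loc_cmult prim_L2loc[OF php])
    show "y' t = s * hp' t" if "t \<ge> 0" for t using that by (simp add: y'_def)
    show "geo_decays (window (\<lambda>t. s * hp' t))" unfolding hp'_def
      by (intro geo_decays_window_cmult geo_decays_window_add L2loc_add Lb Lz db dz)
  qed
  have dy2: "exp_decays (\<lambda>t. (y t)\<^sup>2)"
    by (rule exp_decays_mono[OF exp_decays_square_cmult[OF dhp, of s]]) (simp add: ypos)
  show ?thesis
  proof (rule that[OF casc])
    show "fe 0 = 0" "fb 0 = 0" using b(2) z(2) by (simp_all add: fe_def)
    show "AE x\<in>{0<..<1} in lborel. fe' x + ge' (- x) = e1 x" "AE x\<in>{0<..<1} in lborel. fb' x + gb' (- x) = b1 x"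
      using xe' xb' by auto
    show "energy_decays fe'" unfolding fe'_def by (intro energy_decays_add Lb Lz dfb dfz)
    have "energy_decays (\<lambda>t. (gb' t + gz' t) + (-1) * y' t)"
      by (intro energy_decays_add energy_decays_cmult L2loc_add L2loc_cmult Lb Lz Ly dfb dfz dy)
    then show "energy_decays ge'" by (simp add: ge'_def)
    have "exp_decays (\<lambda>t. (hp t + (-1) * y t)\<^sup>2)" by (rule exp_decays_square_sum[OF dhp exp_decays_square_cmult[OF dy2, of "-1"]])
    then show "exp_decays (\<lambda>t. (fe t + ge t)\<^sup>2)" by (simp add: hfe)
  qed (use xe xb yneg dfb dy dy2 db(3) in auto)
qed

section \<open>The solution assembled from its profiles\<close>

lemma exp_decays_zero: "exp_decays (\<lambda>_. 0)"
  by (rule exp_decaysI[of 0 1]) auto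

lemma exp_decays_shift: assumes "exp_decays E" shows "exp_decays (\<lambda>t. E (1 + t))"
proof -
  obtain M \<mu> where M: "0 \<le> M" "0 < \<mu>" "\<And>t. t \<ge> 0 \<Longrightarrow> E t \<le> M * exp (- \<mu> * t)" using assms by (auto simp: exp_decays_def)
  show ?thesis
  proof (rule exp_decaysI[OF M(1,2)])
    fix t :: real assume t: "t \<ge> 0"
    have "E (1 + t) \<le> M * exp (- \<mu> * (1 + t))" using t by (intro M(3)) simp
    also have "\<dots> \<le> M * exp (- \<mu> * t)" using M by (intro mult_left_mono) auto
    finally show "E (1 + t) \<le> M * exp (- \<mu> * t)" .
  qed
qed

lemma energy_decays_zero: "energy_decays (\<lambda>_. 0)"
  using exp_decays_zero by (simp add: energy_decays_def)

text \<open>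
  All profiles of a solution. The forcing terms of the delay system for \<open>w\<close> are the
  contributions of \<open>exp (q x) * r t\<close> to its boundary conditions, and of the value of
  \<open>\<epsilon>\<close> at \<open>x = 0\<close>.
\<close>

locale profiles =
  fixes q c0 c1 c2 c3 :: real and fe fe' ge ge' fb fb' gb gb' y y' fv fv' gv gv' r r1 :: "real \<Rightarrow> real"
  assumes params: "q > 0" "0 < c0" "c0 < 1" "c1 > 0" "c2 > 0" "c3 > 0"
    and bc: "boundary_conditions c0 c1 fe fe' ge ge' fb fb' gb gb' y y'"
    and r: "\<And>t. (r has_real_derivative r1 t) (at t)"
    and r1: "\<And>t. (r1 has_real_derivative q\<^sup>2 * r t + - ((c1 + q) * (c2 + q)) * (fe t + ge t)) (at t)"
    and v: "delay_system c2 0 ((1 - c3) / (1 + c3)) (\<lambda>t. (c2 - q) * r t + (c1 + q) * (fe t + ge t))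
      (\<lambda>t. - (exp q / (1 + c3)) * (q * r t + c3 * r1 t)) fv fv' gv gv'"
begin

lemma prims: "prim fe fe'" "prim ge ge'" "prim fb fb'" "prim gb gb'" "prim y y'" "prim fv fv'" "prim gv gv'"
  using bc v by (auto simp: boundary_conditions_def delay_system_def)

lemma conditions:
  "AE t in lborel. 0 < t \<longrightarrow> fe' t - ge' t = c1 * (fe t + ge t)"
  "AE t in lborel. 0 < t \<longrightarrow> fe' (t + 1) - ge' (t - 1) = fb' (t + 1) - gb' (t - 1) + y' (t - 1)"
  "AE t in lborel. 0 < t \<longrightarrow> fb' t - gb' t = c1 / (1 - c0) * (fb t + gb t) + c0 / (1 - c0) * (fb' t + gb' t)"
  "t \<ge> 0 \<Longrightarrow> fb (t + 1) + gb (t - 1) = 0" "t \<ge> 0 \<Longrightarrow> y t = - c0 * (fe t + ge t)"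
  using bc by (auto simp: boundary_conditions_def)

lemma continuous_forcing: "continuous_on UNIV (\<lambda>t. fe t + ge t)"
  by (intro continuous_intros prim_continuous_on[OF prims(1)] prim_continuous_on[OF prims(2)])

lemma continuous_particular: "continuous_on UNIV r" "continuous_on UNIV r1"
  by (auto intro!: continuous_at_imp_continuous_on DERIV_isCont[OF r] DERIV_isCont[OF r1])

sublocale E: dalembert q fe fe' ge ge' "\<lambda>_. 0" "\<lambda>_. 0" "\<lambda>_. 0"
  by unfold_locales (auto intro: prims)

sublocale B: dalembert q fb fb' gb gb' "\<lambda>_. 0" "\<lambda>_. 0" "\<lambda>_. 0"
  by unfold_locales (auto intro: prims)

sublocale Y: dalembert q "\<lambda>_. 0" "\<lambda>_. 0" y y' "\<lambda>_. 0" "\<lambda>_. 0" "\<lambda>_. 0"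
  by unfold_locales (auto intro: prims prim_const)

sublocale W: dalembert q fv fv' gv gv' r r1 "\<lambda>t. q\<^sup>2 * r t + - ((c1 + q) * (c2 + q)) * (fe t + ge t)"
proof unfold_locales
  have "continuous_on UNIV (\<lambda>t. - ((c1 + q) * (c2 + q)) * (fe t + ge t))"
    by (rule continuous_on_mult_left[OF continuous_forcing])
  from continuous_on_add[OF continuous_on_mult_left[OF continuous_particular(1), of "q\<^sup>2"] this]
  show "continuous_on UNIV (\<lambda>t. q\<^sup>2 * r t + - ((c1 + q) * (c2 + q)) * (fe t + ge t))" .
qed (rule prims r r1)+

definition sol :: "real \<Rightarrow> state" where
  "sol t = (E.U t, E.Ut t, Y.U t, B.U t, B.Ut t, W.U t, W.Ut t)"

definition starts_at where
  "starts_at e0 e1 Y0 b0 b1 w0 w1 \<longleftrightarrow>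
     (\<forall>x\<in>{0..1}. E.U 0 x = e0 x \<and> Y.U 0 x = Y0 x \<and> B.U 0 x = b0 x \<and> W.U 0 x = w0 x) \<and>
     (AE x\<in>{0<..<1} in lborel. E.Ut 0 x = e1 x \<and> B.Ut 0 x = b1 x \<and> W.Ut 0 x = w1 x)"

lemma clamped: "t \<ge> 0 \<Longrightarrow> B.U t 1 = 0"
  using conditions(4) by (simp add: B.U_def)

lemma continuous_sol: "continuous_X sol"
  unfolding continuous_X_def
proof (intro conjI allI impI)
  show "sol t \<in> X_space" if "t \<ge> 0" for t
    unfolding X_space_def H1_R_def sol_def using that
    by (simp add: E.U_H1 B.U_H1 Y.U_H1 W.U_H1 L2loc_imp_L2 E.Ut_L2loc B.Ut_L2loc W.Ut_L2loc clamped)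
  fix s :: real assume s: "s \<ge> 0"
  have "((\<lambda>t. (norm_X (sol t - sol s))\<^sup>2) \<longlongrightarrow> 0) (at s within {0..})"
    by (simp add: sol_def norm_X_sq)
       (intro tendsto_add_zero E.tendsto_U[OF s] B.tendsto_U[OF s] Y.tendsto_U[OF s] W.tendsto_U[OF s])
  from tendsto_real_sqrt[OF this] show "((\<lambda>t. norm_X (sol t - sol s)) \<longlongrightarrow> 0) (at s within {0..})"
    by (simp add: norm_X_nonneg)
qed

lemma eq_X_sol:
  assumes "starts_at e0 e1 Y0 b0 b1 w0 w1" shows "eq_X (sol 0) (e0, e1, Y0, b0, b1, w0, w1)"
proof -
  have z: "(E.U 0 - e0) x = 0" "(Y.U 0 - Y0) x = 0" "(B.U 0 - b0) x = 0" "(W.U 0 - w0) x = 0" if "x \<in> {0..1}" for x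
    using assms that by (simp_all add: starts_at_def)
  have ae: "AE x\<in>{0<..<1} in lborel. E.Ut 0 x = e1 x \<and> B.Ut 0 x = b1 x \<and> W.Ut 0 x = w1 x"
    using assms by (simp add: starts_at_def)
  have "AE x\<in>{0<..<1} in lborel. (E.Ut 0 - e1) x = 0" "AE x\<in>{0<..<1} in lborel. (B.Ut 0 - b1) x = 0"
    "AE x\<in>{0<..<1} in lborel. (W.Ut 0 - w1) x = 0"
    using ae by (eventually_elim, simp)+
  note n = this[THEN norm_L2_zero]
  have h: "norm_L2 (wderiv (E.U 0 - e0)) = 0" "norm_L2 (wderiv (Y.U 0 - Y0)) = 0" "norm_L2 (Y.U 0 - Y0) = 0"
    "norm_L2 (wderiv (B.U 0 - b0)) = 0" "norm_L2 (B.U 0 - b0) = 0" "norm_L2 (wderiv (W.U 0 - w0)) = 0"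
    by (rule H1_vanishing, erule z)+
  show ?thesis
    unfolding sol_def eq_X_iff
    using z(1)[of 0] z(4)[of 0] h by (simp add: n)
qed

lemma far_end_condition:
  assumes "0 < t" "fv' (t + 1) = (1 - c3) / (1 + c3) * gv' (t - 1) + - (exp q / (1 + c3)) * (q * r t + c3 * r1 t)"
  shows "W.Ux t 1 = - c3 * W.Ut t 1"
proof -
  have "1 + c3 \<noteq> 0" using params by linarith
  moreover have "fv' (t + 1) = ((1 - c3) * gv' (t - 1) - exp q * (q * r t + c3 * r1 t)) / (1 + c3)"
    unfolding assms(2) by (simp add: diff_divide_distrib left_diff_distrib)
  ultimately have "(1 + c3) * fv' (t + 1) = (1 - c3) * gv' (t - 1) - exp q * (q * r t + c3 * r1 t)"
    by simp
  then show ?thesis by (simp add: W.Ux_def W.Ut_def algebra_simps)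
qed

lemma sol_boundary:
  "AE t in lborel. 0 < t \<longrightarrow> E.Ux t 0 = c1 * E.U t 0 \<and> E.Ux t 1 = B.Ux t 1 - Y.Ux t 1 \<and>
    B.Ux t 0 = c1 / (1 - c0) * B.U t 0 + c0 / (1 - c0) * B.Ut t 0 \<and> B.U t 1 = 0 \<and>
    W.Ux t 0 = c2 * W.U t 0 + (c1 + q) * E.U t 0 \<and> W.Ux t 1 = - c3 * W.Ut t 1 \<and> Y.U t 0 = - c0 * E.U t 0"
proof -
  have v: "AE t in lborel. 0 < t \<longrightarrow> fv' t - gv' t = c2 * (fv t + gv t) + 0 * (fv' t + gv' t) +
      ((c2 - q) * r t + (c1 + q) * (fe t + ge t))"
    "AE t in lborel. 0 < t \<longrightarrow> fv' (t + 1) = (1 - c3) / (1 + c3) * gv' (t - 1) + - (exp q / (1 + c3)) * (q * r t + c3 * r1 t)"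
    using v unfolding delay_system_def by blast+
  from conditions(1-3) v show ?thesis
  proof eventually_elim
    case (elim t)
    show ?case
    proof
      assume t: "0 < t"
      have "W.Ux t 0 = c2 * W.U t 0 + (c1 + q) * E.U t 0"
        using elim(4) t by (simp add: W.Ux_def W.U_def E.U_def algebra_simps)
      then show "E.Ux t 0 = c1 * E.U t 0 \<and> E.Ux t 1 = B.Ux t 1 - Y.Ux t 1 \<and>
        B.Ux t 0 = c1 / (1 - c0) * B.U t 0 + c0 / (1 - c0) * B.Ut t 0 \<and> B.U t 1 = 0 \<and>
        W.Ux t 0 = c2 * W.U t 0 + (c1 + q) * E.U t 0 \<and> W.Ux t 1 = - c3 * W.Ut t 1 \<and> Y.U t 0 = - c0 * E.U t 0"
        using elim(1-3) t far_end_condition[OF t] elim(5) conditions(5)[of t] clamped[of t]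
        by (simp add: E.Ux_def E.U_def B.Ux_def B.U_def B.Ut_def Y.Ux_def Y.U_def)
    qed
  qed
qed

lemma wave_eq_W: "wave_eq W.U (\<lambda>t x. - ((c1 + q) * (c2 + q) * exp (q * x) * E.U t 0))"
proof -
  have "dpair (\<lambda>t x. exp (q * x) * (q\<^sup>2 * r t + - ((c1 + q) * (c2 + q)) * (fe t + ge t) - q\<^sup>2 * r t)) \<phi>
    = dpair (\<lambda>t x. - ((c1 + q) * (c2 + q) * exp (q * x) * E.U t 0)) \<phi>" for \<phi>
    by (rule dpair_cong) (simp add: E.U_def algebra_simps)
  then show ?thesis using W.wave_eq_U by (simp add: wave_eq_def)
qed

lemma transport_Y: "transport_eq Y.U"
  unfolding transport_eq_def
proof (intro allI impI)
  fix \<phi> :: "real \<times> real \<Rightarrow> real" assume \<phi>: "test_xt \<phi>"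
  have "L2loc y" by (intro L2loc_continuous prim_continuous_on[OF prims(5)])
  from transport_weak(2)[OF this \<phi>] show "- dpair Y.U (D_t \<phi>) = dpair Y.U (D_x \<phi>)"
    by (simp add: Y.U_def[abs_def])
qed

lemma is_solution_sol:
  assumes "starts_at e0 e1 Y0 b0 b1 w0 w1"
  shows "is_solution q c0 c1 c2 c3 (e0, e1, Y0, b0, b1, w0, w1) sol"
  unfolding is_solution_def
proof (intro conjI exI)
  show "continuous_X sol" by (rule continuous_sol)
  show "eq_X (sol 0) (e0, e1, Y0, b0, b1, w0, w1)" by (rule eq_X_sol[OF assms])
  show "sol = (\<lambda>t. (E.U t, E.Ut t, Y.U t, B.U t, B.Ut t, W.U t, W.Ut t))" by (rule ext) (rule sol_def)
  show "wave_eq E.U (\<lambda>t x. 0)" "wave_eq B.U (\<lambda>t x. 0)" using E.wave_eq_U B.wave_eq_U by simp_all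
  show "AE t in lborel. 0 < t \<longrightarrow> E.Ux t 0 = c1 * E.U t 0 \<and> E.Ux t 1 = B.Ux t 1 - Y.Ux t 1 \<and>
    B.Ux t 0 = c1 / (1 - c0) * B.U t 0 + c0 / (1 - c0) * B.Ut t 0 \<and> B.U t 1 = 0 \<and>
    W.Ux t 0 = c2 * W.U t 0 + (c1 + q) * E.U t 0 \<and> W.Ux t 1 = - c3 * W.Ut t 1 \<and> Y.U t 0 = - c0 * E.U t 0"
    by (rule sol_boundary)
qed (auto intro: E.time_deriv_U B.time_deriv_U W.time_deriv_U wave_eq_W transport_Y E.trace_U B.trace_U Y.trace_U W.trace_U)

text \<open>
  The cascade and \<open>r\<close> force the delay system of \<open>w\<close>, so its decay
  follows from theirs.
\<close>

lemma sol_decays: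
  assumes d: "energy_decays fe'" "energy_decays ge'" "energy_decays fb'" "energy_decays gb'" "energy_decays y'"
    and p: "exp_decays (\<lambda>t. (fe t + ge t)\<^sup>2)" "exp_decays (\<lambda>t. (fb t + gb t)\<^sup>2)" "exp_decays (\<lambda>t. (y t)\<^sup>2)"
    and dr: "exp_decays (\<lambda>t. (r t)\<^sup>2)" "exp_decays (\<lambda>t. (r1 t)\<^sup>2)"
  shows "\<exists>M>0. \<exists>\<mu>>0. \<forall>t\<ge>0. norm_X (sol t) \<le> M * exp (- \<mu> * t)"
proof -
  let ?d0 = "\<lambda>t. (c2 - q) * r t + (c1 + q) * (fe t + ge t)"
  let ?d1 = "\<lambda>t. - (exp q / (1 + c3)) * (q * r t + c3 * r1 t)"
  have \<rho>: "\<bar>(1 - c3) / (1 + c3)\<bar> < 1" using params by (simp add: abs_if field_simps)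
  have c: "continuous_on UNIV ?d0" "continuous_on UNIV ?d1"
    by (rule continuous_on_add[OF continuous_on_mult_left[OF continuous_particular(1)] continuous_on_mult_left[OF continuous_forcing]])
       (intro continuous_intros continuous_particular)
  have d0: "exp_decays (\<lambda>t. (?d0 t)\<^sup>2)"
    by (rule exp_decays_square_sum[OF exp_decays_square_cmult[OF dr(1)] exp_decays_square_cmult[OF p(1)]])
  have "exp_decays (\<lambda>t. (?d1 t)\<^sup>2)"
    by (rule exp_decays_square_cmult[OF exp_decays_square_sum[OF exp_decays_square_cmult[OF dr(1)] exp_decays_square_cmult[OF dr(2)]]])
  from exp_decays_shift[OF this] have d1: "exp_decays (\<lambda>t. (?d1 (1 + t))\<^sup>2)" .
  note dv = far_end_damping_decay[OF v params(5) \<rho> c d0 d1]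
  have vw: "energy_decays fv'" "energy_decays gv'"
    by (rule energy_decays_of_window[OF prim_L2loc[OF prims(6)] dv(1)], rule energy_decays_of_window[OF prim_L2loc[OF prims(7)] dv(2)])
  have z: "exp_decays (\<lambda>t. 0\<^sup>2)" using exp_decays_zero by simp
  note E = E.U_decays[OF d(1,2) z z] and B = B.U_decays[OF d(3,4) z z] and Y = Y.U_decays[OF energy_decays_zero d(5) z z]
    and W = W.U_decays[OF vw dr]
  have e0: "exp_decays (\<lambda>t. (E.U t 0)\<^sup>2)" and b0: "exp_decays (\<lambda>t. (B.U t 0)\<^sup>2)" and y0: "exp_decays (\<lambda>t. (Y.U t 0)\<^sup>2)"
    using p by (simp_all add: E.U_def B.U_def Y.U_def)
  have w0: "exp_decays (\<lambda>t. (W.U t 0)\<^sup>2)" using exp_decays_square_sum[OF dv(3) dr(1)] by (simp add: W.U_def)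
  have bl: "exp_decays (\<lambda>t. (norm_L2 (B.U t))\<^sup>2)"
    by (rule exp_decays_mono[OF exp_decays_add[OF exp_decays_cmult[OF b0, of 2] exp_decays_cmult[OF B(1), of 2]]])
       (use H1_poincare[OF B.U_H1] in auto)
  have yl: "exp_decays (\<lambda>t. (norm_L2 (Y.U t))\<^sup>2)"
    by (rule exp_decays_mono[OF exp_decays_add[OF exp_decays_cmult[OF y0, of 2] exp_decays_cmult[OF Y(1), of 2]]])
       (use H1_poincare[OF Y.U_H1] in auto)
  have "exp_decays (\<lambda>t. (norm_X (sol t))\<^sup>2)"
    unfolding sol_def norm_X_sq by (intro exp_decays_add E B Y(1) W e0 w0 bl yl)
  from exp_decays_sqrt[OF this] obtain M \<mu> where M: "0 \<le> M" "0 < \<mu>"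
    "\<And>t x. t \<ge> 0 \<Longrightarrow> x\<^sup>2 \<le> (norm_X (sol t))\<^sup>2 \<Longrightarrow> \<bar>x\<bar> \<le> M * exp (- \<mu> * t)" by metis
  have "norm_X (sol t) \<le> (M + 1) * exp (- \<mu> * t)" if "t \<ge> 0" for t
  proof -
    have "norm_X (sol t) \<le> M * exp (- \<mu> * t)" using M(3)[OF that order_refl] by simp
    also have "\<dots> \<le> (M + 1) * exp (- \<mu> * t)" by simp
    finally show ?thesis .
  qed
  then show ?thesis using M by (intro exI[of _ "M + 1"] exI[of _ \<mu>] conjI allI impI) auto
qed

end

section \<open>Uniqueness\<close>

lemma CL2_cong_AE:
  assumes F: "CL2 F" and G: "\<And>t. t \<ge> 0 \<Longrightarrow> G t \<in> L2"
    and ae: "\<And>t. t \<ge> 0 \<Longrightarrow> AE x\<in>{0<..<1} in lborel. F t x = G t x"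
  shows "CL2 G"
  unfolding CL2_def
proof (intro conjI allI impI G)
  fix s :: real assume s: "s \<ge> 0"
  have e: "(LINT x:{0<..<1}|lborel. (F t x - F s x)\<^sup>2) = (LINT x:{0<..<1}|lborel. (G t x - G s x)\<^sup>2)" if t: "t \<ge> 0" for t
  proof -
    have "norm_L2 (\<lambda>x. F t x - F s x) = norm_L2 (\<lambda>x. G t x - G s x)"
    proof (rule norm_L2_cong_AE)
      show "(\<lambda>x. F t x - F s x) \<in> L2" "(\<lambda>x. G t x - G s x) \<in> L2" by (intro L2_diff CL2_L2[OF F] G s t)+
      show "AE x\<in>{0<..<1} in lborel. F t x - F s x = G t x - G s x"
        using ae[OF s] ae[OF t] by eventually_elim auto
    qed
    then show ?thesis by (simp add: norm_L2_sq[symmetric])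
  qed
  show "((\<lambda>t. LINT x:{0<..<1}|lborel. (G t x - G s x)\<^sup>2) \<longlongrightarrow> 0) (at s within {0..})"
  proof (rule Lim_transform_eventually[OF CL2_tendsto[OF F s]])
    show "\<forall>\<^sub>F t in at s within {0..}. (LINT x:{0<..<1}|lborel. (F t x - F s x)\<^sup>2) = (LINT x:{0<..<1}|lborel. (G t x - G s x)\<^sup>2)"
      unfolding eventually_at_filter by (intro always_eventually allI impI e) simp
  qed
qed

lemma H1_eqI:
  assumes "f \<in> H1" "g \<in> H1" "norm_L2 (wderiv (f - g)) = 0" "f 0 = g 0 \<or> norm_L2 (f - g) = 0" "x \<in> {0..1}"
  shows "f x = g x"
proof -
  note H = H1_minus(1)[OF assms(1,2)]
  have "(f - g) 0 = 0" using assms(3,4) H1_sobolev[OF H] by auto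
  from H1_norm_L2_wderiv_zero[OF H assms(3) this assms(5)] show ?thesis by simp
qed

lemma L2_eqI:
  assumes "f \<in> L2" "g \<in> L2" "norm_L2 (f - g) = 0" shows "AE x\<in>{0<..<1} in lborel. f x = g x"
proof -
  have "f - g \<in> L2" using L2_diff[OF assms(1,2)] by (simp add: fun_diff_def)
  from norm_L2_zero_D[OF this assms(3)] show ?thesis by eventually_elim simp
qed

text \<open>
  A solution of the transport equation solves the wave equation with time derivative \<open>-
  F\<^sub>x\<close>. The wave moving to the left then has derivative 0.
\<close>

lemma transport_is_travelling:
  assumes H1: "\<And>t. t \<ge> 0 \<Longrightarrow> F t \<in> H1" and CF: "CL2 F" "CL2 (\<lambda>t. wderiv (F t))"
    and c0: "continuous_on {0..} (\<lambda>t. F t 0)" and tr: "transport_eq F"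
  obtains g g' where "prim g g'" "\<And>t x. t \<ge> 0 \<Longrightarrow> x \<in> {0..1} \<Longrightarrow> F t x = g (t - x)"
proof -
  let ?F' = "\<lambda>t x. - wderiv (F t) x"
  have wd: "has_weak_deriv (F t) (wderiv (F t))" if "t > 0" for t using wderiv_H1[OF H1[of t]] that by simp
  have td: "time_deriv F ?F'"
    using tr dpair_D_x[OF wd] by (simp add: time_deriv_def transport_eq_def dpair_uminus)
  have wave: "dpair F (D_t (D_t (moving_product \<sigma> \<theta> \<eta>))) = dpair F (D_x (D_x (moving_product \<sigma> \<theta> \<eta>)))"
    if s: "smooth \<theta>" "smooth \<eta>" and t: "test_xt (moving_product \<sigma> \<theta> \<eta>)" for \<sigma> \<theta> \<eta>
  proof -
    let ?\<phi> = "moving_product \<sigma> \<theta> \<eta>"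
    have "- dpair F (D_t (D_t ?\<phi>)) = dpair F (D_x (D_t ?\<phi>))" "- dpair F (D_t (D_x ?\<phi>)) = dpair F (D_x (D_x ?\<phi>))"
      using tr test_xt_D[OF t] unfolding transport_eq_def by blast+
    then show ?thesis unfolding D_t_D_x_moving_product[OF s] by linarith
  qed
  obtain f f' g g' where p: "prim f f'" "prim g g'" "f 0 = 0"
    and F: "\<And>t x. t \<ge> 0 \<Longrightarrow> x \<in> {0..1} \<Longrightarrow> F t x = f (t + x) + g (t - x)"
    and F': "\<And>t. t \<ge> 0 \<Longrightarrow> AE x\<in>{0<..<1} in lborel. - wderiv (F t) x = f' (t + x) + g' (t - x)"
    by (rule weak_wave_is_travelling[OF H1 CF CL2_uminus[OF CF(2)] c0 td wave]) blast+
  have step: "f (t + x) = f t" if t: "t \<ge> 0" and x: "x \<in> {0..1}" for t x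
  proof -
    have "prim (\<lambda>x. f (t + x) + g (t - x)) (\<lambda>x. f' (t + x) + - g' (t - x))" by (intro prim_add prim_shift prim_flip p)
    from H1_of_prim(2)[OF this, of "F t"] F[OF t]
    have "AE x\<in>{0<..<1} in lborel. wderiv (F t) x = f' (t + x) + - g' (t - x)" by simp
    then have "AE s in lborel. s \<in> {0<..<x} \<longrightarrow> f' (t + s) = 0"
      using F'[OF t] by eventually_elim (use x in auto)
    from prim_zero_deriv[OF prim_shift[OF p(1), of t] _ this] x show ?thesis by simp
  qed
  have nat: "f (real n) = 0" for n
  proof (induction n)
    case (Suc n)
    then show ?case using step[of "real n" 1] by (simp add: add.commute)
  qed (simp add: p(3))
  have f: "f t = 0" if "t \<ge> 0" for t
    using step[of "real (nat \<lfloor>t\<rfloor>)" "t - real (nat \<lfloor>t\<rfloor>)"] nat[of "nat \<lfloor>t\<rfloor>"] that by (simp, linarith)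
  show ?thesis
  proof (rule that[OF p(2)])
    show "F t x = g (t - x)" if "t \<ge> 0" "x \<in> {0..1}" for t x using F[OF that] f[of "t + x"] that by simp
  qed
qed

lemma wave_is_travelling:
  assumes "\<And>t. t \<ge> 0 \<Longrightarrow> F t \<in> H1" "CL2 F" "CL2 (\<lambda>t. wderiv (F t))" "CL2 F'"
    "continuous_on {0..} (\<lambda>t. F t 0)" "time_deriv F F'" and wave: "wave_eq F (\<lambda>t x. 0)"
  obtains f f' g g' where "prim f f'" "prim g g'" "f 0 = 0"
    "\<And>t x. t \<ge> 0 \<Longrightarrow> x \<in> {0..1} \<Longrightarrow> F t x = f (t + x) + g (t - x)"
    "\<And>t. t \<ge> 0 \<Longrightarrow> AE x\<in>{0<..<1} in lborel. F' t x = f' (t + x) + g' (t - x)"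
proof -
  have e: "dpair F (D_t (D_t \<phi>)) = dpair F (D_x (D_x \<phi>))" if "test_xt \<phi>" for \<phi>
    using wave that by (simp add: wave_eq_def dpair_def)
  show ?thesis
    using that by - (rule weak_wave_is_travelling[OF assms(1-6)], assumption, erule e, blast)
qed

lemma travelling_deriv_AE_unique:
  assumes p: "prim f f'" "prim g g'" "prim F F'" "prim G G'"
    and e: "\<And>t. t \<ge> 0 \<Longrightarrow> f t = F t" "\<And>t. t \<ge> -1 \<Longrightarrow> g t = G t" and t: "t \<ge> 0"
  shows "AE x\<in>{0<..<1} in lborel. f' (t + x) + g' (t - x) = F' (t + x) + G' (t - x)"
proof -
  have "prim (\<lambda>x. f (t + x) - g (t - x)) (\<lambda>x. f' (t + x) - - g' (t - x))"
    "prim (\<lambda>x. F (t + x) - G (t - x)) (\<lambda>x. F' (t + x) - - G' (t - x))"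
    by (intro prim_diff prim_shift prim_flip p)+
  from prim_AE_unique[OF this, of 0 1] show ?thesis using e t by simp
qed

lemma (in dalembert) wderiv_of_eq:
  assumes "\<And>x. x \<in> {0..1} \<Longrightarrow> h x = U t x" shows "AE x\<in>{0<..<1} in lborel. wderiv h x = Ux t x"
  using H1_of_prim(2)[OF prim_U_x, of h t] assms by simp

lemma (in dalembert) trace_of_eq:
  assumes "\<And>t x. t \<ge> 0 \<Longrightarrow> x \<in> {0..1} \<Longrightarrow> F t x = U t x" "\<xi> \<in> {0, 1}" "has_trace_x F \<xi> a"
  shows "AE t in lborel. 0 < t \<longrightarrow> a t = Ux t \<xi>"
proof -
  have "AE t in lborel. 0 < t \<longrightarrow> (AE x\<in>{0<..<1} in lborel. wderiv (F t) x = Ux t x)"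
    by (intro AE_I2 impI wderiv_of_eq assms(1)) auto
  from trace_Ux[OF assms(2) this] assms(3) show ?thesis by simp
qed

lemma (in dalembert) trace_of_AE_eq:
  assumes "\<And>t. t \<ge> 0 \<Longrightarrow> AE x\<in>{0<..<1} in lborel. F' t x = Ut t x" "\<xi> \<in> {0, 1}" "has_trace F' \<xi> a"
  shows "AE t in lborel. 0 < t \<longrightarrow> a t = Ut t \<xi>"
proof -
  have "AE t in lborel. 0 < t \<longrightarrow> (AE x\<in>{0<..<1} in lborel. F' t x = Ut t x)"
    by (intro AE_I2 impI assms(1)) auto
  from trace_Ut[OF assms(2) this] assms(3) show ?thesis by simp
qed

lemma solution_has_profiles:
  assumes cont: "continuous_X (\<lambda>t. (e t, e' t, Y t, b t, b' t, w t, w' t))"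
    and eqs: "time_deriv e e'" "time_deriv b b'" "wave_eq e (\<lambda>t x. 0)" "wave_eq b (\<lambda>t x. 0)" "transport_eq Y"
    and tr: "has_trace_x e 0 ex0" "has_trace_x e 1 ex1" "has_trace_x b 0 bx0" "has_trace_x b 1 bx1" "has_trace b' 0 bt0" "has_trace_x Y 1 Yx1"
    and bc: "AE t in lborel. 0 < t \<longrightarrow> ex0 t = c1 * e t 0 \<and> ex1 t = bx1 t - Yx1 t \<and>
      bx0 t = c1 / (1 - c0) * b t 0 + c0 / (1 - c0) * bt0 t \<and> Y t 0 = - c0 * e t 0"
  obtains fe fe' ge ge' fb fb' gb gb' y y' where
    "boundary_conditions c0 c1 fe fe' ge ge' fb fb' gb gb' y y'" "fe 0 = 0" "fb 0 = 0"
    "\<And>t x. t \<ge> 0 \<Longrightarrow> x \<in> {0..1} \<Longrightarrow> e t x = fe (t + x) + ge (t - x)"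
    "\<And>t x. t \<ge> 0 \<Longrightarrow> x \<in> {0..1} \<Longrightarrow> b t x = fb (t + x) + gb (t - x)"
    "\<And>t x. t \<ge> 0 \<Longrightarrow> x \<in> {0..1} \<Longrightarrow> Y t x = y (t - x)"
    "\<And>t. t \<ge> 0 \<Longrightarrow> AE x\<in>{0<..<1} in lborel. e' t x = fe' (t + x) + ge' (t - x)"
    "\<And>t. t \<ge> 0 \<Longrightarrow> AE x\<in>{0<..<1} in lborel. b' t x = fb' (t + x) + gb' (t - x)"
proof -
  note C = continuous_X_trajectories[OF cont]
  have H: "e t \<in> H1" "b t \<in> H1" "Y t \<in> H1" "b t 1 = 0" if "t \<ge> 0" for t using C(1)[OF that] by auto
  obtain fe fe' ge ge' where e: "prim fe fe'" "prim ge ge'" "fe 0 = 0"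
    "\<And>t x. t \<ge> 0 \<Longrightarrow> x \<in> {0..1} \<Longrightarrow> e t x = fe (t + x) + ge (t - x)"
    "\<And>t. t \<ge> 0 \<Longrightarrow> AE x\<in>{0<..<1} in lborel. e' t x = fe' (t + x) + ge' (t - x)"
    by (rule wave_is_travelling[OF H(1) C(3,2,5,4) eqs(1,3)]) blast+
  obtain fb fb' gb gb' where b: "prim fb fb'" "prim gb gb'" "fb 0 = 0"
    "\<And>t x. t \<ge> 0 \<Longrightarrow> x \<in> {0..1} \<Longrightarrow> b t x = fb (t + x) + gb (t - x)"
    "\<And>t. t \<ge> 0 \<Longrightarrow> AE x\<in>{0<..<1} in lborel. b' t x = fb' (t + x) + gb' (t - x)"
    by (rule wave_is_travelling[OF H(2) C(10,9,12,11) eqs(2,4)]) blast+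
  obtain y y' where y: "prim y y'" "\<And>t x. t \<ge> 0 \<Longrightarrow> x \<in> {0..1} \<Longrightarrow> Y t x = y (t - x)"
    by (rule transport_is_travelling[OF H(3) C(7,6,8) eqs(5)]) blast+
  interpret E: dalembert 0 fe fe' ge ge' "\<lambda>_. 0" "\<lambda>_. 0" "\<lambda>_. 0" by unfold_locales (auto intro: e)
  interpret B: dalembert 0 fb fb' gb gb' "\<lambda>_. 0" "\<lambda>_. 0" "\<lambda>_. 0" by unfold_locales (auto intro: b)
  interpret Y: dalembert 0 "\<lambda>_. 0" "\<lambda>_. 0" y y' "\<lambda>_. 0" "\<lambda>_. 0" "\<lambda>_. 0" by unfold_locales (auto intro: y prim_const)
  have eU: "e t x = E.U t x" and bU: "b t x = B.U t x" and YU: "Y t x = Y.U t x" if "t \<ge> 0" "x \<in> {0..1}" for t x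
    using e(4)[OF that] b(4)[OF that] y(2)[OF that] by (simp_all add: E.U_def B.U_def Y.U_def)
  have bUt: "AE x\<in>{0<..<1} in lborel. b' t x = B.Ut t x" if "t \<ge> 0" for t
    using b(5)[OF that] by (simp add: B.Ut_def)
  note T = E.trace_of_eq[OF eU _ tr(1)] E.trace_of_eq[OF eU _ tr(2)] B.trace_of_eq[OF bU _ tr(3)] B.trace_of_eq[OF bU _ tr(4)]
    B.trace_of_AE_eq[OF bUt _ tr(5)] Y.trace_of_eq[OF YU _ tr(6)]
  have ae: "AE t in lborel. 0 < t \<longrightarrow> fe' t - ge' t = c1 * (fe t + ge t)"
    "AE t in lborel. 0 < t \<longrightarrow> fe' (t + 1) - ge' (t - 1) = fb' (t + 1) - gb' (t - 1) + y' (t - 1)"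
    "AE t in lborel. 0 < t \<longrightarrow> fb' t - gb' t = c1 / (1 - c0) * (fb t + gb t) + c0 / (1 - c0) * (fb' t + gb' t)"
    using T[simplified] bc
    by (eventually_elim, use e(4)[of _ 0] b(4)[of _ 0] in \<open>force simp: E.Ux_def B.Ux_def B.Ut_def Y.Ux_def\<close>)+
  have y0: "AE t in lborel. 0 < t \<longrightarrow> y t + c0 * (fe t + ge t) = 0"
    using bc by eventually_elim (use e(4)[of _ 0] y(2)[of _ 0] in force)
  have "continuous_on UNIV (\<lambda>t. y t + c0 * (fe t + ge t))"
    by (intro continuous_intros prim_continuous_on[OF y(1)] prim_continuous_on[OF e(1)] prim_continuous_on[OF e(2)])
  from continuous_AE_zero[OF this y0] have y0: "\<forall>t\<ge>0. y t = - c0 * (fe t + ge t)" by force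
  have cl: "\<forall>t\<ge>0. fb (t + 1) + gb (t - 1) = 0" using b(4)[of _ 1] H(4) by simp
  have "boundary_conditions c0 c1 fe fe' ge ge' fb fb' gb gb' y y'"
    unfolding boundary_conditions_def using e(1,2) b(1,2) y(1) ae cl y0 by blast
  from that[OF this e(3) b(3) e(4) b(4) y(2) e(5) b(5)] show ?thesis .
qed

context profiles
begin

text \<open>
  The difference of two solutions is a weak solution of the homogeneous wave equation, hence
  travelling. The traces of \<open>w\<close> are known only for \<open>w\<close> itself, so they
  are computed by writing \<open>w\<close> as the sum of the difference and of the constructed
  solution, again a d'Alembert solution; subtracting the boundary conditions of the two yields a
  homogeneous delay system with zero initial values.
\<close>

lemma w_part_unique:
  assumes H: "\<And>t. t \<ge> 0 \<Longrightarrow> w t \<in> H1" and C: "CL2 w" "CL2 (\<lambda>t. wderiv (w t))" "CL2 w'" "continuous_on {0..} (\<lambda>t. w t 0)"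
    and eqs: "time_deriv w w'" "wave_eq w (\<lambda>t x. - ((c1 + q) * (c2 + q) * exp (q * x) * e t 0))"
    and e: "\<And>t. t \<ge> 0 \<Longrightarrow> e t 0 = E.U t 0"
    and tr: "has_trace_x w 0 wx0" "has_trace_x w 1 wx1" "has_trace w' 1 wt1"
    and bc: "AE t in lborel. 0 < t \<longrightarrow> wx0 t = c2 * w t 0 + (c1 + q) * e t 0 \<and> wx1 t = - c3 * wt1 t"
    and init: "\<And>x. x \<in> {0..1} \<Longrightarrow> w 0 x = W.U 0 x" "AE x\<in>{0<..<1} in lborel. w' 0 x = W.Ut 0 x"
    and t: "t \<ge> 0"
  shows "x \<in> {0..1} \<Longrightarrow> w t x = W.U t x" and "AE x\<in>{0<..<1} in lborel. w' t x = W.Ut t x"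
proof -
  let ?D = "\<lambda>t. w t - W.U t" and ?D' = "\<lambda>t x. w' t x - W.Ut t x"
  have D: "?D = (\<lambda>t x. w t x - W.U t x)" by (simp add: fun_diff_def)
  have HD: "?D t \<in> H1" if "t \<ge> 0" for t using H1_minus(1)[OF H[OF that] W.U_H1] .
  have CD: "CL2 ?D" unfolding D by (rule CL2_diff[OF C(1) W.CL2_U])
  have CDx: "CL2 (\<lambda>t. wderiv (?D t))"
  proof (rule CL2_cong_AE[OF CL2_diff[OF C(2) W.CL2_Ux]])
    fix t :: real assume t: "t \<ge> 0"
    show "wderiv (?D t) \<in> L2" using wderiv_H1[OF HD[OF t]] by simp
    show "AE x\<in>{0<..<1} in lborel. wderiv (w t) x - W.Ux t x = wderiv (?D t) x"
      using H1_minus(2)[OF H[OF t] W.U_H1[of t]] W.wderiv_U[of t] by eventually_elim auto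
  qed
  have cD: "continuous_on {0..} (\<lambda>t. ?D t 0)"
    using continuous_on_diff[OF C(4) prim_continuous_on[OF W.prim_U_t]] by simp
  have tD: "time_deriv ?D ?D'"
    unfolding time_deriv_def D
  proof (intro allI impI)
    fix \<phi> :: "real \<times> real \<Rightarrow> real" assume \<phi>: "test_xt \<phi>"
    have "- dpair w (D_t \<phi>) = dpair w' \<phi>" "- dpair W.U (D_t \<phi>) = dpair W.Ut \<phi>"
      using eqs(1) W.time_deriv_U \<phi> unfolding time_deriv_def by blast+
    then show "- dpair (\<lambda>t x. w t x - W.U t x) (D_t \<phi>) = dpair ?D' \<phi>"
      using dpair_diff[OF C(1) W.CL2_U test_xt_D(2)[OF \<phi>]] dpair_diff[OF C(3) W.CL2_Ut \<phi>] by simp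
  qed
  have wD: "wave_eq ?D (\<lambda>t x. 0)"
    unfolding wave_eq_def D
  proof (intro allI impI)
    fix \<phi> :: "real \<times> real \<Rightarrow> real" assume \<phi>: "test_xt \<phi>"
    note t2 = test_xt_D(1)[OF test_xt_D(1)[OF \<phi>]] test_xt_D(2)[OF test_xt_D(2)[OF \<phi>]]
    have "dpair w (D_t (D_t \<phi>)) = dpair w (D_x (D_x \<phi>)) + dpair (\<lambda>t x. - ((c1 + q) * (c2 + q) * exp (q * x) * e t 0)) \<phi>"
      "dpair W.U (D_t (D_t \<phi>)) = dpair W.U (D_x (D_x \<phi>)) + dpair (\<lambda>t x. - ((c1 + q) * (c2 + q) * exp (q * x) * E.U t 0)) \<phi>"
      using eqs(2) wave_eq_W \<phi> unfolding wave_eq_def by blast+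
    moreover have "dpair (\<lambda>t x. - ((c1 + q) * (c2 + q) * exp (q * x) * e t 0)) \<phi> = dpair (\<lambda>t x. - ((c1 + q) * (c2 + q) * exp (q * x) * E.U t 0)) \<phi>"
      by (rule dpair_cong) (simp add: e)
    moreover have "dpair (\<lambda>t x. 0) \<phi> = 0" by (simp add: dpair_def)
    ultimately show "dpair (\<lambda>t x. w t x - W.U t x) (D_t (D_t \<phi>)) = dpair (\<lambda>t x. w t x - W.U t x) (D_x (D_x \<phi>)) + dpair (\<lambda>t x. 0) \<phi>"
      using dpair_diff[OF C(1) W.CL2_U t2(1)] dpair_diff[OF C(1) W.CL2_U t2(2)] by simp
  qed
  obtain f f' g g' where p: "prim f f'" "prim g g'" "f 0 = 0"
    and DU: "\<And>t x. t \<ge> 0 \<Longrightarrow> x \<in> {0..1} \<Longrightarrow> ?D t x = f (t + x) + g (t - x)"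
    and DUt: "\<And>t. t \<ge> 0 \<Longrightarrow> AE x\<in>{0<..<1} in lborel. ?D' t x = f' (t + x) + g' (t - x)"
    by (rule wave_is_travelling[OF HD CD CDx CL2_diff[OF C(3) W.CL2_Ut] cD tD wD]) blast+
  interpret V: dalembert q "\<lambda>t. f t + fv t" "\<lambda>t. f' t + fv' t" "\<lambda>t. g t + gv t" "\<lambda>t. g' t + gv' t" r r1
    "\<lambda>t. q\<^sup>2 * r t + - ((c1 + q) * (c2 + q)) * (fe t + ge t)"
    by unfold_locales (intro prim_add p prims W.r W.r1 W.r2)+
  have wV: "w t x = V.U t x" if "t \<ge> 0" "x \<in> {0..1}" for t x
    using DU[OF that] by (simp add: V.U_def W.U_def)
  have wVt: "AE x\<in>{0<..<1} in lborel. w' t x = V.Ut t x" if "t \<ge> 0" for t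
    using DUt[OF that] by eventually_elim (auto simp: V.Ut_def W.Ut_def)
  note T = V.trace_of_eq[OF wV _ tr(1)] V.trace_of_eq[OF wV _ tr(2)] V.trace_of_AE_eq[OF wVt _ tr(3)]
  have near: "AE t in lborel. 0 < t \<longrightarrow> f' t - g' t = c2 * (f t + g t) + 0 * (f' t + g' t) + 0"
    using T(1)[simplified] bc sol_boundary
  proof eventually_elim
    case (elim t)
    show ?case
    proof
      assume t: "0 < t"
      have "V.Ux t 0 = c2 * V.U t 0 + (c1 + q) * E.U t 0" using elim(1,2) t wV[of t 0] e[of t] by simp
      moreover have "W.Ux t 0 = c2 * W.U t 0 + (c1 + q) * E.U t 0" using elim(3) t by simp
      ultimately show "f' t - g' t = c2 * (f t + g t) + 0 * (f' t + g' t) + 0"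
        by (simp add: V.Ux_def W.Ux_def V.U_def W.U_def algebra_simps)
    qed
  qed
  have far: "AE t in lborel. 0 < t \<longrightarrow> f' (t + 1) = (1 - c3) / (1 + c3) * g' (t - 1) + 0"
    using T(2,3)[simplified] bc sol_boundary
  proof eventually_elim
    case (elim t)
    show ?case
    proof
      assume t: "0 < t"
      have "V.Ux t 1 = - c3 * V.Ut t 1" using elim(1-3) t by simp
      moreover have "W.Ux t 1 = - c3 * W.Ut t 1" using elim(4) t by simp
      ultimately have "(1 + c3) * f' (t + 1) = (1 - c3) * g' (t - 1)"
        by (simp add: V.Ux_def W.Ux_def V.Ut_def W.Ut_def algebra_simps)
      then show "f' (t + 1) = (1 - c3) / (1 + c3) * g' (t - 1) + 0"
        using params by (simp add: field_simps)
    qed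
  qed
  have sys: "delay_system c2 0 ((1 - c3) / (1 + c3)) (\<lambda>_. 0) (\<lambda>_. 0) f f' g g'"
    unfolding delay_system_def using p near far by blast
  have z: "prim (\<lambda>_. 0) (\<lambda>_. 0)" by (rule prim_const)
  have i0: "f x + g (- x) = 0 + 0" if "x \<in> {0..1}" for x using DU[of 0 x] that init(1)[of x] by simp
  have i1: "AE x\<in>{0<..<1} in lborel. f' x + g' (- x) = 0 + 0"
    using DUt[of 0, simplified] init(2) by eventually_elim simp
  note i = initial_profiles_unique[OF p(1,2) z z p(3) _ i0 i1]
  have f: "f t = 0" if "t \<ge> 0" for t using delay_system_zero(1)[OF sys order_refl i that] by simp
  have g: "g t = 0" if "t \<ge> -1" for t using delay_system_zero(2)[OF sys order_refl i that] by simp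
  show "x \<in> {0..1} \<Longrightarrow> w t x = W.U t x" using DU[OF t, of x] f[of "t + x"] g[of "t - x"] t by simp
  have "AE x\<in>{0<..<1} in lborel. f' (t + x) + g' (t - x) = 0 + 0"
    by (rule travelling_deriv_AE_unique[OF p(1,2) z z f g t])
  then show "AE x\<in>{0<..<1} in lborel. w' t x = W.Ut t x" using DUt[OF t] by eventually_elim auto
qed

lemma solution_unique:
  assumes X: "(e0, e1, Y0, b0, b1, w0, w1) \<in> X_space" and start: "starts_at e0 e1 Y0 b0 b1 w0 w1" "fe 0 = 0" "fb 0 = 0"
    and sol: "is_solution q c0 c1 c2 c3 (e0, e1, Y0, b0, b1, w0, w1) v" and t: "t \<ge> 0"
  shows "eq_X (v t) (sol t)"
proof -
  obtain e e' Y b b' w w' ex0 ex1 bx0 bx1 bt0 Yx1 wx0 wx1 wt1 where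
    v: "v = (\<lambda>t. (e t, e' t, Y t, b t, b' t, w t, w' t))" and
    eqs: "time_deriv e e'" "time_deriv b b'" "time_deriv w w'" "wave_eq e (\<lambda>t x. 0)" "wave_eq b (\<lambda>t x. 0)"
      "wave_eq w (\<lambda>t x. - ((c1 + q) * (c2 + q) * exp (q * x) * e t 0))" "transport_eq Y" and
    tr: "has_trace_x e 0 ex0" "has_trace_x e 1 ex1" "has_trace_x b 0 bx0" "has_trace_x b 1 bx1" "has_trace b' 0 bt0" "has_trace_x Y 1 Yx1"
      "has_trace_x w 0 wx0" "has_trace_x w 1 wx1" "has_trace w' 1 wt1" and
    bc: "AE t in lborel. 0 < t \<longrightarrow> ex0 t = c1 * e t 0 \<and> ex1 t = bx1 t - Yx1 t \<and>
      bx0 t = c1 / (1 - c0) * b t 0 + c0 / (1 - c0) * bt0 t \<and> b t 1 = 0 \<and>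
      wx0 t = c2 * w t 0 + (c1 + q) * e t 0 \<and> wx1 t = - c3 * wt1 t \<and> Y t 0 = - c0 * e t 0"
    using sol unfolding is_solution_def by (elim conjE exE) blast
  have cont: "continuous_X (\<lambda>t. (e t, e' t, Y t, b t, b' t, w t, w' t))" using sol by (simp add: is_solution_def v)
  note C = continuous_X_trajectories[OF cont]
  have H: "e t \<in> H1" "e' t \<in> L2" "Y t \<in> H1" "b t \<in> H1" "b' t \<in> L2" "w t \<in> H1" "w' t \<in> L2" if "t \<ge> 0" for t
    using C(1)[OF that] by auto
  have X': "e0 \<in> H1" "e1 \<in> L2" "Y0 \<in> H1" "b0 \<in> H1" "b1 \<in> L2" "w0 \<in> H1" "w1 \<in> L2"
    using X by (auto simp: X_space_def H1_R_def)
  have "eq_X (e 0, e' 0, Y 0, b 0, b' 0, w 0, w' 0) (e0, e1, Y0, b0, b1, w0, w1)" using sol by (simp add: is_solution_def v)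
  note q = this[unfolded eq_X_iff]
  have i: "e 0 x = E.U 0 x" "Y 0 x = Y.U 0 x" "b 0 x = B.U 0 x" "w 0 x = W.U 0 x" if x: "x \<in> {0..1}" for x
    using H1_eqI[OF H(1)[of 0] X'(1) _ _ x] H1_eqI[OF H(3)[of 0] X'(3) _ _ x] H1_eqI[OF H(4)[of 0] X'(4) _ _ x]
      H1_eqI[OF H(6)[of 0] X'(6) _ _ x] q start(1) x by (auto simp: starts_at_def)
  have st: "AE x\<in>{0<..<1} in lborel. E.Ut 0 x = e1 x \<and> B.Ut 0 x = b1 x \<and> W.Ut 0 x = w1 x"
    using start(1) by (simp add: starts_at_def)
  have "AE x\<in>{0<..<1} in lborel. e' 0 x = e1 x" "AE x\<in>{0<..<1} in lborel. b' 0 x = b1 x"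
    "AE x\<in>{0<..<1} in lborel. w' 0 x = w1 x"
    using L2_eqI[OF H(2)[of 0] X'(2)] L2_eqI[OF H(5)[of 0] X'(5)] L2_eqI[OF H(7)[of 0] X'(7)] q by auto
  with st have j: "AE x\<in>{0<..<1} in lborel. e' 0 x = E.Ut 0 x" "AE x\<in>{0<..<1} in lborel. b' 0 x = B.Ut 0 x"
    "AE x\<in>{0<..<1} in lborel. w' 0 x = W.Ut 0 x"
    by (eventually_elim, simp)+
  have bc1: "AE t in lborel. 0 < t \<longrightarrow> ex0 t = c1 * e t 0 \<and> ex1 t = bx1 t - Yx1 t \<and>
      bx0 t = c1 / (1 - c0) * b t 0 + c0 / (1 - c0) * bt0 t \<and> Y t 0 = - c0 * e t 0"
    using bc by eventually_elim blast
  obtain Fe Fe' Ge Ge' Fb Fb' Gb Gb' z z' where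
    V: "boundary_conditions c0 c1 Fe Fe' Ge Ge' Fb Fb' Gb Gb' z z'" "Fe 0 = 0" "Fb 0 = 0"
    "\<And>t x. t \<ge> 0 \<Longrightarrow> x \<in> {0..1} \<Longrightarrow> e t x = Fe (t + x) + Ge (t - x)"
    "\<And>t x. t \<ge> 0 \<Longrightarrow> x \<in> {0..1} \<Longrightarrow> b t x = Fb (t + x) + Gb (t - x)"
    "\<And>t x. t \<ge> 0 \<Longrightarrow> x \<in> {0..1} \<Longrightarrow> Y t x = z (t - x)"
    "\<And>t. t \<ge> 0 \<Longrightarrow> AE x\<in>{0<..<1} in lborel. e' t x = Fe' (t + x) + Ge' (t - x)"
    "\<And>t. t \<ge> 0 \<Longrightarrow> AE x\<in>{0<..<1} in lborel. b' t x = Fb' (t + x) + Gb' (t - x)"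
    by (rule solution_has_profiles[OF cont eqs(1,2,4,5,7) tr(1-6) bc1]) blast+
  have pV: "prim Fe Fe'" "prim Ge Ge'" "prim Fb Fb'" "prim Gb Gb'" using V(1) by (auto simp: boundary_conditions_def)
  have ie: "Fe x + Ge (- x) = fe x + ge (- x)" "Fb x + Gb (- x) = fb x + gb (- x)" if "x \<in> {0..1}" for x
    using i[OF that] V(4)[of 0 x] V(5)[of 0 x] that by (simp_all add: E.U_def B.U_def)
  have ie': "AE x\<in>{0<..<1} in lborel. Fe' x + Ge' (- x) = fe' x + ge' (- x)"
    using j(1) V(7)[of 0, simplified] by eventually_elim (simp add: E.Ut_def)
  have ib': "AE x\<in>{0<..<1} in lborel. Fb' x + Gb' (- x) = fb' x + gb' (- x)"
    using j(2) V(8)[of 0, simplified] by eventually_elim (simp add: B.Ut_def)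
  note ue = initial_profiles_unique[OF pV(1,2) prims(1,2) V(2) start(2) ie(1) ie']
  note ub = initial_profiles_unique[OF pV(3,4) prims(3,4) V(3) start(3) ie(2) ib']
  have uy: "z t = y t" if "t \<in> {-1..0}" for t
    using i(2)[of "- t"] V(6)[of 0 "- t"] that by (simp add: Y.U_def)
  have casc: "cascade c0 c1 Fe Fe' Ge Ge' Fb Fb' Gb Gb' z z'" "cascade c0 c1 fe fe' ge ge' fb fb' gb gb' y y'"
    using V(1) bc boundary_conditions_iff_cascade[OF params(2,3)] profiles.bc[OF profiles_axioms] by blast+
  note U = cascade_unique[OF params(2,3) casc ue ub uy]
  have eU: "e t x = E.U t x" and bU: "b t x = B.U t x" and YU: "Y t x = Y.U t x" if "t \<ge> 0" "x \<in> {0..1}" for t x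
    using V(4-6)[OF that] U(1,3)[of "t + x"] U(2,4,5)[of "t - x"] that by (simp_all add: E.U_def B.U_def Y.U_def)
  have "AE x\<in>{0<..<1} in lborel. Fe' (t + x) + Ge' (t - x) = fe' (t + x) + ge' (t - x)"
    by (rule travelling_deriv_AE_unique[OF pV(1,2) prims(1,2) U(1,2) t])
  with V(7)[OF t] have eUt: "AE x\<in>{0<..<1} in lborel. e' t x = E.Ut t x"
    by eventually_elim (simp add: E.Ut_def)
  have "AE x\<in>{0<..<1} in lborel. Fb' (t + x) + Gb' (t - x) = fb' (t + x) + gb' (t - x)"
    by (rule travelling_deriv_AE_unique[OF pV(3,4) prims(3,4) U(3,4) t])
  with V(8)[OF t] have bUt: "AE x\<in>{0<..<1} in lborel. b' t x = B.Ut t x"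
    by eventually_elim (simp add: B.Ut_def)
  have e0: "e t 0 = E.U t 0" if "t \<ge> 0" for t using eU[OF that, of 0] by simp
  have bc2: "AE t in lborel. 0 < t \<longrightarrow> wx0 t = c2 * w t 0 + (c1 + q) * e t 0 \<and> wx1 t = - c3 * wt1 t"
    using bc by eventually_elim blast
  note W = w_part_unique[where w=w and w'=w' and e=e, OF H(6) C(14,13,16,15) eqs(3,6) e0 tr(7-9) bc2 i(4) j(3) t]
  have w: "w t x = W.U t x" if "x \<in> {0..1}" for x by (rule W(1)) (use that in auto)
  have w': "AE x\<in>{0<..<1} in lborel. w' t x = W.Ut t x" by (rule W(2)) auto
  have zero: "norm_L2 (wderiv (e t - E.U t)) = 0" "norm_L2 (Y t - Y.U t) = 0" "norm_L2 (wderiv (Y t - Y.U t)) = 0"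
    "norm_L2 (b t - B.U t) = 0" "norm_L2 (wderiv (b t - B.U t)) = 0" "norm_L2 (wderiv (w t - W.U t)) = 0"
    by (rule H1_vanishing, simp add: eU YU bU w t)+
  have zero': "norm_L2 (e' t - E.Ut t) = 0" "norm_L2 (b' t - B.Ut t) = 0" "norm_L2 (w' t - W.Ut t) = 0"
    by (rule norm_L2_zero, use eUt bUt w' in \<open>eventually_elim, simp\<close>)+
  show ?thesis unfolding v sol_def eq_X_iff using zero zero' e0[OF t] w[of 0] by simp
qed

end

section \<open>Well-posedness and exponential stability\<close>

text \<open>
  The particular solution \<open>exp (q x) * r t\<close> decays but does not start from 0, so its
  initial values are subtracted from those of \<open>w\<close> before the delay system is solved.
\<close>

lemma profiles_exist:
  assumes c: "q > 0" "0 < c0" "c0 < 1" "c1 > 0" "c2 > 0" "c3 > 0"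
    and X: "(e0, e1, Y0, b0, b1, w0, w1) \<in> X_space" and compat: "Y0 0 = - c0 * e0 0"
  obtains fe fe' ge ge' fb fb' gb gb' y y' fv fv' gv gv' r r1 where
    "profiles q c0 c1 c2 c3 fe fe' ge ge' fb fb' gb gb' y y' fv fv' gv gv' r r1" "fe 0 = 0" "fb 0 = 0"
    "profiles.starts_at q fe fe' ge ge' fb fb' gb gb' y fv fv' gv gv' r r1 e0 e1 Y0 b0 b1 w0 w1"
    "energy_decays fe'" "energy_decays ge'" "energy_decays fb'" "energy_decays gb'" "energy_decays y'"
    "exp_decays (\<lambda>t. (fe t + ge t)\<^sup>2)" "exp_decays (\<lambda>t. (fb t + gb t)\<^sup>2)" "exp_decays (\<lambda>t. (y t)\<^sup>2)"
    "exp_decays (\<lambda>t. (r t)\<^sup>2)" "exp_decays (\<lambda>t. (r1 t)\<^sup>2)"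
proof -
  have H: "e0 \<in> H1" "e1 \<in> L2" "Y0 \<in> H1" "b0 \<in> H1" "b0 1 = 0" "b1 \<in> L2" "w0 \<in> H1" "w1 \<in> L2"
    using X by (auto simp: X_space_def H1_R_def)
  obtain fe fe' ge ge' fb fb' gb gb' y y' where C:
    "cascade c0 c1 fe fe' ge ge' fb fb' gb gb' y y'" "fe 0 = 0" "fb 0 = 0"
    "\<And>x. x \<in> {0..1} \<Longrightarrow> fe x + ge (- x) = e0 x" "AE x\<in>{0<..<1} in lborel. fe' x + ge' (- x) = e1 x"
    "\<And>x. x \<in> {0..1} \<Longrightarrow> fb x + gb (- x) = b0 x" "AE x\<in>{0<..<1} in lborel. fb' x + gb' (- x) = b1 x"
    "\<And>x. x \<in> {0..1} \<Longrightarrow> y (- x) = Y0 x"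
    and D: "energy_decays fe'" "energy_decays ge'" "energy_decays fb'" "energy_decays gb'" "energy_decays y'"
    "exp_decays (\<lambda>t. (fe t + ge t)\<^sup>2)" "exp_decays (\<lambda>t. (fb t + gb t)\<^sup>2)" "exp_decays (\<lambda>t. (y t)\<^sup>2)"
    by (rule cascade_exists[OF c(2,3,4) H(1-6) compat]) blast
  have bc: "boundary_conditions c0 c1 fe fe' ge ge' fb fb' gb gb' y y'"
    using C(1) boundary_conditions_iff_cascade[OF c(2,3)] by blast
  then have p: "prim fe fe'" "prim ge ge'" by (auto simp: boundary_conditions_def)
  let ?h = "\<lambda>t. fe t + ge t"
  have ch: "continuous_on UNIV ?h"
    by (intro continuous_intros prim_continuous_on[OF p(1)] prim_continuous_on[OF p(2)])
  have dh: "exp_decays (\<lambda>t. (- ((c1 + q) * (c2 + q)) * ?h t)\<^sup>2)"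
    by (rule exp_decays_square_cmult[OF D(6)])
  obtain r r1 where r: "\<And>t. (r has_real_derivative r1 t) (at t)"
    "\<And>t. (r1 has_real_derivative q\<^sup>2 * r t + - ((c1 + q) * (c2 + q)) * ?h t) (at t)"
    and dr: "exp_decays (\<lambda>t. (r t)\<^sup>2)" "exp_decays (\<lambda>t. (r1 t)\<^sup>2)"
    by (rule decaying_particular_solution[OF c(1) continuous_on_mult_left[OF ch] dh]) blast
  have cr: "continuous_on UNIV r" "continuous_on UNIV r1"
    using r by (auto intro!: continuous_at_imp_continuous_on dest: DERIV_isCont)
  have "prim (\<lambda>x. exp (q * x) * r 0) (\<lambda>x. q * exp (q * x) * r 0)"
    by (rule prim_C1) (auto intro!: derivative_eq_intros continuous_intros)
  from H1_minus(1)[OF H(7) H1_of_prim(1)[OF this refl]]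
  have F0: "(\<lambda>x. w0 x - exp (q * x) * r 0) \<in> H1" by (simp add: fun_diff_def)
  have F1: "(\<lambda>x. w1 x - exp (q * x) * r1 0) \<in> L2"
    by (intro L2_diff H(8) L2loc_imp_L2 L2loc_continuous continuous_intros)
  obtain \<phi> \<gamma> where i: "L2loc \<phi>" "L2loc \<gamma>"
    "\<And>f f' g g' x. prim f f' \<Longrightarrow> prim g g' \<Longrightarrow> f 0 = 0 \<Longrightarrow> g 0 = w0 0 - exp (q * 0) * r 0 \<Longrightarrow> (\<And>t. t < 1 \<Longrightarrow> f' t = \<phi> t) \<Longrightarrow>
       (\<And>t. t < 0 \<Longrightarrow> g' t = \<gamma> t) \<Longrightarrow> x \<in> {0..1} \<Longrightarrow> f x + g (- x) = w0 x - exp (q * x) * r 0"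
    "\<And>f' g' x. (\<And>t. t < 1 \<Longrightarrow> f' t = \<phi> t) \<Longrightarrow> (\<And>t. t < 0 \<Longrightarrow> g' t = \<gamma> t) \<Longrightarrow> x \<in> {0<..<1} \<Longrightarrow> f' x + g' (- x) = w1 x - exp (q * x) * r1 0"
    by (rule initial_profiles[OF F0 F1]) blast
  have L: "L2loc (\<lambda>t. (c2 - q) * r t + (c1 + q) * ?h t)" "L2loc (\<lambda>t. - (exp q / (1 + c3)) * (q * r t + c3 * r1 t))"
    by (intro L2loc_add L2loc_cmult L2loc_continuous cr ch)+
  obtain fv fv' gv gv' where v: "delay_system c2 0 ((1 - c3) / (1 + c3)) (\<lambda>t. (c2 - q) * r t + (c1 + q) * ?h t)
      (\<lambda>t. - (exp q / (1 + c3)) * (q * r t + c3 * r1 t)) fv fv' gv gv'" "fv 0 = 0" "gv 0 = w0 0 - exp (q * 0) * r 0"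
    "\<And>t. t < 1 \<Longrightarrow> fv' t = \<phi> t" "\<And>t. t < 0 \<Longrightarrow> gv' t = \<gamma> t"
    by (rule delay_system_exists[OF order_refl L i(1,2), of c2 "(1 - c3) / (1 + c3)" "w0 0 - exp (q * 0) * r 0"]) blast
  have pv: "prim fv fv'" "prim gv gv'" using v(1) by (simp_all add: delay_system_def)
  interpret S: profiles q c0 c1 c2 c3 fe fe' ge ge' fb fb' gb gb' y y' fv fv' gv gv' r r1
    by unfold_locales (rule c bc r v(1))+
  have w0: "fv x + gv (- x) = w0 x - exp (q * x) * r 0" if "x \<in> {0..1}" for x using i(3)[OF pv v(2,3,4,5) that] .
  have w1: "fv' x + gv' (- x) = w1 x - exp (q * x) * r1 0" if "x \<in> {0<..<1}" for x using i(4)[OF v(4,5) that] .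
  have "S.starts_at e0 e1 Y0 b0 b1 w0 w1"
    unfolding S.starts_at_def
  proof
    show "\<forall>x\<in>{0..1}. S.E.U 0 x = e0 x \<and> S.Y.U 0 x = Y0 x \<and> S.B.U 0 x = b0 x \<and> S.W.U 0 x = w0 x"
      using C(4,6,8) w0 by (simp add: S.E.U_def S.Y.U_def S.B.U_def S.W.U_def)
    show "AE x\<in>{0<..<1} in lborel. S.E.Ut 0 x = e1 x \<and> S.B.Ut 0 x = b1 x \<and> S.W.Ut 0 x = w1 x"
      using C(5,7) by eventually_elim (use w1 in \<open>simp add: S.E.Ut_def S.B.Ut_def S.W.Ut_def\<close>)
  qed
  from that[OF S.profiles_axioms C(2,3) this D dr] show ?thesis .
qed

theorem lemma4p1:
  fixes q c0 c1 c2 c3 :: real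
    and \<epsilon>0 \<epsilon>1 Y0 \<beta>0 \<beta>1 w0 w1 :: "real \<Rightarrow> real"
  assumes "q > 0" and "0 < c0" and "c0 < 1" and "c1 > 0" and "c2 > 0" and "c3 > 0"
    and "(\<epsilon>0, \<epsilon>1, Y0, \<beta>0, \<beta>1, w0, w1) \<in> X_space"
    and "Y0 0 = - c0 * \<epsilon>0 0"
  shows "\<exists>u. is_solution q c0 c1 c2 c3 (\<epsilon>0, \<epsilon>1, Y0, \<beta>0, \<beta>1, w0, w1) u \<and>
    (\<forall>v. is_solution q c0 c1 c2 c3 (\<epsilon>0, \<epsilon>1, Y0, \<beta>0, \<beta>1, w0, w1) v \<longrightarrow> (\<forall>t\<ge>0. eq_X (v t) (u t))) \<and>
    (\<exists>M>0. \<exists>\<mu>>0. \<forall>t\<ge>0. norm_X (u t) \<le> M * exp (- \<mu> * t))"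
proof -
  obtain fe fe' ge ge' fb fb' gb gb' y y' fv fv' gv gv' r r1 where
    P: "profiles q c0 c1 c2 c3 fe fe' ge ge' fb fb' gb gb' y y' fv fv' gv gv' r r1" "fe 0 = 0" "fb 0 = 0"
    and s: "profiles.starts_at q fe fe' ge ge' fb fb' gb gb' y fv fv' gv gv' r r1 \<epsilon>0 \<epsilon>1 Y0 \<beta>0 \<beta>1 w0 w1"
    and D: "energy_decays fe'" "energy_decays ge'" "energy_decays fb'" "energy_decays gb'" "energy_decays y'"
    "exp_decays (\<lambda>t. (fe t + ge t)\<^sup>2)" "exp_decays (\<lambda>t. (fb t + gb t)\<^sup>2)" "exp_decays (\<lambda>t. (y t)\<^sup>2)"
    "exp_decays (\<lambda>t. (r t)\<^sup>2)" "exp_decays (\<lambda>t. (r1 t)\<^sup>2)"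
    by (rule profiles_exist[OF assms]) blast
  interpret S: profiles q c0 c1 c2 c3 fe fe' ge ge' fb fb' gb gb' y y' fv fv' gv gv' r r1 by (rule P(1))
  show ?thesis
    using S.is_solution_sol[OF s] S.solution_unique[OF assms(7) s P(2,3)] S.sol_decays[OF D]
    by (intro exI[of _ S.sol] conjI) auto
qed

end
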